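(* Let $k\geq 5$ and $\lambda,\mu\in\mathbb{C}$. The algebra of symmetries $\mathcal{I}^k_{\lambda,\mu}(S^1)$ is trivial (i.e. spanned by the identity map) for all $(\lambda,\mu)$ except in the following cases: (1) $\mathcal{I}^k_{\lambda,\mu}(S^1)\cong\mathbb{R}^2$ if either $\lambda+\mu=1$ with $\lambda\neq 0$; or $\lambda=0$ with $\mu\neq 1,0$; or $\mu=1$ with $\lambda\neq 1,0$; (2) $\mathcal{I}^k_{0,0}(S^1)\cong\mathcal{I}^k_{1,1}(S^1)\cong\mathbb{R}^3$; (3) $\mathcal{I}^k_{0,1}(S^1)\cong\mathfrak{b}\oplus\mathbb{R}^2$. All isomorphisms are isomorphisms of associative algebras.
   Context: For $\lambda\in\mathbb{C}$, $\mathcal{F}_\lambda=\mathcal{F}_\lambda(S^1)$ denotes the space of smooth $\lambda$-densities $\varphi=\phi(x)(dx)^\lambda$ on the circle $S^1$ ($\phi$ smooth), with the action of the diffeomorphism group $\mathrm{Diff}(S^1)$ given by $\rho^\lambda_{f^{-1}}:\phi(x)(dx)^\lambda\mapsto (f'(x))^\lambda\phi(f(x))(dx)^\lambda$. $\mathcal{D}^k_{\lambda,\mu}(S^1)$ denotes the space of linear differential operators $A:\mathcal{F}_\lambda\to\mathcal{F}_\mu$ of order $\leq k$; in a local coordinate $x$, $A=\sum_{i=0}^k a_i(x)\frac{d^i}{dx^i}$ with smooth $a_i$, acting by $\phi(dx)^\lambda\mapsto(\sum_i a_i\phi^{(i)})(dx)^\mu$. $\mathrm{Diff}(S^1)$ acts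 on $\mathcal{D}^k_{\lambda,\mu}(S^1)$ by $A\mapsto\rho^\mu_f\circ A\circ\rho^\lambda_{f^{-1}}$. The algebra of symmetries $\mathcal{I}^k_{\lambda,\mu}(S^1)$ is the associative algebra (under composition) of all linear maps $T:\mathcal{D}^k_{\lambda,\mu}(S^1)\to\mathcal{D}^k_{\lambda,\mu}(S^1)$ commuting with this $\mathrm{Diff}(S^1)$-action; it is called trivial if it is spanned by the identity. Matrix algebras: $\mathbb{R}^n$ is the commutative algebra $\mathbb{R}\oplus\cdots\oplus\mathbb{R}$ ($n$ copies, i.e. diagonal $n\times n$ matrices); $\mathfrak{b}$ is the algebra of real $4\times4$ matrices of the form $\begin{pmatrix}a&0&0&d\\0&a&0&0\\0&c&b&0\\0&0&0&b\end{pmatrix}$ with $a,b,c,d\in\mathbb{R}$.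
   Formalization: Since λ, μ are complex, densities are complex valued and the symmetry algebra is complex, so ℝ², ℝ³ and 𝔟⊕ℝ² are replaced by ℂ², ℂ³ and 𝔟⊕ℂ² with 𝔟 over ℂ; Diff(S¹) means orientation-preserving diffeomorphisms. *)

theory Defs
  imports "HOL-Analysis.Analysis"
begin

fun dnth :: "nat \<Rightarrow> (real \<Rightarrow> 'a::real_normed_vector) \<Rightarrow> real \<Rightarrow> 'a" where
  "dnth 0 f = f"
| "dnth (Suc n) f = (\<lambda>x. vector_derivative (dnth n f) (at x))"

definition smooth_fun :: "(real \<Rightarrow> 'a::real_normed_vector) \<Rightarrow> bool" where
  "smooth_fun f \<longleftrightarrow> (\<forall>n x. dnth n f differentiable (at x))"

text \<open>Smooth (complex-valued) functions on S^1 = R/Z, i.e. 1-periodic smooth functions.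
  A lambda-density phi(x)(dx)^lambda is identified with its coefficient phi.\<close>
definition Fsp :: "(real \<Rightarrow> complex) set" where
  "Fsp = {\<phi>. smooth_fun \<phi> \<and> (\<forall>x. \<phi> (x + 1) = \<phi> x)}"

text \<open>Orientation-preserving diffeomorphisms of S^1, represented by their lifts to R.\<close>
definition DiffS1 :: "(real \<Rightarrow> real) set" where
  "DiffS1 = {f. smooth_fun f \<and> (\<forall>x. dnth 1 f x > 0) \<and> (\<forall>x. f (x + 1) = f x + 1)}"

text \<open>rho^lambda_{f^{-1}} : phi (dx)^lambda |-> (f')^lambda (phi o f) (dx)^lambda.\<close>
definition pull :: "complex \<Rightarrow> (real \<Rightarrow> real) \<Rightarrow> (real \<Rightarrow> complex) \<Rightarrow> (real \<Rightarrow> complex)" where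
  "pull l f \<phi> = (\<lambda>x. (complex_of_real (dnth 1 f x)) powr l * \<phi> (f x))"

definition diffop :: "nat \<Rightarrow> (nat \<Rightarrow> real \<Rightarrow> complex) \<Rightarrow> (real \<Rightarrow> complex) \<Rightarrow> (real \<Rightarrow> complex)" where
  "diffop k a = (\<lambda>\<phi>\<in>Fsp. (\<lambda>x. \<Sum>i\<le>k. a i x * dnth i \<phi> x))"

definition DiffOps :: "nat \<Rightarrow> ((real \<Rightarrow> complex) \<Rightarrow> (real \<Rightarrow> complex)) set" where
  "DiffOps k = {diffop k a | a. \<forall>i\<le>k. a i \<in> Fsp}"

definition act :: "complex \<Rightarrow> complex \<Rightarrow> (real \<Rightarrow> real) \<Rightarrow>
    ((real \<Rightarrow> complex) \<Rightarrow> (real \<Rightarrow> complex)) \<Rightarrow> ((real \<Rightarrow> complex) \<Rightarrow> (real \<Rightarrow> complex))" where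
  "act l m f A = (\<lambda>\<phi>\<in>Fsp. pull m (inv f) (A (pull l f \<phi>)))"

definition op_add :: "((real \<Rightarrow> complex) \<Rightarrow> (real \<Rightarrow> complex)) \<Rightarrow>
    ((real \<Rightarrow> complex) \<Rightarrow> (real \<Rightarrow> complex)) \<Rightarrow> ((real \<Rightarrow> complex) \<Rightarrow> (real \<Rightarrow> complex))" where
  "op_add A B = (\<lambda>\<phi>\<in>Fsp. (\<lambda>x. A \<phi> x + B \<phi> x))"

definition op_scale :: "complex \<Rightarrow> ((real \<Rightarrow> complex) \<Rightarrow> (real \<Rightarrow> complex)) \<Rightarrow>
    ((real \<Rightarrow> complex) \<Rightarrow> (real \<Rightarrow> complex))" where
  "op_scale c A = (\<lambda>\<phi>\<in>Fsp. (\<lambda>x. c * A \<phi> x))"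

type_synonym dop = "(real \<Rightarrow> complex) \<Rightarrow> (real \<Rightarrow> complex)"

definition Symmetries :: "nat \<Rightarrow> complex \<Rightarrow> complex \<Rightarrow> (dop \<Rightarrow> dop) set" where
  "Symmetries k l m = {T \<in> DiffOps k \<rightarrow>\<^sub>E DiffOps k.
      (\<forall>A\<in>DiffOps k. \<forall>B\<in>DiffOps k. T (op_add A B) = op_add (T A) (T B)) \<and>
      (\<forall>c. \<forall>A\<in>DiffOps k. T (op_scale c A) = op_scale c (T A)) \<and>
      (\<forall>f\<in>DiffS1. \<forall>A\<in>DiffOps k. T (act l m f A) = act l m f (T A))}"

definition sym_add :: "nat \<Rightarrow> (dop \<Rightarrow> dop) \<Rightarrow> (dop \<Rightarrow> dop) \<Rightarrow> (dop \<Rightarrow> dop)" where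
  "sym_add k T S = (\<lambda>A\<in>DiffOps k. op_add (T A) (S A))"

definition sym_scale :: "nat \<Rightarrow> complex \<Rightarrow> (dop \<Rightarrow> dop) \<Rightarrow> (dop \<Rightarrow> dop)" where
  "sym_scale k c T = (\<lambda>A\<in>DiffOps k. op_scale c (T A))"

definition sym_comp :: "nat \<Rightarrow> (dop \<Rightarrow> dop) \<Rightarrow> (dop \<Rightarrow> dop) \<Rightarrow> (dop \<Rightarrow> dop)" where
  "sym_comp k T S = (\<lambda>A\<in>DiffOps k. T (S A))"

definition sym_id :: "nat \<Rightarrow> (dop \<Rightarrow> dop)" where
  "sym_id k = (\<lambda>A\<in>DiffOps k. A)"

definition sym_trivial :: "nat \<Rightarrow> complex \<Rightarrow> complex \<Rightarrow> bool" where
  "sym_trivial k l m \<longleftrightarrow> Symmetries k l m = {sym_scale k c (sym_id k) | c. True}"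

definition sym_alg_iso :: "nat \<Rightarrow> complex \<Rightarrow> complex \<Rightarrow> 'b set \<Rightarrow> ('b \<Rightarrow> 'b \<Rightarrow> 'b) \<Rightarrow>
    (complex \<Rightarrow> 'b \<Rightarrow> 'b) \<Rightarrow> ('b \<Rightarrow> 'b \<Rightarrow> 'b) \<Rightarrow> bool" where
  "sym_alg_iso k l m M addM scaleM mulM \<longleftrightarrow>
     (\<exists>\<Phi>. bij_betw \<Phi> (Symmetries k l m) M \<and>
       (\<forall>T\<in>Symmetries k l m. \<forall>S\<in>Symmetries k l m.
          \<Phi> (sym_add k T S) = addM (\<Phi> T) (\<Phi> S) \<and>
          \<Phi> (sym_comp k T S) = mulM (\<Phi> T) (\<Phi> S)) \<and>
       (\<forall>c. \<forall>T\<in>Symmetries k l m. \<Phi> (sym_scale k c T) = scaleM c (\<Phi> T)))"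

text \<open>C^n (= diagonal n x n matrices) as complex^'n with componentwise operations.\<close>
definition iso_Cn :: "nat \<Rightarrow> complex \<Rightarrow> complex \<Rightarrow> 'n::finite itself \<Rightarrow> bool" where
  "iso_Cn k l m (_ :: 'n itself) \<longleftrightarrow>
     sym_alg_iso k l m (UNIV :: (complex^'n) set) (+) (\<lambda>c v. c *s v) (*)"

definition mscale :: "complex \<Rightarrow> complex^'n^'m \<Rightarrow> complex^'n^'m" where
  "mscale c A = (\<chi> i j. c * A $ i $ j)"

definition b_alg :: "(complex^4^4) set" where
  "b_alg = {vector [vector [a, 0, 0, d], vector [0, a, 0, 0], vector [0, c, b, 0], vector [0, 0, 0, b]]
             | a b c d. True}"

definition iso_b_C2 :: "nat \<Rightarrow> complex \<Rightarrow> complex \<Rightarrow> bool" where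
  "iso_b_C2 k l m \<longleftrightarrow>
     sym_alg_iso k l m (b_alg \<times> (UNIV :: (complex^2) set))
       (\<lambda>(A, v) (B, w). (A + B, v + w))
       (\<lambda>c (A, v). (mscale c A, c *s v))
       (\<lambda>(A, v) (B, w). (A ** B, v * w))"

end

theory Submission
  imports Defs "HOL-Computational_Algebra.Polynomial"
begin

text \<open>A symmetry is read off on the coefficients \<open>a\<^sub>0, \<dots>, a\<^sub>k\<close> of differential operators. Nothing is known
  about its continuity, but the transforms of \<open>d\<^sup>j\<close> under diffeomorphisms reach, by the inverse function
  theorem, every bounded family of leading coefficients. Hence a symmetry maps bounded families to bounded
  families, and differentiating its equivariance along \<open>x + t X(x)\<close> shows that it commutes with vector fields.
  For \<open>X = e\<^sup>2\<^sup>\<pi>\<^sup>i\<^sup>z\<^sup>x\<close> this becomes a system of relations between the matrices \<open>T\<^sub>n\<close> of the symmetry on the Fourier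
  modes. Composing vector fields along closed paths of modes gives matrices commuting with \<open>T\<^sub>0\<close>; homogeneity
  in \<open>z\<close> splits these relations by degree, so that \<open>T\<^sub>0\<close> is diagonal, with one more entry if \<open>(\<lambda>, \<mu>) = (0, 1)\<close>, and
  diagonal entries agree whenever the commuting matrices join them. A symmetry with \<open>T\<^sub>0 = 0\<close> vanishes, except that
  for \<open>(0, 1)\<close> one entry of \<open>T\<^sub>1\<close> is free. Thus the algebra embeds into a small matrix algebra, and it is all of it
  because of the symmetries built from the formal adjoint, \<open>A \<mapsto> A(1)\<close>, \<open>A = A(1) + B d \<mapsto> A(1) + B\<^sup>* d\<close> and
  \<open>A \<mapsto> (\<integral> A(1)) d\<close>.\<close>

section \<open>Bounded families of periodic functions\<close>

text \<open>Boundedness can replace continuity because the remainder of the expansion along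
  \<open>x + t X(x)\<close> is \<open>t^2 R t\<close>: dividing by \<open>t\<close> only asks that a
  symmetry be bounded on the family \<open>R t\<close>. The obstacle is the symbol of weight zero,
  \<open>m - l = j\<close>. There no power of the Jacobian multiplies the leading coefficient,
  \<open>d^j\<close> reaches only the constant 1, and \<open>ee 1 d^j\<close> has to be moved
  instead; hence mode 1 enters beside mode 0. A single vector field relates two different modes,
  whereas a closed path constrains \<open>T 0\<close> alone. Two lengths of path are used because
  the entries of \<open>N2\<close> with odd gap vanish identically, while the odd-gap entries taken
  from \<open>N3\<close> carry the factor \<open>l + m - 1\<close>. The adjoint exchanges
  \<open>l\<close> and \<open>1 - m\<close>; the remaining factors are expressed in the symmetric
  functions \<open>l + 1 - m\<close> and \<open>l * (1 - m)\<close>, and \<open>l + m - 1\<close> is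
  antisymmetric, zero exactly where the adjoint preserves the weights. The exceptional weights are
  those where these quantities degenerate.\<close>

definition vd :: "(real \<Rightarrow> 'a::real_normed_vector) \<Rightarrow> real \<Rightarrow> 'a" where
  "vd f = (\<lambda>x. vector_derivative f (at x))"

lemma dnth_Suc_vd: "dnth (Suc n) f = vd (dnth n f)"
  by (simp add: vd_def)

lemma dnth_Suc_right: "dnth (Suc n) f = dnth n (vd f)"
  by (induction n) (simp_all add: vd_def)

lemma dnth_1: "dnth 1 f = vd f" "dnth (Suc 0) f = vd f"
  by (simp_all add: vd_def)

lemma vd_eqI: "(\<And>x. (f has_vector_derivative f' x) (at x)) \<Longrightarrow> vd f = f'"
  by (rule ext) (simp add: vd_def vector_derivative_at)

lemma vd_works: "f differentiable at x \<Longrightarrow> (f has_vector_derivative vd f x) (at x)"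
  by (simp add: vd_def vector_derivative_works[symmetric])

text \<open>Families \<open>F t\<close>, \<open>t \<in> I\<close>, whose derivatives up to order \<open>n\<close> are bounded uniformly in \<open>t\<close>. Neither continuity
  nor differentiability in the parameter is required. For \<open>I = UNIV\<close> and a constant family, \<open>pf\<close> below is membership in \<open>Fsp\<close>.\<close>
fun bf :: "real set \<Rightarrow> nat \<Rightarrow> (real \<Rightarrow> real \<Rightarrow> complex) \<Rightarrow> bool" where
  "bf I 0 F \<longleftrightarrow> (\<exists>C. \<forall>t\<in>I. \<forall>x. norm (F t x) \<le> C)"
| "bf I (Suc n) F \<longleftrightarrow> (\<exists>C. \<forall>t\<in>I. \<forall>x. norm (F t x) \<le> C) \<and>
     (\<exists>F'. (\<forall>t\<in>I. \<forall>x. (F t has_vector_derivative F' t x) (at x)) \<and> bf I n F')"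

lemma bf_bound: "bf I n F \<Longrightarrow> \<exists>C. \<forall>t\<in>I. \<forall>x. norm (F t x) \<le> C"
  by (cases n) auto

lemma bf_SucI:
  assumes "bf I 0 F" "\<And>t x. t \<in> I \<Longrightarrow> (F t has_vector_derivative F' t x) (at x)" "bf I n F'"
  shows "bf I (Suc n) F"
  using assms by auto

lemma bf_lower: "bf I (Suc n) F \<Longrightarrow> bf I n F"
proof (induction n arbitrary: F)
  case (Suc n)
  then obtain F' where F': "\<forall>t\<in>I. \<forall>x. (F t has_vector_derivative F' t x) (at x)" "bf I (Suc n) F'"
    by auto
  from Suc.IH[OF F'(2)] F'(1) bf_bound[OF Suc.prems] show ?case by auto
qed auto

lemma bf_0: "bf I n F \<Longrightarrow> bf I 0 F"
  using bf_bound by auto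

lemma bf_cong:
  assumes "\<And>t x. t \<in> I \<Longrightarrow> F t x = G t x" "bf I n F" shows "bf I n G"
proof -
  have FG: "F t = G t" if "t \<in> I" for t using assms(1)[OF that] by auto
  show ?thesis using assms(2) FG by (cases n) simp_all
qed

lemma bf_unique_deriv:
  assumes "bf I (Suc n) F" "\<And>t x. t \<in> I \<Longrightarrow> (F t has_vector_derivative F' t x) (at x)"
  shows "bf I n F'"
proof -
  from assms(1) obtain G where G: "\<forall>t\<in>I. \<forall>x. (F t has_vector_derivative G t x) (at x)" "bf I n G"
    by auto
  show ?thesis
    by (rule bf_cong[OF _ G(2)]) (metis G(1) assms(2) vector_derivative_at)
qed

lemma bf_zero: "bf I n (\<lambda>t x. 0)"
  by (induction n) (auto intro!: exI[of _ "\<lambda>t x. 0"] exI[of _ 0])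

lemma bounded_const_image: "bounded ((\<lambda>t. c) ` I)"
  by (auto intro: bounded_subset[of "{c}"])

lemma bf_const: "bounded (c ` I) \<Longrightarrow> bf I n (\<lambda>t x. c t)"
  by (cases n) (auto simp: bounded_iff intro!: exI[of _ "\<lambda>t x. 0"] bf_zero)

lemma bf_add: "bf I n F \<Longrightarrow> bf I n G \<Longrightarrow> bf I n (\<lambda>t x. F t x + G t x)"
proof (induction n arbitrary: F G)
  case 0
  then obtain C D where "\<forall>t\<in>I. \<forall>x. norm (F t x) \<le> C" "\<forall>t\<in>I. \<forall>x. norm (G t x) \<le> D" by auto
  then have "\<forall>t\<in>I. \<forall>x. norm (F t x + G t x) \<le> C + D"
    by (auto intro!: norm_triangle_mono)
  then show ?case by auto
next
  case (Suc n)
  obtain F' where F': "\<forall>t\<in>I. \<forall>x. (F t has_vector_derivative F' t x) (at x)" "bf I n F'"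
    using Suc.prems by auto
  obtain G' where G': "\<forall>t\<in>I. \<forall>x. (G t has_vector_derivative G' t x) (at x)" "bf I n G'"
    using Suc.prems by auto
  show ?case
  proof (rule bf_SucI)
    show "bf I 0 (\<lambda>t x. F t x + G t x)"
      using bf_lower Suc by (metis bf_0)
    show "bf I n (\<lambda>t x. F' t x + G' t x)" using Suc.IH F' G' by auto
  qed (use F' G' in \<open>auto intro!: derivative_intros\<close>)
qed

lemma bf_mult: "bf I n F \<Longrightarrow> bf I n G \<Longrightarrow> bf I n (\<lambda>t x. F t x * G t x)"
proof (induction n arbitrary: F G)
  case 0
  then obtain C D where C: "\<forall>t\<in>I. \<forall>x. norm (F t x) \<le> C" and D: "\<forall>t\<in>I. \<forall>x. norm (G t x) \<le> D" by auto
  have "\<forall>t\<in>I. \<forall>x. norm (F t x * G t x) \<le> \<bar>C\<bar> * \<bar>D\<bar>"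
    unfolding norm_mult using C D by (auto intro!: mult_mono elim: order_trans[OF _ abs_ge_self] dest!: bspec) 
  then show ?case by auto
next
  case (Suc n)
  obtain F' where F': "\<forall>t\<in>I. \<forall>x. (F t has_vector_derivative F' t x) (at x)" "bf I n F'"
    using Suc.prems by auto
  obtain G' where G': "\<forall>t\<in>I. \<forall>x. (G t has_vector_derivative G' t x) (at x)" "bf I n G'"
    using Suc.prems by auto
  show ?case
  proof (rule bf_SucI)
    show "bf I 0 (\<lambda>t x. F t x * G t x)"
      using bf_lower Suc by (metis bf_0)
    show "bf I n (\<lambda>t x. F t x * G' t x + F' t x * G t x)"
      by (intro bf_add Suc.IH F' G' bf_lower[OF Suc.prems(1)] bf_lower[OF Suc.prems(2)])
  qed (use F' G' in \<open>auto intro!: derivative_intros\<close>)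
qed

lemma bf_cmult: "bf I n F \<Longrightarrow> bf I n (\<lambda>t x. c * F t x)"
  by (rule bf_mult[OF bf_const[OF bounded_const_image]])

lemma bf_sum: "finite S \<Longrightarrow> (\<And>i. i \<in> S \<Longrightarrow> bf I n (F i)) \<Longrightarrow> bf I n (\<lambda>t x. \<Sum>i\<in>S. F i t x)"
  by (induction S rule: finite_induct) (auto intro!: bf_zero bf_add)

lemma bf_exp: "bf I n F \<Longrightarrow> bf I n (\<lambda>t x. exp (F t x))"
proof (induction n arbitrary: F)
  case 0
  then obtain C where C: "\<forall>t\<in>I. \<forall>x. norm (F t x) \<le> C" by auto
  have "norm (exp (F t x)) \<le> exp C" if "t \<in> I" for t x
    using norm_exp[of "F t x"] C that by (meson exp_le_cancel_iff order_trans)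
  then show ?case unfolding bf.simps by blast
next
  case (Suc n)
  obtain F' where F': "\<forall>t\<in>I. \<forall>x. (F t has_vector_derivative F' t x) (at x)" "bf I n F'"
    using Suc.prems by auto
  show ?case
  proof (rule bf_SucI)
    show "bf I 0 (\<lambda>t x. exp (F t x))" using bf_lower Suc by (metis bf_0)
    show "bf I n (\<lambda>t x. F' t x * exp (F t x))"
      by (intro bf_mult Suc.IH F' bf_lower[OF Suc.prems(1)])
    show "((\<lambda>x. exp (F t x)) has_vector_derivative F' t x * exp (F t x)) (at x)" if "t \<in> I" for t x
      using field_vector_diff_chain_at[of "F t" "F' t x" x exp "exp (F t x)"] F'(1) that
      by (auto simp: o_def)
  qed
qed

lemma bf_inverse:
  assumes "c > 0" "\<And>t x. t \<in> I \<Longrightarrow> norm (F t x) \<ge> c" 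
  shows "bf I n F \<Longrightarrow> bf I n (\<lambda>t x. inverse (F t x))"
proof (induction n)
  case 0
  have "norm (inverse (F t x)) \<le> inverse c" if "t \<in> I" for t x
    using assms(1) assms(2)[OF that] by (simp add: norm_inverse le_imp_inverse_le)
  then show ?case by auto
next
  case (Suc n)
  obtain F' where F': "\<forall>t\<in>I. \<forall>x. (F t has_vector_derivative F' t x) (at x)" "bf I n F'"
    using Suc.prems by auto
  show ?case
  proof (rule bf_SucI)
    show "bf I 0 (\<lambda>t x. inverse (F t x))" using bf_lower Suc by (metis bf_0)
    show "bf I n (\<lambda>t x. F' t x * ((-1) * (inverse (F t x) * inverse (F t x))))"
      using bf_mult[OF F'(2) bf_cmult[OF bf_mult]] Suc.IH[OF bf_lower[OF Suc.prems]] by blast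
    show "((\<lambda>x. inverse (F t x)) has_vector_derivative F' t x * ((-1) * (inverse (F t x) * inverse (F t x)))) (at x)"
      if "t \<in> I" for t x
    proof -
      have "F t x \<noteq> 0" using assms(1) assms(2)[OF that, of x] by auto
      then have "(inverse has_field_derivative - (inverse (F t x) * inverse (F t x))) (at (F t x))"
        using DERIV_inverse[of "F t x"] by (simp add: power2_eq_square numeral_2_eq_2)
      then show ?thesis
        using field_vector_diff_chain_at[of "F t" "F' t x" x inverse "- (inverse (F t x) * inverse (F t x))"] F'(1) that
        by (simp add: o_def)
    qed
  qed
qed

lemma bf_cnj: "bf I n F \<Longrightarrow> bf I n (\<lambda>t x. cnj (F t x))"
proof (induction n arbitrary: F)
  case (Suc n)
  obtain F' where F': "\<forall>t\<in>I. \<forall>x. (F t has_vector_derivative F' t x) (at x)" "bf I n F'"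
    using Suc.prems by auto
  show ?case
  proof (rule bf_SucI)
    show "bf I 0 (\<lambda>t x. cnj (F t x))" using bf_bound[OF Suc.prems] by auto
    show "bf I n (\<lambda>t x. cnj (F' t x))" using Suc F' by auto
    show "((\<lambda>x. cnj (F t x)) has_vector_derivative cnj (F' t x)) (at x)" if "t \<in> I" for t x
      using F' that by (simp add: has_vector_derivative_cnj)
  qed
qed auto

lemma bf_Re: "bf I n F \<Longrightarrow> bf I n (\<lambda>t x. complex_of_real (Re (F t x)))"
  using bf_cong[OF _ bf_cmult[OF bf_add[OF _ bf_cnj], of I n F F "1/2"], of "\<lambda>t x. complex_of_real (Re (F t x))"]
  by (simp add: complex_add_cnj)

lemma bf_subset: "I \<subseteq> J \<Longrightarrow> bf J n F \<Longrightarrow> bf I n F"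
  by (induction n arbitrary: F) (auto, meson subsetD, metis subsetD)

definition pf :: "real set \<Rightarrow> (real \<Rightarrow> real \<Rightarrow> complex) \<Rightarrow> bool" where
  "pf I F \<longleftrightarrow> (\<forall>n. bf I n F) \<and> (\<forall>t\<in>I. \<forall>x. F t (x + 1) = F t x)"

lemma pf_bound: "pf I F \<Longrightarrow> \<exists>C. \<forall>t\<in>I. \<forall>x. norm (F t x) \<le> C"
  unfolding pf_def using bf_bound by blast

lemma pf_deriv: "pf I F \<Longrightarrow> t \<in> I \<Longrightarrow> (F t has_vector_derivative vd (F t) x) (at x)"
  unfolding pf_def vd_def
  by (metis bf.simps(2) vector_derivative_at)

lemma has_vector_derivative_shift:
  "(f has_vector_derivative f') (at (x + c)) \<Longrightarrow> ((\<lambda>x. f (x + c)) has_vector_derivative f') (at (x::real))"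
  using vector_diff_chain_at[of "\<lambda>x. x + c" 1 x f f'] has_vector_derivative_add_const[of "\<lambda>x. x" c 1 "at x"]
  by (auto simp: o_def)

lemma pf_vd: assumes "pf I F" shows "pf I (\<lambda>t. vd (F t))"
  unfolding pf_def
proof (intro conjI allI ballI)
  show "bf I n (\<lambda>t. vd (F t))" for n
    by (rule bf_unique_deriv[of I n F])
      (use assms pf_deriv[OF assms] in \<open>auto simp: pf_def simp del: bf.simps\<close>)
  fix t x assume t: "t \<in> I"
  have "((\<lambda>x. F t (x + 1)) has_vector_derivative vd (F t) (x + 1)) (at x)"
    using has_vector_derivative_shift pf_deriv[OF assms t, of "x + 1"] by blast
  moreover have "(\<lambda>x. F t (x + 1)) = F t" using assms t unfolding pf_def by auto
  ultimately show "vd (F t) (x + 1) = vd (F t) x"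
    using pf_deriv[OF assms t, of x] by (metis vector_derivative_at)
qed

text \<open>All higher orders are inherited from the derivative, so only a sup bound remains. This
  is the way in for logarithms and difference quotients, whose derivatives are simpler than they
  are.\<close>

lemma pfI_deriv:
  assumes "bf I 0 F" "\<And>t x. t \<in> I \<Longrightarrow> (F t has_vector_derivative F' t x) (at x)" "pf I F'"
    "\<And>t x. t \<in> I \<Longrightarrow> F t (x + 1) = F t x"
  shows "pf I F"
  unfolding pf_def
proof (intro conjI allI ballI)
  fix n show "bf I n F"
    using assms bf_SucI[OF assms(1,2)] by (cases n) (auto simp: pf_def)
qed (use assms in auto)

lemma pf_cong: "(\<And>t x. t \<in> I \<Longrightarrow> F t x = G t x) \<Longrightarrow> pf I F \<Longrightarrow> pf I G"
  unfolding pf_def by (metis bf_cong)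

lemma pf_subset: "I \<subseteq> J \<Longrightarrow> pf J F \<Longrightarrow> pf I F"
  unfolding pf_def by (meson bf_subset subsetD)

lemma pf_const: "bounded (c ` I) \<Longrightarrow> pf I (\<lambda>t x. c t)"
  by (simp add: pf_def bf_const)

lemma pf_const': "pf I (\<lambda>t x. c)"
  by (rule pf_const[OF bounded_const_image])

lemma pf_add: "pf I F \<Longrightarrow> pf I G \<Longrightarrow> pf I (\<lambda>t x. F t x + G t x)"
  by (simp add: pf_def bf_add)

lemma pf_mult: "pf I F \<Longrightarrow> pf I G \<Longrightarrow> pf I (\<lambda>t x. F t x * G t x)"
  by (simp add: pf_def bf_mult)

lemma pf_minus: "pf I F \<Longrightarrow> pf I (\<lambda>t x. - F t x)"
  using pf_mult[OF pf_const'[of I "-1"]] by simp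

lemma pf_diff: "pf I F \<Longrightarrow> pf I G \<Longrightarrow> pf I (\<lambda>t x. F t x - G t x)"
  using pf_add[OF _ pf_minus, of I F G] by simp

lemma pf_sum: "finite S \<Longrightarrow> (\<And>i. i \<in> S \<Longrightarrow> pf I (F i)) \<Longrightarrow> pf I (\<lambda>t x. \<Sum>i\<in>S. F i t x)"
  by (simp add: pf_def bf_sum)

lemma pf_exp: "pf I F \<Longrightarrow> pf I (\<lambda>t x. exp (F t x))"
  by (simp add: pf_def bf_exp)

lemma pf_inverse: "c > 0 \<Longrightarrow> (\<And>t x. t \<in> I \<Longrightarrow> norm (F t x) \<ge> c) \<Longrightarrow> pf I F \<Longrightarrow> pf I (\<lambda>t x. inverse (F t x))"
  by (auto simp add: pf_def bf_inverse)

lemma pf_cnj: "pf I F \<Longrightarrow> pf I (\<lambda>t x. cnj (F t x))"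
  by (simp add: pf_def bf_cnj)

lemma pf_Re: "pf I F \<Longrightarrow> pf I (\<lambda>t x. complex_of_real (Re (F t x)))"
  by (simp add: pf_def bf_Re)

section \<open>Periodic functions as constant families\<close>

lemma periodic_int:
  fixes f :: "real \<Rightarrow> 'a"
  assumes "\<And>x. f (x + 1) = f x" shows "f (x + of_int n) = f x"
proof (induction n rule: int_induct[of _ 0])
  case (step1 i) then show ?case using assms[of "x + of_int i"] by (simp add: add.assoc)
next
  case (step2 i) then show ?case using assms[of "x + of_int i - 1"] by (simp add: algebra_simps)
qed simp

lemma periodic_bounded:
  fixes f :: "real \<Rightarrow> complex"
  assumes "\<And>x. f (x + 1) = f x" "continuous_on UNIV f"
  shows "\<exists>C. \<forall>x. norm (f x) \<le> C"
proof -
  have "compact (f ` {0..1})"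
    using assms(2) continuous_on_subset by (intro compact_continuous_image) auto
  then obtain C where C: "\<forall>x\<in>{0..1}. norm (f x) \<le> C"
    using compact_imp_bounded bounded_iff by (metis image_eqI)
  have "norm (f x) \<le> C" for x
  proof -
    have "f x = f (x + of_int (- \<lfloor>x\<rfloor>))" using periodic_int[of f, OF assms(1)] by metis
    moreover have "x + of_int (- \<lfloor>x\<rfloor>) \<in> {0..1}" by auto linarith
    ultimately show ?thesis using C by metis
  qed
  then show ?thesis by blast
qed

text \<open>Continuity on one period bounds every derivative, which is all that \<open>pf\<close>
  adds to smoothness and periodicity. Closure properties of \<open>Fsp\<close> become those of
  \<open>pf\<close>.\<close>

lemma Fsp_iff_pf: "f \<in> Fsp \<longleftrightarrow> pf UNIV (\<lambda>_. f)"
proof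
  assume f: "f \<in> Fsp"
  then have der: "(dnth m f has_vector_derivative dnth (Suc m) f x) (at x)" for m x
    unfolding Fsp_def smooth_fun_def dnth_Suc_vd using vd_works by blast
  have per: "dnth m f (x + 1) = dnth m f x" for m x
  proof (induction m arbitrary: x)
    case 0 then show ?case using f by (simp add: Fsp_def)
  next
    case (Suc m)
    have "((\<lambda>x. dnth m f (x + 1)) has_vector_derivative dnth (Suc m) f (x + 1)) (at x)"
      using has_vector_derivative_shift der[of m "x + 1"] by blast
    then show ?case using Suc der[of m x] vector_derivative_at by (metis (no_types, lifting) ext)
  qed
  have "continuous_on UNIV (dnth m f)" for m
    using der by (simp add: continuous_on_eq_continuous_at has_vector_derivative_continuous del: dnth.simps) 
      (metis has_vector_derivative_continuous)
  then have bnd: "\<exists>C. \<forall>x. norm (dnth m f x) \<le> C" for m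
    using periodic_bounded[of "dnth m f"] per by blast
  have "bf UNIV n (\<lambda>_. dnth m f)" for n m
  proof (induction n arbitrary: m)
    case (Suc n)
    show ?case by (rule bf_SucI[OF _ _ Suc[of "Suc m"]]) (use bnd in simp, rule der)
  qed (use bnd in simp)
  then have "bf UNIV n (\<lambda>_. f)" for n by (metis dnth.simps(1))
  then show "pf UNIV (\<lambda>_. f)" using f by (simp add: pf_def Fsp_def)
next
  assume pf: "pf UNIV (\<lambda>_. f)"
  have *: "pf UNIV (\<lambda>_. dnth n f)" for n
  proof (induction n)
    case (Suc n)
    show ?case using pf_vd[OF Suc] unfolding dnth_Suc_vd .
  qed (simp add: pf)
  show "f \<in> Fsp"
    using pf differentiableI_vector[OF pf_deriv[OF * UNIV_I]]
    unfolding Fsp_def smooth_fun_def pf_def by simp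
qed

lemma pf_Fsp: "f \<in> Fsp \<Longrightarrow> pf I (\<lambda>_. f)"
  using pf_subset[of I UNIV] by (simp add: Fsp_iff_pf)

lemma Fsp_pf: "pf I F \<Longrightarrow> t \<in> I \<Longrightarrow> F t \<in> Fsp"
proof -
  assume a: "pf I F" "t \<in> I"
  have "bf UNIV n (\<lambda>_. G t)" if "bf I n G" for n G
    using that
  proof (induction n arbitrary: G)
    case (Suc n)
    then obtain G' where G': "\<forall>t\<in>I. \<forall>x. (G t has_vector_derivative G' t x) (at x)" "bf I n G'" by auto
    have "bf UNIV 0 (\<lambda>_. G t)" using bf_bound[OF Suc.prems] a(2) unfolding bf.simps by blast
    then show ?case using Suc.IH[OF G'(2)] G'(1) a(2)
      by (intro bf_SucI[of UNIV "\<lambda>_. G t" "\<lambda>_. G' t"]) auto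
  qed (use a in auto)
  then show ?thesis using a unfolding Fsp_iff_pf pf_def by auto
qed

lemma Fsp_periodic: "f \<in> Fsp \<Longrightarrow> f (x + 1) = f x"
  by (simp add: Fsp_def)

lemma Fsp_deriv: "f \<in> Fsp \<Longrightarrow> (f has_vector_derivative vd f x) (at x)"
  using pf_deriv[of UNIV "\<lambda>_. f"] by (simp add: Fsp_iff_pf)

lemma Fsp_vd: "f \<in> Fsp \<Longrightarrow> vd f \<in> Fsp"
  using pf_vd[of UNIV "\<lambda>_. f"] by (simp add: Fsp_iff_pf)

lemma Fsp_dnth: "f \<in> Fsp \<Longrightarrow> dnth n f \<in> Fsp"
  by (induction n) (auto simp: dnth_Suc_vd Fsp_vd simp del: dnth.simps(2))

lemma FspI_deriv:
  assumes "\<And>x. (f has_vector_derivative f' x) (at x)" "f' \<in> Fsp" "\<And>x. f (x + 1) = f x"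
  shows "f \<in> Fsp"
proof -
  have "continuous_on UNIV f" using assms(1)
    by (simp add: continuous_on_eq_continuous_at) (metis has_vector_derivative_continuous)
  then show ?thesis unfolding Fsp_iff_pf
    using periodic_bounded[of f] assms(1,3) assms(2)[unfolded Fsp_iff_pf]
    by (intro pfI_deriv[of UNIV "\<lambda>_. f" "\<lambda>_. f'"]) auto
qed

lemma Fsp_const: "(\<lambda>x. c) \<in> Fsp" by (simp add: Fsp_iff_pf pf_const')
lemma Fsp_add: "f \<in> Fsp \<Longrightarrow> g \<in> Fsp \<Longrightarrow> (\<lambda>x. f x + g x) \<in> Fsp" unfolding Fsp_iff_pf by (rule pf_add)
lemma Fsp_mult: "f \<in> Fsp \<Longrightarrow> g \<in> Fsp \<Longrightarrow> (\<lambda>x. f x * g x) \<in> Fsp" unfolding Fsp_iff_pf by (rule pf_mult)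
lemma Fsp_minus: "f \<in> Fsp \<Longrightarrow> (\<lambda>x. - f x) \<in> Fsp" unfolding Fsp_iff_pf by (rule pf_minus)
lemma Fsp_diff: "f \<in> Fsp \<Longrightarrow> g \<in> Fsp \<Longrightarrow> (\<lambda>x. f x - g x) \<in> Fsp" unfolding Fsp_iff_pf by (rule pf_diff)
lemma Fsp_exp: "f \<in> Fsp \<Longrightarrow> (\<lambda>x. exp (f x)) \<in> Fsp" unfolding Fsp_iff_pf by (rule pf_exp)
lemma Fsp_cnj: "f \<in> Fsp \<Longrightarrow> (\<lambda>x. cnj (f x)) \<in> Fsp" unfolding Fsp_iff_pf by (rule pf_cnj)
lemma Fsp_Re: "f \<in> Fsp \<Longrightarrow> (\<lambda>x. complex_of_real (Re (f x))) \<in> Fsp" unfolding Fsp_iff_pf by (rule pf_Re)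
lemma Fsp_sum: "finite S \<Longrightarrow> (\<And>i. i \<in> S \<Longrightarrow> f i \<in> Fsp) \<Longrightarrow> (\<lambda>x. \<Sum>i\<in>S. f i x) \<in> Fsp"
  unfolding Fsp_iff_pf by (rule pf_sum)

lemma vd_const: "vd (\<lambda>x. c) = (\<lambda>x. 0)"
  by (rule vd_eqI) auto

lemma vd_add: "f \<in> Fsp \<Longrightarrow> g \<in> Fsp \<Longrightarrow> vd (\<lambda>x. f x + g x) = (\<lambda>x. vd f x + vd g x)"
  by (rule vd_eqI) (auto intro!: derivative_intros Fsp_deriv)

lemma vd_mult: "f \<in> Fsp \<Longrightarrow> g \<in> Fsp \<Longrightarrow> vd (\<lambda>x. f x * g x) = (\<lambda>x. f x * vd g x + vd f x * g x)"
  by (rule vd_eqI) (auto intro!: derivative_intros Fsp_deriv)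

lemma vd_cmult: "f \<in> Fsp \<Longrightarrow> vd (\<lambda>x. c * f x) = (\<lambda>x. c * vd f x)"
  using vd_mult[OF Fsp_const, of f c] by (simp add: vd_const)

lemma vd_sum: "finite S \<Longrightarrow> (\<And>i. i \<in> S \<Longrightarrow> f i \<in> Fsp) \<Longrightarrow> vd (\<lambda>x. \<Sum>i\<in>S. f i x) = (\<lambda>x. \<Sum>i\<in>S. vd (f i) x)"
  by (rule vd_eqI) (auto intro!: derivative_intros has_vector_derivative_sum Fsp_deriv)

lemma dnth_add: "f \<in> Fsp \<Longrightarrow> g \<in> Fsp \<Longrightarrow> dnth n (\<lambda>x. f x + g x) = (\<lambda>x. dnth n f x + dnth n g x)"
  by (induction n) (auto simp: dnth_Suc_vd vd_add Fsp_dnth simp del: dnth.simps(2))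

lemma dnth_cmult: "f \<in> Fsp \<Longrightarrow> dnth n (\<lambda>x. c * f x) = (\<lambda>x. c * dnth n f x)"
  by (induction n) (auto simp: dnth_Suc_vd vd_cmult Fsp_dnth simp del: dnth.simps(2))

section \<open>Diffeomorphisms and the action on coefficients\<close>

lemma has_vector_derivative_of_real_iff:
  fixes f :: "real \<Rightarrow> real"
  shows "((\<lambda>x. complex_of_real (f x)) has_vector_derivative complex_of_real f') (at x) \<longleftrightarrow> (f has_vector_derivative f') (at x)"
proof
  assume "((\<lambda>x. complex_of_real (f x)) has_vector_derivative complex_of_real f') (at x)"
  from bounded_linear.has_vector_derivative[OF bounded_linear_Re this]
  show "(f has_vector_derivative f') (at x)" by simp
qed (rule bounded_linear.has_vector_derivative[OF bounded_linear_of_real])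

lemma real_dnth:
  fixes f :: "real \<Rightarrow> real"
  assumes "(\<lambda>x. complex_of_real (f x)) \<in> Fsp"
  shows "dnth n (\<lambda>x. complex_of_real (f x)) = (\<lambda>x. complex_of_real (dnth n f x))"
    and "(dnth n f has_vector_derivative dnth (Suc n) f x) (at x)"
proof -
  let ?F = "\<lambda>x. complex_of_real (f x)"
  have *: "(dnth n ?F has_vector_derivative dnth (Suc n) ?F x) (at x)" for n x
    using Fsp_deriv[OF Fsp_dnth[OF assms]] by (simp only: dnth_Suc_vd)
  have A: "dnth n ?F = (\<lambda>x. complex_of_real (dnth n f x))" for n
  proof (induction n)
    case (Suc n)
    have "(dnth n f has_vector_derivative Re (dnth (Suc n) ?F x)) (at x)" for x
      using bounded_linear.has_vector_derivative[OF bounded_linear_Re *[of n x]] Suc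
      by (simp del: dnth.simps)
    from this vd_eqI[OF this] have "(dnth n f has_vector_derivative dnth (Suc n) f x) (at x)" for x
      unfolding dnth_Suc_vd by simp
    then have "(dnth n ?F has_vector_derivative of_real (dnth (Suc n) f x)) (at x)" for x
      unfolding Suc has_vector_derivative_of_real_iff .
    from vd_eqI[OF this] show ?case unfolding dnth_Suc_vd .
  qed auto
  show "dnth n ?F = (\<lambda>x. complex_of_real (dnth n f x))" by (rule A)
  show "(dnth n f has_vector_derivative dnth (Suc n) f x) (at x)"
    using *[of n x] unfolding A has_vector_derivative_of_real_iff .
qed

text \<open>A zero-free periodic function stays away from zero because its inverse is continuous and
  hence bounded; \<open>pf_inverse\<close> asks for this uniform bound.\<close>

lemma Fsp_inverse:
  assumes "f \<in> Fsp" "\<And>x. f x \<noteq> 0" shows "(\<lambda>x. inverse (f x)) \<in> Fsp"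
proof -
  have cont: "continuous_on UNIV f"
    using Fsp_deriv[OF assms(1)] by (simp add: continuous_on_eq_continuous_at) (metis has_vector_derivative_continuous)
  then have "continuous_on UNIV (\<lambda>x. inverse (f x))" using assms by (intro continuous_intros) auto
  then obtain C where C: "\<And>x. norm (inverse (f x)) \<le> C"
    using periodic_bounded[of "\<lambda>x. inverse (f x)"] Fsp_periodic[OF assms(1)] by auto
  define c where "c = inverse (\<bar>C\<bar> + 1)"
  have "c \<le> norm (f x)" for x
  proof -
    have "norm (inverse (f x)) \<le> \<bar>C\<bar> + 1" using C[of x] by linarith
    then show ?thesis unfolding c_def using assms(2)[of x]
      by (metis inverse_inverse_eq le_imp_inverse_le norm_inverse zero_less_norm_iff inverse_nonzero_iff_nonzero)
  qed
  then show ?thesis using assms(1) unfolding Fsp_iff_pf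
    by (intro pf_inverse[of c]) (auto simp: c_def)
qed

text \<open>With the logarithm of the Jacobian a Jacobian power is \<open>exp (l * lgd g x)\<close>:
  complex weights then need no branch of the power function, and factors combine by adding
  exponents.\<close>

definition lgd :: "(real \<Rightarrow> real) \<Rightarrow> real \<Rightarrow> complex" where
  "lgd g = (\<lambda>x. complex_of_real (ln (vd g x)))"

lemma DiffS1_deriv:
  assumes "g \<in> DiffS1"
  shows "(g has_vector_derivative vd g x) (at x)" "vd g x > 0" "g (x + 1) = g x + 1"
    "(\<lambda>x. complex_of_real (vd g x)) \<in> Fsp"
proof -
  from assms have sm: "\<And>n x. dnth n g differentiable (at x)" and pos: "\<And>x. vd g x > 0"
    and per: "\<And>x. g (x + 1) = g x + 1"
    unfolding DiffS1_def smooth_fun_def dnth_1 by auto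
  have der: "(dnth n g has_vector_derivative dnth (Suc n) g x) (at x)" for n x
    using vd_works[OF sm] unfolding dnth_Suc_vd by blast
  show g': "(g has_vector_derivative vd g x) (at x)" for x using der[of 0 x] by (simp add: vd_def)
  show "vd g x > 0" "g (x + 1) = g x + 1" by (fact pos per)+
  have A: "dnth n (\<lambda>x. complex_of_real (vd g x)) = (\<lambda>x. complex_of_real (dnth (Suc n) g x))" for n
  proof (induction n)
    case 0 then show ?case by (simp add: vd_def)
  next
    case (Suc n)
    have "vd (\<lambda>x. complex_of_real (dnth (Suc n) g x)) = (\<lambda>x. complex_of_real (dnth (Suc (Suc n)) g x))"
      by (rule vd_eqI) (simp only: has_vector_derivative_of_real_iff der)
    then show ?case using Suc by (simp only: dnth_Suc_vd)
  qed
  have "vd g (x + 1) = vd g x" for x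
  proof -
    have "((\<lambda>x. g (x + 1)) has_vector_derivative vd g (x + 1)) (at x)"
      using has_vector_derivative_shift g' by blast
    moreover have "((\<lambda>x. g x + 1) has_vector_derivative vd g x) (at x)"
      using has_vector_derivative_add_const g' by blast
    ultimately show ?thesis unfolding per using vector_derivative_unique_at by blast
  qed
  moreover have "dnth n (\<lambda>x. complex_of_real (vd g x)) differentiable (at x)" for n x
    unfolding A using der[of "Suc n" x] has_vector_derivative_of_real_iff differentiableI_vector by blast
  ultimately show "(\<lambda>x. complex_of_real (vd g x)) \<in> Fsp"
    unfolding Fsp_def smooth_fun_def by simp
qed

lemma DiffS1I:
  assumes "\<And>x. (g has_vector_derivative g' x) (at x)" "\<And>x. g' x > 0" "\<And>x. g (x + 1) = g x + 1"
    "(\<lambda>x. complex_of_real (g' x)) \<in> Fsp"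
  shows "g \<in> DiffS1" "vd g = g'"
proof -
  show v: "vd g = g'" using assms(1) by (rule vd_eqI)
  have "dnth n g differentiable (at x)" for n x
  proof (cases n)
    case 0 then show ?thesis using differentiableI_vector[OF assms(1)] by simp
  next
    case (Suc m)
    then have "dnth n g = dnth m g'" using dnth_Suc_right v by metis
    then show ?thesis using differentiableI_vector[OF real_dnth(2)[OF assms(4)]] by simp
  qed
  then show "g \<in> DiffS1"
    unfolding DiffS1_def smooth_fun_def dnth_1 using assms v by simp
qed

lemma exp_lgd: "g \<in> DiffS1 \<Longrightarrow> exp (lgd g x) = complex_of_real (vd g x)"
  unfolding lgd_def using DiffS1_deriv(2)[of g x] by (metis exp_ln exp_of_real)

lemma lgd_Fsp:
  assumes g: "g \<in> DiffS1" shows "lgd g \<in> Fsp"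
proof -
  let ?G = "\<lambda>x. complex_of_real (vd g x)"
  note G = DiffS1_deriv(4)[OF g]
  have nz: "?G x \<noteq> 0" for x using DiffS1_deriv(2)[OF g, of x] by simp
  have d: "(vd g has_vector_derivative dnth 1 (vd g) x) (at x)" for x
    using real_dnth(2)[OF G, of 0 x] by simp
  have "((\<lambda>x. ln (vd g x)) has_vector_derivative dnth 1 (vd g) x * inverse (vd g x)) (at x)" for x
    using field_vector_diff_chain_at[of "vd g" "dnth 1 (vd g) x" x ln "inverse (vd g x)"] d[of x]
      DERIV_ln[OF DiffS1_deriv(2)[OF g, of x]] by (simp add: o_def)
  then have "((\<lambda>x. complex_of_real (ln (vd g x))) has_vector_derivative complex_of_real (dnth 1 (vd g) x * inverse (vd g x))) (at x)" for x
    unfolding has_vector_derivative_of_real_iff .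
  moreover have "complex_of_real (dnth 1 (vd g) x * inverse (vd g x)) = dnth 1 ?G x * inverse (?G x)" for x
    using fun_cong[OF real_dnth(1)[OF G, of 1], of x] by simp
  ultimately have "(lgd g has_vector_derivative dnth 1 ?G x * inverse (?G x)) (at x)" for x
    unfolding lgd_def by metis
  moreover have "(\<lambda>x. dnth 1 ?G x * inverse (?G x)) \<in> Fsp"
    using Fsp_dnth[OF G, of 1] Fsp_inverse[OF G nz] by (intro Fsp_mult)
  moreover have "lgd g (x + 1) = lgd g x" for x
    using Fsp_periodic[OF G, of x] by (simp add: lgd_def)
  ultimately show ?thesis by (rule FspI_deriv)
qed

lemma pull_lgd: "g \<in> DiffS1 \<Longrightarrow> pull l g \<phi> = (\<lambda>x. exp (l * lgd g x) * \<phi> (g x))"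
  unfolding pull_def lgd_def dnth_1 using DiffS1_deriv(2)[of g]
  by (auto simp: powr_def Ln_of_real fun_eq_iff less_imp_neq[THEN not_sym])

text \<open>Bounds on \<open>lgd\<close> bound the Jacobian above and away from zero at once,
  together with its derivatives. The lifts \<open>g t\<close> themselves are not periodic and are
  never bounded directly.\<close>

definition dfam :: "real set \<Rightarrow> (real \<Rightarrow> real \<Rightarrow> real) \<Rightarrow> bool" where
  "dfam I g \<longleftrightarrow> (\<forall>t\<in>I. g t \<in> DiffS1) \<and> pf I (\<lambda>t. lgd (g t))"

lemma dfam_const: "g \<in> DiffS1 \<Longrightarrow> dfam I (\<lambda>_. g)"
  by (simp add: dfam_def lgd_Fsp pf_Fsp)

lemma has_vector_derivative_comp:
  assumes "\<phi> \<in> Fsp" "(g has_vector_derivative g') (at x)"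
  shows "((\<lambda>x. \<phi> (g x)) has_vector_derivative complex_of_real g' * vd \<phi> (g x)) (at x)"
  using vector_diff_chain_at[OF assms(2) Fsp_deriv[OF assms(1)]] by (simp add: o_def scaleR_conv_of_real)

text \<open>Differentiating \<open>\<phi> (g t x)\<close> gives \<open>exp (lgd (g t) x)\<close>
  times a composition of the same kind, so an induction over all \<open>\<phi>\<close> asks nothing
  of \<open>g\<close> beyond \<open>lgd\<close>.\<close>

lemma pf_comp:
  assumes g: "dfam I g" and \<phi>: "\<phi> \<in> Fsp"
  shows "pf I (\<lambda>t x. \<phi> (g t x))"
proof -
  have E: "pf I (\<lambda>t x. exp (lgd (g t) x))" using g by (auto simp: dfam_def pf_exp)
  have "bf I n (\<lambda>t x. \<phi> (g t x))" for n
    using \<phi>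
  proof (induction n arbitrary: \<phi>)
    case 0
    then have "\<exists>C. \<forall>x. norm (\<phi> x) \<le> C" using pf_bound[of UNIV "\<lambda>_. \<phi>"] by (auto simp: Fsp_iff_pf)
    then show ?case by auto
  next
    case (Suc n)
    show ?case
    proof (rule bf_SucI)
      show "bf I 0 (\<lambda>t x. \<phi> (g t x))"
        using pf_bound[of UNIV "\<lambda>_. \<phi>"] Suc.prems by (auto simp: Fsp_iff_pf)
      show "bf I n (\<lambda>t x. exp (lgd (g t) x) * vd \<phi> (g t x))"
        using E Suc.IH[OF Fsp_vd[OF Suc.prems]] by (auto simp: pf_def intro: bf_mult)
      show "((\<lambda>x. \<phi> (g t x)) has_vector_derivative exp (lgd (g t) x) * vd \<phi> (g t x)) (at x)" if "t \<in> I" for t x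
      proof -
        have "g t \<in> DiffS1" using g that by (simp add: dfam_def)
        then show ?thesis
          using has_vector_derivative_comp[OF Suc.prems DiffS1_deriv(1)] exp_lgd by metis
      qed
    qed
  qed
  moreover have "\<phi> (g t (x + 1)) = \<phi> (g t x)" if "t \<in> I" for t x
    using that g DiffS1_deriv(3) Fsp_periodic[OF \<phi>] by (metis dfam_def)
  ultimately show ?thesis by (simp add: pf_def)
qed

lemma Fsp_comp: "g \<in> DiffS1 \<Longrightarrow> \<phi> \<in> Fsp \<Longrightarrow> (\<lambda>x. \<phi> (g x)) \<in> Fsp"
  using pf_comp[OF dfam_const, of g \<phi> UNIV] by (simp add: Fsp_iff_pf)

lemma pull_Fsp: "g \<in> DiffS1 \<Longrightarrow> \<phi> \<in> Fsp \<Longrightarrow> pull l g \<phi> \<in> Fsp"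
  using Fsp_mult[OF Fsp_exp[OF Fsp_mult[OF Fsp_const lgd_Fsp]] Fsp_comp] by (simp add: pull_lgd)

lemma DiffS1_strict_mono: assumes "g \<in> DiffS1" shows "strict_mono g"
proof (rule strict_monoI)
  fix x y :: real assume "x < y"
  then show "g x < g y"
    using DERIV_pos_imp_increasing[of x y g] DiffS1_deriv(1,2)[OF assms]
    by (metis has_real_derivative_iff_has_vector_derivative)
qed

lemma DiffS1_isCont: "g \<in> DiffS1 \<Longrightarrow> isCont g x"
  using DiffS1_deriv(1) has_vector_derivative_continuous by blast

lemma DiffS1_int: assumes "g \<in> DiffS1" shows "g (x + of_int n) = g x + of_int n"
  using periodic_int[of "\<lambda>x. g x - x" x n] DiffS1_deriv(3)[OF assms] by (simp add: algebra_simps)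

lemma DiffS1_bij: assumes g: "g \<in> DiffS1" shows "bij g"
proof -
  have "\<exists>x. g x = y" for y
  proof -
    obtain n where n: "of_int n \<ge> y - g 0" using ex_le_of_int by blast
    obtain m where m: "of_int m \<ge> g 0 - y" using ex_le_of_int by blast
    have "g (of_int (-m)) \<le> y" "y \<le> g (of_int n)"
      using DiffS1_int[OF g, of 0 "-m"] DiffS1_int[OF g, of 0 n] n m by auto
    moreover have "of_int (-m) \<le> (of_int n :: real)" using n m
      using calculation DiffS1_strict_mono[OF g] by (meson dual_order.trans strict_mono_less_eq)
    ultimately show ?thesis
      using IVT[of g "of_int (-m)" y "of_int n"] DiffS1_isCont[OF g] by auto
  qed
  then show ?thesis
    using DiffS1_strict_mono[OF g] by (metis bijI strict_mono_imp_inj_on surjI)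
qed

lemma DiffS1_inv: assumes g: "g \<in> DiffS1" shows "inv g \<in> DiffS1" "inv (inv g) = g"
proof -
  note b = DiffS1_bij[OF g]
  show "inv (inv g) = g" using b by (rule inv_inv_eq)
  define q where "q = inv g"
  have gq: "g (q y) = y" and qg: "q (g x) = x" for x y
    unfolding q_def using b by (simp_all add: bij_is_surj surj_f_inv_f bij_is_inj)
  have per: "q (y + 1) = q y + 1" for y
    using DiffS1_deriv(3)[OF g, of "q y"] gq qg by metis
  have cont: "isCont q y" for y
    using isCont_inverse_function[of 1 "q y" q g] qg gq DiffS1_isCont[OF g] by auto
  have der: "(q has_vector_derivative inverse (vd g (q y))) (at y)" for y
  proof -
    have "(g has_real_derivative vd g (q y)) (at (q y))"
      using DiffS1_deriv(1)[OF g] has_real_derivative_iff_has_vector_derivative by blast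
    then have "DERIV q y :> inverse (vd g (q y))"
      using DiffS1_deriv(2)[OF g, of "q y"] gq cont
      by (intro DERIV_inverse_function[where f=g and a="y-1" and b="y+1"]) auto
    then show ?thesis using has_real_derivative_iff_has_vector_derivative by blast
  qed
  define r where "r = (\<lambda>x. inverse (complex_of_real (vd g x)))"
  have r: "r \<in> Fsp" unfolding r_def
    using DiffS1_deriv(2,4)[OF g] by (intro Fsp_inverse) (auto simp: less_imp_neq[symmetric] order_less_imp_not_eq2)
  \<comment> \<open>Bootstrapping: the derivative of \<open>\<phi> (q y)\<close> is the function
    \<open>r * vd \<phi>\<close> of \<open>Fsp\<close>, again composed with
    \<open>q\<close>.\<close>
  have "bf UNIV n (\<lambda>_ y. \<phi> (q y))" if "\<phi> \<in> Fsp" for n \<phi>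
    using that
  proof (induction n arbitrary: \<phi>)
    case 0
    then show ?case using pf_bound[of UNIV "\<lambda>_. \<phi>"] by (auto simp: Fsp_iff_pf)
  next
    case (Suc n)
    show ?case
    proof (rule bf_SucI)
      show "bf UNIV 0 (\<lambda>_ x. \<phi> (q x))"
        using pf_bound[of UNIV "\<lambda>_. \<phi>"] Suc.prems by (auto simp: Fsp_iff_pf)
      show "bf UNIV n (\<lambda>_ y. r (q y) * vd \<phi> (q y))"
        using Suc.IH[OF Fsp_mult[OF r Fsp_vd[OF Suc.prems]]] .
      show "((\<lambda>y. \<phi> (q y)) has_vector_derivative r (q y) * vd \<phi> (q y)) (at y)" for y
        using has_vector_derivative_comp[OF Suc.prems der[of y]] by (simp add: r_def)
    qed
  qed
  then have "(\<lambda>y. r (q y)) \<in> Fsp"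
    using r per Fsp_periodic[OF r] by (simp add: Fsp_iff_pf pf_def)
  then have "(\<lambda>y. complex_of_real (inverse (vd g (q y)))) \<in> Fsp" by (simp add: r_def)
  from DiffS1I(1)[OF der _ per this] show "inv g \<in> DiffS1"
    using DiffS1_deriv(2)[OF g] by (simp add: q_def)
qed

lemma pull_inv:
  assumes g: "g \<in> DiffS1"
  shows "pull l g (pull l (inv g) \<phi>) = \<phi>" "pull l (inv g) (pull l g \<phi>) = \<phi>"
proof -
  have *: "pull l g (pull l (inv g) \<phi>) = \<phi>" if g: "g \<in> DiffS1" for g
  proof
    fix x
    note b = DiffS1_bij[OF g]
    note gi = DiffS1_inv(1)[OF g]
    have qg: "inv g (g y) = y" for y using b by (simp add: bij_is_inj)
    have "((inv g \<circ> g) has_vector_derivative vd g x *\<^sub>R vd (inv g) (g x)) (at x)"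
      by (rule vector_diff_chain_at[OF DiffS1_deriv(1)[OF g] DiffS1_deriv(1)[OF gi]])
    moreover have "inv g \<circ> g = (\<lambda>x. x)" using qg by auto
    ultimately have "vd g x * vd (inv g) (g x) = 1"
      using vector_derivative_unique_at[of "\<lambda>x. x" _ x 1] by (metis has_vector_derivative_id real_scaleR_def)
    then have "ln (vd g x) + ln (vd (inv g) (g x)) = 0"
      using DiffS1_deriv(2)[OF g, of x] DiffS1_deriv(2)[OF gi, of "g x"] by (metis ln_mult_pos ln_one)
    then have "lgd g x + lgd (inv g) (g x) = 0"
      unfolding lgd_def by (metis of_real_0 of_real_add)
    then have "exp (l * lgd g x) * exp (l * lgd (inv g) (g x)) = 1"
      by (metis distrib_left exp_zero mult_exp_exp mult_zero_right)
    then show "pull l g (pull l (inv g) \<phi>) x = \<phi> x"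
      unfolding pull_lgd[OF g] pull_lgd[OF gi] qg by (simp add: mult.assoc[symmetric])
  qed
  show "pull l g (pull l (inv g) \<phi>) = \<phi>" "pull l (inv g) (pull l g \<phi>) = \<phi>"
    using *[OF g] *[OF DiffS1_inv(1)[OF g]] DiffS1_inv(2)[OF g] by auto
qed

text \<open>With \<open>\<eta> = (ln g')'\<close>, \<open>Pc l \<eta> i s\<close> is the coefficient of the \<open>s\<close>-th derivative of \<open>g'\<^sup>l (\<psi> \<circ> g)\<close> in
  \<open>g'\<^sup>l\<^sup>+\<^sup>i (\<psi>\<^sup>(\<^sup>i\<^sup>) \<circ> g)\<close>.\<close>
fun Pc :: "complex \<Rightarrow> (real \<Rightarrow> complex) \<Rightarrow> nat \<Rightarrow> nat \<Rightarrow> real \<Rightarrow> complex" where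
  "Pc l \<eta> 0 s = (\<lambda>x. if s = 0 then 1 else 0)"
| "Pc l \<eta> (Suc i) s = (\<lambda>x. vd (Pc l \<eta> i s) x + (if s = 0 then 0 else Pc l \<eta> i (s - 1) x)
     - (l + of_nat i) * \<eta> x * Pc l \<eta> i s x)"

lemma Pc_pf: "pf I \<eta> \<Longrightarrow> pf I (\<lambda>t. Pc l (\<eta> t) i s)"
proof (induction i arbitrary: s)
  case 0 then show ?case by (cases "s = 0") (auto simp: pf_const')
next
  case (Suc i)
  show ?case unfolding Pc.simps
    using Suc by (cases "s = 0") (auto intro!: pf_add pf_diff pf_mult pf_vd pf_const')
qed

lemma Pc_Fsp: "\<eta> \<in> Fsp \<Longrightarrow> Pc l \<eta> i s \<in> Fsp"
  using Pc_pf[of UNIV "\<lambda>_. \<eta>"] by (simp add: Fsp_iff_pf)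

lemma Pc_gt: "s > i \<Longrightarrow> Pc l \<eta> i s = (\<lambda>x. 0)"
  by (induction i arbitrary: s) (auto simp: vd_const)

lemma Pc_diag: "Pc l \<eta> i i = (\<lambda>x. 1)"
  by (induction i) (auto simp: vd_const Pc_gt)

lemma sum_triangle:
  fixes f :: "nat \<Rightarrow> nat \<Rightarrow> 'a::comm_monoid_add"
  shows "(\<Sum>i\<le>k. \<Sum>s\<le>i. f i s) = (\<Sum>s\<le>k. \<Sum>i\<in>{s..k}. f i s)"
proof (induction k)
  case (Suc k)
  have "(\<Sum>s\<le>k. \<Sum>i\<in>{s..Suc k}. f i s) = (\<Sum>s\<le>k. (\<Sum>i\<in>{s..k}. f i s) + f (Suc k) s)"
    by (intro sum.cong refl) (simp add: atLeastAtMostSuc_conv add.commute)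
  then show ?case using Suc by (simp add: sum.distrib ac_simps)
qed simp

text \<open>Differentiation raises the weight by one up to a correction by
  \<open>vd (lgd g)\<close>. Used with \<open>l + of_nat i\<close> in place of \<open>l\<close>,
  this is the recursion of \<open>Pc\<close>.\<close>

lemma vd_pull:
  assumes g: "g \<in> DiffS1" and \<psi>: "\<psi> \<in> Fsp"
  shows "pull (l + 1) g (vd \<psi>) = (\<lambda>x. vd (pull l g \<psi>) x - l * vd (lgd g) x * pull l g \<psi> x)"
proof -
  have "((\<lambda>x. exp (l * lgd g x) * \<psi> (g x)) has_vector_derivative
      exp (l * lgd g x) * (complex_of_real (vd g x) * vd \<psi> (g x)) + (l * vd (lgd g) x * exp (l * lgd g x)) * \<psi> (g x)) (at x)" for x
  proof (rule has_vector_derivative_mult)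
    show "((\<lambda>x. \<psi> (g x)) has_vector_derivative complex_of_real (vd g x) * vd \<psi> (g x)) (at x)"
      by (rule has_vector_derivative_comp[OF \<psi> DiffS1_deriv(1)[OF g]])
    have "((\<lambda>x. l * lgd g x) has_vector_derivative l * vd (lgd g) x) (at x)"
      by (intro has_vector_derivative_mult_right Fsp_deriv lgd_Fsp g)
    from field_vector_diff_chain_at[OF this DERIV_exp]
    show "((\<lambda>x. exp (l * lgd g x)) has_vector_derivative l * vd (lgd g) x * exp (l * lgd g x)) (at x)"
      by (simp add: o_def)
  qed
  then have "vd (pull l g \<psi>) = (\<lambda>x. exp (l * lgd g x) * (exp (lgd g x) * vd \<psi> (g x)) + (l * vd (lgd g) x * exp (l * lgd g x)) * \<psi> (g x))"
    unfolding pull_lgd[OF g] exp_lgd[OF g] by (rule vd_eqI)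
  then show ?thesis unfolding pull_lgd[OF g]
    by (auto simp: fun_eq_iff algebra_simps exp_add)
qed

lemma pull_dnth:
  assumes g: "g \<in> DiffS1" and \<phi>: "\<phi> \<in> Fsp"
  shows "pull (l + of_nat i) g (dnth i \<phi>) x = (\<Sum>s\<le>i. Pc l (vd (lgd g)) i s x * dnth s (pull l g \<phi>) x)"
proof (induction i arbitrary: x)
  case 0 then show ?case by simp
next
  case (Suc i)
  let ?u = "pull l g \<phi>" and ?P = "Pc l (vd (lgd g))" and ?\<eta> = "vd (lgd g)"
  have u: "?u \<in> Fsp" using g \<phi> by (rule pull_Fsp)
  have P: "?P i s \<in> Fsp" for i s by (intro Pc_Fsp Fsp_vd lgd_Fsp g)
  have IH: "pull (l + of_nat i) g (dnth i \<phi>) = (\<lambda>x. \<Sum>s\<le>i. ?P i s x * dnth s ?u x)"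
    using Suc by auto
  have vdS: "vd (pull (l + of_nat i) g (dnth i \<phi>)) = (\<lambda>x. \<Sum>s\<le>i. ?P i s x * dnth (Suc s) ?u x + vd (?P i s) x * dnth s ?u x)"
    unfolding IH by (subst vd_sum) (auto simp: vd_mult P u Fsp_dnth Fsp_mult dnth_Suc_vd simp del: dnth.simps)
  have "pull (l + of_nat (Suc i)) g (dnth (Suc i) \<phi>) = pull ((l + of_nat i) + 1) g (vd (dnth i \<phi>))"
    by (simp only: dnth_Suc_vd) (simp add: ac_simps)
  also have "\<dots> = (\<lambda>x. vd (pull (l + of_nat i) g (dnth i \<phi>)) x - (l + of_nat i) * ?\<eta> x * pull (l + of_nat i) g (dnth i \<phi>) x)"
    by (rule vd_pull[OF g Fsp_dnth[OF \<phi>]])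
  finally have "pull (l + of_nat (Suc i)) g (dnth (Suc i) \<phi>) x
     = (\<Sum>s\<le>i. ?P i s x * dnth (Suc s) ?u x) + (\<Sum>s\<le>i. vd (?P i s) x * dnth s ?u x)
       - (\<Sum>s\<le>i. (l + of_nat i) * ?\<eta> x * ?P i s x * dnth s ?u x)"
    unfolding vdS unfolding IH sum.distrib sum_distrib_left by (simp add: mult.assoc del: dnth.simps)
  also have "(\<Sum>s\<le>i. ?P i s x * dnth (Suc s) ?u x) = (\<Sum>s\<le>Suc i. (if s = 0 then 0 else ?P i (s - 1) x) * dnth s ?u x)"
    by (simp only: sum.atMost_Suc_shift) simp
  also have "(\<Sum>s\<le>i. vd (?P i s) x * dnth s ?u x) = (\<Sum>s\<le>Suc i. vd (?P i s) x * dnth s ?u x)"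
    by (simp add: Pc_gt vd_const del: dnth.simps)
  also have "(\<Sum>s\<le>i. (l + of_nat i) * ?\<eta> x * ?P i s x * dnth s ?u x) = (\<Sum>s\<le>Suc i. (l + of_nat i) * ?\<eta> x * ?P i s x * dnth s ?u x)"
    by (simp add: Pc_gt del: dnth.simps)
  finally show ?case
    by (simp only: Pc.simps ring_distribs sum.distrib[symmetric] sum_subtractf[symmetric])
       (simp add: algebra_simps del: dnth.simps)
qed

type_synonym coeffs = "nat \<Rightarrow> real \<Rightarrow> complex"

text \<open>Entries beyond \<open>k\<close> are fixed to zero so that \<open>diffop k\<close> is a
  bijection from \<open>Cf k\<close> onto \<open>DiffOps k\<close>.\<close>

definition Cf :: "nat \<Rightarrow> coeffs set" where
  "Cf k = {a. (\<forall>i. a i \<in> Fsp) \<and> (\<forall>i>k. a i = (\<lambda>x. 0))}"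

text \<open>The coefficients of the transform under \<open>inv g\<close>. Acting by the inverse puts
  \<open>g\<close> itself into the formula, and \<open>inv g\<close> still ranges over all
  diffeomorphisms.\<close>

definition acth :: "complex \<Rightarrow> complex \<Rightarrow> nat \<Rightarrow> (real \<Rightarrow> real) \<Rightarrow> coeffs \<Rightarrow> coeffs" where
  "acth l m k g a s = (\<lambda>x. \<Sum>i\<in>{s..k}. exp ((m - l - of_nat i) * lgd g x) * a i (g x) * Pc l (vd (lgd g)) i s x)"

lemma acth_pf:
  assumes "dfam I g" "a \<in> Cf k" shows "pf I (\<lambda>t. acth l m k (g t) a s)"
proof -
  have lg: "pf I (\<lambda>t. lgd (g t))" using assms by (simp add: dfam_def)
  have "pf I (\<lambda>t x. exp ((m - l - of_nat i) * lgd (g t) x) * a i (g t x) * Pc l (vd (lgd (g t))) i s x)" for i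
    using pf_mult[OF pf_mult[OF pf_exp[OF pf_mult[OF pf_const' lg]] pf_comp[OF assms(1)]] Pc_pf[OF pf_vd[OF lg]]]
      assms(2) by (auto simp: Cf_def)
  then show ?thesis unfolding acth_def by (intro pf_sum) auto
qed

lemma acth_Cf: "g \<in> DiffS1 \<Longrightarrow> a \<in> Cf k \<Longrightarrow> acth l m k g a \<in> Cf k"
  using acth_pf[OF dfam_const, of g a k UNIV l m] unfolding Cf_def Fsp_iff_pf
  by (auto simp: acth_def)

lemma diffop_Cf: "a \<in> Cf k \<Longrightarrow> diffop k a \<in> DiffOps k"
  unfolding DiffOps_def Cf_def by auto

lemma DiffOps_Cf: assumes "A \<in> DiffOps k" obtains a where "a \<in> Cf k" "A = diffop k a"
proof -
  from assms obtain b where b: "A = diffop k b" "\<forall>i\<le>k. b i \<in> Fsp" unfolding DiffOps_def by auto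
  show ?thesis
    by (rule that[of "\<lambda>i. if i \<le> k then b i else (\<lambda>x. 0)"])
       (use b in \<open>auto simp: Cf_def Fsp_const diffop_def restrict_def fun_eq_iff\<close>)
qed

lemma act_inv_diffop:
  assumes g: "g \<in> DiffS1" and a: "a \<in> Cf k"
  shows "act l m (inv g) (diffop k a) = diffop k (acth l m k g a)"
proof
  fix \<phi>
  show "act l m (inv g) (diffop k a) \<phi> = diffop k (acth l m k g a) \<phi>"
  proof (cases "\<phi> \<in> Fsp")
    case True
    let ?\<psi> = "pull l (inv g) \<phi>"
    have \<psi>: "?\<psi> \<in> Fsp" by (intro pull_Fsp DiffS1_inv g True)
    have pp: "pull l g ?\<psi> = \<phi>" using pull_inv[OF g] by simp
    have "act l m (inv g) (diffop k a) \<phi> x = (\<Sum>s\<le>k. acth l m k g a s x * dnth s \<phi> x)" for x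
    proof -
      have "act l m (inv g) (diffop k a) \<phi> x = pull m g (\<lambda>x. \<Sum>i\<le>k. a i x * dnth i ?\<psi> x) x"
        using True \<psi> DiffS1_inv(2)[OF g] by (simp add: act_def diffop_def)
      also have "\<dots> = (\<Sum>i\<le>k. exp ((m - l - of_nat i) * lgd g x) * a i (g x) * pull (l + of_nat i) g (dnth i ?\<psi>) x)"
        unfolding pull_lgd[OF g] sum_distrib_left
        by (intro sum.cong refl) (simp add: mult_exp_exp algebra_simps exp_add[symmetric])
      also have "\<dots> = (\<Sum>i\<le>k. \<Sum>s\<le>i. exp ((m - l - of_nat i) * lgd g x) * a i (g x) * Pc l (vd (lgd g)) i s x * dnth s \<phi> x)"
        unfolding pull_dnth[OF g \<psi>] pp by (simp add: sum_distrib_left mult.assoc)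
      also have "\<dots> = (\<Sum>s\<le>k. \<Sum>i\<in>{s..k}. exp ((m - l - of_nat i) * lgd g x) * a i (g x) * Pc l (vd (lgd g)) i s x * dnth s \<phi> x)"
        by (rule sum_triangle)
      finally show ?thesis unfolding acth_def sum_distrib_right .
    qed
    then show ?thesis using True by (auto simp: diffop_def)
  qed (simp add: act_def diffop_def)
qed

section \<open>Symmetries as maps of coefficient sequences\<close>

lemma poly_int_zero:
  fixes c :: "nat \<Rightarrow> complex"
  assumes "\<And>z::int. (\<Sum>i\<le>n. c i * of_int z ^ i) = 0" "i \<le> n"
  shows "c i = 0"
proof (rule ccontr)
  assume "c i \<noteq> 0"
  then have "finite {x. (\<Sum>i\<le>n. c i * x ^ i) = 0}" using polyfun_finite_roots[of c n] assms(2) by auto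
  then have "finite (range (of_int :: int \<Rightarrow> complex))" by (rule finite_subset[rotated]) (use assms(1) in auto)
  then have "finite (UNIV :: int set)" by (rule finite_imageD) (simp add: inj_on_def)
  then show False by simp
qed

abbreviation tpi :: complex where "tpi \<equiv> 2 * of_real pi * \<i>"

definition ee :: "int \<Rightarrow> real \<Rightarrow> complex" where
  "ee z = (\<lambda>x. exp (tpi * of_int z * of_real x))"

lemma ee_deriv: "(ee z has_vector_derivative tpi * of_int z * ee z x) (at x)"
proof -
  have "((\<lambda>x. tpi * of_int z * of_real x) has_vector_derivative tpi * of_int z * of_real 1) (at x)"
    by (intro has_vector_derivative_mult_right) (simp add: has_vector_derivative_of_real_iff[of "\<lambda>x. x" 1, simplified])
  from field_vector_diff_chain_at[OF this DERIV_exp] show ?thesis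
    by (simp add: ee_def o_def)
qed

lemma dnth_ee: "dnth n (ee z) = (\<lambda>x. (tpi * of_int z) ^ n * ee z x)"
proof (induction n)
  case (Suc n)
  show ?case unfolding dnth_Suc_vd Suc
    by (rule vd_eqI) (auto intro!: derivative_eq_intros ee_deriv)
qed auto

lemma ee_Fsp: "ee z \<in> Fsp"
proof -
  have "(\<lambda>x. (tpi * of_int z) ^ n * ee z x) differentiable (at x)" for n x
    by (rule differentiableI_vector, rule has_vector_derivative_mult_right, rule ee_deriv)
  moreover have "ee z (x + 1) = ee z x" for x
    using exp_integer_2pi[of "of_int z"] by (simp add: ee_def algebra_simps exp_add)
  ultimately show ?thesis unfolding Fsp_def smooth_fun_def by (simp only: dnth_ee mem_Collect_eq) simp
qed

lemma vd_ee: "vd (ee z) = (\<lambda>x. tpi * of_int z * ee z x)"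
  by (rule vd_eqI[OF ee_deriv])

lemma ee_add: "ee (y + z) x = ee y x * ee z x"
  by (simp add: ee_def exp_add[symmetric] algebra_simps)

lemma ee_0: "ee 0 = (\<lambda>x. 1)"
  by (simp add: ee_def)

lemma ee_nonzero: "ee z x \<noteq> 0"
  by (simp add: ee_def)

text \<open>On \<open>ee z\<close> an operator acts as multiplication by a polynomial in
  \<open>z\<close> with coefficients \<open>a i x * tpi ^ i\<close>; agreement at all integers
  determines them.\<close>

lemma diffop_inj:
  assumes a: "a \<in> Cf k" and b: "b \<in> Cf k" and eq: "diffop k a = diffop k b"
  shows "a = b"
proof (intro ext)
  fix i x
  show "a i x = b i x"
  proof (cases "i \<le> k")
    case True
    have "(\<Sum>i\<le>k. ((a i x - b i x) * tpi ^ i) * of_int z ^ i) = 0" for z :: int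
    proof -
      have "diffop k a (ee z) x = diffop k b (ee z) x" using eq by simp
      then have "(\<Sum>i\<le>k. a i x * ((tpi * of_int z) ^ i * ee z x)) = (\<Sum>i\<le>k. b i x * ((tpi * of_int z) ^ i * ee z x))"
        by (simp add: diffop_def ee_Fsp dnth_ee)
      moreover have "(\<Sum>i\<le>k. ((a i x - b i x) * tpi ^ i) * of_int z ^ i) * ee z x
          = (\<Sum>i\<le>k. a i x * ((tpi * of_int z) ^ i * ee z x)) - (\<Sum>i\<le>k. b i x * ((tpi * of_int z) ^ i * ee z x))"
        unfolding sum_distrib_right sum_subtractf[symmetric]
        by (intro sum.cong refl) (simp add: power_mult_distrib algebra_simps)
      ultimately have "(\<Sum>i\<le>k. ((a i x - b i x) * tpi ^ i) * of_int z ^ i) * ee z x = 0" by simp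
      then show ?thesis using ee_nonzero by simp
    qed
    from poly_int_zero[OF this True] show ?thesis by simp
  qed (use a b in \<open>auto simp: Cf_def\<close>)
qed

definition cadd :: "coeffs \<Rightarrow> coeffs \<Rightarrow> coeffs" where
  "cadd a b = (\<lambda>i x. a i x + b i x)"
definition cscale :: "complex \<Rightarrow> coeffs \<Rightarrow> coeffs" where
  "cscale c a = (\<lambda>i x. c * a i x)"
definition sgl :: "nat \<Rightarrow> (real \<Rightarrow> complex) \<Rightarrow> coeffs" where
  "sgl j f = (\<lambda>i. if i = j then f else (\<lambda>x. 0))"

lemma cadd_Cf: "a \<in> Cf k \<Longrightarrow> b \<in> Cf k \<Longrightarrow> cadd a b \<in> Cf k"
  by (auto simp: Cf_def cadd_def Fsp_add)
lemma cscale_Cf: "a \<in> Cf k \<Longrightarrow> cscale c a \<in> Cf k"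
  by (auto simp: Cf_def cscale_def Fsp_mult Fsp_const)
lemma sgl_Cf: "f \<in> Fsp \<Longrightarrow> j \<le> k \<Longrightarrow> sgl j f \<in> Cf k"
  by (auto simp: Cf_def sgl_def Fsp_const)

lemma diffop_cadd: "op_add (diffop k a) (diffop k b) = diffop k (cadd a b)"
  by (auto simp: op_add_def diffop_def cadd_def fun_eq_iff sum.distrib ring_distribs)
lemma diffop_cscale: "op_scale c (diffop k a) = diffop k (cscale c a)"
  by (auto simp: op_scale_def diffop_def cscale_def fun_eq_iff sum_distrib_left mult.assoc)

definition cf :: "nat \<Rightarrow> dop \<Rightarrow> coeffs" where
  "cf k A = (THE a. a \<in> Cf k \<and> A = diffop k a)"

lemma cf_diffop: "a \<in> Cf k \<Longrightarrow> cf k (diffop k a) = a"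
  unfolding cf_def by (rule the_equality) (auto intro: diffop_inj)

lemma cf_works: "A \<in> DiffOps k \<Longrightarrow> cf k A \<in> Cf k \<and> diffop k (cf k A) = A"
  by (metis DiffOps_Cf cf_diffop)

text \<open>A symmetry, read off on coefficient sequences: \<open>H a\<close> are the coefficients of the image of \<open>diffop k a\<close>.\<close>
locale csym =
  fixes k :: nat and l m :: complex and H :: "coeffs \<Rightarrow> coeffs"
  assumes H_Cf: "a \<in> Cf k \<Longrightarrow> H a \<in> Cf k"
    and H_add: "a \<in> Cf k \<Longrightarrow> b \<in> Cf k \<Longrightarrow> H (cadd a b) = cadd (H a) (H b)"
    and H_scale: "a \<in> Cf k \<Longrightarrow> H (cscale c a) = cscale c (H a)"
    and H_act: "a \<in> Cf k \<Longrightarrow> g \<in> DiffS1 \<Longrightarrow> H (acth l m k g a) = acth l m k g (H a)"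

definition hat :: "nat \<Rightarrow> (dop \<Rightarrow> dop) \<Rightarrow> coeffs \<Rightarrow> coeffs" where
  "hat k T a = cf k (T (diffop k a))"

lemma hat_works:
  assumes "T \<in> Symmetries k l m" "a \<in> Cf k"
  shows "hat k T a \<in> Cf k" "T (diffop k a) = diffop k (hat k T a)"
  using assms(1) cf_works[of "T (diffop k a)" k] diffop_Cf[OF assms(2)] unfolding hat_def Symmetries_def
  by (metis (no_types, lifting) PiE_mem mem_Collect_eq)+

lemma csym_hat:
  assumes T: "T \<in> Symmetries k l m" shows "csym k l m (hat k T)"
proof
  fix a b c assume a: "a \<in> Cf k" 
  note A = diffop_Cf[OF a]
  show "hat k T a \<in> Cf k" using hat_works[OF T a] by simp
  show "hat k T (cadd a b) = cadd (hat k T a) (hat k T b)" if b: "b \<in> Cf k"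
  proof -
    have "T (op_add (diffop k a) (diffop k b)) = op_add (T (diffop k a)) (T (diffop k b))"
      using T A diffop_Cf[OF b] by (simp add: Symmetries_def)
    then have "diffop k (hat k T (cadd a b)) = diffop k (cadd (hat k T a) (hat k T b))"
      unfolding diffop_cadd hat_works(2)[OF T a] hat_works(2)[OF T b] hat_works(2)[OF T cadd_Cf[OF a b]] .
    then show ?thesis using hat_works(1)[OF T] a b cadd_Cf diffop_inj by metis
  qed
  show "hat k T (cscale c a) = cscale c (hat k T a)"
  proof -
    have "T (op_scale c (diffop k a)) = op_scale c (T (diffop k a))"
      using T A by (simp add: Symmetries_def)
    then have "diffop k (hat k T (cscale c a)) = diffop k (cscale c (hat k T a))"
      unfolding diffop_cscale hat_works(2)[OF T a] hat_works(2)[OF T cscale_Cf[OF a]] .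
    then show ?thesis using hat_works(1)[OF T] a cscale_Cf diffop_inj by metis
  qed
  show "hat k T (acth l m k g a) = acth l m k g (hat k T a)" if g: "g \<in> DiffS1" for g
  proof -
    have "T (act l m (inv g) (diffop k a)) = act l m (inv g) (T (diffop k a))"
      using T A DiffS1_inv(1)[OF g] by (simp add: Symmetries_def)
    then have "diffop k (hat k T (acth l m k g a)) = diffop k (acth l m k g (hat k T a))"
      unfolding act_inv_diffop[OF g a] hat_works(2)[OF T a] hat_works(2)[OF T acth_Cf[OF g a]]
        act_inv_diffop[OF g hat_works(1)[OF T a]] .
    then show ?thesis using hat_works(1)[OF T] acth_Cf[OF g] a diffop_inj by metis
  qed
qed

section \<open>Reaching all coefficients by diffeomorphisms\<close>

text \<open>For real exponents \<theta> the values \<open>exp (w * \<theta>)\<close> fill only a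
  curve. Two such exponentials, the second multiplied by \<open>\<i>\<close>, have derivative
  \<open>w\<close> times the identity at 0 and cover a neighbourhood of \<open>1 + \<i>\<close>. The
  two exponents are stored as real and imaginary part of \<open>Z\<close>.\<close>

definition epair :: "complex \<Rightarrow> complex \<Rightarrow> complex" where
  "epair w Z = exp (w * of_real (Re Z)) + \<i> * exp (w * of_real (Im Z))"

lemma epair_inverse:
  assumes w: "w \<noteq> 0" and \<rho>: "\<rho> > 0"
  shows "\<exists>r>0. \<exists>g. \<forall>y\<in>ball (1 + \<i>) r. epair w (g y) = y \<and> norm (g y) < \<rho> \<and> g differentiable (at y)"
proof -
  define \<alpha> where "\<alpha> = (\<lambda>Z. w * exp (w * of_real (Re Z)))"
  define \<beta> where "\<beta> = (\<lambda>Z. \<i> * (w * exp (w * of_real (Im Z))))"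
  define f' where "f' = (\<lambda>Z. (blinfun_scaleR_left (\<alpha> Z) o\<^sub>L Blinfun Re) + (blinfun_scaleR_left (\<beta> Z) o\<^sub>L Blinfun Im))"
  have f'app: "blinfun_apply (f' Z) = (\<lambda>h. Re h *\<^sub>R \<alpha> Z + Im h *\<^sub>R \<beta> Z)" for Z
    by (rule ext) (simp add: f'_def blinfun.add_left bounded_linear_Blinfun_apply bounded_linear_Re bounded_linear_Im)
  have der: "(epair w has_derivative blinfun_apply (f' Z)) (at Z)" for Z
  proof -
    have R: "((\<lambda>Z. w * complex_of_real (Re Z)) has_derivative (\<lambda>h. w * complex_of_real (Re h))) (at Z)"
      by (auto intro!: derivative_eq_intros)
    have I: "((\<lambda>Z. w * complex_of_real (Im Z)) has_derivative (\<lambda>h. w * complex_of_real (Im h))) (at Z)"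
      by (auto intro!: derivative_eq_intros)
    have E: "(exp has_derivative (*) (exp z)) (at (z::complex))" for z
      using DERIV_exp[of z] by (simp add: has_field_derivative_def)
    have "((\<lambda>Z. exp (w * complex_of_real (Re Z))) has_derivative (\<lambda>h. exp (w * of_real (Re Z)) * (w * complex_of_real (Re h)))) (at Z)"
      by (rule has_derivative_compose[OF R E])
    moreover have "((\<lambda>Z. exp (w * complex_of_real (Im Z))) has_derivative (\<lambda>h. exp (w * of_real (Im Z)) * (w * complex_of_real (Im h)))) (at Z)"
      by (rule has_derivative_compose[OF I E])
    ultimately have "((\<lambda>Z. exp (w * of_real (Re Z)) + \<i> * exp (w * of_real (Im Z))) has_derivative
       (\<lambda>h. exp (w * of_real (Re Z)) * (w * complex_of_real (Re h)) + \<i> * (exp (w * of_real (Im Z)) * (w * complex_of_real (Im h))))) (at Z)"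
      by (intro has_derivative_add has_derivative_mult_right)
    then show ?thesis unfolding f'app epair_def[abs_def] \<alpha>_def \<beta>_def
      by (simp add: scaleR_conv_of_real mult_ac)
  qed
  have cont: "continuous_on UNIV f'"
    unfolding f'_def \<alpha>_def \<beta>_def
    by (intro continuous_intros bounded_linear.continuous_on[OF bounded_linear_blinfun_scaleR_left]
        bounded_bilinear.continuous_on[OF bounded_bilinear_blinfun_compose])
  have inv: "blinfun_mult_right (inverse w) o\<^sub>L f' 0 = id_blinfun"
  proof (rule blinfun_eqI)
    fix h :: complex
    have "of_real (Re h) + \<i> * of_real (Im h) = h" by (rule complex_eq[symmetric])
    moreover have "blinfun_apply (f' 0) h = w * (of_real (Re h) + \<i> * of_real (Im h))"
      by (simp add: f'app \<alpha>_def \<beta>_def scaleR_conv_of_real algebra_simps)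
    ultimately show "blinfun_apply (blinfun_mult_right (inverse w) o\<^sub>L f' 0) h = blinfun_apply id_blinfun h"
      using w by simp
  qed
  obtain U V g g' where U: "open U" "0 \<in> U" and V: "open V" "epair w 0 \<in> V"
    and hom: "homeomorphism U V (epair w) g"
    and g: "\<And>y. y \<in> V \<Longrightarrow> (g has_derivative (g' y)) (at y)"
    using inverse_function_theorem[of UNIV "epair w" f' 0 "blinfun_mult_right (inverse w)", OF open_UNIV der cont UNIV_I inv]
    by metis
  have e0: "epair w 0 = 1 + \<i>" by (simp add: epair_def)
  have g0: "g (1 + \<i>) = 0" using hom U(2) e0 by (metis homeomorphism_apply1)
  have "isCont g (1 + \<i>)" using g[OF V(2)] e0 has_derivative_continuous by metis
  then obtain r1 where r1: "r1 > 0" "\<And>y. dist y (1 + \<i>) < r1 \<Longrightarrow> dist (g y) 0 < \<rho>"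
    using \<rho> g0 unfolding continuous_at_eps_delta by (metis)
  obtain r2 where r2: "r2 > 0" "ball (1 + \<i>) r2 \<subseteq> V" using V e0 openE by metis
  show ?thesis
  proof (intro exI[of _ "min r1 r2"] conjI exI[of _ g] ballI)
    fix y assume y: "y \<in> ball (1 + \<i>) (min r1 r2)"
    then have "y \<in> V" using r2 by auto
    then show "epair w (g y) = y" using hom by (metis homeomorphism_apply2)
    show "norm (g y) < \<rho>" using r1(2)[of y] y by (simp add: dist_commute)
    show "g differentiable at y" using g[OF \<open>y \<in> V\<close>] by (auto simp: differentiable_def)
  qed (use r1 r2 in auto)
qed

text \<open>Up to the factor \<open>(norm w)^2\<close> this real part is the Jacobian determinant of
  \<open>epair w\<close>. Its lower bound near 0 makes the derivatives of the exponents uniformly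
  bounded.\<close>

lemma epair_nondegenerate:
  "\<exists>\<rho>>0. \<forall>Z. norm Z < \<rho> \<longrightarrow> Re (exp (w * of_real (Re Z)) * cnj (exp (w * of_real (Im Z)))) > 1/2"
proof -
  let ?D = "\<lambda>Z::complex. Re (exp (w * of_real (Re Z)) * cnj (exp (w * of_real (Im Z))))"
  have "continuous_on UNIV ?D" by (intro continuous_intros continuous_on_cnj)
  then have "isCont ?D 0" by (simp add: continuous_on_eq_continuous_at)
  then have "\<exists>\<rho>>0. \<forall>Z. dist Z 0 < \<rho> \<longrightarrow> dist (?D Z) (?D 0) < 1/2"
    unfolding continuous_at_eps_delta by (meson half_gt_zero zero_less_one)
  then obtain \<rho> where "\<rho> > 0" and \<rho>: "\<And>Z. norm Z < \<rho> \<Longrightarrow> dist (?D Z) (?D 0) < 1/2" by auto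
  have "?D Z > 1/2" if "norm Z < \<rho>" for Z
  proof -
    have "?D 0 = 1" by simp
    then have "\<bar>?D Z - 1\<bar> < 1/2" using \<rho>[OF that] unfolding dist_real_def by metis
    then show ?thesis by linarith
  qed
  then show ?thesis using \<open>\<rho> > 0\<close> by blast
qed

lemma of_real_solve:
  assumes "n = D * u" "(D::real) > 0"
  shows "complex_of_real u = of_real n * inverse (of_real D)"
proof -
  have "u = n * inverse D" using assms by simp
  then show ?thesis by (metis of_real_inverse of_real_mult)
qed

text \<open>Cramer's rule over the reals: multiplication by \<open>cnj B\<close> or by
  \<open>cnj (\<i> * A)\<close> makes the term of the other unknown purely imaginary, and taking
  real parts removes it.\<close>

lemma solve_pair:
  fixes A B q :: complex and u v :: real
  assumes "A * of_real u + \<i> * B * of_real v = q" "Re (A * cnj B) > 0"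
  shows "of_real u = complex_of_real (Re (q * cnj B)) * inverse (of_real (Re (A * cnj B)))"
    and "of_real v = complex_of_real (Re (q * cnj (\<i> * A))) * inverse (of_real (Re (A * cnj B)))"
proof -
  have "q * cnj B = A * cnj B * of_real u + \<i> * (B * cnj B) * of_real v"
    unfolding assms(1)[symmetric] by (simp add: algebra_simps)
  then have "Re (q * cnj B) = Re (A * cnj B) * u" by (simp add: complex_mult_cnj)
  from of_real_solve[OF this assms(2)]
  show "of_real u = complex_of_real (Re (q * cnj B)) * inverse (of_real (Re (A * cnj B)))" .
  have "q * cnj (\<i> * A) = - \<i> * (A * cnj A) * of_real u + (B * cnj A) * of_real v"
    unfolding assms(1)[symmetric] by (simp add: algebra_simps)
  then have "Re (q * cnj (\<i> * A)) = Re (B * cnj A) * v" by (simp add: complex_mult_cnj)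
  moreover have "Re (B * cnj A) = Re (A * cnj B)" by simp
  ultimately have "Re (q * cnj (\<i> * A)) = Re (A * cnj B) * v" by simp
  from of_real_solve[OF this assms(2)]
  show "of_real v = complex_of_real (Re (q * cnj (\<i> * A))) * inverse (of_real (Re (A * cnj B)))" .
qed

text \<open>This is how arbitrary coefficients are reached by powers of the Jacobians of diffeomorphisms.\<close>
lemma exp_pair_family:
  fixes F :: "real \<Rightarrow> real \<Rightarrow> complex"
  assumes w: "w \<noteq> 0" and F: "pf I F"
  shows "\<exists>\<theta>1 \<theta>2 :: real \<Rightarrow> real \<Rightarrow> real. \<exists>e::real. e > 0 \<and>
     pf I (\<lambda>t x. of_real (\<theta>1 t x)) \<and> pf I (\<lambda>t x. of_real (\<theta>2 t x)) \<and>
     (\<forall>t\<in>I. \<forall>x. exp (w * of_real (\<theta>1 t x)) + \<i> * exp (w * of_real (\<theta>2 t x)) = 1 + \<i> + of_real e * F t x) \<and>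
     (\<forall>t\<in>I. \<forall>x. norm (vd (\<lambda>x. complex_of_real (\<theta>1 t x)) x) \<le> 1/2 \<and> norm (vd (\<lambda>x. complex_of_real (\<theta>2 t x)) x) \<le> 1/2)"
proof -
  obtain \<rho> where \<rho>: "\<rho> > 0" "\<And>Z. norm Z < \<rho> \<Longrightarrow> Re (exp (w * of_real (Re Z)) * cnj (exp (w * of_real (Im Z)))) > 1/2"
    using epair_nondegenerate[of w] by blast
  obtain r g where r: "r > 0" and g: "\<And>y. y \<in> ball (1 + \<i>) r \<Longrightarrow> epair w (g y) = y"
    "\<And>y. y \<in> ball (1 + \<i>) r \<Longrightarrow> norm (g y) < \<rho>" "\<And>y. y \<in> ball (1 + \<i>) r \<Longrightarrow> g differentiable (at y)"
    using epair_inverse[OF w \<rho>(1)] by blast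
  obtain C0 where C0: "\<And>t x. t \<in> I \<Longrightarrow> norm (F t x) \<le> C0" using pf_bound[OF F] by blast
  obtain C1 where C1: "\<And>t x. t \<in> I \<Longrightarrow> norm (vd (F t) x) \<le> C1" using pf_bound[OF pf_vd[OF F]] by blast
  define K where "K = exp (norm w * \<rho>)"
  have K: "K > 0" by (simp add: K_def)
  \<comment> \<open>The first bound keeps \<open>1 + \<i> + e * F\<close> in the ball on which the
    local inverse is defined; the second makes the derivatives of both exponents at most 1/2, as
    \<open>dfam_shift\<close> demands.\<close>
  define e where "e = min (r / (2 * (\<bar>C0\<bar> + 1))) (norm w / (4 * K * (\<bar>C1\<bar> + 1)))"
  have e: "e > 0" using r K w by (auto simp: e_def)
  define Z where "Z = (\<lambda>t x. g (1 + \<i> + of_real e * F t x))"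
  have inb: "1 + \<i> + of_real e * F t x \<in> ball (1 + \<i>) r" if "t \<in> I" for t x
  proof -
    have "norm (of_real e * F t x) \<le> e * (\<bar>C0\<bar> + 1)"
      using C0[OF that, of x] e by (auto simp: norm_mult intro!: mult_left_mono)
    also have "\<dots> \<le> r / (2 * (\<bar>C0\<bar> + 1)) * (\<bar>C0\<bar> + 1)"
      by (intro mult_right_mono) (auto simp: e_def)
    also have "\<dots> = r / 2" by (simp add: field_simps)
    also have "\<dots> < r" using r by simp
    finally show ?thesis by (simp add: dist_norm)
  qed
  define A where "A = (\<lambda>t x. exp (w * of_real (Re (Z t x))))"
  define B where "B = (\<lambda>t x. exp (w * of_real (Im (Z t x))))"
  have AB: "A t x + \<i> * B t x = 1 + \<i> + of_real e * F t x" if "t \<in> I" for t x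
    using g(1)[OF inb[OF that]] by (simp add: A_def B_def Z_def epair_def)
  have D: "Re (A t x * cnj (B t x)) > 1/2" if "t \<in> I" for t x
    using \<rho>(2)[OF g(2)[OF inb[OF that]]] by (simp add: A_def B_def Z_def)
  have Zb: "norm (Z t x) < \<rho>" if "t \<in> I" for t x using g(2)[OF inb[OF that]] by (simp add: Z_def)
  have ABb: "norm (A t x) \<le> K \<and> norm (B t x) \<le> K" if "t \<in> I" for t x
  proof -
    have "norm w * \<bar>Re (Z t x)\<bar> \<le> norm w * \<rho>" "norm w * \<bar>Im (Z t x)\<bar> \<le> norm w * \<rho>"
      using Zb[OF that, of x] abs_Re_le_cmod[of "Z t x"] abs_Im_le_cmod[of "Z t x"] by (auto intro!: mult_left_mono)
    then show ?thesis unfolding A_def B_def K_def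
      using norm_exp[of "w * of_real (Re (Z t x))"] norm_exp[of "w * of_real (Im (Z t x))"]
      by (simp add: norm_mult)
  qed
  \<comment> \<open>Differentiating \<open>A + \<i> * B = 1 + \<i> + e * F\<close> and dividing by
    \<open>w\<close> gives \<open>A * u + \<i> * B * v = q\<close> for the real derivatives
    \<open>u\<close> and \<open>v\<close> of the exponents.\<close>
  define q where "q = (\<lambda>t x. of_real e / w * vd (F t) x)"
  define \<delta> where "\<delta> = (\<lambda>t x. inverse (complex_of_real (Re (A t x * cnj (B t x)))))"
  define u where "u = (\<lambda>t x. complex_of_real (Re (q t x * cnj (B t x))) * \<delta> t x)"
  define v where "v = (\<lambda>t x. complex_of_real (Re (q t x * cnj (\<i> * A t x))) * \<delta> t x)"
  have qb: "norm (q t x) \<le> 1 / (4 * K)" if "t \<in> I" for t x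
  proof -
    have "norm (q t x) \<le> e / norm w * (\<bar>C1\<bar> + 1)"
      using C1[OF that, of x] e by (auto simp: q_def norm_mult norm_divide intro!: divide_right_mono mult_left_mono)
    also have "\<dots> \<le> (norm w / (4 * K * (\<bar>C1\<bar> + 1))) / norm w * (\<bar>C1\<bar> + 1)"
      by (intro mult_right_mono divide_right_mono) (auto simp: e_def)
    also have "\<dots> = 1 / (4 * K)"
    proof -
      have "norm w \<noteq> 0" "K \<noteq> 0" "\<bar>C1\<bar> + 1 \<noteq> 0" using w K by auto
      then show ?thesis by (simp add: divide_simps)
    qed
    finally show ?thesis .
  qed
  have \<delta>b: "norm (\<delta> t x) \<le> 2" if "t \<in> I" for t x
  proof -
    have "inverse (Re (A t x * cnj (B t x))) \<le> inverse (1/2)"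
      using D[OF that, of x] by (intro le_imp_inverse_le) auto
    then show ?thesis unfolding \<delta>_def norm_inverse norm_of_real using D[OF that, of x] by (simp add: abs_of_pos)
  qed
  have uvb: "norm (u t x) \<le> 1/2 \<and> norm (v t x) \<le> 1/2" if t: "t \<in> I" for t x
  proof -
    have "norm (complex_of_real (Re (q t x * y))) * norm (\<delta> t x) \<le> 1/2" if "norm y \<le> K" for y
    proof -
      have "norm (complex_of_real (Re (q t x * y))) \<le> norm (q t x) * norm y"
        using abs_Re_le_cmod[of "q t x * y"] by (simp only: norm_mult norm_of_real)
      also have "\<dots> \<le> 1 / (4 * K) * K" using qb[OF t, of x] that K by (intro mult_mono) auto
      also have "\<dots> = 1/4" using K by simp
      finally have "norm (complex_of_real (Re (q t x * y))) * norm (\<delta> t x) \<le> 1/4 * 2"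
        using \<delta>b[OF t, of x] by (intro mult_mono) auto
      then show ?thesis by simp
    qed
    from this[of "cnj (B t x)"] this[of "cnj (\<i> * A t x)"] show ?thesis
      using ABb[OF t, of x] unfolding u_def v_def by (simp add: norm_mult)
  qed
  have der: "((\<lambda>x. complex_of_real (Re (Z t x))) has_vector_derivative u t x) (at x) \<and>
    ((\<lambda>x. complex_of_real (Im (Z t x))) has_vector_derivative v t x) (at x)" if t: "t \<in> I" for t x
  proof -
    have "((\<lambda>x. 1 + \<i> + of_real e * F t x) has_vector_derivative 0 + of_real e * vd (F t) x) (at x)"
      by (intro has_vector_derivative_add has_vector_derivative_const has_vector_derivative_mult_right pf_deriv[OF F t])
    then have Fd: "((\<lambda>x. 1 + \<i> + of_real e * F t x) has_vector_derivative of_real e * vd (F t) x) (at x)" by simp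
    have "(g \<circ> (\<lambda>x. 1 + \<i> + of_real e * F t x)) differentiable (at x)"
      by (rule differentiable_chain_at[OF differentiableI_vector[OF Fd] g(3)[OF inb[OF t]]])
    then obtain Z' where Z': "(Z t has_vector_derivative Z') (at x)"
      unfolding Z_def o_def using vector_derivative_works by blast
    have Re': "((\<lambda>x. complex_of_real (Re (Z t x))) has_vector_derivative of_real (Re Z')) (at x)"
      using bounded_linear.has_vector_derivative[OF bounded_linear_Re Z'] by (simp add: has_vector_derivative_of_real_iff)
    have Im': "((\<lambda>x. complex_of_real (Im (Z t x))) has_vector_derivative of_real (Im Z')) (at x)"
      using bounded_linear.has_vector_derivative[OF bounded_linear_Im Z'] by (simp add: has_vector_derivative_of_real_iff)
    have A': "(A t has_vector_derivative w * of_real (Re Z') * A t x) (at x)"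
      unfolding A_def using field_vector_diff_chain_at[OF has_vector_derivative_mult_right[OF Re', of w] DERIV_exp]
      by (simp add: o_def)
    have B': "(B t has_vector_derivative w * of_real (Im Z') * B t x) (at x)"
      unfolding B_def using field_vector_diff_chain_at[OF has_vector_derivative_mult_right[OF Im', of w] DERIV_exp]
      by (simp add: o_def)
    have "((\<lambda>x. A t x + \<i> * B t x) has_vector_derivative w * of_real (Re Z') * A t x + \<i> * (w * of_real (Im Z') * B t x)) (at x)"
      by (intro has_vector_derivative_add has_vector_derivative_mult_right A' B')
    then have "w * of_real (Re Z') * A t x + \<i> * (w * of_real (Im Z') * B t x) = of_real e * vd (F t) x"
      using Fd unfolding AB[OF t] by (rule vector_derivative_unique_at)
    then have "w * (A t x * of_real (Re Z') + \<i> * B t x * of_real (Im Z')) = of_real e * vd (F t) x"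
      by (simp add: algebra_simps)
    then have "A t x * of_real (Re Z') + \<i> * B t x * of_real (Im Z') = q t x"
      unfolding q_def using w by (simp add: nonzero_eq_divide_eq mult.commute)
    from solve_pair[OF this] D[OF t, of x] have "u t x = of_real (Re Z')" "v t x = of_real (Im Z')"
      by (auto simp: u_def v_def \<delta>_def)
    then show ?thesis using Re' Im' by simp
  qed
  have Fq: "bf I n (\<lambda>t x. q t x)" for n
    unfolding q_def by (rule bf_cmult) (use pf_vd[OF F] in \<open>simp add: pf_def\<close>)
  \<comment> \<open>The derivatives \<open>u\<close> and \<open>v\<close> are built from
    \<open>q\<close> and from exponentials of the exponents, so bounds at order \<open>n\<close>
    give bounds at order \<open>n + 1\<close>. No higher derivative of the local inverse
    enters.\<close>
  have b: "bf I n (\<lambda>t x. complex_of_real (Re (Z t x))) \<and> bf I n (\<lambda>t x. complex_of_real (Im (Z t x)))" for n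
  proof (induction n)
    case 0
    have "norm (complex_of_real (Re (Z t x))) \<le> \<rho> \<and> norm (complex_of_real (Im (Z t x))) \<le> \<rho>" if "t \<in> I" for t x
      using Zb[OF that, of x] abs_Re_le_cmod[of "Z t x"] abs_Im_le_cmod[of "Z t x"] by auto
    then show ?case unfolding bf.simps by blast
  next
    case (Suc n)
    have bA: "bf I n A" unfolding A_def by (intro bf_exp bf_cmult conjunct1[OF Suc])
    have bB: "bf I n B" unfolding B_def by (intro bf_exp bf_cmult conjunct2[OF Suc])
    have b\<delta>: "bf I n \<delta>" unfolding \<delta>_def
    proof (rule bf_inverse[of "1/2"])
      show "1/2 \<le> norm (complex_of_real (Re (A t x * cnj (B t x))))" if "t \<in> I" for t x
        using D[OF that, of x] unfolding norm_of_real by linarith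
      show "bf I n (\<lambda>t x. complex_of_real (Re (A t x * cnj (B t x))))"
        by (intro bf_Re bf_mult bf_cnj bA bB)
    qed simp
    have bu: "bf I n u" unfolding u_def by (intro bf_mult b\<delta> bf_Re bf_cnj bB Fq)
    have bv: "bf I n v" unfolding v_def by (intro bf_mult b\<delta> bf_Re bf_cnj bf_cmult bA Fq)
    show ?case
      using bf_SucI[OF bf_0[OF conjunct1[OF Suc]] conjunct1[OF der] bu]
        bf_SucI[OF bf_0[OF conjunct2[OF Suc]] conjunct2[OF der] bv] by (rule conjI)
  qed
  have per: "Z t (x + 1) = Z t x" if "t \<in> I" for t x
    using F that by (simp add: Z_def pf_def)
  have vd: "vd (\<lambda>x. complex_of_real (Re (Z t x))) = u t \<and> vd (\<lambda>x. complex_of_real (Im (Z t x))) = v t" if "t \<in> I" for t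
    using der[OF that] vd_eqI by blast
  show ?thesis
    by (rule exI[of _ "\<lambda>t x. Re (Z t x)"], rule exI[of _ "\<lambda>t x. Im (Z t x)"], rule exI[of _ e])
       (use e b per AB uvb vd in \<open>auto simp: pf_def A_def B_def\<close>)
qed

section \<open>Diffeomorphisms with prescribed displacement or Jacobian\<close>

lemma vd_lgd:
  assumes g: "g \<in> DiffS1"
  shows "vd (lgd g) x = vd (\<lambda>x. complex_of_real (vd g x)) x * inverse (complex_of_real (vd g x))"
proof -
  have "((\<lambda>x. exp (lgd g x)) has_vector_derivative vd (lgd g) x * exp (lgd g x)) (at x)" for x
    using field_vector_diff_chain_at[OF Fsp_deriv[OF lgd_Fsp[OF g]] DERIV_exp] by (simp add: o_def)
  then have "vd (\<lambda>x. complex_of_real (vd g x)) = (\<lambda>x. vd (lgd g) x * complex_of_real (vd g x))"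
    unfolding exp_lgd[OF g] by (rule vd_eqI)
  then show ?thesis using DiffS1_deriv(2)[OF g, of x] by simp
qed

lemma dfam_lower:
  assumes g: "\<And>t. t \<in> I \<Longrightarrow> g t \<in> DiffS1" and p: "pf I (\<lambda>t x. complex_of_real (vd (g t) x))"
    and c: "c > 0" "\<And>t x. t \<in> I \<Longrightarrow> vd (g t) x \<ge> c"
  shows "dfam I g"
proof -
  obtain C where C: "\<And>t x. t \<in> I \<Longrightarrow> norm (complex_of_real (vd (g t) x)) \<le> C"
    using pf_bound[OF p] by blast
  have b: "norm (lgd (g t) x) \<le> \<bar>ln c\<bar> + \<bar>ln (max C c)\<bar>" if t: "t \<in> I" for t x
  proof -
    have "ln c \<le> ln (vd (g t) x)" using c(1) c(2)[OF t] by (simp add: order_less_le_trans)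
    moreover have "ln (vd (g t) x) \<le> ln (max C c)"
      using C[OF t, of x] c(1) c(2)[OF t, of x] by (intro ln_mono) auto
    ultimately show ?thesis unfolding lgd_def norm_of_real by linarith
  qed
  have "pf I (\<lambda>t. lgd (g t))"
  proof (rule pfI_deriv)
    show "bf I 0 (\<lambda>t. lgd (g t))" using b by auto
    show "(lgd (g t) has_vector_derivative vd (\<lambda>x. complex_of_real (vd (g t) x)) x * inverse (complex_of_real (vd (g t) x))) (at x)"
      if "t \<in> I" for t x
      using Fsp_deriv[OF lgd_Fsp[OF g[OF that]]] vd_lgd[OF g[OF that]] by metis
    show "pf I (\<lambda>t x. vd (\<lambda>x. complex_of_real (vd (g t) x)) x * inverse (complex_of_real (vd (g t) x)))"
    proof (intro pf_mult pf_vd p pf_inverse[OF c(1)])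
      show "c \<le> norm (complex_of_real (vd (g t) x))" if "t \<in> I" for t x
        using c(1) c(2)[OF that, of x] by simp
    qed
    show "lgd (g t) (x + 1) = lgd (g t) x" if "t \<in> I" for t x
      using Fsp_periodic[OF lgd_Fsp[OF g[OF that]]] .
  qed
  then show ?thesis using g by (simp add: dfam_def)
qed

lemma real_pf:
  assumes "pf I (\<lambda>t x. complex_of_real (\<theta> t x))" "t \<in> I"
  shows "(\<theta> t has_vector_derivative vd (\<theta> t) x) (at x)"
    "vd (\<lambda>x. complex_of_real (\<theta> t x)) = (\<lambda>x. complex_of_real (vd (\<theta> t) x))"
    "\<theta> t (x + 1) = \<theta> t x"
proof -
  have F: "(\<lambda>x. complex_of_real (\<theta> t x)) \<in> Fsp" using Fsp_pf[OF assms] .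
  show "(\<theta> t has_vector_derivative vd (\<theta> t) x) (at x)"
    using real_dnth(2)[OF F, of 0 x] by (simp add: vd_def)
  show "vd (\<lambda>x. complex_of_real (\<theta> t x)) = (\<lambda>x. complex_of_real (vd (\<theta> t) x))"
    using real_dnth(1)[OF F, of 1] by (simp only: dnth_1)
  show "\<theta> t (x + 1) = \<theta> t x" using Fsp_periodic[OF F, of x] by simp
qed

lemma dfam_shift:
  assumes \<theta>: "pf I (\<lambda>t x. complex_of_real (\<theta> t x))"
    and small: "\<And>t x. t \<in> I \<Longrightarrow> norm (vd (\<lambda>x. complex_of_real (\<theta> t x)) x) \<le> 1/2"
  shows "dfam I (\<lambda>t x. x + \<theta> t x)" "\<And>t. t \<in> I \<Longrightarrow> vd (\<lambda>x. x + \<theta> t x) = (\<lambda>x. 1 + vd (\<theta> t) x)"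
proof -
  have ge: "1 + vd (\<theta> t) x \<ge> 1/2" if "t \<in> I" for t x
    using small[OF that, of x] unfolding real_pf(2)[OF \<theta> that] norm_of_real by linarith
  have der: "((\<lambda>x. x + \<theta> t x) has_vector_derivative 1 + vd (\<theta> t) x) (at x)" if "t \<in> I" for t x
    by (intro has_vector_derivative_add has_vector_derivative_id real_pf(1)[OF \<theta> that])
  have p: "pf I (\<lambda>t x. complex_of_real (1 + vd (\<theta> t) x))"
    by (rule pf_cong[OF _ pf_add[OF pf_const'[of I 1] pf_vd[OF \<theta>]]]) (simp add: real_pf(2)[OF \<theta>])
  have D: "(\<lambda>x. x + \<theta> t x) \<in> DiffS1" "vd (\<lambda>x. x + \<theta> t x) = (\<lambda>x. 1 + vd (\<theta> t) x)" if t: "t \<in> I" for t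
  proof -
    have "1 + vd (\<theta> t) x > 0" for x using ge[OF t, of x] by linarith
    from DiffS1I[OF der[OF t] this _ Fsp_pf[OF p t]]
    show "(\<lambda>x. x + \<theta> t x) \<in> DiffS1" "vd (\<lambda>x. x + \<theta> t x) = (\<lambda>x. 1 + vd (\<theta> t) x)"
      using real_pf(3)[OF \<theta> t] by auto
  qed
  show "vd (\<lambda>x. x + \<theta> t x) = (\<lambda>x. 1 + vd (\<theta> t) x)" if "t \<in> I" for t using D(2)[OF that] .
  show "dfam I (\<lambda>t x. x + \<theta> t x)"
  proof (rule dfam_lower[of _ _ "1/2"])
    show "pf I (\<lambda>t x. complex_of_real (vd (\<lambda>x. x + \<theta> t x) x))"
      by (rule pf_cong[OF _ p]) (simp add: D(2))
  qed (use D ge in auto)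
qed

lemma antiderivative_line:
  fixes f :: "real \<Rightarrow> real"
  assumes "continuous_on UNIV f"
  shows "\<exists>G. \<forall>x. (G has_vector_derivative f x) (at x)"
  using einterval_antiderivative[of "-\<infinity>" "\<infinity>" f] assms by (auto simp: continuous_on_eq_continuous_at)

text \<open>A positive periodic density divided by its mass \<open>M t\<close> over one period is
  the Jacobian of its integral, and that integral is a lift of a circle diffeomorphism. The constant
  \<open>L t = ln (M t)\<close> is harmless: it only contributes a scalar, which linear maps let
  through.\<close>

lemma dfam_density:
  assumes \<theta>: "pf I (\<lambda>t x. complex_of_real (\<theta> t x))"
  shows "\<exists>g L. dfam I g \<and> bounded ((\<lambda>t. complex_of_real (L t)) ` I) \<and>
    (\<forall>t\<in>I. \<forall>x. lgd (g t) x = of_real (\<theta> t x) - of_real (L t))"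
proof -
  obtain C where C: "\<And>t x. t \<in> I \<Longrightarrow> norm (complex_of_real (\<theta> t x)) \<le> C" using pf_bound[OF \<theta>] by blast
  have "\<exists>G. \<forall>x. (G has_vector_derivative exp (\<theta> t x)) (at x)" if "t \<in> I" for t
  proof (rule antiderivative_line)
    have "continuous_on UNIV (\<theta> t)"
      using has_vector_derivative_continuous[OF real_pf(1)[OF \<theta> that]]
      by (simp add: continuous_on_eq_continuous_at)
    then show "continuous_on UNIV (\<lambda>x. exp (\<theta> t x))" by (intro continuous_intros)
  qed
  then obtain G where G: "\<And>t x. t \<in> I \<Longrightarrow> (G t has_vector_derivative exp (\<theta> t x)) (at x)" by metis
  define M where "M = (\<lambda>t. G t 1 - G t 0)"
  define g where "g = (\<lambda>t x. (G t x - G t 0) / M t)"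
  have M: "exp (-C) \<le> M t \<and> M t \<le> exp C" if t: "t \<in> I" for t
  proof -
    obtain z where "M t = exp (\<theta> t z)"
      using MVT2[of 0 1 "G t" "\<lambda>x. exp (\<theta> t x)"] G[OF t] unfolding M_def
      by (auto simp: has_real_derivative_iff_has_vector_derivative)
    moreover have "\<bar>\<theta> t z\<bar> \<le> C" using C[OF t, of z] by simp
    ultimately show ?thesis by auto
  qed
  have Mpos: "M t > 0" if "t \<in> I" for t using M[OF that] exp_gt_zero[of "-C"] by linarith
  have per: "G t (x + 1) - G t x = M t" if t: "t \<in> I" for t x
  proof -
    have "((\<lambda>x. G t (x + 1) - G t x) has_vector_derivative exp (\<theta> t (x + 1)) - exp (\<theta> t x)) (at x)" for x
      by (intro has_vector_derivative_diff has_vector_derivative_shift G t)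
    then have "\<forall>x. DERIV (\<lambda>x. G t (x + 1) - G t x) x :> 0"
      using real_pf(3)[OF \<theta> t] by (simp add: has_real_derivative_iff_has_vector_derivative)
    from DERIV_isconst_all[OF this, of x 0] show ?thesis by (simp add: M_def)
  qed
  have der: "(g t has_vector_derivative exp (\<theta> t x) / M t) (at x)" if t: "t \<in> I" for t x
    unfolding g_def using has_vector_derivative_mult_right[OF has_vector_derivative_diff[OF G[OF t] has_vector_derivative_const], of "inverse (M t)"]
    by (simp add: divide_inverse mult.commute)
  have eqe: "complex_of_real (exp (\<theta> t x) / M t) = of_real (inverse (M t)) * exp (of_real (\<theta> t x))" for t x
    by (simp add: divide_inverse exp_of_real)
  have F: "(\<lambda>x. complex_of_real (exp (\<theta> t x) / M t)) \<in> Fsp" if t: "t \<in> I" for t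
    unfolding eqe using Fsp_pf[OF \<theta> t] by (intro Fsp_mult Fsp_const Fsp_exp)
  have D: "g t \<in> DiffS1" "vd (g t) = (\<lambda>x. exp (\<theta> t x) / M t)" if t: "t \<in> I" for t
  proof -
    have "g t (x + 1) = g t x + 1" for x
      using per[OF t, of x] Mpos[OF t] by (simp add: g_def field_simps)
    from DiffS1I[OF der[OF t] _ this F[OF t]] Mpos[OF t]
    show "g t \<in> DiffS1" "vd (g t) = (\<lambda>x. exp (\<theta> t x) / M t)" by auto
  qed
  have lg: "lgd (g t) x = of_real (\<theta> t x) - of_real (ln (M t))" if t: "t \<in> I" for t x
    unfolding lgd_def D(2)[OF t] using Mpos[OF t] by (simp add: ln_div)
  have bL: "bounded ((\<lambda>t. complex_of_real (ln (M t))) ` I)"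
  proof -
    have "\<bar>ln (M t)\<bar> \<le> C" if t: "t \<in> I" for t
    proof -
      have "ln (exp (-C)) \<le> ln (M t)" "ln (M t) \<le> ln (exp C)"
        using M[OF t] Mpos[OF t] by (auto simp del: ln_exp)
      then show ?thesis by simp
    qed
    then show ?thesis unfolding bounded_iff by (intro exI[of _ C]) auto
  qed
  have "pf I (\<lambda>t. lgd (g t))"
    by (rule pf_cong[OF _ pf_diff[OF \<theta> pf_const[OF bL]]]) (simp add: lg)
  then have "dfam I g" using D by (simp add: dfam_def)
  then show ?thesis using bL lg by (intro exI[of _ g] exI[of _ "\<lambda>t. ln (M t)"] conjI) auto
qed

section \<open>Generating all coefficient families\<close>

context csym
begin

lemma H_zero: "H (\<lambda>i x. 0) = (\<lambda>i x. 0)"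
proof -
  have z: "(\<lambda>i x. 0) \<in> Cf k" by (simp add: Cf_def Fsp_const)
  from H_scale[OF this, of 0] show ?thesis by (simp add: cscale_def)
qed

lemma sgl_zero: "sgl j (\<lambda>x. 0) = (\<lambda>i x. 0)"
  by (auto simp: sgl_def)

lemma H_lower:
  assumes a: "a \<in> Cf k" shows "H a s x = (\<Sum>i\<le>k. H (sgl i (a i)) s x)"
proof -
  define tr where "tr = (\<lambda>n i. if i < n then a i else (\<lambda>x. 0))"
  have tr: "tr n \<in> Cf k" for n using a by (auto simp: Cf_def tr_def Fsp_const)
  have "n \<le> Suc k \<Longrightarrow> H (tr n) s x = (\<Sum>i<n. H (sgl i (a i)) s x)" for n
  proof (induction n)
    case 0 then show ?case using H_zero by (simp add: tr_def)
  next
    case (Suc n)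
    have "tr (Suc n) = cadd (tr n) (sgl n (a n))"
      by (auto simp: tr_def cadd_def sgl_def fun_eq_iff less_Suc_eq)
    moreover have "sgl n (a n) \<in> Cf k" using a Suc by (intro sgl_Cf) (auto simp: Cf_def)
    ultimately have "H (tr (Suc n)) = cadd (H (tr n)) (H (sgl n (a n)))" using H_add tr by simp
    then show ?case using Suc by (simp add: cadd_def)
  qed
  moreover have "tr (Suc k) = a" using a by (auto simp: tr_def Cf_def)
  ultimately show ?thesis by (metis lessThan_Suc_atMost order_refl)
qed

lemma H_sgl_scale: "f \<in> Fsp \<Longrightarrow> j \<le> k \<Longrightarrow> H (sgl j (\<lambda>x. c * f x)) s x = c * H (sgl j f) s x"
proof -
  assume f: "f \<in> Fsp" "j \<le> k"
  have "sgl j (\<lambda>x. c * f x) = cscale c (sgl j f)" by (auto simp: sgl_def cscale_def fun_eq_iff)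
  then show ?thesis using H_scale[OF sgl_Cf[OF f]] by (simp add: cscale_def)
qed

lemma H_sgl_add: "f \<in> Fsp \<Longrightarrow> h \<in> Fsp \<Longrightarrow> j \<le> k \<Longrightarrow>
  H (sgl j (\<lambda>x. f x + h x)) s x = H (sgl j f) s x + H (sgl j h) s x"
proof -
  assume f: "f \<in> Fsp" "h \<in> Fsp" "j \<le> k"
  have "sgl j (\<lambda>x. f x + h x) = cadd (sgl j f) (sgl j h)" by (auto simp: sgl_def cadd_def fun_eq_iff)
  then show ?thesis using H_add[OF sgl_Cf sgl_Cf] f by (simp add: cadd_def)
qed

lemma acth_sgl:
  assumes "j \<le> k"
  shows "acth l m k g (sgl j W) i = (\<lambda>x. if i \<le> j then exp ((m - l - of_nat j) * lgd g x) * W (g x) * Pc l (vd (lgd g)) j i x else 0)"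
proof (rule ext)
  fix x
  show "acth l m k g (sgl j W) i x = (if i \<le> j then exp ((m - l - of_nat j) * lgd g x) * W (g x) * Pc l (vd (lgd g)) j i x else 0)"
  proof -
    have "acth l m k g (sgl j W) i x = (\<Sum>i'\<in>{i..k}. if i' = j then exp ((m - l - of_nat j) * lgd g x) * W (g x) * Pc l (vd (lgd g)) j i x else 0)"
      unfolding acth_def by (intro sum.cong refl) (simp add: sgl_def)
    then show ?thesis using assms by (simp add: sum.delta)
  qed
qed

text \<open>Up to coefficients of lower order, every coefficient family is a combination of the leading
  coefficients of the transforms of \<open>d\<^sup>j\<close> (of \<open>e\<^sub>1 d\<^sup>j\<close> if the symbol has weight zero).
  The predicate \<open>P\<close> is used for boundedness and for vanishing.\<close>
lemma span:
  fixes P :: "(real \<Rightarrow> complex) \<Rightarrow> bool"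
  assumes P_zero: "P (\<lambda>t. 0)"
    and P_add: "\<And>u v. P u \<Longrightarrow> P v \<Longrightarrow> P (\<lambda>t. u t + v t)"
    and P_mult: "\<And>c u. bounded (c ` I) \<Longrightarrow> P u \<Longrightarrow> P (\<lambda>t. c t * u t)"
    and P_cong: "\<And>u v. (\<And>t. t \<in> I \<Longrightarrow> u t = v t) \<Longrightarrow> P u \<Longrightarrow> P v"
    and B1: "\<And>g j. dfam I g \<Longrightarrow> j \<le> k \<Longrightarrow> P (\<lambda>t. acth l m k (g t) (H (sgl j (\<lambda>x. 1))) s x)"
    and B2: "\<And>g j. dfam I g \<Longrightarrow> j \<le> k \<Longrightarrow> m - l = of_nat j \<Longrightarrow> P (\<lambda>t. acth l m k (g t) (H (sgl j (ee 1))) s x)"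
  shows "pf I F \<Longrightarrow> j \<le> k \<Longrightarrow> P (\<lambda>t. H (sgl j (F t)) s x)"
proof (induction j arbitrary: F rule: less_induct)
  case (less j F)
  note jk = less.prems(2)
  let ?w = "m - l - of_nat j"
  have P_cmult: "P (\<lambda>t. c * u t)" if "P u" for c u
    using P_mult[OF bounded_const_image that] .
  have P_sum: "P (\<lambda>t. \<Sum>i\<in>S. u i t)" if "finite S" "\<And>i. i \<in> S \<Longrightarrow> P (u i)" for S :: "nat set" and u
    using that by (induction S rule: finite_induct) (auto intro!: P_zero P_add)
  have LOW: "P (\<lambda>t. H (a t) s x)" if a: "\<And>t. t \<in> I \<Longrightarrow> a t \<in> Cf k" "\<And>i t. i \<ge> j \<Longrightarrow> a t i = (\<lambda>x. 0)" "\<And>i. pf I (\<lambda>t. a t i)" for a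
  proof -
    have "P (\<lambda>t. \<Sum>i<j. H (sgl i (a t i)) s x)"
      using less.IH[OF _ a(3)] jk by (intro P_sum) auto
    moreover have "(\<Sum>i<j. H (sgl i (a t i)) s x) = H (a t) s x" if "t \<in> I" for t
      unfolding H_lower[OF a(1)[OF that]]
      by (rule sum.mono_neutral_left) (use jk a(2) H_zero sgl_zero in auto)
    ultimately show ?thesis using P_cong by (metis (no_types, lifting))
  qed
  \<comment> \<open>The transform of \<open>W d^j\<close> is its leading term plus terms of order
    below \<open>j\<close>. Equivariance controls the image of the transform, the induction that of
    the lower terms.\<close>
  have KEY: "P (\<lambda>t. H (sgl j (\<lambda>x. exp (?w * lgd (g t) x) * W (g t x))) s x)"
    if g: "dfam I g" and W: "W \<in> Fsp" and PW: "P (\<lambda>t. acth l m k (g t) (H (sgl j W)) s x)" for g W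
  proof -
    define low where "low = (\<lambda>t i. if i < j then acth l m k (g t) (sgl j W) i else (\<lambda>x. 0))"
    have sW: "sgl j W \<in> Cf k" using W jk by (rule sgl_Cf)
    have gD: "g t \<in> DiffS1" if "t \<in> I" for t using g that by (simp add: dfam_def)
    have aC: "acth l m k (g t) (sgl j W) \<in> Cf k" if "t \<in> I" for t using acth_Cf[OF gD[OF that] sW] .
    have lC: "low t \<in> Cf k" if "t \<in> I" for t
      using aC[OF that] by (auto simp: low_def Cf_def Fsp_const)
    have Plow: "P (\<lambda>t. H (low t) s x)"
    proof (rule LOW[OF lC])
      show "pf I (\<lambda>t. low t i)" for i
        unfolding low_def using acth_pf[OF g sW] by (cases "i < j") (simp_all add: pf_const')
    qed (auto simp: low_def)
    let ?lead = "\<lambda>t x. exp (?w * lgd (g t) x) * W (g t x)"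
    have lead: "?lead t = acth l m k (g t) (sgl j W) j" for t
      unfolding acth_sgl[OF jk] by (simp add: Pc_diag)
    have lF: "?lead t \<in> Fsp" if "t \<in> I" for t
      unfolding lead using aC[OF that] by (simp add: Cf_def)
    have "H (sgl j (?lead t)) s x = acth l m k (g t) (H (sgl j W)) s x + (-1) * H (low t) s x" if t: "t \<in> I" for t
    proof -
      have "acth l m k (g t) (sgl j W) = cadd (sgl j (?lead t)) (low t)"
      proof (rule ext)
        fix i show "acth l m k (g t) (sgl j W) i = cadd (sgl j (?lead t)) (low t) i"
          using acth_sgl[OF jk, of "g t" W i] lead[of t]
          by (cases i j rule: linorder_cases) (auto simp: cadd_def sgl_def low_def fun_eq_iff)
      qed
      then have "acth l m k (g t) (H (sgl j W)) = cadd (H (sgl j (?lead t))) (H (low t))"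
        using H_act[OF sW gD[OF t]] H_add[OF sgl_Cf[OF lF[OF t] jk] lC[OF t]] by simp
      then show ?thesis by (simp add: cadd_def)
    qed
    then show ?thesis using P_add[OF PW P_cmult[OF Plow, of "-1"]] P_cong by (metis (no_types, lifting))
  qed
  show ?case
  proof (cases "?w = 0")
    case False
    \<comment> \<open>\<open>dfam_density\<close> realises \<theta> as \<open>lgd\<close> up to the
      constant \<open>L t\<close>, which the bounded scalar \<open>c t\<close> compensates.\<close>
    have EXPP: "P (\<lambda>t. H (sgl j (\<lambda>x. exp (?w * of_real (\<theta> t x)))) s x)" if \<theta>: "pf I (\<lambda>t x. complex_of_real (\<theta> t x))" for \<theta>
    proof -
      obtain g L where g: "dfam I g" and L: "bounded ((\<lambda>t. complex_of_real (L t)) ` I)"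
        and lg: "\<And>t x. t \<in> I \<Longrightarrow> lgd (g t) x = of_real (\<theta> t x) - of_real (L t)"
        using dfam_density[OF \<theta>] by blast
      define c where "c = (\<lambda>t. exp (?w * complex_of_real (L t)))"
      have "bounded (c ` I)"
        using pf_bound[OF pf_exp[OF pf_mult[OF pf_const'[of I ?w] pf_const[OF L]]]]
        unfolding bounded_iff c_def by auto
      from P_mult[OF this KEY[OF g Fsp_const B1[OF g jk]]]
      have "P (\<lambda>t. c t * H (sgl j (\<lambda>x. exp (?w * lgd (g t) x))) s x)" by simp
      moreover have "c t * H (sgl j (\<lambda>x. exp (?w * lgd (g t) x))) s x = H (sgl j (\<lambda>x. exp (?w * of_real (\<theta> t x)))) s x"
        if t: "t \<in> I" for t
      proof -
        have "(\<lambda>x. exp (?w * lgd (g t) x)) \<in> Fsp"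
          using g t by (intro Fsp_exp Fsp_mult Fsp_const lgd_Fsp) (simp add: dfam_def)
        moreover have "c t * exp (?w * lgd (g t) x) = exp (?w * of_real (\<theta> t x))" for x
          unfolding c_def lg[OF t] mult_exp_exp by (simp add: algebra_simps)
        ultimately show ?thesis using H_sgl_scale[of "\<lambda>x. exp (?w * lgd (g t) x)" j "c t" s x] jk by simp
      qed
      ultimately show ?thesis using P_cong by (metis (no_types, lifting))
    qed
    obtain \<theta>1 \<theta>2 :: "real \<Rightarrow> real \<Rightarrow> real" and e :: real where e: "e > 0"
      and \<theta>: "pf I (\<lambda>t x. of_real (\<theta>1 t x))" "pf I (\<lambda>t x. of_real (\<theta>2 t x))"
      and eq: "\<And>t x. t \<in> I \<Longrightarrow> exp (?w * of_real (\<theta>1 t x)) + \<i> * exp (?w * of_real (\<theta>2 t x)) = 1 + \<i> + of_real e * F t x"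
      using exp_pair_family[OF False less.prems(1)] by blast
    have P1: "P (\<lambda>t. H (sgl j (\<lambda>x. 1)) s x)"
      using EXPP[of "\<lambda>t x. 0"] pf_const'[of I 0] by simp
    let ?E1 = "\<lambda>t x. exp (?w * of_real (\<theta>1 t x))" and ?E2 = "\<lambda>t x. exp (?w * of_real (\<theta>2 t x))"
    have "1 / of_real e * (H (sgl j (?E1 t)) s x + (\<i> * H (sgl j (?E2 t)) s x + (-1-\<i>) * H (sgl j (\<lambda>x. 1)) s x)) = H (sgl j (F t)) s x"
      if t: "t \<in> I" for t
    proof -
      have E1: "?E1 t \<in> Fsp" using Fsp_pf[OF \<theta>(1) t] by (intro Fsp_exp Fsp_mult Fsp_const)
      have E2: "?E2 t \<in> Fsp" using Fsp_pf[OF \<theta>(2) t] by (intro Fsp_exp Fsp_mult Fsp_const)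
      have c: "(\<lambda>x. \<i> * ?E2 t x) \<in> Fsp" "(\<lambda>x. (-1-\<i>) * 1) \<in> Fsp" using E2 by (auto intro!: Fsp_mult Fsp_const)
      have "F t x = 1 / of_real e * (?E1 t x + (\<i> * ?E2 t x + (-1-\<i>) * 1))" for x
        using eq[OF t, of x] e by (simp add: field_simps)
      then have "F t = (\<lambda>x. 1 / of_real e * (?E1 t x + (\<i> * ?E2 t x + (-1-\<i>) * 1)))" by auto
      then show ?thesis
        by (simp only: H_sgl_scale[OF Fsp_add[OF E1 Fsp_add[OF c]] jk] H_sgl_add[OF E1 Fsp_add[OF c] jk]
            H_sgl_add[OF c jk] H_sgl_scale[OF E2 jk] H_sgl_scale[OF Fsp_const jk])
    qed
    moreover have "P (\<lambda>t. 1 / of_real e * (H (sgl j (?E1 t)) s x + (\<i> * H (sgl j (?E2 t)) s x + (-1-\<i>) * H (sgl j (\<lambda>x. 1)) s x)))"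
      by (intro P_cmult P_add EXPP[OF \<theta>(1)] EXPP[OF \<theta>(2)] P1)
    ultimately show ?thesis using P_cong by (metis (no_types, lifting))
  next
    \<comment> \<open>The Jacobian factor is 1, so leading coefficients change by composition only.
      Moving \<open>ee 1\<close> by \<open>x + \<theta> t x\<close> multiplies it by
      \<open>exp (tpi * \<theta> t x)\<close>; solving for \<open>F * ee (-1)\<close> instead of
      \<open>F\<close> removes the common factor \<open>ee 1\<close>.\<close>
    case True
    then have ml: "m - l = of_nat j" by simp
    have SH: "P (\<lambda>t. H (sgl j (\<lambda>x. ee 1 x * exp (tpi * of_real (\<theta> t x)))) s x)"
      if \<theta>: "pf I (\<lambda>t x. complex_of_real (\<theta> t x))" "\<And>t x. t \<in> I \<Longrightarrow> norm (vd (\<lambda>x. complex_of_real (\<theta> t x)) x) \<le> 1/2" for \<theta>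
    proof -
      have g: "dfam I (\<lambda>t x. x + \<theta> t x)" by (rule dfam_shift[OF \<theta>])
      have "exp (?w * y) * ee 1 (x + \<theta> t x) = ee 1 x * exp (tpi * of_real (\<theta> t x))" for t x y
        unfolding True by (simp add: ee_def exp_add[symmetric] algebra_simps)
      then show ?thesis using KEY[OF g ee_Fsp B2[OF g jk ml]] by simp
    qed
    have tpi: "tpi \<noteq> 0" by simp
    have F': "pf I (\<lambda>t x. F t x * ee (-1) x)" by (intro pf_mult less.prems(1) pf_Fsp ee_Fsp)
    obtain \<theta>1 \<theta>2 :: "real \<Rightarrow> real \<Rightarrow> real" and e :: real where e: "e > 0"
      and \<theta>: "pf I (\<lambda>t x. of_real (\<theta>1 t x))" "pf I (\<lambda>t x. of_real (\<theta>2 t x))"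
      and eq: "\<And>t x. t \<in> I \<Longrightarrow> exp (tpi * of_real (\<theta>1 t x)) + \<i> * exp (tpi * of_real (\<theta>2 t x)) = 1 + \<i> + of_real e * (F t x * ee (-1) x)"
      and sm: "\<And>t x. t \<in> I \<Longrightarrow> norm (vd (\<lambda>x. complex_of_real (\<theta>1 t x)) x) \<le> 1/2"
        "\<And>t x. t \<in> I \<Longrightarrow> norm (vd (\<lambda>x. complex_of_real (\<theta>2 t x)) x) \<le> 1/2"
      using exp_pair_family[OF tpi F'] by blast
    have P1: "P (\<lambda>t. H (sgl j (ee 1)) s x)"
      using SH[of "\<lambda>t x. 0"] pf_const'[of I 0] by (simp add: vd_const)
    let ?E1 = "\<lambda>t x. ee 1 x * exp (tpi * of_real (\<theta>1 t x))" and ?E2 = "\<lambda>t x. ee 1 x * exp (tpi * of_real (\<theta>2 t x))"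
    have "1 / of_real e * (H (sgl j (?E1 t)) s x + (\<i> * H (sgl j (?E2 t)) s x + (-1-\<i>) * H (sgl j (ee 1)) s x)) = H (sgl j (F t)) s x"
      if t: "t \<in> I" for t
    proof -
      have E1: "?E1 t \<in> Fsp" using Fsp_pf[OF \<theta>(1) t] by (intro Fsp_exp Fsp_mult Fsp_const ee_Fsp)
      have E2: "?E2 t \<in> Fsp" using Fsp_pf[OF \<theta>(2) t] by (intro Fsp_exp Fsp_mult Fsp_const ee_Fsp)
      have c: "(\<lambda>x. \<i> * ?E2 t x) \<in> Fsp" "(\<lambda>x. (-1-\<i>) * ee 1 x) \<in> Fsp"
        using E2 by (auto intro!: Fsp_mult Fsp_const ee_Fsp)
      have "F t x = 1 / of_real e * (?E1 t x + (\<i> * ?E2 t x + (-1-\<i>) * ee 1 x))" for x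
      proof -
        have "ee 1 x * ee (-1) x = 1" using ee_add[of 1 "-1" x] by (simp add: ee_0)
        then have "of_real e * F t x = ee 1 x * (of_real e * (F t x * ee (-1) x))" by simp
        also have "\<dots> = ee 1 x * (exp (tpi * of_real (\<theta>1 t x)) + \<i> * exp (tpi * of_real (\<theta>2 t x)) - (1 + \<i>))"
          unfolding eq[OF t] by simp
        finally show ?thesis using e by (simp add: field_simps)
      qed
      then have "F t = (\<lambda>x. 1 / of_real e * (?E1 t x + (\<i> * ?E2 t x + (-1-\<i>) * ee 1 x)))" by auto
      then show ?thesis
        by (simp only: H_sgl_scale[OF Fsp_add[OF E1 Fsp_add[OF c]] jk] H_sgl_add[OF E1 Fsp_add[OF c] jk]
            H_sgl_add[OF c jk] H_sgl_scale[OF E2 jk] H_sgl_scale[OF ee_Fsp jk])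
    qed
    moreover have "P (\<lambda>t. 1 / of_real e * (H (sgl j (?E1 t)) s x + (\<i> * H (sgl j (?E2 t)) s x + (-1-\<i>) * H (sgl j (ee 1)) s x)))"
      by (intro P_cmult P_add SH \<theta> sm P1)
    ultimately show ?thesis using P_cong by (metis (no_types, lifting))
  qed
qed

text \<open>The substitute for continuity: \<open>span\<close> with \<open>P\<close> meaning
  boundedness over \<open>I\<close>. The bound may depend on \<open>s\<close> and \<open>x\<close>,
  since expansions are compared pointwise.\<close>

lemma H_bounded:
  assumes a: "\<And>i. pf I (\<lambda>t. a t i)" "\<And>t. t \<in> I \<Longrightarrow> a t \<in> Cf k"
  shows "\<exists>C. \<forall>t\<in>I. norm (H (a t) s x) \<le> C"
proof -
  let ?P = "\<lambda>u::real \<Rightarrow> complex. \<exists>C. \<forall>t\<in>I. norm (u t) \<le> C"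
  have "?P (\<lambda>t. H (sgl j (a t j)) s x)" if "j \<le> k" for j
  proof (rule span[where P="?P", OF _ _ _ _ _ _ a(1) that])
    fix u v :: "real \<Rightarrow> complex" assume "?P u" "?P v"
    then obtain C D where "\<forall>t\<in>I. norm (u t) \<le> C" "\<forall>t\<in>I. norm (v t) \<le> D" by blast
    then have "\<forall>t\<in>I. norm (u t + v t) \<le> C + D" by (auto intro!: norm_triangle_mono)
    then show "?P (\<lambda>t. u t + v t)" by blast
  next
    fix c u :: "real \<Rightarrow> complex" assume c: "bounded (c ` I)" and "?P u"
    then obtain C where C: "\<forall>t\<in>I. norm (u t) \<le> C" by blast
    obtain D where D: "\<forall>t\<in>I. norm (c t) \<le> D" using c by (auto simp: bounded_iff)
    have "norm (c t * u t) \<le> \<bar>D\<bar> * \<bar>C\<bar>" if "t \<in> I" for t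
      unfolding norm_mult using C D that by (intro mult_mono) (auto intro: order_trans[OF _ abs_ge_self])
    then show "?P (\<lambda>t. c t * u t)" by blast
  next
    fix g j assume g: "dfam I g" and j: "j \<le> k"
    have "pf I (\<lambda>t. acth l m k (g t) (H (sgl j (\<lambda>x. 1))) s)"
      using g j by (intro acth_pf H_Cf sgl_Cf Fsp_const)
    from pf_bound[OF this] show "?P (\<lambda>t. acth l m k (g t) (H (sgl j (\<lambda>x. 1))) s x)" by blast
    have "pf I (\<lambda>t. acth l m k (g t) (H (sgl j (ee 1))) s)"
      using g j by (intro acth_pf H_Cf sgl_Cf ee_Fsp)
    from pf_bound[OF this] show "?P (\<lambda>t. acth l m k (g t) (H (sgl j (ee 1))) s x)" by blast
  next
    fix u v :: "real \<Rightarrow> complex" assume "\<And>t. t \<in> I \<Longrightarrow> u t = v t" "?P u"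
    then show "?P v" by (metis (no_types, lifting))
  qed (rule exI[of _ 0], simp)
  then obtain C where C: "\<And>j t. j \<le> k \<Longrightarrow> t \<in> I \<Longrightarrow> norm (H (sgl j (a t j)) s x) \<le> C j" by metis
  have "norm (H (a t) s x) \<le> (\<Sum>j\<le>k. C j)" if t: "t \<in> I" for t
    unfolding H_lower[OF a(2)[OF t]] using C t by (intro sum_norm_le) auto
  then show ?thesis by blast
qed

text \<open>\<open>span\<close> for a constant family, with \<open>P\<close> meaning vanishing: the
  operators \<open>d^j\<close>, and \<open>ee 1 d^j\<close> in the order of weight zero, generate
  everything.\<close>

lemma H_vanish:
  assumes 1: "\<And>j. j \<le> k \<Longrightarrow> H (sgl j (\<lambda>x. 1)) = (\<lambda>i x. 0)"
    and 2: "\<And>j. j \<le> k \<Longrightarrow> m - l = of_nat j \<Longrightarrow> H (sgl j (ee 1)) = (\<lambda>i x. 0)"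
    and a: "a \<in> Cf k"
  shows "H a = (\<lambda>i x. 0)"
proof (intro ext)
  fix s x
  have z: "acth l m k g (\<lambda>i x. 0) s x = 0" for g by (simp add: acth_def)
  have "\<forall>t\<in>(UNIV::real set). H (sgl j (a j)) s x = 0" if "j \<le> k" for j
    by (rule span[where I=UNIV and P="\<lambda>u. \<forall>t\<in>UNIV. u t = 0" and F="\<lambda>_. a j", OF _ _ _ _ _ _ _ that])
       (use 1 2 z a in \<open>auto simp: Cf_def pf_Fsp\<close>)
  then show "H a s x = 0" unfolding H_lower[OF a] by simp
qed

end

section \<open>Infinitesimal equivariance\<close>

lemma cancel_square: "t \<noteq> 0 \<Longrightarrow> t\<^sup>2 * (inverse (t\<^sup>2) * y) = (y :: 'a::field)"
  by (metis mult.assoc mult_1 right_inverse zero_eq_power2)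

lemma norm_diff_le_deriv:
  fixes f :: "real \<Rightarrow> complex"
  assumes "convex S" "\<And>x. x \<in> S \<Longrightarrow> (f has_vector_derivative f' x) (at x)" "\<And>x. x \<in> S \<Longrightarrow> norm (f' x) \<le> C"
    "x \<in> S" "y \<in> S"
  shows "norm (f x - f y) \<le> C * \<bar>x - y\<bar>"
proof -
  have "onorm (\<lambda>h. h *\<^sub>R f' x) \<le> C" if "x \<in> S" for x
    using assms(3)[OF that] by (intro onorm_le) (simp add: mult.commute[of C] mult_left_mono)
  then show ?thesis
    using differentiable_bound[of S f "\<lambda>x h. h *\<^sub>R f' x" C x y] assms
    by (auto simp: has_vector_derivative_def has_derivative_at_withinI)
qed

lemma vd_congI: "(f has_vector_derivative f') (at x) \<Longrightarrow> vd f x = f'"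
  by (simp add: vd_def vector_derivative_at)

text \<open>First-order expansion \<open>F t = a + t v + O(t\<^sup>2)\<close>, with all derivatives of the remainder controlled.\<close>
definition jet :: "real set \<Rightarrow> (real \<Rightarrow> real \<Rightarrow> complex) \<Rightarrow> (real \<Rightarrow> complex) \<Rightarrow> (real \<Rightarrow> complex) \<Rightarrow> bool" where
  "jet I F a v \<longleftrightarrow> a \<in> Fsp \<and> v \<in> Fsp \<and>
     (\<exists>R. pf I R \<and> (\<forall>t\<in>I. \<forall>x. F t x = a x + of_real t * v x + (of_real t)\<^sup>2 * R t x))"

lemma jetI: "a \<in> Fsp \<Longrightarrow> v \<in> Fsp \<Longrightarrow> pf I R \<Longrightarrow>
  (\<And>t x. t \<in> I \<Longrightarrow> F t x = a x + of_real t * v x + (of_real t)\<^sup>2 * R t x) \<Longrightarrow> jet I F a v"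
  unfolding jet_def by blast

lemma jet_E:
  assumes "jet I F a v"
  obtains R where "a \<in> Fsp" "v \<in> Fsp" "pf I R"
    "\<And>t x. t \<in> I \<Longrightarrow> F t x = a x + of_real t * v x + (of_real t)\<^sup>2 * R t x"
  using assms unfolding jet_def by blast

lemma jet_const: "a \<in> Fsp \<Longrightarrow> jet I (\<lambda>t. a) a (\<lambda>x. 0)"
  by (rule jetI[where R="\<lambda>t x. 0"]) (auto intro: Fsp_const pf_const')

lemma jet_cong: "jet I F a v \<Longrightarrow> (\<And>t x. t \<in> I \<Longrightarrow> F t x = G t x) \<Longrightarrow> (\<And>x. a x = b x) \<Longrightarrow> (\<And>x. v x = w x) \<Longrightarrow> jet I G b w"
proof -
  assume *: "jet I F a v" "\<And>t x. t \<in> I \<Longrightarrow> F t x = G t x" "\<And>x. a x = b x" "\<And>x. v x = w x"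
  have "a = b" "v = w" using * by auto
  then show ?thesis using *(1,2) unfolding jet_def by metis
qed

lemma jet_add:
  assumes "jet I F a v" "jet I G b w" shows "jet I (\<lambda>t x. F t x + G t x) (\<lambda>x. a x + b x) (\<lambda>x. v x + w x)"
proof -
  obtain R where R: "a \<in> Fsp" "v \<in> Fsp" "pf I R" "\<And>t x. t \<in> I \<Longrightarrow> F t x = a x + of_real t * v x + (of_real t)\<^sup>2 * R t x"
    using jet_E[OF assms(1)] by blast
  obtain S where S: "b \<in> Fsp" "w \<in> Fsp" "pf I S" "\<And>t x. t \<in> I \<Longrightarrow> G t x = b x + of_real t * w x + (of_real t)\<^sup>2 * S t x"
    using jet_E[OF assms(2)] by blast
  show ?thesis
    by (rule jetI[where R="\<lambda>t x. R t x + S t x"]) (use R S in \<open>auto intro!: Fsp_add pf_add simp: algebra_simps\<close>)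
qed

lemma jet_mult:
  assumes b: "bounded ((\<lambda>t. complex_of_real t) ` I)" and "jet I F a v" "jet I G b w"
  shows "jet I (\<lambda>t x. F t x * G t x) (\<lambda>x. a x * b x) (\<lambda>x. v x * b x + a x * w x)"
proof -
  obtain R where R: "a \<in> Fsp" "v \<in> Fsp" "pf I R" "\<And>t x. t \<in> I \<Longrightarrow> F t x = a x + of_real t * v x + (of_real t)\<^sup>2 * R t x"
    using jet_E[OF assms(2)] by blast
  obtain S where S: "b \<in> Fsp" "w \<in> Fsp" "pf I S" "\<And>t x. t \<in> I \<Longrightarrow> G t x = b x + of_real t * w x + (of_real t)\<^sup>2 * S t x"
    using jet_E[OF assms(3)] by blast
  note pt = pf_const[OF b]
  show ?thesis
  proof (rule jetI[where R="\<lambda>t x. v x * w x + a x * S t x + R t x * b x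
      + (of_real t * (v x * S t x + R t x * w x) + of_real t * of_real t * (R t x * S t x))"])
    show "pf I (\<lambda>t x. v x * w x + a x * S t x + R t x * b x
      + (of_real t * (v x * S t x + R t x * w x) + of_real t * of_real t * (R t x * S t x)))"
      by (intro pf_add pf_mult pt R(3) S(3) pf_Fsp R(1,2) S(1,2))
  qed (use R S in \<open>auto intro!: Fsp_add Fsp_mult simp: algebra_simps power2_eq_square\<close>)
qed

lemma jet_sum:
  assumes "finite S" "\<And>i. i \<in> S \<Longrightarrow> jet I (F i) (a i) (v i)"
  shows "jet I (\<lambda>t x. \<Sum>i\<in>S. F i t x) (\<lambda>x. \<Sum>i\<in>S. a i x) (\<lambda>x. \<Sum>i\<in>S. v i x)"
  using assms by (induction S rule: finite_induct) (auto intro!: jet_add jet_const Fsp_const)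

lemma jet_vd:
  assumes "jet I F a v" shows "jet I (\<lambda>t. vd (F t)) (vd a) (vd v)"
proof -
  obtain R where R: "a \<in> Fsp" "v \<in> Fsp" "pf I R" "\<And>t x. t \<in> I \<Longrightarrow> F t x = a x + of_real t * v x + (of_real t)\<^sup>2 * R t x"
    using jet_E[OF assms(1)] by blast
  show ?thesis
  proof (rule jetI[where R="\<lambda>t. vd (R t)"])
    show "vd (F t) x = vd a x + of_real t * vd v x + (of_real t)\<^sup>2 * vd (R t) x" if t: "t \<in> I" for t x
    proof -
      have "F t = (\<lambda>x. a x + of_real t * v x + (of_real t)\<^sup>2 * R t x)" using R(4)[OF t] by auto
      then show ?thesis
        by (simp only:) (intro vd_congI has_vector_derivative_add has_vector_derivative_mult_right
            Fsp_deriv[OF R(1)] Fsp_deriv[OF R(2)] pf_deriv[OF R(3) t])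
    qed
  qed (use R in \<open>auto intro!: Fsp_vd pf_vd\<close>)
qed

lemma exp_minus_1_bound: "norm (exp z - 1) \<le> norm z * exp (norm z)" for z :: complex
  using Taylor_exp_field[of z 0] by (simp add: mult.commute)

lemma exp_minus_1_z_bound: "norm (exp z - 1 - z) \<le> (norm z)\<^sup>2 * exp (norm z)" for z :: complex
  using Taylor_exp_field[of z 1] by (simp add: mult.commute power2_eq_square algebra_simps)

lemma has_vector_derivative_exp:
  "(f has_vector_derivative f') (at x) \<Longrightarrow> ((\<lambda>x. exp (f x)) has_vector_derivative f' * exp (f x)) (at x)"
  for f :: "real \<Rightarrow> complex"
  using field_vector_diff_chain_at[OF _ DERIV_exp] by (simp add: o_def)

text \<open>The scaled remainders \<open>S1\<close> and \<open>S2\<close> of the exponential series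
  have derivatives \<open>vd (G t)\<close> times the exponential and \<open>vd (G t)\<close> times
  \<open>S1\<close>. By \<open>pfI_deriv\<close> only their sup bounds, from Taylor's formula, have
  to be estimated.\<close>

lemma jet_exp:
  assumes I: "I \<subseteq> {0<..1}" and "jet I F (\<lambda>x. 0) v" shows "jet I (\<lambda>t x. exp (F t x)) (\<lambda>x. 1) v"
proof -
  obtain R where R: "v \<in> Fsp" "pf I R" "\<And>t x. t \<in> I \<Longrightarrow> F t x = of_real t * v x + (of_real t)\<^sup>2 * R t x"
    using assms(2) unfolding jet_def by auto
  have bI: "bounded ((\<lambda>t. complex_of_real t) ` I)"
    unfolding bounded_iff using I by (intro exI[of _ 1]) auto
  define G where "G = (\<lambda>t x. v x + of_real t * R t x)"
  have G: "pf I G" unfolding G_def by (intro pf_add pf_mult pf_Fsp R pf_const bI)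
  have FG: "F t x = of_real t * G t x" if "t \<in> I" for t x
    unfolding R(3)[OF that] G_def by (simp add: power2_eq_square algebra_simps)
  obtain C where C: "\<And>t x. t \<in> I \<Longrightarrow> norm (G t x) \<le> C" using pf_bound[OF G] by blast
  have t: "t > 0" "t \<le> 1" if "t \<in> I" for t using I that by auto
  have tG: "norm (of_real t * G t x) \<le> t * C \<and> norm (of_real t * G t x) \<le> C" if "t \<in> I" for t x
  proof -
    have "norm (of_real t * G t x) \<le> t * C" using C[OF that, of x] t[OF that] by (simp add: norm_mult)
    moreover have "0 \<le> C" using C[OF that, of x] norm_ge_zero order_trans by blast
    then have "t * C \<le> 1 * C" using t[OF that] by (intro mult_right_mono) auto
    ultimately show ?thesis by simp
  qed
  have dG: "((\<lambda>x. of_real t * G t x) has_vector_derivative of_real t * vd (G t) x) (at x)" if "t \<in> I" for t x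
    by (intro has_vector_derivative_mult_right pf_deriv[OF G that])
  define S1 where "S1 = (\<lambda>t x. inverse (of_real t) * (exp (of_real t * G t x) - 1))"
  define S2 where "S2 = (\<lambda>t x. inverse ((of_real t)\<^sup>2) * (exp (of_real t * G t x) - 1 - of_real t * G t x))"
  have pe: "pf I (\<lambda>t x. exp (of_real t * G t x))" by (intro pf_exp pf_mult pf_const bI G)
  have S1: "pf I S1"
  proof (rule pfI_deriv)
    have "norm (S1 t x) \<le> C * exp C" if ti: "t \<in> I" for t x
    proof -
      have "norm (exp (of_real t * G t x) - 1) \<le> (t * C) * exp C"
        using exp_minus_1_bound[of "of_real t * G t x"] tG[OF ti, of x] norm_ge_zero t[OF ti]
        by (meson exp_ge_zero exp_le_cancel_iff mult_mono order_trans)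
      then show ?thesis unfolding S1_def using t[OF ti] by (simp add: norm_mult norm_divide norm_inverse field_simps)
    qed
    then show "bf I 0 S1" by auto
    show "(S1 t has_vector_derivative vd (G t) x * exp (of_real t * G t x)) (at x)" if ti: "t \<in> I" for t x
    proof -
      have "(S1 t has_vector_derivative inverse (of_real t) * ((of_real t * vd (G t) x) * exp (of_real t * G t x) - 0)) (at x)"
        unfolding S1_def by (intro has_vector_derivative_mult_right has_vector_derivative_diff has_vector_derivative_const has_vector_derivative_exp dG ti)
      moreover have "inverse (of_real t) * ((of_real t * vd (G t) x) * exp (of_real t * G t x) - 0) = vd (G t) x * exp (of_real t * G t x)"
        using t[OF ti] by simp
      ultimately show ?thesis by metis
    qed
    show "pf I (\<lambda>t x. vd (G t) x * exp (of_real t * G t x))" by (intro pf_mult pf_vd G pe)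
    show "S1 t (x + 1) = S1 t x" if "t \<in> I" for t x using G that by (simp add: S1_def pf_def)
  qed
  have S2: "pf I S2"
  proof (rule pfI_deriv)
    have "norm (S2 t x) \<le> C\<^sup>2 * exp C" if ti: "t \<in> I" for t x
    proof -
      have "(norm (of_real t * G t x))\<^sup>2 \<le> (t * C)\<^sup>2" using tG[OF ti, of x] by (intro power_mono) auto
      then have "norm (exp (of_real t * G t x) - 1 - of_real t * G t x) \<le> (t * C)\<^sup>2 * exp C"
        using exp_minus_1_z_bound[of "of_real t * G t x"] tG[OF ti, of x]
        by (meson exp_ge_zero exp_le_cancel_iff mult_mono order_trans zero_le_power2)
      then show ?thesis unfolding S2_def using t[OF ti]
        by (simp add: norm_mult norm_divide norm_inverse norm_power power_mult_distrib field_simps)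
    qed
    then show "bf I 0 S2" by auto
    show "(S2 t has_vector_derivative vd (G t) x * S1 t x) (at x)" if ti: "t \<in> I" for t x
    proof -
      have "(S2 t has_vector_derivative inverse ((of_real t)\<^sup>2) * ((of_real t * vd (G t) x) * exp (of_real t * G t x) - 0 - of_real t * vd (G t) x)) (at x)"
        unfolding S2_def by (intro has_vector_derivative_mult_right has_vector_derivative_diff has_vector_derivative_const has_vector_derivative_exp dG ti)
      moreover have "inverse ((of_real t)\<^sup>2) * ((of_real t * vd (G t) x) * exp (of_real t * G t x) - 0 - of_real t * vd (G t) x) = vd (G t) x * S1 t x"
        using t[OF ti] by (simp add: S1_def power2_eq_square field_simps)
      ultimately show ?thesis by simp
    qed
    show "pf I (\<lambda>t x. vd (G t) x * S1 t x)" by (intro pf_mult pf_vd G S1)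
    show "S2 t (x + 1) = S2 t x" if "t \<in> I" for t x using G that by (simp add: S2_def pf_def)
  qed
  show ?thesis
  proof (rule jetI[where R="\<lambda>t x. R t x + S2 t x"])
    show "pf I (\<lambda>t x. R t x + S2 t x)" by (intro pf_add R S2)
    show "exp (F t x) = 1 + of_real t * v x + (of_real t)\<^sup>2 * (R t x + S2 t x)" if ti: "t \<in> I" for t x
    proof -
      have "(of_real t)\<^sup>2 * S2 t x = exp (F t x) - 1 - F t x"
        unfolding FG[OF ti] S2_def using t[OF ti] by simp
      then show ?thesis using R(3)[OF ti, of x] by (simp add: algebra_simps)
    qed
  qed (use R Fsp_const in auto)
qed

section \<open>First-order expansion of the action along \<open>x + t X(x)\<close>\<close>

locale perturb =
  fixes X :: "real \<Rightarrow> real" and \<epsilon> :: real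
  assumes X: "(\<lambda>x. complex_of_real (X x)) \<in> Fsp" and eps: "0 < \<epsilon>" "\<epsilon> \<le> 1"
    and small: "\<And>x. \<epsilon> * \<bar>vd X x\<bar> \<le> 1/2"
begin

text \<open>Zero is left out because remainders are defined by dividing by powers of
  \<open>t\<close>.\<close>

abbreviation "I \<equiv> {0<..\<epsilon>}"
abbreviation "Xc \<equiv> \<lambda>x. complex_of_real (X x)"
definition "gt t x = x + t * X x"

lemma I: "t \<in> I \<Longrightarrow> t > 0" "t \<in> I \<Longrightarrow> t \<le> 1" "I \<subseteq> {0<..1}"
  using eps by auto

lemma bI: "bounded ((\<lambda>t. complex_of_real t) ` I)"
  unfolding bounded_iff using eps by (intro exI[of _ 1]) auto

lemma vdXc: "vd Xc = (\<lambda>x. complex_of_real (vd X x))"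
  using real_dnth(1)[OF X, of 1] by (simp only: dnth_1)

lemma vdXc2: "vd (vd Xc) = (\<lambda>x. complex_of_real (vd (vd X) x))"
  using real_dnth(1)[OF X, of 2] by (simp only: numeral_2_eq_2 dnth_Suc_vd dnth.simps(1))

lemma vdXc3: "vd (\<lambda>x. complex_of_real (vd X x)) = (\<lambda>x. complex_of_real (vd (vd X) x))"
  using vdXc2 unfolding vdXc .

lemma X_deriv: "(X has_vector_derivative vd X x) (at x)"
  using real_dnth(2)[OF X, of 0 x] by (simp add: vd_def)

lemma X_deriv2: "(vd X has_vector_derivative vd (vd X) x) (at x)"
  using real_dnth(2)[OF X, of 1 x] by (simp add: vd_def)

lemma pfX: "pf I (\<lambda>t x. complex_of_real (t * X x))"
  using pf_mult[OF pf_const[OF bI] pf_Fsp[OF X]] by simp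

lemma dfam_gt: "dfam I gt" "t \<in> I \<Longrightarrow> vd (gt t) = (\<lambda>x. 1 + t * vd X x)"
proof -
  have v: "vd (\<lambda>x. t * X x) = (\<lambda>x. t * vd X x)" for t
    by (rule vd_eqI) (intro has_vector_derivative_mult_right X_deriv)
  have "norm (vd (\<lambda>x. complex_of_real (t * X x)) x) \<le> 1/2" if t: "t \<in> I" for t x
  proof -
    have "norm (vd (\<lambda>x. complex_of_real (t * X x)) x) = t * \<bar>vd X x\<bar>"
      using I(1)[OF t] unfolding real_pf(2)[OF pfX t] v norm_of_real by (simp add: abs_mult)
    also have "\<dots> \<le> \<epsilon> * \<bar>vd X x\<bar>" using t by (intro mult_right_mono) auto
    finally show ?thesis using small[of x] by linarith
  qed
  note D = dfam_shift[OF pfX this]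
  show "dfam I gt" "t \<in> I \<Longrightarrow> vd (gt t) = (\<lambda>x. 1 + t * vd X x)"
    using D(1) D(2)[of t] by (auto simp: gt_def[abs_def] v)
qed

lemma gtD: "t \<in> I \<Longrightarrow> gt t \<in> DiffS1"
  using dfam_gt(1) by (simp add: dfam_def)

lemma small_t: "t \<in> I \<Longrightarrow> \<bar>t * vd X x\<bar> \<le> 1/2"
proof -
  assume t: "t \<in> I"
  have "\<bar>t * vd X x\<bar> \<le> \<epsilon> * \<bar>vd X x\<bar>" using t by (auto simp: abs_mult intro!: mult_right_mono)
  then show ?thesis using small[of x] by linarith
qed

lemma jet_lgd: "jet I (\<lambda>t. lgd (gt t)) (\<lambda>x. 0) (vd Xc)"
proof -
  obtain C where C: "\<And>x. norm (vd Xc x) \<le> C" using pf_bound[OF pf_Fsp[OF Fsp_vd[OF X], of UNIV]] by blast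
  define R where "R = (\<lambda>t x. complex_of_real (inverse (t\<^sup>2) * (ln (1 + t * vd X x) - t * vd X x)))"
  have lg: "lgd (gt t) x = complex_of_real (ln (1 + t * vd X x))" if "t \<in> I" for t x
    by (simp add: lgd_def dfam_gt(2)[OF that])
  have pos: "1 + t * vd X x > 0" if "t \<in> I" for t x using small_t[OF that, of x] by linarith
  \<comment> \<open>The derivative of the remainder contains no negative power of \<open>t\<close>;
    an estimate of the logarithm is needed only for the remainder itself.\<close>
  have R': "(R t has_vector_derivative - (vd Xc x * vd (vd Xc) x) * exp (- lgd (gt t) x)) (at x)" if t: "t \<in> I" for t x
  proof -
    have "((\<lambda>x. 1 + t * vd X x) has_vector_derivative 0 + t * vd (vd X) x) (at x)"
      by (intro has_vector_derivative_add has_vector_derivative_const has_vector_derivative_mult_right X_deriv2)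
    then have d: "((\<lambda>x. 1 + t * vd X x) has_vector_derivative t * vd (vd X) x) (at x)" by simp
    have "((\<lambda>x. ln (1 + t * vd X x)) has_vector_derivative (t * vd (vd X) x) * inverse (1 + t * vd X x)) (at x)"
      using field_vector_diff_chain_at[OF d DERIV_ln[OF pos[OF t]]] by (simp add: o_def)
    then have "((\<lambda>x. inverse (t\<^sup>2) * (ln (1 + t * vd X x) - t * vd X x)) has_vector_derivative
      inverse (t\<^sup>2) * ((t * vd (vd X) x) * inverse (1 + t * vd X x) - t * vd (vd X) x)) (at x)"
      by (intro has_vector_derivative_mult_right has_vector_derivative_diff X_deriv2)
    moreover have "inverse (t\<^sup>2) * ((t * vd (vd X) x) * inverse (1 + t * vd X x) - t * vd (vd X) x)
       = - (vd X x * vd (vd X) x) * inverse (1 + t * vd X x)"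
      using pos[OF t, of x] I(1)[OF t] by (simp add: field_simps power2_eq_square)
    ultimately have "(R t has_vector_derivative complex_of_real (- (vd X x * vd (vd X) x) * inverse (1 + t * vd X x))) (at x)"
      unfolding R_def has_vector_derivative_of_real_iff by simp
    moreover have "exp (- lgd (gt t) x) = complex_of_real (inverse (1 + t * vd X x))"
      unfolding exp_minus exp_lgd[OF gtD[OF t]] dfam_gt(2)[OF t] by simp
    ultimately show ?thesis by (simp add: vdXc vdXc3)
  qed
  have "pf I R"
  proof (rule pfI_deriv[OF _ R'])
    have "norm (R t x) \<le> 2 * C\<^sup>2" if t: "t \<in> I" for t x
    proof -
      have "\<bar>ln (1 + t * vd X x) - t * vd X x\<bar> \<le> 2 * (t * vd X x)\<^sup>2"
        by (rule abs_ln_one_plus_x_minus_x_bound[OF small_t[OF t]])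
      moreover have "(vd X x)\<^sup>2 \<le> C\<^sup>2" using C[of x] by (simp add: vdXc power2_le_iff_abs_le abs_le_square_iff[symmetric])
      then have "2 * (t * vd X x)\<^sup>2 \<le> 2 * (t\<^sup>2 * C\<^sup>2)" by (simp add: power_mult_distrib mult_left_mono)
      ultimately have "\<bar>ln (1 + t * vd X x) - t * vd X x\<bar> \<le> t\<^sup>2 * (2 * C\<^sup>2)" by linarith
      then have "inverse (t\<^sup>2) * \<bar>ln (1 + t * vd X x) - t * vd X x\<bar> \<le> inverse (t\<^sup>2) * (t\<^sup>2 * (2 * C\<^sup>2))"
        by (intro mult_left_mono) auto
      also have "\<dots> = 2 * C\<^sup>2" using I(1)[OF t] by simp
      finally show ?thesis unfolding R_def norm_of_real abs_mult by simp
    qed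
    then show "bf I 0 R" unfolding bf.simps by blast
    show "pf I (\<lambda>t x. - (vd Xc x * vd (vd Xc) x) * exp (- lgd (gt t) x))"
      using dfam_gt(1) by (intro pf_mult pf_minus pf_exp pf_Fsp Fsp_vd X) (simp add: dfam_def)
    show "R t (x + 1) = R t x" for t x
      using Fsp_periodic[OF Fsp_vd[OF X], of x] by (simp add: R_def vdXc)
  qed
  then show ?thesis
  proof (rule jetI[OF Fsp_const Fsp_vd[OF X]])
    show "lgd (gt t) x = 0 + of_real t * vd Xc x + (of_real t)\<^sup>2 * R t x" if t: "t \<in> I" for t x
      unfolding lg[OF t] R_def vdXc
    proof -
      have "t\<^sup>2 * (inverse (t\<^sup>2) * (ln (1 + t * vd X x) - t * vd X x)) = ln (1 + t * vd X x) - t * vd X x"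
        by (rule cancel_square) (use I(1)[OF t] in simp)
      then show "complex_of_real (ln (1 + t * vd X x)) = 0 + complex_of_real t * complex_of_real (vd X x)
          + (complex_of_real t)\<^sup>2 * complex_of_real (inverse (t\<^sup>2) * (ln (1 + t * vd X x) - t * vd X x))"
        by (simp only: of_real_mult[symmetric] of_real_power[symmetric]) simp
    qed
  qed
qed

lemma gt_deriv: "t \<in> I \<Longrightarrow> a \<in> Fsp \<Longrightarrow>
  ((\<lambda>x. a (gt t x)) has_vector_derivative (1 + of_real t * vd Xc x) * vd a (gt t x)) (at x)"
  using has_vector_derivative_comp[OF _ DiffS1_deriv(1)[OF gtD], of a t x] dfam_gt(2)[of t]
  by (simp add: vdXc)

text \<open>The derivative of this quotient is the quotient of \<open>vd a\<close> plus
  \<open>vd Xc\<close> times \<open>vd a\<close> composed with \<open>gt t\<close>. The induction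
  thus runs over all \<open>a\<close>, and the only estimate is the mean value inequality.\<close>

lemma pf_Q:
  assumes "a \<in> Fsp"
  shows "pf I (\<lambda>t x. inverse (of_real t) * (a (gt t x) - a x))"
proof -
  obtain B where B: "\<And>x. norm (Xc x) \<le> B" using pf_bound[OF pf_Fsp[OF X, of UNIV]] by blast
  let ?Q = "\<lambda>a t x. inverse (complex_of_real t) * (a (gt t x) - a x)"
  have "bf I n (?Q a)" for n
    using assms
  proof (induction n arbitrary: a)
    case 0
    obtain C where C: "\<And>x. norm (vd a x) \<le> C" using pf_bound[OF pf_Fsp[OF Fsp_vd[OF 0], of UNIV]] by blast
    have "norm (?Q a t x) \<le> C * B" if t: "t \<in> I" for t x
    proof -
      have "norm (a (gt t x) - a x) \<le> C * \<bar>gt t x - x\<bar>"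
        by (rule norm_diff_le_deriv[of UNIV a "vd a"]) (use Fsp_deriv[OF 0] C in auto)
      also have "\<dots> = t * (C * \<bar>X x\<bar>)" using I(1)[OF t] by (simp add: gt_def abs_mult)
      also have "\<dots> \<le> t * (C * B)"
        using B[of x] C[of x] I(1)[OF t] norm_ge_zero[of "vd a x"]
        by (intro mult_left_mono) (auto simp del: norm_ge_zero)
      finally show ?thesis using I(1)[OF t] by (simp add: norm_mult norm_divide norm_inverse field_simps)
    qed
    then show ?case unfolding bf.simps by blast
  next
    case (Suc n)
    show ?case
    proof (rule bf_SucI)
      show "bf I 0 (?Q a)" using Suc.IH[OF Suc.prems] by (rule bf_0)
      show "bf I n (\<lambda>t x. ?Q (vd a) t x + vd Xc x * vd a (gt t x))"
        using pf_Fsp[OF Fsp_vd[OF X], of I] pf_comp[OF dfam_gt(1) Fsp_vd[OF Suc.prems]]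
        by (intro bf_add bf_mult Suc.IH[OF Fsp_vd[OF Suc.prems]]) (auto simp: pf_def)
      show "(?Q a t has_vector_derivative ?Q (vd a) t x + vd Xc x * vd a (gt t x)) (at x)" if t: "t \<in> I" for t x
      proof -
        have "(?Q a t has_vector_derivative inverse (of_real t) * ((1 + of_real t * vd Xc x) * vd a (gt t x) - vd a x)) (at x)"
          by (intro has_vector_derivative_mult_right has_vector_derivative_diff gt_deriv Fsp_deriv t Suc.prems)
        moreover have "inverse (of_real t) * ((1 + of_real t * vd Xc x) * vd a (gt t x) - vd a x) = ?Q (vd a) t x + vd Xc x * vd a (gt t x)"
          using I(1)[OF t] by (simp add: field_simps)
        ultimately show ?thesis by simp
      qed
    qed
  qed
  moreover have "?Q a t (x + 1) = ?Q a t x" if "t \<in> I" for t x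
    using Fsp_periodic[OF assms] Fsp_periodic[OF Fsp_comp[OF gtD[OF that] assms], of x] by simp
  ultimately show ?thesis by (simp add: pf_def)
qed

text \<open>The induction of \<open>pf_Q\<close> one order higher: the derivative of the
  second-order remainder of \<open>a\<close> is that of \<open>vd a\<close> plus
  \<open>vd Xc\<close> times the first-order quotient of \<open>vd a\<close>.\<close>

lemma jet_comp:
  assumes "a \<in> Fsp"
  shows "jet I (\<lambda>t x. a (gt t x)) a (\<lambda>x. Xc x * vd a x)"
proof -
  obtain B where B: "\<And>x. norm (Xc x) \<le> B" using pf_bound[OF pf_Fsp[OF X, of UNIV]] by blast
  let ?Q = "\<lambda>a t x. inverse (complex_of_real t) * (a (gt t x) - a x)"
  let ?R = "\<lambda>a t x. inverse ((complex_of_real t)\<^sup>2) * (a (gt t x) - a x - of_real t * (Xc x * vd a x))"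
  have "bf I n (?R a)" for n
    using assms
  proof (induction n arbitrary: a)
    case 0
    obtain C where C: "\<And>x. norm (vd (vd a) x) \<le> C" using pf_bound[OF pf_Fsp[OF Fsp_vd[OF Fsp_vd[OF 0]], of UNIV]] by blast
    have C0: "C \<ge> 0" using C[of 0] norm_ge_zero order_trans by blast
    have B0: "B \<ge> 0" using B[of 0] norm_ge_zero order_trans by blast
    have "norm (?R a t x) \<le> B * (C * B)" if t: "t \<in> I" for t x
    proof -
      \<comment> \<open>Follows the segment from \<open>x\<close> to \<open>gt t x\<close>: the
        derivative in \<open>s\<close> is bounded by a multiple of \<open>t\<close>, hence the
        increment up to \<open>s = t\<close> by a multiple of \<open>t^2\<close>.\<close>
      let ?f = "\<lambda>s. a (x + s * X x) - of_real s * (Xc x * vd a x)"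
      have der: "(?f has_vector_derivative Xc x * (vd a (x + s * X x) - vd a x)) (at s)" for s
      proof -
        have "((\<lambda>s. x + s * X x) has_vector_derivative 0 + 1 * X x) (at s)"
          by (intro has_vector_derivative_add has_vector_derivative_const has_vector_derivative_mult_left has_vector_derivative_id)
        from has_vector_derivative_comp[OF 0 this]
        have 1: "((\<lambda>s. a (x + s * X x)) has_vector_derivative Xc x * vd a (x + s * X x)) (at s)" by simp
        have 2: "((\<lambda>s. of_real s * (Xc x * vd a x)) has_vector_derivative of_real 1 * (Xc x * vd a x)) (at s)"
          by (intro has_vector_derivative_mult_left) (simp add: has_vector_derivative_of_real_iff[of "\<lambda>x. x" 1, simplified])
        show ?thesis using has_vector_derivative_diff[OF 1 2] by (simp add: algebra_simps)
      qed
      have bnd: "norm (Xc x * (vd a (x + s * X x) - vd a x)) \<le> t * (B * (C * B))" if s: "s \<in> {0..t}" for s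
      proof -
        have "norm (vd a (x + s * X x) - vd a x) \<le> C * \<bar>(x + s * X x) - x\<bar>"
          by (rule norm_diff_le_deriv[of UNIV "vd a" "vd (vd a)"]) (use Fsp_deriv[OF Fsp_vd[OF 0]] C in auto)
        also have "\<dots> = s * (C * \<bar>X x\<bar>)" using s by (simp add: abs_mult)
        also have "\<dots> \<le> t * (C * B)"
          using B[of x] C0 s by (intro mult_mono mult_left_mono) auto
        finally have "norm (vd a (x + s * X x) - vd a x) \<le> t * (C * B)" .
        then have "norm (Xc x) * norm (vd a (x + s * X x) - vd a x) \<le> B * (t * (C * B))"
          using B[of x] B0 by (intro mult_mono) auto
        moreover have "B * (t * (C * B)) = t * (B * (C * B))" by simp
        ultimately show ?thesis unfolding norm_mult by metis
      qed
      have "norm (?f t - ?f 0) \<le> t * (B * (C * B)) * \<bar>t - 0\<bar>"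
        by (rule norm_diff_le_deriv[of "{0..t}" ?f, OF _ der bnd]) (use I(1)[OF t] in auto)
      then have *: "norm (a (gt t x) - a x - of_real t * (Xc x * vd a x)) \<le> t\<^sup>2 * (B * (C * B))"
        using I(1)[OF t] by (simp add: gt_def algebra_simps power2_eq_square)
      have "inverse (t\<^sup>2) * norm (a (gt t x) - a x - of_real t * (Xc x * vd a x)) \<le> inverse (t\<^sup>2) * (t\<^sup>2 * (B * (C * B)))"
        by (intro mult_left_mono *) auto
      also have "\<dots> = B * (C * B)" using I(1)[OF t] by simp
      finally show ?thesis by (simp add: norm_mult norm_inverse norm_power)
    qed
    then show ?case unfolding bf.simps by blast
  next
    case (Suc n)
    show ?case
    proof (rule bf_SucI)
      show "bf I 0 (?R a)" using Suc.IH[OF Suc.prems] by (rule bf_0)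
      show "bf I n (\<lambda>t x. ?R (vd a) t x + vd Xc x * ?Q (vd a) t x)"
        using pf_Fsp[OF Fsp_vd[OF X], of I] pf_Q[OF Fsp_vd[OF Suc.prems]]
        by (intro bf_add[OF Suc.IH[OF Fsp_vd[OF Suc.prems]]] bf_mult[where F="\<lambda>t x. vd Xc x"]) (auto simp: pf_def)
      show "(?R a t has_vector_derivative ?R (vd a) t x + vd Xc x * ?Q (vd a) t x) (at x)" if t: "t \<in> I" for t x
      proof -
        have "(?R a t has_vector_derivative inverse ((of_real t)\<^sup>2) * ((1 + of_real t * vd Xc x) * vd a (gt t x) - vd a x
           - of_real t * (Xc x * vd (vd a) x + vd Xc x * vd a x))) (at x)"
          by (intro has_vector_derivative_mult_right has_vector_derivative_diff gt_deriv Fsp_deriv t Suc.prems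
              has_vector_derivative_mult X Fsp_vd)
        moreover have "inverse ((of_real t)\<^sup>2) * ((1 + of_real t * vd Xc x) * vd a (gt t x) - vd a x
           - of_real t * (Xc x * vd (vd a) x + vd Xc x * vd a x)) = ?R (vd a) t x + vd Xc x * ?Q (vd a) t x"
          using I(1)[OF t] by (simp add: field_simps power2_eq_square)
        ultimately show ?thesis by simp
      qed
    qed
  qed
  moreover have "?R a t (x + 1) = ?R a t x" if "t \<in> I" for t x
    using Fsp_periodic[OF assms] Fsp_periodic[OF Fsp_vd[OF assms]] Fsp_periodic[OF X, of x]
      Fsp_periodic[OF Fsp_comp[OF gtD[OF that] assms], of x] by simp
  ultimately have "pf I (?R a)" by (simp add: pf_def)
  then show ?thesis
  proof (rule jetI[OF assms Fsp_mult[OF X Fsp_vd[OF assms]]])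
    show "a (gt t x) = a x + of_real t * (Xc x * vd a x) + (of_real t)\<^sup>2 * ?R a t x" if "t \<in> I" for t x
    proof -
      have "complex_of_real t \<noteq> 0" using I(1)[OF that] by simp
      then show ?thesis by (subst cancel_square) auto
    qed
  qed
qed

end

text \<open>The nonzero linear coefficients of \<open>Pc l (ln g')'\<close> at \<open>g = id\<close>.\<close>
definition kap :: "complex \<Rightarrow> nat \<Rightarrow> nat \<Rightarrow> complex" where
  "kap l i s = (if s < i then - ((if s = 0 then 0 else of_nat (i choose (s - 1))) + l * of_nat (i choose s)) else 0)"

text \<open>The recursion of \<open>Pc\<close> linearised at \<eta> = 0, where
  \<open>Pc l \<eta> i s\<close> is 1 for \<open>i = s\<close> and 0 otherwise. The binomials
  combine by Pascal's rule.\<close>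

lemma kap_Suc: "kap l (Suc i) s = kap l i s + (if s = 0 then 0 else kap l i (s - 1)) - (if i = s then l + of_nat i else 0)"
proof -
  consider "s < i" | "s = i" | "s > i" by linarith
  then show ?thesis
  proof cases
    case 1
    show ?thesis
    proof (cases s)
      case 0 with 1 show ?thesis by (simp add: kap_def)
    next
      case (Suc s')
      show ?thesis using 1 unfolding Suc by (cases s') (auto simp: kap_def algebra_simps)
    qed
  next
    case 2
    show ?thesis
    proof (cases s)
      case 0 with 2 show ?thesis by (simp add: kap_def)
    next
      case (Suc s')
      have "Suc s' choose s' = Suc s'" by (simp add: binomial_symmetric[of s' "Suc s'"])
      then show ?thesis using 2 unfolding Suc
        by (cases s') (auto simp: kap_def algebra_simps)
    qed
  next
    case 3 then show ?thesis by (auto simp: kap_def)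
  qed
qed

context perturb
begin

lemma jet_Pc: "jet I (\<lambda>t. Pc l (vd (lgd (gt t))) i s) (\<lambda>x. if i = s then 1 else 0) (\<lambda>x. kap l i s * dnth (i + 1 - s) Xc x)"
proof (induction i arbitrary: s)
  case 0
  have "jet I (\<lambda>t x. if s = 0 then 1 else 0) (\<lambda>x. if s = 0 then 1 else 0) (\<lambda>x. 0)"
    by (rule jet_const) (simp add: Fsp_const)
  then show ?case by (rule jet_cong) (auto simp: kap_def)
next
  case (Suc i)
  let ?c = "l + of_nat i"
  have E: "jet I (\<lambda>t. vd (lgd (gt t))) (\<lambda>x. 0) (vd (vd Xc))" using jet_vd[OF jet_lgd] by (simp add: vd_const)
  have 1: "jet I (\<lambda>t. vd (Pc l (vd (lgd (gt t))) i s)) (\<lambda>x. 0) (\<lambda>x. kap l i s * dnth (i + 2 - s) Xc x)"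
  proof (rule jet_cong[OF jet_vd[OF Suc[of s]]])
    show "vd (\<lambda>x. if i = s then 1 else 0) x = 0" for x by (cases "i = s") (simp_all add: vd_const)
    show "vd (\<lambda>x. kap l i s * dnth (i + 1 - s) Xc x) x = kap l i s * dnth (i + 2 - s) Xc x" for x
    proof (cases "s < i")
      case True
      then have "i + 2 - s = Suc (i + 1 - s)" by simp
      then show ?thesis unfolding vd_cmult[OF Fsp_dnth[OF X]] by (simp only: dnth_Suc_vd)
    qed (simp add: kap_def vd_const)
  qed auto
  have 2: "jet I (\<lambda>t x. if s = 0 then 0 else Pc l (vd (lgd (gt t))) i (s - 1) x) (\<lambda>x. if Suc i = s then 1 else 0)
     (\<lambda>x. (if s = 0 then 0 else kap l i (s - 1)) * dnth (i + 2 - s) Xc x)"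
  proof (cases s)
    case 0
    then show ?thesis using jet_const[OF Fsp_const, of I 0] by simp
  next
    case (Suc s')
    then show ?thesis using Suc.IH[of s'] by simp
  qed
  have 3: "jet I (\<lambda>t x. (- ?c) * (vd (lgd (gt t)) x * Pc l (vd (lgd (gt t))) i s x)) (\<lambda>x. 0)
     (\<lambda>x. - (if i = s then ?c else 0) * dnth (i + 2 - s) Xc x)"
    by (rule jet_cong[OF jet_mult[OF bI jet_const[OF Fsp_const, of I "- ?c"] jet_mult[OF bI E Suc[of s]]]])
       (auto simp: vd_def[symmetric] numeral_2_eq_2 dnth_Suc_vd algebra_simps)
  show ?case
    by (rule jet_cong[OF jet_add[OF jet_add[OF 1 2] 3]])
       (auto simp: kap_Suc algebra_simps)
qed

end

text \<open>The derivative of \<open>acth\<close> at \<open>t = 0\<close> along \<open>g = x + t X(x)\<close>.\<close>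
definition VV :: "complex \<Rightarrow> complex \<Rightarrow> nat \<Rightarrow> (real \<Rightarrow> complex) \<Rightarrow> coeffs \<Rightarrow> coeffs" where
  "VV l m k X a s = (\<lambda>x. (m - l - of_nat s) * (vd X x * a s x) + X x * vd (a s) x
     + (\<Sum>i\<in>{s..k}. kap l i s * (a i x * dnth (i + 1 - s) X x)))"

lemma VV_Cf: "X \<in> Fsp \<Longrightarrow> a \<in> Cf k \<Longrightarrow> VV l m k X a \<in> Cf k"
  unfolding Cf_def VV_def
  by (auto intro!: Fsp_add Fsp_mult Fsp_sum Fsp_const Fsp_vd Fsp_dnth simp: vd_const)

lemma (in perturb) jet_acth:
  assumes a: "a \<in> Cf k"
  shows "jet I (\<lambda>t. acth l m k (gt t) a s) (a s) (VV l m k Xc a s)"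
proof (cases "s \<le> k")
  case True
  have ai: "a i \<in> Fsp" for i using a by (simp add: Cf_def)
  have e: "jet I (\<lambda>t x. exp ((m - l - of_nat i) * lgd (gt t) x)) (\<lambda>x. 1) (\<lambda>x. (m - l - of_nat i) * vd Xc x)" for i
    by (rule jet_exp[OF I(3) jet_cong[OF jet_mult[OF bI jet_const[OF Fsp_const] jet_lgd]]]) auto
  have "jet I (\<lambda>t x. exp ((m - l - of_nat i) * lgd (gt t) x) * a i (gt t x) * Pc l (vd (lgd (gt t))) i s x)
     (\<lambda>x. if i = s then a s x else 0)
     (\<lambda>x. (if i = s then (m - l - of_nat s) * (vd Xc x * a s x) + Xc x * vd (a s) x else 0) + kap l i s * (a i x * dnth (i + 1 - s) Xc x))" for i
    by (rule jet_cong[OF jet_mult[OF bI jet_mult[OF bI e jet_comp[OF ai]] jet_Pc[of l i s]]])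
       (auto simp: algebra_simps)
  then have "jet I (\<lambda>t x. \<Sum>i\<in>{s..k}. exp ((m - l - of_nat i) * lgd (gt t) x) * a i (gt t x) * Pc l (vd (lgd (gt t))) i s x)
     (\<lambda>x. \<Sum>i\<in>{s..k}. if i = s then a s x else 0)
     (\<lambda>x. \<Sum>i\<in>{s..k}. (if i = s then (m - l - of_nat s) * (vd Xc x * a s x) + Xc x * vd (a s) x else 0) + kap l i s * (a i x * dnth (i + 1 - s) Xc x))"
    by (intro jet_sum) auto
  then show ?thesis
    by (rule jet_cong) (use True in \<open>auto simp: acth_def VV_def sum.distrib sum.delta\<close>)
next
  case False
  then have "a s = (\<lambda>x. 0)" using a by (simp add: Cf_def)
  then show ?thesis using False jet_const[OF Fsp_const, of I 0]
    by (simp add: acth_def VV_def vd_const)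
qed

section \<open>Symmetries commute with vector fields\<close>

context csym
begin

text \<open>Expanding both sides of the equivariance shows that \<open>t\<close> times the defect is
  \<open>t^2\<close> times a bounded quantity, with the bound for the image of the remainder coming
  from \<open>H_bounded\<close>.\<close>

lemma H_VV_real:
  fixes X :: "real \<Rightarrow> real"
  assumes X: "(\<lambda>x. complex_of_real (X x)) \<in> Fsp" and a: "a \<in> Cf k"
  shows "H (VV l m k (\<lambda>x. complex_of_real (X x)) a) = VV l m k (\<lambda>x. complex_of_real (X x)) (H a)"
proof (intro ext)
  fix s x
  obtain C where C: "\<And>x. norm (vd (\<lambda>x. complex_of_real (X x)) x) \<le> C"
    using pf_bound[OF pf_Fsp[OF Fsp_vd[OF X], of UNIV]] by blast
  define \<epsilon> where "\<epsilon> = min 1 (1 / (2 * (\<bar>C\<bar> + 1)))"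
  interpret perturb X \<epsilon>
  proof
    fix x
    have "\<bar>vd X x\<bar> \<le> \<bar>C\<bar> + 1"
      using C[of x] real_dnth(1)[OF X, of 1] by (simp only: dnth_1 norm_of_real)
    then have "\<epsilon> * \<bar>vd X x\<bar> \<le> 1 / (2 * (\<bar>C\<bar> + 1)) * (\<bar>C\<bar> + 1)"
      by (intro mult_mono) (auto simp: \<epsilon>_def)
    also have "\<dots> = 1 / 2" by (simp add: field_simps)
    finally show "\<epsilon> * \<bar>vd X x\<bar> \<le> 1 / 2" .
  qed (use X in \<open>auto simp: \<epsilon>_def\<close>)
  have "\<forall>s. \<exists>R. pf I R \<and> (\<forall>t\<in>I. \<forall>x. acth l m k (gt t) a s x = a s x + of_real t * VV l m k Xc a s x + (of_real t)\<^sup>2 * R t x)"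
    using jet_acth[OF a, of l m] unfolding jet_def by blast
  then obtain R where R: "\<And>s. pf I (R s)"
    "\<And>s t x. t \<in> I \<Longrightarrow> acth l m k (gt t) a s x = a s x + of_real t * VV l m k Xc a s x + (of_real t)\<^sup>2 * R s t x"
    by metis
  \<comment> \<open>The cut-off above \<open>k\<close> puts the remainder into \<open>Cf k\<close>;
    all terms of the expansion vanish there.\<close>
  define Rt where "Rt = (\<lambda>t i. if i \<le> k then R i t else (\<lambda>x. 0))"
  have RtC: "Rt t \<in> Cf k" if "t \<in> I" for t
    using Fsp_pf[OF R(1) that] by (auto simp: Rt_def Cf_def Fsp_const)
  have Va: "VV l m k Xc a \<in> Cf k" by (rule VV_Cf[OF X a])
  have eq1: "acth l m k (gt t) a = cadd a (cadd (cscale (of_real t) (VV l m k Xc a)) (cscale ((of_real t)\<^sup>2) (Rt t)))" if t: "t \<in> I" for t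
  proof (intro ext)
    fix i x
    show "acth l m k (gt t) a i x = cadd a (cadd (cscale (of_real t) (VV l m k Xc a)) (cscale ((of_real t)\<^sup>2) (Rt t))) i x"
    proof (cases "i \<le> k")
      case True then show ?thesis using R(2)[OF t] by (simp add: cadd_def cscale_def Rt_def)
    next
      case False then show ?thesis using acth_Cf[OF gtD[OF t] a] a Va
        by (auto simp: cadd_def cscale_def Rt_def Cf_def)
    qed
  qed
  obtain S where S: "pf I S"
    "\<And>t x. t \<in> I \<Longrightarrow> acth l m k (gt t) (H a) s x = H a s x + of_real t * VV l m k Xc (H a) s x + (of_real t)\<^sup>2 * S t x"
    using jet_acth[OF H_Cf[OF a], of l m s] unfolding jet_def by blast
  have "\<exists>C. \<forall>t\<in>I. norm (H (Rt t) s x) \<le> C"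
  proof (rule H_bounded[OF _ RtC])
    show "pf I (\<lambda>t. Rt t i)" for i using R(1)[of i] by (cases "i \<le> k") (simp_all add: Rt_def pf_const')
  qed
  then obtain C1 where C1: "\<And>t. t \<in> I \<Longrightarrow> norm (H (Rt t) s x) \<le> C1" by blast
  obtain C2 where C2: "\<And>t. t \<in> I \<Longrightarrow> norm (S t x) \<le> C2" using pf_bound[OF S(1)] by blast
  let ?d = "H (VV l m k Xc a) s x - VV l m k Xc (H a) s x"
  have le: "norm ?d \<le> t * (C1 + C2)" if t: "t \<in> I" for t
  proof -
    have "H (acth l m k (gt t) a) s x = H a s x + (of_real t * H (VV l m k Xc a) s x + (of_real t)\<^sup>2 * H (Rt t) s x)"
      unfolding eq1[OF t]
      using H_add[OF a cadd_Cf[OF cscale_Cf[OF Va] cscale_Cf[OF RtC[OF t]]]]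
        H_add[OF cscale_Cf[OF Va] cscale_Cf[OF RtC[OF t]]] H_scale[OF Va] H_scale[OF RtC[OF t]]
      by (simp add: cadd_def cscale_def)
    moreover have "H (acth l m k (gt t) a) s x = H a s x + of_real t * VV l m k Xc (H a) s x + (of_real t)\<^sup>2 * S t x"
      unfolding H_act[OF a gtD[OF t]] by (rule S(2)[OF t])
    ultimately have "of_real t * ?d = of_real t * (of_real t * (S t x - H (Rt t) s x))"
      by (simp add: algebra_simps power2_eq_square)
    then have "?d = of_real t * (S t x - H (Rt t) s x)" using I(1)[OF t] by simp
    then have "norm ?d \<le> t * (norm (S t x) + norm (H (Rt t) s x))"
      using I(1)[OF t] norm_triangle_ineq4[of "S t x" "H (Rt t) s x"] by (simp add: norm_mult)
    also have "\<dots> \<le> t * (C1 + C2)" using I(1)[OF t] C1[OF t] C2[OF t] by (intro mult_left_mono) auto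
    finally show ?thesis .
  qed
  have "norm ?d \<le> 0"
  proof (rule field_le_epsilon)
    fix e :: real assume "e > 0"
    define t where "t = min \<epsilon> (e / (\<bar>C1 + C2\<bar> + 1))"
    have t: "t \<in> I" using eps \<open>e > 0\<close> by (auto simp: t_def)
    have "t * (C1 + C2) \<le> t * (\<bar>C1 + C2\<bar> + 1)" using I(1)[OF t] by (intro mult_left_mono) auto
    also have "\<dots> \<le> e / (\<bar>C1 + C2\<bar> + 1) * (\<bar>C1 + C2\<bar> + 1)" by (intro mult_right_mono) (auto simp: t_def)
    also have "\<dots> = e" by (simp add: field_simps)
    finally show "norm ?d \<le> 0 + e" using le[OF t] by linarith
  qed
  then show "H (VV l m k Xc a) s x = VV l m k Xc (H a) s x" by simp
qed

lemma VV_lin: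
  assumes "X \<in> Fsp" "Y \<in> Fsp"
  shows "VV l m k (\<lambda>x. X x + c * Y x) a = cadd (VV l m k X a) (cscale c (VV l m k Y a))"
proof -
  have cY: "(\<lambda>x. c * Y x) \<in> Fsp" using assms by (intro Fsp_mult Fsp_const)
  show ?thesis
    unfolding VV_def cadd_def cscale_def vd_add[OF assms(1) cY] vd_cmult[OF assms(2)]
      dnth_add[OF assms(1) cY] dnth_cmult[OF assms(2)]
    by (intro ext) (simp add: algebra_simps sum.distrib sum_distrib_left)
qed

text \<open>Diffeomorphisms only provide real fields. Since \<open>VV\<close> is complex linear in
  the field and \<open>H\<close> is complex linear, real and imaginary part together give complex
  fields, in particular \<open>ee z\<close>.\<close>

theorem H_VV:
  assumes X: "X \<in> Fsp" and a: "a \<in> Cf k"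
  shows "H (VV l m k X a) = VV l m k X (H a)"
proof -
  have R: "(\<lambda>x. complex_of_real (Re (X x))) \<in> Fsp" by (rule Fsp_Re[OF X])
  have "(\<lambda>x. complex_of_real (Re (- \<i> * X x))) \<in> Fsp" by (intro Fsp_Re Fsp_mult Fsp_const X)
  then have J: "(\<lambda>x. complex_of_real (Im (X x))) \<in> Fsp" by simp
  have X': "X = (\<lambda>x. complex_of_real (Re (X x)) + \<i> * complex_of_real (Im (X x)))"
    by (rule ext) (rule complex_eq)
  have "VV l m k X b = cadd (VV l m k (\<lambda>x. complex_of_real (Re (X x))) b) (cscale \<i> (VV l m k (\<lambda>x. complex_of_real (Im (X x))) b))" for b
    using VV_lin[OF R J, of \<i> b] X' by metis
  then show ?thesis
    using H_add[OF VV_Cf[OF R a] cscale_Cf[OF VV_Cf[OF J a]]] H_scale[OF VV_Cf[OF J a]]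
      H_VV_real[OF R a] H_VV_real[OF J a] by simp
qed

end

section \<open>The action on Fourier modes\<close>

text \<open>The matrix of the field \<open>ee z\<close> from mode \<open>n\<close> to mode
  \<open>n + z\<close>, stripped of powers of \<open>tpi\<close>. The arguments are complex so that
  \<open>z\<close> and \<open>n\<close> can be rescaled together.\<close>

definition ell :: "complex \<Rightarrow> complex \<Rightarrow> complex \<Rightarrow> complex \<Rightarrow> nat \<Rightarrow> nat \<Rightarrow> complex" where
  "ell l m z n i j = (if i = j then n + (m - l - of_nat j) * z else 0) + kap l j i * z ^ (j + 1 - i)"

lemma ell_gt: "i > j \<Longrightarrow> ell l m z n i j = 0"
  by (simp add: ell_def kap_def)

lemma ell_diag: "ell l m z n j j = n + (m - l - of_nat j) * z"
  by (simp add: ell_def kap_def)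

lemma ell_less: "i < j \<Longrightarrow> ell l m z n i j = kap l j i * z ^ (j + 1 - i)"
  by (simp add: ell_def)

lemma ell_scale: "i \<le> j \<Longrightarrow> ell l m (z * c) (z * n) i j = z ^ (j + 1 - i) * ell l m c n i j"
  by (cases "i = j") (simp_all add: ell_diag ell_less power_mult_distrib algebra_simps)

text \<open>The matrix \<open>ell\<close> is the symbol calculus form
  \<open>p(x) \<mapsto> (x + n + m z) p(x) - (x + l z) p(x + z)\<close> of the infinitesimal action.\<close>
definition Lp :: "complex \<Rightarrow> complex \<Rightarrow> complex \<Rightarrow> complex \<Rightarrow> complex poly \<Rightarrow> complex poly" where
  "Lp l m z n p = [:n + m * z, 1:] * p - [:l * z, 1:] * pcompose p [:z, 1:]"

lemma coeff_linear_mult: "coeff ([:c, 1:] * q) i = c * coeff q i + (if i = 0 then 0 else coeff q (i - 1))"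
  for q :: "complex poly"
  by (cases i) (simp_all)

lemma pcompose_power': "pcompose (p ^ n) q = (pcompose p q) ^ n" for q :: "complex poly"
  by (induction n) (simp_all add: pcompose_mult pcompose_1)

lemma monom_power: "monom 1 j = [:0, 1:] ^ j" for j and x :: complex
  by (simp add: monom_altdef)

lemma pcompose_monom_shift: "pcompose (monom (1::complex) j) [:z, 1:] = [:z, 1:] ^ j"
  unfolding monom_power pcompose_power' by (simp add: pcompose_pCons)

lemma coeff_shift_power: "coeff ([:z, 1:] ^ j) i = of_nat (j choose i) * (z::complex) ^ (j - i)"
  by (cases "i \<le> j")
     (simp_all add: coeff_linear_poly_power coeff_eq_0 degree_linear_power binomial_eq_0)

text \<open>Below degree \<open>j\<close>, \<open>kap\<close> collects up to sign and powers of
  \<open>z\<close> the coefficients of \<open>(x + l z) (x + z)^j\<close>; in degree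
  \<open>j + 1\<close> the two products in \<open>Lp\<close> cancel.\<close>

lemma coeff_Lp_monom: "coeff (Lp l m z n (monom 1 j)) i = ell l m z n i j"
proof -
  consider "i < j" | "i = j" | "i = Suc j" | "i > Suc j" by linarith
  then show ?thesis
  proof cases
    case 1
    then show ?thesis
      unfolding Lp_def pcompose_monom_shift coeff_diff coeff_linear_mult coeff_shift_power
      by (cases i) (auto simp: ell_less kap_def Suc_diff_le algebra_simps Suc_diff_Suc[symmetric])
  next
    case 2
    show ?thesis
    proof (cases j)
      case 0
      with 2 show ?thesis
        unfolding Lp_def pcompose_monom_shift coeff_diff coeff_linear_mult coeff_shift_power
        by (simp add: ell_diag algebra_simps)
    next
      case (Suc j')
      have "Suc j' choose j' = Suc j'" by (simp add: binomial_symmetric[of j' "Suc j'"])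
      with 2 Suc show ?thesis
        unfolding Lp_def pcompose_monom_shift coeff_diff coeff_linear_mult coeff_shift_power
        by (simp add: ell_diag algebra_simps)
    qed
  next
    case 3
    then show ?thesis
      unfolding Lp_def pcompose_monom_shift coeff_diff coeff_linear_mult coeff_shift_power
      by (simp add: ell_gt)
  next
    case 4
    then show ?thesis
      unfolding Lp_def pcompose_monom_shift coeff_diff coeff_linear_mult coeff_shift_power
      by (simp add: ell_gt binomial_eq_0)
  qed
qed

lemma Lp_add: "Lp l m z n (p + q) = Lp l m z n p + Lp l m z n q"
proof -
  have "a * (p + q) - b * (r + s) = (a * p - b * r) + (a * q - b * s)" for a b r s :: "complex poly"
    by (simp only: distrib_left add_diff_add)
  then show ?thesis unfolding Lp_def pcompose_add .
qed

lemma Lp_smult: "Lp l m z n (smult c p) = smult c (Lp l m z n p)"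
  by (simp add: Lp_def pcompose_smult smult_diff_right)

lemma Lp_sum: "finite S \<Longrightarrow> Lp l m z n (\<Sum>i\<in>S. f i) = (\<Sum>i\<in>S. Lp l m z n (f i))"
  by (induction S rule: finite_induct) (simp_all add: Lp_add, simp add: Lp_def)

lemma coeff_Lp:
  assumes "degree p \<le> k"
  shows "coeff (Lp l m z n p) i = (\<Sum>j\<le>k. ell l m z n i j * coeff p j)"
proof -
  have "p = (\<Sum>j\<le>k. smult (coeff p j) (monom 1 j))"
    using poly_as_sum_of_monoms'[OF assms] by (simp add: smult_monom)
  then have "Lp l m z n p = (\<Sum>j\<le>k. smult (coeff p j) (Lp l m z n (monom 1 j)))"
    by (metis (no_types, lifting) Lp_sum Lp_smult finite_atMost sum.cong)
  then show ?thesis by (simp add: coeff_sum coeff_Lp_monom mult.commute)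
qed

lemma degree_Lp_monom: "degree (Lp l m z n (monom 1 j)) \<le> j"
  by (intro degree_le) (simp add: coeff_Lp_monom ell_gt)

section \<open>Closed paths of modes and the entries of their matrices\<close>

definition mm :: "nat \<Rightarrow> (nat \<Rightarrow> nat \<Rightarrow> complex) \<Rightarrow> (nat \<Rightarrow> nat \<Rightarrow> complex) \<Rightarrow> nat \<Rightarrow> nat \<Rightarrow> complex" where
  "mm k A B i j = (\<Sum>p\<le>k. A i p * B p j)"

lemma mm_assoc: "mm k (mm k A B) C i j = mm k A (mm k B C) i j"
  unfolding mm_def sum_distrib_left sum_distrib_right
  by (subst sum.swap) (simp add: mult.assoc)

definition upper :: "(nat \<Rightarrow> nat \<Rightarrow> complex) \<Rightarrow> bool" where
  "upper A \<longleftrightarrow> (\<forall>i j. i > j \<longrightarrow> A i j = 0)"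

lemma upper_ell: "upper (ell l m z n)"
  by (simp add: upper_def ell_gt)

lemma mm_upper:
  assumes "upper A" "upper B" "j \<le> k"
  shows "mm k A B i j = (\<Sum>p\<in>{i..j}. A i p * B p j)"
  unfolding mm_def by (rule sum.mono_neutral_right) (use assms in \<open>auto simp: upper_def not_le\<close>)

lemma upper_mm: "upper A \<Longrightarrow> upper B \<Longrightarrow> upper (mm k A B)"
  unfolding upper_def mm_def
  by (auto intro!: sum.neutral) (metis linorder_cases order.strict_trans)

text \<open>The action of vector fields moves Fourier modes along the closed paths \<open>0 \<rightarrow> z \<rightarrow> 0\<close> and
  \<open>0 \<rightarrow> z \<rightarrow> 2 z \<rightarrow> 0\<close>, so the matrix of a symmetry on mode \<open>0\<close> commutes with \<open>N2\<close> and \<open>N3\<close>.\<close>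
definition N2 :: "nat \<Rightarrow> complex \<Rightarrow> complex \<Rightarrow> complex \<Rightarrow> nat \<Rightarrow> nat \<Rightarrow> complex" where
  "N2 k l m z = mm k (ell l m (-z) z) (ell l m z 0)"

definition N3 :: "nat \<Rightarrow> complex \<Rightarrow> complex \<Rightarrow> complex \<Rightarrow> nat \<Rightarrow> nat \<Rightarrow> complex" where
  "N3 k l m z = mm k (ell l m (-2*z) (2*z)) (mm k (ell l m z z) (ell l m z 0))"

lemma upper_N2: "upper (N2 k l m z)" unfolding N2_def by (intro upper_mm upper_ell)
lemma upper_N3: "upper (N3 k l m z)" unfolding N3_def by (intro upper_mm upper_ell)

lemma mm_scale:
  assumes "upper A" "upper B" "upper A'" "upper B'" "i \<le> j" "j \<le> k"
    "\<And>i j. i \<le> j \<Longrightarrow> A' i j = z ^ (j + d - i) * A i j" "\<And>i j. i \<le> j \<Longrightarrow> B' i j = z ^ (j + e - i) * B i j"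
  shows "mm k A' B' i j = z ^ (j + (d + e) - i) * mm k A B i j"
  unfolding mm_upper[OF assms(1,2,6)] mm_upper[OF assms(3,4,6)] sum_distrib_left
proof (rule sum.cong[OF refl])
  fix p assume p: "p \<in> {i..j}"
  have "j + (d + e) - i = (p + d - i) + (j + e - p)" using p by auto
  then have e: "z ^ (j + (d + e) - i) = z ^ (p + d - i) * z ^ (j + e - p)" by (simp only: power_add)
  show "A' i p * B' p j = z ^ (j + (d + e) - i) * (A i p * B p j)"
    using p assms(7)[of i p] assms(8)[of p j] unfolding e by simp
qed

lemma N2_scale:
  assumes "i \<le> j" "j \<le> k" shows "N2 k l m z i j = z ^ (j + 2 - i) * N2 k l m 1 i j"
  using mm_scale[of "ell l m (-1) 1" "ell l m 1 0" "ell l m (-z) z" "ell l m z 0" i j k z 1 1]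
    ell_scale[of _ _ l m z "-1" 1] ell_scale[of _ _ l m z 1 0] assms
  by (simp add: N2_def upper_ell numeral_2_eq_2)

lemma N3_scale:
  assumes "i \<le> j" "j \<le> k" shows "N3 k l m z i j = z ^ (j + 3 - i) * N3 k l m 1 i j"
proof -
  have "mm k (ell l m z z) (ell l m z 0) i j = z ^ (j + 2 - i) * mm k (ell l m 1 1) (ell l m 1 0) i j" if "i \<le> j" "j \<le> k" for i j
    using mm_scale[of "ell l m 1 1" "ell l m 1 0" "ell l m z z" "ell l m z 0" i j k z 1 1]
      ell_scale[of _ _ l m z 1 1] ell_scale[of _ _ l m z 1 0] that
    by (simp add: upper_ell numeral_2_eq_2)
  note A = this
  show ?thesis
    unfolding N3_def mm_upper[OF upper_ell upper_mm[OF upper_ell upper_ell] assms(2)] sum_distrib_left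
  proof (rule sum.cong[OF refl])
    fix p assume p: "p \<in> {i..j}"
    have "ell l m (-2 * z) (2 * z) i p = z ^ (p + 1 - i) * ell l m (-2 * 1) (2 * 1) i p"
      using ell_scale[of i p l m z "-2" 2] p by (simp add: mult.commute)
    moreover have "j + 3 - i = (p + 1 - i) + (j + 2 - p)" using p by auto
    ultimately show "ell l m (-2 * z) (2 * z) i p * mm k (ell l m z z) (ell l m z 0) p j
        = z ^ (j + 3 - i) * (ell l m (-2 * 1) (2 * 1) i p * mm k (ell l m 1 1) (ell l m 1 0) p j)"
      using A[of p j] p assms(2) by (simp only: power_add) (simp add: mult_ac)
  qed
qed

lemma coeff_quadratic_monom:
  "i < j \<Longrightarrow> coeff ([:a, 1:] * ([:b, 1:] * monom 1 j)) i = (0::complex)"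
  unfolding coeff_linear_mult by auto

lemma coeff_quadratic_shift:
  assumes "i < j"
  shows "coeff ([:a, 1:] * ([:b, 1:] * [:c, 1:] ^ j)) i = of_nat (j choose (j - i + 2)) * (c::complex) ^ (j - i + 2)
    + (a + b) * (of_nat (j choose (j - i + 1)) * c ^ (j - i + 1)) + a * b * (of_nat (j choose (j - i)) * c ^ (j - i))"
proof -
  have sym: "coeff ([:c, 1:] ^ j) p = of_nat (j choose (j - p)) * c ^ (j - p)" if "p \<le> j" for p
    unfolding coeff_shift_power using binomial_symmetric[OF that] by simp
  consider "i = 0" | "i = 1" | p where "i = Suc (Suc p)"
    by (metis One_nat_def not0_implies_Suc)
  then show ?thesis
  proof cases
    case 1
    then show ?thesis unfolding coeff_linear_mult using sym[of 0] assms by (simp add: binomial_eq_0)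
  next
    case 2
    then have "j - i + 1 = j" "j - i + 2 = Suc j" using assms by auto
    then show ?thesis unfolding coeff_linear_mult using sym[of 0] sym[of 1] assms 2
      by (simp add: binomial_eq_0 algebra_simps)
  next
    case 3
    then have "j - i + 1 = j - Suc p" "j - i + 2 = j - p" using assms by auto
    then show ?thesis unfolding coeff_linear_mult using sym[of p] sym[of "Suc p"] sym[of i] assms 3
      by (simp add: algebra_simps)
  qed
qed

text \<open>Composing two \<open>Lp\<close> gives quadratics times \<open>monom 1 j\<close>, which
  have no coefficient below \<open>j\<close>, and quadratics times \<open>(x + 1)^j\<close> and
  \<open>(x - 1)^j\<close>. The coefficients of the last two agree up to
  \<open>(-1)^(j - i)\<close>, so odd gaps cancel.\<close>

lemma N2_coeff:
  assumes "i < j" "j \<le> k"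
  shows "N2 k l m 1 i j = - (1 + (-1) ^ (j - i)) *
    (of_nat (j choose (j - i + 2)) + (l + 1 - m) * of_nat (j choose (j - i + 1)) + l * (1 - m) * of_nat (j choose (j - i)))"
proof -
  let ?q = "Lp l m 1 0 (monom 1 j)"
  have d: "degree ?q \<le> k" using degree_Lp_monom[of l m 1 0 j] assms by linarith
  have "N2 k l m 1 i j = coeff (Lp l m (-1) 1 ?q) i"
    unfolding coeff_Lp[OF d] coeff_Lp_monom by (simp add: N2_def mm_def)
  also have "Lp l m (-1) 1 ?q = [:1 - m, 1:] * ([:m, 1:] * monom 1 j) - [:1 - m, 1:] * ([:l, 1:] * [:1, 1:] ^ j)
      - [:-l, 1:] * ([:m - 1, 1:] * [:-1, 1:] ^ j) + [:-l, 1:] * ([:l - 1, 1:] * monom 1 j)"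
  proof -
    have "pcompose ?q [:-1, 1:] = [:m - 1, 1:] * [:-1, 1:] ^ j - [:l - 1, 1:] * monom 1 j"
    proof -
      have lin: "pcompose [:a, 1:] [:c, 1:] = [:a + c, 1:]" for a c :: complex
        by (simp add: pcompose_pCons)
      show ?thesis
        unfolding Lp_def pcompose_monom_shift pcompose_diff pcompose_mult pcompose_power' lin
        by (simp add: monom_power)
    qed
    then show ?thesis
      unfolding Lp_def[of l m "-1" 1] unfolding Lp_def pcompose_monom_shift
      by (simp only: right_diff_distrib) simp
  qed
  also have "coeff \<dots> i = - (of_nat (j choose (j - i + 2)) + (l + 1 - m) * of_nat (j choose (j - i + 1)) + l * (1 - m) * of_nat (j choose (j - i)))
     - (-1) ^ (j - i) * (of_nat (j choose (j - i + 2)) + (l + 1 - m) * of_nat (j choose (j - i + 1)) + l * (1 - m) * of_nat (j choose (j - i)))"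
    unfolding coeff_add coeff_diff coeff_quadratic_monom[OF assms(1)] coeff_quadratic_shift[OF assms(1)]
    by (simp add: algebra_simps)
  finally show ?thesis by (simp add: algebra_simps)
qed

lemma binomial_next: "of_nat (r + 1) * of_nat (j choose (r + 1)) = of_nat (j - r) * (of_nat (j choose r) :: complex)"
proof -
  have "Suc r * (j choose Suc r) = (j - r) * (j choose r)"
    by (metis binomial_absorb_comp binomial_absorption)
  then show ?thesis by (metis Suc_eq_plus1 of_nat_mult)
qed

text \<open>Multiplication by \<open>(r + 1) * (r + 2)\<close> turns three neighbouring binomials
  into multiples of \<open>j choose r\<close> and leaves a quadratic in \<open>i\<close>.\<close>

lemma N2_gap:
  assumes "i + r = j" "r \<noteq> 0" "even r" "j \<le> k"
  shows "of_nat ((r + 1) * (r + 2)) * N2 k l m 1 i j = - 2 * of_nat (j choose r) *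
    (of_nat i * (of_nat i - 1) + of_nat (r + 2) * (l + 1 - m) * of_nat i + of_nat ((r + 1) * (r + 2)) * (l * (1 - m)))"
proof -
  let ?c = "\<lambda>s. of_nat (j choose s) :: complex"
  have ji: "j - i = r" "i < j" using assms by auto
  have c1: "of_nat (r + 1) * ?c (r + 1) = of_nat i * ?c r" using binomial_next[of r j] assms by auto
  have c2: "of_nat (r + 2) * ?c (r + 2) = (of_nat i - 1) * ?c (r + 1)"
  proof (cases i)
    case 0
    then show ?thesis using assms by (simp add: binomial_eq_0)
  next
    case (Suc i')
    then have "j - (r + 1) = i'" using assms by auto
    then show ?thesis using binomial_next[of "r + 1" j] Suc by (simp add: add.commute)
  qed
  have "of_nat ((r + 1) * (r + 2)) * ?c (r + 2) = of_nat (r + 1) * (of_nat (r + 2) * ?c (r + 2))"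
    by (simp only: of_nat_mult mult.assoc)
  also have "\<dots> = (of_nat i - 1) * (of_nat (r + 1) * ?c (r + 1))" unfolding c2 by simp
  finally have d2: "of_nat ((r + 1) * (r + 2)) * ?c (r + 2) = (of_nat i - 1) * (of_nat i * ?c r)" unfolding c1 .
  have d1: "of_nat ((r + 1) * (r + 2)) * ?c (r + 1) = of_nat (r + 2) * (of_nat i * ?c r)"
    unfolding c1[symmetric] by (simp only: of_nat_mult mult_ac)
  have "of_nat ((r + 1) * (r + 2)) * N2 k l m 1 i j = - 2 * (of_nat ((r + 1) * (r + 2)) * ?c (r + 2)
     + (l + 1 - m) * (of_nat ((r + 1) * (r + 2)) * ?c (r + 1)) + l * (1 - m) * of_nat ((r + 1) * (r + 2)) * ?c r)"
    unfolding N2_coeff[OF ji(2) assms(4)] ji(1) using assms(3) by (simp add: algebra_simps)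
  then show ?thesis unfolding d1 d2 by (simp add: algebra_simps)
qed

text \<open>The quadratic of \<open>N2_gap\<close>, affine in \<open>l + 1 - m\<close> and
  \<open>l * (1 - m)\<close>. For an even gap \<open>r\<close> it decides whether \<open>N2\<close>
  joins \<open>i\<close> to \<open>i + r\<close>.\<close>

definition gq :: "complex \<Rightarrow> complex \<Rightarrow> nat \<Rightarrow> nat \<Rightarrow> complex" where
  "gq l m r i = of_nat i * (of_nat i - 1) + of_nat (r + 2) * (l + 1 - m) * of_nat i + of_nat ((r + 1) * (r + 2)) * (l * (1 - m))"

lemma N2_zero_iff:
  assumes "i + r = j" "r \<noteq> 0" "even r" "j \<le> k"
  shows "N2 k l m 1 i j = 0 \<longleftrightarrow> gq l m r i = 0"
proof -
  have "of_nat (j choose r) \<noteq> (0::complex)" using assms by (simp add: binomial_eq_0_iff)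
  moreover have "of_nat ((r + 1) * (r + 2)) \<noteq> (0::complex)" by (simp only: of_nat_eq_0_iff) simp
  ultimately show ?thesis using N2_gap[OF assms, of l m] unfolding gq_def[symmetric]
    by (metis mult_eq_0_iff neg_equal_0_iff_equal zero_neq_numeral)
qed

text \<open>Three affine forms in two unknowns. The coefficients 5, -2 and 14, -3 eliminate
  \<open>l * (1 - m)\<close> from the gaps 2, 4 and 2, 6; the factor 4 then eliminates
  \<open>l + 1 - m\<close>. What is left depends on \<open>j\<close> alone and is positive.\<close>

lemma gq_not_all_zero:
  assumes "j \<ge> 6" shows "gq l m 2 (j - 2) \<noteq> 0 \<or> gq l m 4 (j - 4) \<noteq> 0 \<or> gq l m 6 (j - 6) \<noteq> 0"
proof (rule ccontr)
  assume "\<not> ?thesis"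
  then have z: "gq l m 2 (j - 2) = 0" "gq l m 4 (j - 4) = 0" "gq l m 6 (j - 6) = 0" by auto
  let ?x = "of_nat j :: complex"
  have o: "of_nat (j - 2) = ?x - 2" "of_nat (j - 4) = ?x - 4" "of_nat (j - 6) = ?x - 6"
    using assms by (simp_all add: of_nat_diff)
  have "(?x + 1) * (?x + 2) = 4 * (5 * gq l m 2 (j - 2) - 2 * gq l m 4 (j - 4)) - (14 * gq l m 2 (j - 2) - 3 * gq l m 6 (j - 6))"
    unfolding gq_def o by (simp add: algebra_simps)
  then have "(?x + 1) * (?x + 2) = 0" unfolding z by simp
  moreover have "(?x + 1) * (?x + 2) = of_nat ((j + 1) * (j + 2))" by (simp add: algebra_simps)
  ultimately show False by (metis of_nat_eq_0_iff add_is_0 mult_is_0 one_neq_zero zero_neq_numeral)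
qed

text \<open>The odd gaps that \<open>N2\<close> cannot supply. The factor \<open>l + m - 1\<close>
  has to appear: for \<open>l + m = 1\<close> the adjoint is a symmetry that takes different values
  on even and odd orders.\<close>

lemma N3_entries:
  assumes "k \<ge> 5"
  shows "N3 k l m 1 0 3 = 12 * (l + m - 1) * (l * (1 - m))"
    "N3 k l m 1 1 4 = 12 * (l + m - 1) * (4 * (l * (1 - m)) + (l + 1 - m) - 1)"
    "N3 k l m 1 0 5 = 60 * (l + m - 1) * (l * (1 - m))"
    "N3 k l m 1 2 5 = 60 * (l + m - 1) * (2 * (l * (1 - m)) + (l + 1 - m) - 1)"
proof -
  have E: "N3 k l m 1 i j = (\<Sum>p\<in>{i..j}. ell l m (-2) 2 i p * (\<Sum>q\<in>{p..j}. ell l m 1 1 p q * ell l m 1 0 q j))" if "j \<le> k" for i j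
    unfolding N3_def mm_upper[OF upper_ell upper_mm[OF upper_ell upper_ell] that]
    by (simp add: mm_upper[OF upper_ell upper_ell that])
  show "N3 k l m 1 0 3 = 12 * (l + m - 1) * (l * (1 - m))"
    using assms by (simp add: E ell_def kap_def numeral_eq_Suc atLeastAtMostSuc_conv) algebra
  show "N3 k l m 1 1 4 = 12 * (l + m - 1) * (4 * (l * (1 - m)) + (l + 1 - m) - 1)"
    using assms by (simp add: E ell_def kap_def numeral_eq_Suc atLeastAtMostSuc_conv) algebra
  show "N3 k l m 1 0 5 = 60 * (l + m - 1) * (l * (1 - m))"
    using assms by (simp add: E ell_def kap_def numeral_eq_Suc atLeastAtMostSuc_conv) algebra
  show "N3 k l m 1 2 5 = 60 * (l + m - 1) * (2 * (l * (1 - m)) + (l + 1 - m) - 1)"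
    using assms by (simp add: E ell_def kap_def numeral_eq_Suc atLeastAtMostSuc_conv) algebra
qed

lemma N2_diag: "j \<le> k \<Longrightarrow> N2 k l m 1 j j = (m - l - of_nat j) * (1 - (m - l - of_nat j))"
  unfolding N2_def by (subst mm_upper[OF upper_ell upper_ell]) (simp_all add: ell_diag algebra_simps)

lemma N3_diag: "j \<le> k \<Longrightarrow> N3 k l m 1 j j = 2 * ((m - l - of_nat j) * (1 - (m - l - of_nat j))) * (1 + (m - l - of_nat j))"
  unfolding N3_def
  by (subst mm_upper[OF upper_ell upper_mm[OF upper_ell upper_ell]], simp)
     (simp add: mm_upper[OF upper_ell upper_ell] ell_diag algebra_simps)

lemma poly_int_zero':
  fixes c :: "nat \<Rightarrow> complex"
  assumes "\<And>z::int. z \<noteq> 0 \<Longrightarrow> (\<Sum>i\<le>n. c i * of_int z ^ i) = 0" "i \<le> n"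
  shows "c i = 0"
proof -
  let ?c = "\<lambda>i. if i = 0 then 0 else c (i - 1)"
  have "(\<Sum>i\<le>Suc n. ?c i * of_int z ^ i) = 0" for z :: int
  proof -
    have "(\<Sum>i\<le>Suc n. ?c i * of_int z ^ i) = of_int z * (\<Sum>i\<le>n. c i * of_int z ^ i)"
      by (simp only: sum.atMost_Suc_shift sum_distrib_left) (simp add: mult_ac)
    then show ?thesis using assms(1)[of z] by (cases "z = 0") auto
  qed
  from poly_int_zero[OF this, of "Suc i"] assms(2) show ?thesis by simp
qed

definition eqk :: "nat \<Rightarrow> (nat \<Rightarrow> nat \<Rightarrow> complex) \<Rightarrow> (nat \<Rightarrow> nat \<Rightarrow> complex) \<Rightarrow> bool" where
  "eqk k A B \<longleftrightarrow> (\<forall>i\<le>k. \<forall>j\<le>k. A i j = B i j)"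

lemma eqk_refl: "eqk k A A" by (simp add: eqk_def)
lemma eqk_sym: "eqk k A B \<Longrightarrow> eqk k B A" by (simp add: eqk_def)
lemma eqk_trans [trans]: "eqk k A B \<Longrightarrow> eqk k B C \<Longrightarrow> eqk k A C" by (simp add: eqk_def)
lemma eqk_mm: "eqk k A A' \<Longrightarrow> eqk k B B' \<Longrightarrow> eqk k (mm k A B) (mm k A' B')"
  unfolding eqk_def mm_def by (intro allI impI sum.cong refl) auto
lemma eqk_assoc: "eqk k (mm k (mm k A B) C) (mm k A (mm k B C))"
  by (simp add: eqk_def mm_assoc)

text \<open>After cancelling \<open>z^d\<close> the commutation is a polynomial identity in
  \<open>z\<close>, valid at all nonzero integers. The coefficient of \<open>z^s\<close> isolates
  the \<open>s\<close>-th superdiagonal of \<open>M 1\<close>; the matrix \<open>t\<close> may be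
  arbitrary.\<close>

lemma graded_comm:
  fixes M :: "complex \<Rightarrow> nat \<Rightarrow> nat \<Rightarrow> complex"
  assumes up: "\<And>z. upper (M z)"
    and sc: "\<And>z i j. i \<le> j \<Longrightarrow> j \<le> k \<Longrightarrow> M z i j = z ^ (j + d - i) * M 1 i j"
    and comm: "\<And>z::int. eqk k (mm k t (M (of_int z))) (mm k (M (of_int z)) t)"
    and ij: "i \<le> k" "j \<le> k" "s \<le> k"
  shows "(if s \<le> j then t i (j - s) * M 1 (j - s) j else 0) = (if i + s \<le> k then M 1 i (i + s) * t (i + s) j else 0)"
proof -
  let ?L = "\<lambda>s. if s \<le> j then t i (j - s) * M 1 (j - s) j else 0"
  let ?R = "\<lambda>s. if i + s \<le> k then M 1 i (i + s) * t (i + s) j else 0"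
  have "(\<Sum>s\<le>k. (?L s - ?R s) * of_int z ^ s) = 0" if z: "z \<noteq> 0" for z :: int
  proof -
    let ?z = "of_int z :: complex"
    have "mm k t (M ?z) i j = (\<Sum>p\<le>j. t i p * M ?z p j)"
      unfolding mm_def by (rule sum.mono_neutral_right) (use ij up in \<open>auto simp: upper_def\<close>)
    also have "\<dots> = (\<Sum>s\<le>j. t i (j - s) * M ?z (j - s) j)"
      by (rule sum.reindex_bij_witness[where i="\<lambda>s. j - s" and j="\<lambda>p. j - p"]) auto
    also have "\<dots> = (\<Sum>s\<le>j. ?z ^ d * (?L s * ?z ^ s))"
      by (intro sum.cong refl) (use sc[of _ j ?z] ij in \<open>auto simp: power_add mult_ac\<close>)
    also have "\<dots> = (\<Sum>s\<le>k. ?z ^ d * (?L s * ?z ^ s))"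
      by (rule sum.mono_neutral_left) (use ij in auto)
    finally have L: "mm k t (M ?z) i j = ?z ^ d * (\<Sum>s\<le>k. ?L s * ?z ^ s)" by (simp add: sum_distrib_left)
    have "mm k (M ?z) t i j = (\<Sum>p\<in>{i..k}. M ?z i p * t p j)"
      unfolding mm_def by (rule sum.mono_neutral_right) (use ij up in \<open>auto simp: upper_def\<close>)
    also have "\<dots> = (\<Sum>s\<le>k - i. M ?z i (i + s) * t (i + s) j)"
      by (rule sum.reindex_bij_witness[where i="\<lambda>s. i + s" and j="\<lambda>p. p - i"]) (use ij(1) in auto)
    also have "\<dots> = (\<Sum>s\<le>k - i. ?z ^ d * (?R s * ?z ^ s))"
      by (intro sum.cong refl) (use sc[of i _ ?z] ij in \<open>auto simp: power_add mult_ac\<close>)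
    also have "\<dots> = (\<Sum>s\<le>k. ?z ^ d * (?R s * ?z ^ s))"
      by (rule sum.mono_neutral_left) (use ij in auto)
    finally have R: "mm k (M ?z) t i j = ?z ^ d * (\<Sum>s\<le>k. ?R s * ?z ^ s)" by (simp add: sum_distrib_left)
    have "(\<Sum>s\<le>k. ?L s * ?z ^ s) = (\<Sum>s\<le>k. ?R s * ?z ^ s)"
    proof -
      have "?z ^ d * (\<Sum>s\<le>k. ?L s * ?z ^ s) = ?z ^ d * (\<Sum>s\<le>k. ?R s * ?z ^ s)"
        using comm[of z] ij unfolding eqk_def L[symmetric] R[symmetric] by blast
      moreover have "?z ^ d \<noteq> 0" using z by simp
      ultimately show ?thesis by (metis (no_types, lifting) mult_left_cancel)
    qed
    then show ?thesis by (simp add: left_diff_distrib sum_subtractf)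
  qed
  from poly_int_zero'[OF this ij(3)] show ?thesis by simp
qed

section \<open>The matrices of a symmetry on Fourier modes\<close>

lemma vd_zero_const:
  fixes f :: "real \<Rightarrow> complex"
  assumes "f \<in> Fsp" "\<And>x. vd f x = 0" shows "f x = f 0"
proof -
  have "\<And>x. (f has_vector_derivative 0) (at x within UNIV)" using Fsp_deriv[OF assms(1)] assms(2) by simp
  from has_vector_derivative_zero_constant[OF convex_UNIV this] obtain c where c: "\<And>x. x \<in> UNIV \<Longrightarrow> f x = c" by blast
  show ?thesis unfolding c[OF UNIV_I] ..
qed

lemma ee_solves:
  assumes f: "f \<in> Fsp" and d: "\<And>x. vd f x = tpi * of_int n * f x"
  shows "f x = f 0 * ee n x"
proof -
  have e: "ee n x * ee (- n) x = 1" for x using ee_add[of n "- n" x] by (simp add: ee_0)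
  have "vd (\<lambda>x. f x * ee (- n) x) x = 0" for x
    unfolding vd_mult[OF f ee_Fsp] vd_ee d by simp
  from vd_zero_const[OF Fsp_mult[OF f ee_Fsp] this, of x]
  have "f x * ee (- n) x = f 0" by (simp add: ee_def)
  then show ?thesis using e[of x] by (metis mult.assoc mult.commute mult_1)
qed

lemma frac_swap: "b \<noteq> 0 \<Longrightarrow> x * b / c * e * (d / b * t) = x * d / c * (e * (t::complex))"
  by (cases "c = 0") (simp_all add: field_simps)

lemma frac_swap': "b \<noteq> 0 \<Longrightarrow> x * d / b * e * (b / c * t * 1) = x * d / c * (t * (e::complex))"
  by (cases "c = 0") (simp_all add: field_simps)

lemma tpi_power_nz: "tpi ^ p \<noteq> 0"
  by (rule power_not_zero) simp

lemma VV_const: "VV l m k (\<lambda>x. 1) a s = vd (a s)"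
proof -
  have "dnth n (\<lambda>x. 1::complex) x = 0" if "n > 0" for n x
    using fun_cong[OF dnth_ee[of n 0], of x] that by (simp add: ee_0)
  then show ?thesis by (simp add: VV_def vd_const)
qed

lemma VV_ee:
  assumes i: "i \<le> k"
  shows "VV l m k (ee z) (\<lambda>p. if p \<le> k then (\<lambda>x. \<alpha> p * ee n x) else (\<lambda>x. 0)) i x
    = (\<Sum>p\<le>k. tpi * tpi ^ p / tpi ^ i * ell l m (of_int z) (of_int n) i p * \<alpha> p) * ee (n + z) x"
proof -
  have v: "vd (\<lambda>x. \<alpha> i * ee n x) x = \<alpha> i * (tpi * of_int n * ee n x)"
    unfolding vd_cmult[OF ee_Fsp] vd_ee by simp
  have "VV l m k (ee z) (\<lambda>p. if p \<le> k then (\<lambda>x. \<alpha> p * ee n x) else (\<lambda>x. 0)) i x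
    = (tpi * (of_int n + (m - l - of_nat i) * of_int z) * \<alpha> i
       + (\<Sum>p\<in>{i..k}. kap l p i * \<alpha> p * (tpi * of_int z) ^ (p + 1 - i))) * ee (n + z) x"
  proof -
    have "(\<Sum>p\<in>{i..k}. kap l p i * ((if p \<le> k then (\<lambda>x. \<alpha> p * ee n x) else (\<lambda>x. 0)) x * dnth (p + 1 - i) (ee z) x))
       = (\<Sum>p\<in>{i..k}. kap l p i * \<alpha> p * (tpi * of_int z) ^ (p + 1 - i)) * ee (n + z) x"
      unfolding dnth_ee sum_distrib_right ee_add by (intro sum.cong refl) (simp add: mult_ac)
    then show ?thesis
      unfolding VV_def using i v by (simp add: vd_ee ee_add algebra_simps)
  qed
  also have "tpi * (of_int n + (m - l - of_nat i) * of_int z) * \<alpha> i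
       + (\<Sum>p\<in>{i..k}. kap l p i * \<alpha> p * (tpi * of_int z) ^ (p + 1 - i))
     = (\<Sum>p\<in>{i..k}. (if p = i then tpi * (of_int n + (m - l - of_nat i) * of_int z) * \<alpha> i else 0)
       + kap l p i * \<alpha> p * (tpi * of_int z) ^ (p + 1 - i))"
    using i by (simp add: sum.distrib sum.delta)
  also have "\<dots> = (\<Sum>p\<in>{i..k}. tpi * tpi ^ p / tpi ^ i * ell l m (of_int z) (of_int n) i p * \<alpha> p)"
  proof (intro sum.cong refl)
    fix p assume p: "p \<in> {i..k}"
    have "tpi * tpi ^ p / tpi ^ i = tpi ^ (p + 1 - i)"
      using p by (simp only: power_Suc[symmetric]) (subst power_diff[symmetric], auto)
    then show "(if p = i then tpi * (of_int n + (m - l - of_nat i) * of_int z) * \<alpha> i else 0)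
       + kap l p i * \<alpha> p * (tpi * of_int z) ^ (p + 1 - i) = tpi * tpi ^ p / tpi ^ i * ell l m (of_int z) (of_int n) i p * \<alpha> p"
      by (cases "p = i") (simp_all add: ell_def power_mult_distrib algebra_simps kap_def)
  qed
  also have "\<dots> = (\<Sum>p\<le>k. tpi * tpi ^ p / tpi ^ i * ell l m (of_int z) (of_int n) i p * \<alpha> p)"
    by (rule sum.mono_neutral_left) (auto simp: ell_gt)
  finally show ?thesis .
qed

context csym
begin

text \<open>The matrix of \<open>H\<close> on the Fourier mode \<open>n\<close>; the powers of \<open>tpi\<close> make its relations to \<open>ell\<close> free of \<open>tpi\<close>.\<close>
definition T :: "int \<Rightarrow> nat \<Rightarrow> nat \<Rightarrow> complex" where
  "T n i j = tpi ^ i / tpi ^ j * H (sgl j (ee n)) i 0"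

text \<open>The constant field acts as differentiation of the coefficients, so a symmetry maps
  eigenfunctions of differentiation to eigenfunctions with the same eigenvalue.\<close>

lemma H_ee:
  assumes j: "j \<le> k" shows "H (sgl j (ee n)) i x = tpi ^ j / tpi ^ i * T n i j * ee n x"
proof -
  let ?a = "sgl j (ee n)"
  have a: "?a \<in> Cf k" using sgl_Cf[OF ee_Fsp j] .
  have "H (VV l m k (\<lambda>x. 1) ?a) = VV l m k (\<lambda>x. 1) (H ?a)" by (rule H_VV[OF Fsp_const a])
  moreover have "VV l m k (\<lambda>x. 1) ?a = cscale (tpi * of_int n) ?a"
    unfolding VV_const[abs_def] by (auto simp: fun_eq_iff VV_const sgl_def cscale_def vd_const vd_ee)
  ultimately have "vd (H ?a i) x = tpi * of_int n * H ?a i x" for x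
    using H_scale[OF a, of "tpi * of_int n"] VV_const[of l m k "H ?a" i] by (metis cscale_def)
  then have "H ?a i x = H ?a i 0 * ee n x"
    using ee_solves H_Cf[OF a] unfolding Cf_def by blast
  then show ?thesis by (simp add: T_def)
qed

text \<open>The field \<open>ee z\<close> takes mode \<open>n\<close> to mode \<open>n + z\<close>.
  By the normalisation of \<open>T\<close> all powers of \<open>tpi\<close> collect in one nonzero
  factor common to both sides.\<close>

lemma T_comm:
  assumes ij: "i \<le> k" "j \<le> k"
  shows "(\<Sum>p\<le>k. T (n + z) i p * ell l m (of_int z) (of_int n) p j) = (\<Sum>p\<le>k. ell l m (of_int z) (of_int n) i p * T n p j)"
proof -
  let ?a = "sgl j (ee n)" and ?c = "\<lambda>p. tpi * tpi ^ j / tpi ^ p * ell l m (of_int z) (of_int n) p j"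
  have a: "?a \<in> Cf k" using sgl_Cf[OF ee_Fsp ij(2)] .
  have tn: "tpi \<noteq> 0" by simp
  have Va: "VV l m k (ee z) ?a \<in> Cf k" by (rule VV_Cf[OF ee_Fsp a])
  have Vp: "VV l m k (ee z) ?a p = (\<lambda>x. ?c p * ee (n + z) x)" if "p \<le> k" for p
  proof
    fix x
    have "?a = (\<lambda>p. if p \<le> k then (\<lambda>x. (if p = j then 1 else 0) * ee n x) else (\<lambda>x. 0))"
      using ij by (auto simp: sgl_def fun_eq_iff)
    then have "VV l m k (ee z) ?a p x = (\<Sum>q\<le>k. tpi * tpi ^ q / tpi ^ p * ell l m (of_int z) (of_int n) p q * (if q = j then 1 else 0)) * ee (n + z) x"
      using VV_ee[OF that, of l m z "\<lambda>p. if p = j then 1 else 0" n x] by simp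
    then show "VV l m k (ee z) ?a p x = ?c p * ee (n + z) x"
      using ij by (simp add: sum.delta if_distrib cong: if_cong)
  qed
  have "H (VV l m k (ee z) ?a) i 0 = (\<Sum>p\<le>k. ?c p * H (sgl p (ee (n + z))) i 0)"
    unfolding H_lower[OF Va]
  proof (intro sum.cong refl)
    fix p assume "p \<in> {..k}"
    then have p: "p \<le> k" by simp
    show "H (sgl p (VV l m k (ee z) ?a p)) i 0 = ?c p * H (sgl p (ee (n + z))) i 0"
      unfolding Vp[OF p] by (rule H_sgl_scale[OF ee_Fsp p])
  qed
  also have "\<dots> = (\<Sum>p\<le>k. tpi * tpi ^ j / tpi ^ i * (T (n + z) i p * ell l m (of_int z) (of_int n) p j))"
  proof (intro sum.cong refl)
    fix p assume "p \<in> {..k}"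
    then have "H (sgl p (ee (n + z))) i 0 = tpi ^ p / tpi ^ i * T (n + z) i p * 1"
      using H_ee[of p "n + z" i 0] by (simp add: ee_def)
    then show "?c p * H (sgl p (ee (n + z))) i 0 = tpi * tpi ^ j / tpi ^ i * (T (n + z) i p * ell l m (of_int z) (of_int n) p j)"
      using frac_swap'[OF tpi_power_nz] by metis
  qed
  finally have L: "H (VV l m k (ee z) ?a) i 0 = tpi * tpi ^ j / tpi ^ i * (\<Sum>p\<le>k. T (n + z) i p * ell l m (of_int z) (of_int n) p j)"
    by (simp only: sum_distrib_left)
  have Ha: "H ?a = (\<lambda>p. if p \<le> k then (\<lambda>x. (tpi ^ j / tpi ^ p * T n p j) * ee n x) else (\<lambda>x. 0))"
    using H_Cf[OF a] H_ee[OF ij(2)] by (auto simp: Cf_def fun_eq_iff)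
  have "VV l m k (ee z) (H ?a) i 0 = (\<Sum>p\<le>k. tpi * tpi ^ p / tpi ^ i * ell l m (of_int z) (of_int n) i p * (tpi ^ j / tpi ^ p * T n p j))"
    unfolding Ha VV_ee[OF ij(1)] by (simp add: ee_def)
  also have "\<dots> = (\<Sum>p\<le>k. tpi * tpi ^ j / tpi ^ i * (ell l m (of_int z) (of_int n) i p * T n p j))"
    by (intro sum.cong refl frac_swap tpi_power_nz)
  finally have R: "VV l m k (ee z) (H ?a) i 0 = tpi * tpi ^ j / tpi ^ i * (\<Sum>p\<le>k. ell l m (of_int z) (of_int n) i p * T n p j)"
    by (simp only: sum_distrib_left)
  have nz: "tpi * tpi ^ j / tpi ^ i \<noteq> 0" using tpi_power_nz tn by (simp only: divide_eq_0_iff mult_eq_0_iff) blast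
  show ?thesis
    by (rule mult_left_cancel[THEN iffD1, OF nz]) (simp only: L[symmetric] R[symmetric] H_VV[OF ee_Fsp a])
qed

lemma T_comm_mm: "eqk k (mm k (T (n + z)) (ell l m (of_int z) (of_int n))) (mm k (ell l m (of_int z) (of_int n)) (T n))"
  unfolding eqk_def mm_def using T_comm by blast

lemma T0_N2: "eqk k (mm k (T 0) (N2 k l m (of_int z))) (mm k (N2 k l m (of_int z)) (T 0))"
proof -
  let ?A = "ell l m (- of_int z) (of_int z)" and ?B = "ell l m (of_int z) 0"
  have 1: "eqk k (mm k (T z) ?B) (mm k ?B (T 0))" using T_comm_mm[of 0 z] by simp
  have 2: "eqk k (mm k (T 0) ?A) (mm k ?A (T z))" using T_comm_mm[of z "-z"] by simp
  have "eqk k (mm k (T 0) (mm k ?A ?B)) (mm k (mm k ?A (T z)) ?B)"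
    by (rule eqk_trans[OF eqk_sym[OF eqk_assoc] eqk_mm[OF 2 eqk_refl]])
  also have "eqk k (mm k (mm k ?A (T z)) ?B) (mm k ?A (mm k ?B (T 0)))"
    by (rule eqk_trans[OF eqk_assoc eqk_mm[OF eqk_refl 1]])
  finally show ?thesis unfolding N2_def
    using eqk_sym[OF eqk_assoc] eqk_trans by blast
qed

lemma T0_N3: "eqk k (mm k (T 0) (N3 k l m (of_int z))) (mm k (N3 k l m (of_int z)) (T 0))"
proof -
  let ?A = "ell l m (- 2 * of_int z) (2 * of_int z)" and ?B = "ell l m (of_int z) (of_int z)" and ?C = "ell l m (of_int z) 0"
  have 1: "eqk k (mm k (T z) ?C) (mm k ?C (T 0))" using T_comm_mm[of 0 z] by simp
  have 2: "eqk k (mm k (T (2 * z)) ?B) (mm k ?B (T z))" using T_comm_mm[of z z] unfolding mult_2 .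
  have 3: "eqk k (mm k (T 0) ?A) (mm k ?A (T (2 * z)))"
  proof -
    have "2 * z + - 2 * z = 0" "complex_of_int (- 2 * z) = - 2 * of_int z" "complex_of_int (2 * z) = 2 * of_int z" by auto
    then show ?thesis using T_comm_mm[of "2 * z" "-2 * z"] by metis
  qed
  have "eqk k (mm k (T 0) (mm k ?A (mm k ?B ?C))) (mm k (mm k ?A (T (2 * z))) (mm k ?B ?C))"
    by (rule eqk_trans[OF eqk_sym[OF eqk_assoc] eqk_mm[OF 3 eqk_refl]])
  also have "eqk k \<dots> (mm k ?A (mm k (mm k ?B (T z)) ?C))"
    by (rule eqk_trans[OF eqk_assoc eqk_mm[OF eqk_refl eqk_trans[OF eqk_sym[OF eqk_assoc] eqk_mm[OF 2 eqk_refl]]]])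
  also have "eqk k \<dots> (mm k ?A (mm k (mm k ?B ?C) (T 0)))"
    by (rule eqk_mm[OF eqk_refl eqk_trans[OF eqk_trans[OF eqk_assoc eqk_mm[OF eqk_refl 1]] eqk_sym[OF eqk_assoc]]])
  finally show ?thesis unfolding N3_def
    using eqk_sym[OF eqk_assoc] eqk_trans by blast
qed

lemma graded2: "i \<le> k \<Longrightarrow> j \<le> k \<Longrightarrow> s \<le> k \<Longrightarrow>
  (if s \<le> j then T 0 i (j - s) * N2 k l m 1 (j - s) j else 0) = (if i + s \<le> k then N2 k l m 1 i (i + s) * T 0 (i + s) j else 0)"
  using graded_comm[of "N2 k l m" k 2 "T 0" i j s, OF upper_N2 N2_scale T0_N2] by auto

lemma graded3: "i \<le> k \<Longrightarrow> j \<le> k \<Longrightarrow> s \<le> k \<Longrightarrow>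
  (if s \<le> j then T 0 i (j - s) * N3 k l m 1 (j - s) j else 0) = (if i + s \<le> k then N3 k l m 1 i (i + s) * T 0 (i + s) j else 0)"
  using graded_comm[of "N3 k l m" k 3 "T 0" i j s, OF upper_N3 N3_scale T0_N3] by auto

text \<open>For \<open>s = j - i\<close> the graded relation contains the single entry from
  \<open>i\<close> to \<open>j\<close>, multiplied by \<open>T 0 i i\<close> on one side and by
  \<open>T 0 j j\<close> on the other. Nonzero entries thus are edges of a graph on the orders
  \<open>0..k\<close>, and the diagonal of \<open>T 0\<close> is constant on its components.\<close>

lemma edge2: "i < j \<Longrightarrow> j \<le> k \<Longrightarrow> N2 k l m 1 i j \<noteq> 0 \<Longrightarrow> T 0 i i = T 0 j j"
  using graded2[of i j "j - i"] by auto

lemma edge3: "i < j \<Longrightarrow> j \<le> k \<Longrightarrow> N3 k l m 1 i j \<noteq> 0 \<Longrightarrow> T 0 i i = T 0 j j"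
  using graded3[of i j "j - i"] by auto

text \<open>In degree \<open>s = 0\<close>, \<open>T 0\<close> commutes with the diagonals of both
  matrices. With \<open>p = m - l - of_nat i\<close> their entries are \<open>p * (1 - p)\<close>
  and \<open>2 * p * (1 - p) * (1 + p)\<close>, and this pair separates all values of
  \<open>p\<close> except 0 and 1.\<close>

lemma T0_off:
  assumes ij: "i \<le> k" "j \<le> k" "i \<noteq> j" "T 0 i j \<noteq> 0"
  shows "(m - l = of_nat i \<and> i = j + 1) \<or> (m - l = of_nat j \<and> j = i + 1)"
proof -
  define p where "p = m - l - of_nat i"
  define q where "q = m - l - of_nat j"
  have 2: "q * (1 - q) = p * (1 - p)"
    using graded2[of i j 0] ij N2_diag[of i k l m] N2_diag[of j k l m] by (auto simp: p_def q_def)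
  have 3: "q * (1 - q) * (1 + q) = p * (1 - p) * (1 + p)"
    using graded3[of i j 0] ij N3_diag[of i k l m] N3_diag[of j k l m] by (auto simp: p_def q_def mult.assoc)
  have pq: "p \<noteq> q" using ij by (simp add: p_def q_def)
  have "p * (1 - p) * (q - p) = 0" using 2 3 by algebra
  then have p01: "p = 0 \<or> p = 1" using pq by auto
  then have "q = 0 \<or> q = 1" using 2 by auto
  with p01 pq have "(p = 0 \<and> q = 1) \<or> (p = 1 \<and> q = 0)" by auto
  then show ?thesis
  proof
    assume a: "p = 0 \<and> q = 1"
    then have "(of_nat i :: complex) = of_nat (j + 1)"
      by (simp add: p_def q_def algebra_simps) (metis add.assoc add.commute add_left_cancel)
    then have "i = j + 1" using of_nat_eq_iff by blast
    then show ?thesis using a by (simp add: p_def)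
  next
    assume a: "p = 1 \<and> q = 0"
    then have "(of_nat j :: complex) = of_nat (i + 1)"
      by (simp add: p_def q_def algebra_simps) (metis add.assoc add.commute add_left_cancel)
    then have "j = i + 1" using of_nat_eq_iff by blast
    then show ?thesis using a by (simp add: q_def)
  qed
qed

end

section \<open>Closed forms of \<open>kap\<close> on its first three superdiagonals\<close>

lemma choose_diff_2: "2 * of_nat (s + 2 choose s) = (of_nat ((s + 2) * (s + 1)) :: complex)"
proof (induction s)
  case (Suc s)
  have e: "Suc s + 2 choose Suc s = (s + 2 choose s) + (s + 2)"
  proof -
    have "Suc (s + 1) choose (s + 1) = s + 2" by (simp add: binomial_symmetric[of "s + 1" "Suc (s + 1)"])
    then show ?thesis by simp
  qed
  show ?case unfolding e using Suc by (simp add: algebra_simps)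
qed simp

lemma choose_diff_3: "6 * of_nat (s + 3 choose s) = (of_nat ((s + 3) * (s + 2) * (s + 1)) :: complex)"
proof (induction s)
  case (Suc s)
  have e: "Suc s + 3 choose Suc s = (s + 3 choose s) + (Suc s + 2 choose Suc s)"
    by (simp add: numeral_3_eq_3 numeral_2_eq_2)
  have "6 * of_nat (Suc s + 2 choose Suc s) = (3 * of_nat ((Suc s + 2) * (Suc s + 1)) :: complex)"
  proof -
    have "6 * x = 3 * (2 * x)" for x :: complex by simp
    then show ?thesis using choose_diff_2[of "Suc s"] by (simp only:)
  qed
  then show ?case unfolding e using Suc by (simp add: algebra_simps)
qed simp

lemma choose_diff_4: "24 * of_nat (s + 4 choose s) = (of_nat ((s + 4) * (s + 3) * (s + 2) * (s + 1)) :: complex)"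
proof (induction s)
  case (Suc s)
  have e: "Suc s + 4 choose Suc s = (s + 4 choose s) + (Suc s + 3 choose Suc s)"
    by (simp add: eval_nat_numeral)
  have "24 * of_nat (Suc s + 3 choose Suc s) = (4 * of_nat ((Suc s + 3) * (Suc s + 2) * (Suc s + 1)) :: complex)"
  proof -
    have "24 * x = 4 * (6 * x)" for x :: complex by simp
    then show ?thesis using choose_diff_3[of "Suc s"] by (simp only:)
  qed
  then show ?case unfolding e using Suc by (simp add: algebra_simps)
qed simp

lemma kap_1: "2 * kap l (Suc s) s = - (of_nat s + 1) * (of_nat s + 2 * l)"
proof (cases s)
  case 0 then show ?thesis by (simp add: kap_def)
next
  case (Suc r)
  have "2 * of_nat (Suc s choose (s - 1)) = (of_nat ((s + 1) * s) :: complex)"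
    using choose_diff_2[of r] Suc by simp
  moreover have "Suc s choose s = Suc s" by (simp add: binomial_symmetric[of s "Suc s"])
  ultimately show ?thesis using Suc by (simp add: kap_def algebra_simps)
qed

lemma kap_2: "6 * kap l (Suc (Suc s)) s = - (of_nat s + 2) * (of_nat s + 1) * (of_nat s + 3 * l)"
proof -
  have 2: "2 * of_nat (Suc (Suc s) choose s) = (of_nat ((s + 2) * (s + 1)) :: complex)"
    using choose_diff_2[of s] by simp
  show ?thesis
  proof (cases s)
    case 0 then show ?thesis by (simp add: kap_def)
  next
    case (Suc r)
    have 3: "6 * of_nat (Suc (Suc s) choose (s - 1)) = (of_nat ((s + 2) * (s + 1) * s) :: complex)"
      using choose_diff_3[of r] Suc by (simp add: numeral_3_eq_3)
    have "6 * kap l (Suc (Suc s)) s = - (6 * of_nat (Suc (Suc s) choose (s - 1)) + 3 * l * (2 * of_nat (Suc (Suc s) choose s)))"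
      using Suc by (simp add: kap_def algebra_simps del: binomial_Suc_Suc)
    then show ?thesis unfolding 2 3 by (simp add: algebra_simps)
  qed
qed

lemma kap_3: "24 * kap l (Suc (Suc (Suc s))) s = - (of_nat s + 3) * (of_nat s + 2) * (of_nat s + 1) * (of_nat s + 4 * l)"
proof -
  have 2: "6 * of_nat (Suc (Suc (Suc s)) choose s) = (of_nat ((s + 3) * (s + 2) * (s + 1)) :: complex)"
    using choose_diff_3[of s] by (simp add: numeral_3_eq_3)
  show ?thesis
  proof (cases s)
    case 0 then show ?thesis by (simp add: kap_def)
  next
    case (Suc r)
    have 3: "24 * of_nat (Suc (Suc (Suc s)) choose (s - 1)) = (of_nat ((s + 3) * (s + 2) * (s + 1) * s) :: complex)"
      using choose_diff_4[of r] Suc by (simp add: eval_nat_numeral)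
    have "24 * kap l (Suc (Suc (Suc s))) s = - (24 * of_nat (Suc (Suc (Suc s)) choose (s - 1)) + 4 * l * (6 * of_nat (Suc (Suc (Suc s)) choose s)))"
      using Suc by (simp add: kap_def algebra_simps del: binomial_Suc_Suc)
    then show ?thesis unfolding 2 3 by (simp add: algebra_simps)
  qed
qed

lemma of_nat_pos_nz: "of_nat n + 1 \<noteq> (0::complex)" "of_nat n + 2 \<noteq> (0::complex)" "of_nat n + 3 \<noteq> (0::complex)"
    "of_nat n + 4 \<noteq> (0::complex)" "of_nat n + 5 \<noteq> (0::complex)"
proof -
  have "of_nat n + numeral w \<noteq> (0::complex)" for w
    by (metis add_is_0 of_nat_0_eq_iff of_nat_add of_nat_numeral zero_neq_numeral)
  then show "of_nat n + 2 \<noteq> (0::complex)" "of_nat n + 3 \<noteq> (0::complex)"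
    "of_nat n + 4 \<noteq> (0::complex)" "of_nat n + 5 \<noteq> (0::complex)" by blast+
  show "of_nat n + 1 \<noteq> (0::complex)" by (metis of_nat_Suc of_nat_eq_0_iff nat.distinct(2) add.commute)
qed

lemma numeral_mult_zero: "numeral w * a * x = (0::complex) \<Longrightarrow> a * x = 0"
  by (metis mult_eq_0_iff zero_neq_numeral)

section \<open>Off-diagonal entries of \<open>T 0\<close> and classes of its diagonal
  entries\<close>

locale csym5 = csym +
  assumes k5: "k \<ge> 5"
begin

lemma N2_0: "i + r \<le> k \<Longrightarrow> r \<in> {2, 4} \<Longrightarrow> N2 k l m 1 i (i + r) = 0 \<longleftrightarrow> gq l m r i = 0"
  by (rule N2_zero_iff) auto

lemma T0_off_J:
  assumes J: "m - l = of_nat J" and ij: "i \<le> k" "j \<le> k" "i \<noteq> j" "T 0 i j \<noteq> 0"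
  shows "(i = J \<and> J = j + 1) \<or> (j = J \<and> J = i + 1)"
  using T0_off[OF ij] J by auto

text \<open>If the entry is nonzero, all off-diagonal entries except it and its mirror image vanish,
  and the graded relations empty row \<open>b\<close> of \<open>N2\<close> right of the diagonal and
  column \<open>b + 1\<close> above it. Since \<open>m - l = b + 1\<close>, every empty position is
  an equation for \<open>l\<close> alone; for \<open>b > 0\<close> two of them contradict each
  other.\<close>

lemma T0_raise:
  assumes b: "Suc b \<le> k" "T 0 (Suc b) b \<noteq> 0"
  shows "l = 0 \<and> m = 1 \<and> b = 0"
proof -
  have J: "m - l = of_nat (Suc b)" using T0_off[of "Suc b" b] b by auto
  have off: "T 0 i j = 0" if "i \<le> k" "j \<le> k" "i \<noteq> j" "\<not> (i = Suc b \<and> j = b)" "\<not> (i = b \<and> j = Suc b)" for i j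
    using T0_off_J[OF J that(1-3)] that by auto
  have up: "N2 k l m 1 b (b + s) = 0" if "s \<ge> 1" "b + s \<le> k" for s
    using graded2[of "Suc b" "b + s" s] off[of "Suc b + s" "b + s"] b that by (auto split: if_splits)
  have low: "N2 k l m 1 i (Suc b) = 0" if "i \<le> b" for i
  proof -
    have "(if Suc b - i \<le> b then T 0 i (b - (Suc b - i)) * N2 k l m 1 (b - (Suc b - i)) b else 0) = N2 k l m 1 i (Suc b) * T 0 (Suc b) b"
      using graded2[of i b "Suc b - i"] b that by auto
    moreover have "T 0 i (b - (Suc b - i)) = 0" if "Suc b - i \<le> b"
      using off[of i "b - (Suc b - i)"] \<open>i \<le> b\<close> b that by (cases i) auto
    ultimately show ?thesis using b by (auto split: if_splits)
  qed
  have m: "m = l + of_nat b + 1" using J by (simp add: algebra_simps)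
  have q: "gq l m r i = of_nat i * (of_nat i - 1) - of_nat (r + 2) * of_nat b * of_nat i + of_nat ((r + 1) * (r + 2)) * (l * (- l - of_nat b))" for r i
    unfolding gq_def m by (simp add: algebra_simps)
  show ?thesis
  proof (cases "b = 0")
    case True
    then have "gq l m 2 0 = 0" using up[of 2] N2_0[of 0 2] k5 by auto
    then have "l = 0" unfolding q True by simp
    then show ?thesis using True m by simp
  next
    case False
    then obtain d where d: "b = Suc d" using not0_implies_Suc by blast
    have 2: "gq l m 2 d = 0" using low[of d] N2_0[of d 2] b d by auto
    show ?thesis
    proof (cases "b + 2 \<le> k")
      case True
      then have 1: "gq l m 2 b = 0" using up[of 2] N2_0[of b 2] by auto
      have "gq l m 2 d - gq l m 2 b = 2 * (of_nat b + 1)"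
        unfolding q d by (simp add: algebra_simps)
      then have "2 * (of_nat b + 1) = (0::complex)" using 1 2 by (metis diff_self)
      then have "of_nat b + 1 = (0::complex)" by (metis mult_eq_0_iff zero_neq_numeral)
      then show ?thesis using of_nat_pos_nz(1) by blast
    next
      case False
      \<comment> \<open>Row \<open>b\<close> has no room for a gap of 2, so
        \<open>b + 1 = k\<close>, and \<open>k \<ge> 5\<close> leaves room in column
        \<open>b + 1\<close> for the gaps 2 and 4.\<close>
      then have "\<exists>e. d = Suc (Suc e)" using b(1) d k5 by presburger
      then obtain e where e: "d = Suc (Suc e)" by blast
      have 4: "gq l m 4 e = 0" using low[of e] N2_0[of e 4] b d e by (auto simp: eval_nat_numeral)
      have "(5 * (of_nat b + 1) + 2) * (of_nat b + 2) = 2 * gq l m 4 e - 5 * gq l m 2 d"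
        unfolding q d e by (simp add: algebra_simps)
      then have "(5 * (of_nat b + 1) + 2) * (of_nat b + 2) = (0::complex)" unfolding 2 4 by (simp only: mult_zero_right diff_self)
      moreover have "5 * (of_nat b + 1) + 2 \<noteq> (0::complex)"
        using of_nat_pos_nz(1)[of "5 * b + 6"] by (simp add: algebra_simps)
      ultimately show ?thesis using of_nat_pos_nz(2) by simp
    qed
  qed
qed

text \<open>Mirror image of \<open>T0_raise\<close>: row \<open>b + 1\<close> right of the diagonal
  and column \<open>b\<close> above it are empty, now in \<open>N2\<close> and \<open>N3\<close>.
  Small \<open>b\<close> has room in the row, large \<open>b\<close> in the column;
  \<open>b = 1\<close> and \<open>b = 3\<close> also use an odd gap of \<open>N3\<close>.\<close>

lemma T0_lower:
  assumes b: "Suc b \<le> k" shows "T 0 b (Suc b) = 0"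
proof (rule ccontr)
  assume nz: "T 0 b (Suc b) \<noteq> 0"
  have J: "m - l = of_nat (Suc b)" using T0_off[of b "Suc b"] b nz by auto
  have off: "T 0 i j = 0" if "i \<le> k" "j \<le> k" "i \<noteq> j" "\<not> (i = Suc b \<and> j = b)" "\<not> (i = b \<and> j = Suc b)" for i j
    using T0_off_J[OF J that(1-3)] that by auto
  have up2: "N2 k l m 1 (Suc b) (Suc b + s) = 0" if "s \<ge> 1" "Suc b + s \<le> k" for s
    using graded2[of b "Suc b + s" s] off[of "b + s" "Suc b + s"] b that nz by (auto split: if_splits)
  have up3: "N3 k l m 1 (Suc b) (Suc b + s) = 0" if "s \<ge> 1" "Suc b + s \<le> k" for s
    using graded3[of b "Suc b + s" s] off[of "b + s" "Suc b + s"] b that nz by (auto split: if_splits)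
  have low2: "N2 k l m 1 i b = 0" if "i < b" for i
  proof -
    have *: "Suc b - (b - i) = Suc i" "b - i \<le> Suc b" "i + (b - i) = b" "T 0 i (Suc i) = 0"
      using that b off[of i "Suc i"] by auto
    have "(if b - i \<le> Suc b then T 0 i (Suc b - (b - i)) * N2 k l m 1 (Suc b - (b - i)) (Suc b) else 0) = N2 k l m 1 i b * T 0 b (Suc b)"
      using graded2[of i "Suc b" "b - i"] b that * by simp
    then show ?thesis unfolding * using nz *(4) by (simp add: *(2))
  qed
  have low3: "N3 k l m 1 i b = 0" if "i < b" for i
  proof -
    have *: "Suc b - (b - i) = Suc i" "b - i \<le> Suc b" "i + (b - i) = b" "T 0 i (Suc i) = 0"
      using that b off[of i "Suc i"] by auto
    have "(if b - i \<le> Suc b then T 0 i (Suc b - (b - i)) * N3 k l m 1 (Suc b - (b - i)) (Suc b) else 0) = N3 k l m 1 i b * T 0 b (Suc b)"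
      using graded3[of i "Suc b" "b - i"] b that * by simp
    then show ?thesis unfolding * using nz *(4) by (simp add: *(2))
  qed
  have m: "m = l + of_nat b + 1" using J by (simp add: algebra_simps)
  have q: "gq l m r i = of_nat i * (of_nat i - 1) - of_nat (r + 2) * of_nat b * of_nat i + of_nat ((r + 1) * (r + 2)) * (l * (- l - of_nat b))" for r i
    unfolding gq_def m by (simp add: algebra_simps)
  have U: "gq l m 2 (Suc b) = 0" if "b + 3 \<le> k" using up2[of 2] N2_0[of "Suc b" 2] that by auto
  have L: "gq l m 2 i = 0" if "b = i + 2" for i using low2[of i] N2_0[of i 2] that b by auto
  have "b = 0 \<or> b = 1 \<or> b = 2 \<or> b = 3 \<or> (\<exists>d. b = d + 4)" by presburger
  then consider "b = 0" | "b = 1" | "b = 2" | "b = 3" | d where "b = d + 4" by blast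
  then show False
  proof cases
    case 1
    then have "gq l m 2 1 = 0" using U k5 by simp
    then have l: "l = 0" unfolding q 1 by simp
    then have m1: "m = 1" using m 1 by simp
    \<comment> \<open>For \<open>l = 0\<close>, \<open>m = 1\<close> the relation from mode 0 to
      mode 1 decides: column 1 of \<open>ell\<close> vanishes, so the left side is zero, while the
      right side is \<open>T 0 0 1\<close>.\<close>
    have s: "sum f {..k} = f 0 + f 1 + sum f {2..k}" for f :: "nat \<Rightarrow> complex"
    proof -
      have "{..k} = {0, 1} \<union> {2..k}" using k5 by auto
      then show ?thesis by (simp add: sum.union_disjoint)
    qed
    have "(\<Sum>p\<le>k. T (0 + 1) 0 p * ell l m (of_int 1) (of_int 0) p 1) = (\<Sum>p\<le>k. ell l m (of_int 1) (of_int 0) 0 p * T 0 p 1)"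
      using T_comm[of 0 1 0 1] k5 by simp
    moreover have "(\<Sum>p\<in>{2..k}. T (0 + 1) 0 p * ell l m (of_int 1) (of_int 0) p 1) = 0"
      by (intro sum.neutral) (auto simp: ell_gt)
    moreover have "(\<Sum>p\<in>{2..k}. ell l m (of_int 1) (of_int 0) 0 p * T 0 p 1) = 0"
      using off k5 1 by (intro sum.neutral) auto
    ultimately have "T 0 0 1 = 0"
      unfolding s by (simp add: ell_def l m1 kap_def)
    then show False using nz 1 by simp
  next
    case 2
    have "gq l m 2 2 = 0" using U 2 k5 by (simp add: eval_nat_numeral)
    moreover have "gq l m 2 2 = 6 * (2 * (l * (- l - 1)) - 1)" unfolding q 2 by (simp add: algebra_simps)
    ultimately have p: "2 * (l * (- l - 1)) = 1"
      by (metis eq_iff_diff_eq_0 mult_eq_0_iff zero_neq_numeral)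
    have "N3 k l m 1 2 5 = 0" using up3[of 3] 2 k5 by (simp add: eval_nat_numeral)
    then have "(l + m - 1) * (2 * (l * (1 - m)) + (l + 1 - m) - 1) = 0" unfolding N3_entries(4)[OF k5] by (rule numeral_mult_zero)
    then have "(2 * l + 1) * (2 * (l * (- l - 1)) - 2) = 0" unfolding m 2 by (simp add: algebra_simps)
    then have "2 * l + 1 = 0" unfolding p mult_eq_0_iff by simp
    then have "l = -1/2" by (simp add: eq_neg_iff_add_eq_0 field_simps)
    then show False using p by simp
  next
    case 3
    have "gq l m 2 3 = 0" using U 3 k5 by simp
    moreover have "gq l m 2 0 = 0" using L[of 0] 3 by simp
    moreover have "gq l m 2 3 - gq l m 2 0 = - 18" unfolding q 3 by (simp add: algebra_simps)
    ultimately show False by simp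
  next
    case 4
    have "gq l m 2 1 = 0" using L[of 1] 4 by simp
    moreover have "gq l m 2 1 = 12 * (l * (- l - 3) - 1)" unfolding q 4 by (simp add: algebra_simps)
    ultimately have p: "l * (- l - 3) = 1"
      by (metis eq_iff_diff_eq_0 mult_eq_0_iff zero_neq_numeral)
    have "N3 k l m 1 0 3 = 0" using low3[of 0] 4 by simp
    then have "(l + m - 1) * (l * (1 - m)) = 0" unfolding N3_entries(1)[OF k5] by (rule numeral_mult_zero)
    then have "(2 * l + 3) * (l * (- l - 3)) = 0" unfolding m 4 by (simp add: algebra_simps)
    then have "2 * l + 3 = 0" unfolding p mult_eq_0_iff by simp
    then have "l = -3/2" by (simp add: eq_neg_iff_add_eq_0 field_simps)
    then show False using p by simp
  next
    case 5
    have 2: "gq l m 2 (d + 2) = 0" using L[of "d + 2"] 5 by simp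
    have 4: "gq l m 4 d = 0" using low2[of d] N2_0[of d 4] b 5 by auto
    have "5 * gq l m 2 (d + 2) - 2 * gq l m 4 d = - 5 * ((of_nat d + 5) * (of_nat d + 6))"
      unfolding q 5 by (simp add: algebra_simps)
    then have "(of_nat d + 5) * (of_nat d + 6) = (0::complex)" unfolding 2 4 by simp
    moreover have "of_nat d + 6 = (of_nat (d + 1) + 5 :: complex)" by simp
    ultimately show False using of_nat_pos_nz(5) by (metis mult_eq_0_iff)
  qed
qed

lemma T0_offdiag:
  assumes "i \<le> k" "j \<le> k" "i \<noteq> j" "T 0 i j \<noteq> 0"
  shows "l = 0 \<and> m = 1 \<and> i = 1 \<and> j = 0"
  using T0_off[OF assms] T0_raise[of j] T0_lower[of i] assms by auto

text \<open>By \<open>gq_not_all_zero\<close> every order from 6 on has an edge to a smaller one, so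
  classes are settled on \<open>0..5\<close>. An edge to 0 requires
  \<open>l * (1 - m) \<noteq> 0\<close>, which the step may therefore assume.\<close>

lemma chain:
  assumes base: "\<And>j. j \<le> 5 \<Longrightarrow> Q j"
    and step: "\<And>i j. i < j \<Longrightarrow> j \<le> k \<Longrightarrow> even (j - i) \<Longrightarrow> (i = 0 \<longrightarrow> l * (1 - m) \<noteq> 0) \<Longrightarrow> j \<ge> 6 \<Longrightarrow> T 0 i i = T 0 j j \<Longrightarrow> Q i \<Longrightarrow> Q j"
    and j: "j \<le> k"
  shows "Q j"
  using j
proof (induction j rule: less_induct)
  case (less j)
  show ?case
  proof (cases "j \<le> 5")
    case False
    then have j6: "j \<ge> 6" by simp
    obtain r where r: "r \<in> {2, 4, 6}" "gq l m r (j - r) \<noteq> 0"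
      using gq_not_all_zero[OF j6, of l m] by blast
    define i where "i = j - r"
    have ij: "i + r = j" "i < j" "j - i = r" using r j6 by (auto simp: i_def)
    have "N2 k l m 1 i j \<noteq> 0"
      using N2_zero_iff[OF ij(1), of k l m] r less.prems by (auto simp: i_def)
    then have e: "T 0 i i = T 0 j j" by (rule edge2[OF ij(2) less.prems])
    have "l * (1 - m) \<noteq> 0" if "i = 0" using r(2) that unfolding i_def[symmetric] gq_def by auto
    then show ?thesis using step[OF ij(2) less.prems _ _ j6 e less.IH[OF ij(2)]] ij r less.prems by auto
  qed (rule base)
qed

lemma edges:
  shows "l * (1 - m) \<noteq> 0 \<Longrightarrow> T 0 0 0 = T 0 2 2" "l * (1 - m) \<noteq> 0 \<Longrightarrow> T 0 0 0 = T 0 4 4"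
    "(l + 1 - m) + 3 * (l * (1 - m)) \<noteq> 0 \<Longrightarrow> T 0 1 1 = T 0 3 3"
    "(l + 1 - m) + 5 * (l * (1 - m)) \<noteq> 0 \<Longrightarrow> T 0 1 1 = T 0 5 5"
    "1 + 4 * (l + 1 - m) + 6 * (l * (1 - m)) \<noteq> 0 \<Longrightarrow> T 0 2 2 = T 0 4 4"
    "1 + 2 * (l + 1 - m) + 2 * (l * (1 - m)) \<noteq> 0 \<Longrightarrow> T 0 3 3 = T 0 5 5"
    "l + m \<noteq> 1 \<Longrightarrow> l * (1 - m) \<noteq> 0 \<Longrightarrow> T 0 0 0 = T 0 3 3"
    "l + m \<noteq> 1 \<Longrightarrow> l * (1 - m) \<noteq> 0 \<Longrightarrow> T 0 0 0 = T 0 5 5"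
    "l + m \<noteq> 1 \<Longrightarrow> 4 * (l * (1 - m)) + (l + 1 - m) - 1 \<noteq> 0 \<Longrightarrow> T 0 1 1 = T 0 4 4"
    "l + m \<noteq> 1 \<Longrightarrow> 2 * (l * (1 - m)) + (l + 1 - m) - 1 \<noteq> 0 \<Longrightarrow> T 0 2 2 = T 0 5 5"
proof -
  have E: "T 0 i i = T 0 j j" if "gq l m r i \<noteq> 0" "r \<in> {2, 4}" "j = i + r" "j \<le> k" for i r j
    using edge2[of i j] N2_0[of i r] that by auto
  have E': "gq l m 2 1 \<noteq> 0 \<Longrightarrow> T 0 1 1 = T 0 3 3" "gq l m 4 1 \<noteq> 0 \<Longrightarrow> T 0 1 1 = T 0 5 5"
    "gq l m 2 2 \<noteq> 0 \<Longrightarrow> T 0 2 2 = T 0 4 4" "gq l m 2 3 \<noteq> 0 \<Longrightarrow> T 0 3 3 = T 0 5 5"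
    by (rule E[of 2 1 3] E[of 4 1 5] E[of 2 2 4] E[of 2 3 5]; use k5 in simp)+
  have nz: "x \<noteq> 0 \<Longrightarrow> numeral w * x \<noteq> (0::complex)" for x w
    by (metis mult_eq_0_iff zero_neq_numeral)
  have g: "gq l m 2 0 = 12 * (l * (1 - m))" "gq l m 4 0 = 30 * (l * (1 - m))"
    "gq l m 2 1 = 4 * ((l + 1 - m) + 3 * (l * (1 - m)))" "gq l m 4 1 = 6 * ((l + 1 - m) + 5 * (l * (1 - m)))"
    "gq l m 2 2 = 2 * (1 + 4 * (l + 1 - m) + 6 * (l * (1 - m)))" "gq l m 2 3 = 6 * (1 + 2 * (l + 1 - m) + 2 * (l * (1 - m)))"
    by (simp_all add: gq_def algebra_simps)
  show "l * (1 - m) \<noteq> 0 \<Longrightarrow> T 0 0 0 = T 0 2 2" "l * (1 - m) \<noteq> 0 \<Longrightarrow> T 0 0 0 = T 0 4 4"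
    using E[of 2 0 2] E[of 4 0 4] k5 unfolding g mult_eq_0_iff by simp_all
  show "(l + 1 - m) + 3 * (l * (1 - m)) \<noteq> 0 \<Longrightarrow> T 0 1 1 = T 0 3 3"
    by (rule E'(1), unfold g, rule nz)
  show "(l + 1 - m) + 5 * (l * (1 - m)) \<noteq> 0 \<Longrightarrow> T 0 1 1 = T 0 5 5"
    by (rule E'(2), unfold g, rule nz)
  show "1 + 4 * (l + 1 - m) + 6 * (l * (1 - m)) \<noteq> 0 \<Longrightarrow> T 0 2 2 = T 0 4 4"
    by (rule E'(3), unfold g, rule nz)
  show "1 + 2 * (l + 1 - m) + 2 * (l * (1 - m)) \<noteq> 0 \<Longrightarrow> T 0 3 3 = T 0 5 5"
    by (rule E'(4), unfold g, rule nz)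
  have n: "l + m \<noteq> 1 \<Longrightarrow> x \<noteq> 0 \<Longrightarrow> numeral w * (l + m - 1) * x \<noteq> 0" for x w
    by (metis eq_iff_diff_eq_0 mult_eq_0_iff zero_neq_numeral)
  show "l + m \<noteq> 1 \<Longrightarrow> l * (1 - m) \<noteq> 0 \<Longrightarrow> T 0 0 0 = T 0 3 3"
    by (rule edge3, simp, use k5 in simp, unfold N3_entries(1)[OF k5], rule n)
  show "l + m \<noteq> 1 \<Longrightarrow> l * (1 - m) \<noteq> 0 \<Longrightarrow> T 0 0 0 = T 0 5 5"
    by (rule edge3, simp, use k5 in simp, unfold N3_entries(3)[OF k5], rule n)
  show "l + m \<noteq> 1 \<Longrightarrow> 4 * (l * (1 - m)) + (l + 1 - m) - 1 \<noteq> 0 \<Longrightarrow> T 0 1 1 = T 0 4 4"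
    by (rule edge3, simp, use k5 in simp, unfold N3_entries(2)[OF k5], rule n)
  show "l + m \<noteq> 1 \<Longrightarrow> 2 * (l * (1 - m)) + (l + 1 - m) - 1 \<noteq> 0 \<Longrightarrow> T 0 2 2 = T 0 5 5"
    by (rule edge3, simp, use k5 in simp, unfold N3_entries(4)[OF k5], rule n)
qed

lemma le5: "j \<le> 5 \<Longrightarrow> j = 0 \<or> j = 1 \<or> j = 2 \<or> j = 3 \<or> j = 4 \<or> j = (5::nat)"
  by auto

text \<open>Orders 2, 3, 4 and 5 are joined to 0 directly. Order 1 is joined to 3 or to 5, because
  the two deciding forms differ by \<open>2 * (l * (1 - m))\<close> and cannot both vanish.\<close>

lemma diag_generic:
  assumes "l + m \<noteq> 1" "l \<noteq> 0" "m \<noteq> 1" "j \<le> k"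
  shows "T 0 j j = T 0 0 0"
proof (rule chain[OF _ _ assms(4)])
  have p: "l * (1 - m) \<noteq> 0" using assms by simp
  have 1: "T 0 1 1 = T 0 0 0"
  proof (cases "(l + 1 - m) + 3 * (l * (1 - m)) = 0")
    case True
    then have "(l + 1 - m) + 5 * (l * (1 - m)) = 2 * (l * (1 - m))" by algebra
    then have "(l + 1 - m) + 5 * (l * (1 - m)) \<noteq> 0" using p by (metis mult_eq_0_iff zero_neq_numeral)
    then show ?thesis using edges(4) edges(8)[OF assms(1) p] by metis
  qed (use edges(3) edges(7)[OF assms(1) p] in metis)
  show "T 0 j j = T 0 0 0" if "j \<le> 5" for j
    using le5[OF that] 1 edges(1,2,7,8) p assms by auto
qed auto

text \<open>Even gaps connect each parity class. The edges 1-3 and 1-5 fail at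
  \<open>l = -2/3\<close> and \<open>l = -2/5\<close> respectively; there the edge 3-5 makes the
  detour.\<close>

lemma diag_conj:
  assumes "l + m = 1" "l \<noteq> 0" "j \<le> k"
  shows "T 0 j j = T 0 (j mod 2) (j mod 2)"
proof (rule chain[OF _ _ assms(3)])
  have m: "m = 1 - l" using assms(1) by (simp add: eq_diff_eq add.commute)
  have p: "l * (1 - m) \<noteq> 0" using assms(2) m by simp
  have "T 0 1 1 = T 0 3 3 \<and> T 0 1 1 = T 0 5 5"
  proof (cases "2 + 3 * l = 0")
    case True
    then have l: "l = -2/3" by (simp add: eq_neg_iff_add_eq_0 field_simps)
    have "T 0 1 1 = T 0 5 5" by (rule edges(4)) (simp add: m l)
    moreover have "T 0 3 3 = T 0 5 5" by (rule edges(6)) (simp add: m l)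
    ultimately show ?thesis by simp
  next
    case False
    have e: "(l + 1 - m) + 3 * (l * (1 - m)) = l * (2 + 3 * l)" by (simp add: m algebra_simps)
    have 13: "T 0 1 1 = T 0 3 3" by (rule edges(3)) (use False assms(2) in \<open>simp add: e\<close>)
    show ?thesis
    proof (cases "2 + 5 * l = 0")
      case True
      then have l: "l = -2/5" by (simp add: eq_neg_iff_add_eq_0 field_simps)
      have "T 0 3 3 = T 0 5 5" by (rule edges(6)) (simp add: m l)
      then show ?thesis using 13 by simp
    next
      case False
      have e: "(l + 1 - m) + 5 * (l * (1 - m)) = l * (2 + 5 * l)" by (simp add: m algebra_simps)
      have "T 0 1 1 = T 0 5 5" by (rule edges(4)) (use False assms(2) in \<open>simp add: e\<close>)
      then show ?thesis using 13 by simp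
    qed
  qed
  then show "T 0 j j = T 0 (j mod 2) (j mod 2)" if "j \<le> 5" for j
    using le5[OF that] edges(1,2) p by auto
  fix i j assume *: "i < j" "even (j - i)" "T 0 i i = T 0 j j" "T 0 i i = T 0 (i mod 2) (i mod 2)"
  have "j mod 2 = i mod 2" using *(1,2) by presburger
  then show "T 0 j j = T 0 (j mod 2) (j mod 2)" using *(3,4) by simp
qed

text \<open>\<open>l * (1 - m) = 0\<close> cuts order 0 off. Since \<open>l + 1 - m\<close> is
  neither 0 nor 1, the edges 1-3, 1-5, 1-4 and 2-5 survive and hold the other orders
  together.\<close>

lemma diag_one:
  assumes "(l = 0 \<and> m \<noteq> 1) \<or> (m = 1 \<and> l \<noteq> 0)" "\<not> (l = m \<and> l * (1 - m) = 0)" "1 \<le> j" "j \<le> k"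
  shows "T 0 j j = T 0 1 1"
proof -
  have p: "l * (1 - m) = 0" using assms by auto
  have s0: "l + 1 - m \<noteq> 0" using assms by auto
  have s1: "l + 1 - m \<noteq> 1" using assms by auto
  have lm: "l + m \<noteq> 1" using assms by auto
  have 13: "T 0 1 1 = T 0 3 3" by (rule edges(3)) (use s0 in \<open>simp add: p\<close>)
  have 15: "T 0 1 1 = T 0 5 5" by (rule edges(4)) (use s0 in \<open>simp add: p\<close>)
  have 14: "T 0 1 1 = T 0 4 4" by (rule edges(9)[OF lm]) (use s1 in \<open>simp add: p\<close>)
  have 25: "T 0 2 2 = T 0 5 5" by (rule edges(10)[OF lm]) (use s1 in \<open>simp add: p\<close>)
  have "1 \<le> j \<longrightarrow> T 0 j j = T 0 1 1"
  proof (rule chain[OF _ _ assms(4)])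
    show "1 \<le> j \<longrightarrow> T 0 j j = T 0 1 1" if "j \<le> 5" for j
      using le5[OF that] 13 15 14 25 by auto
  qed (use p in auto)
  then show ?thesis using assms by simp
qed

text \<open>Here \<open>l + 1 - m = 1\<close> closes the odd gaps 1-4 and 2-5 as well, so the
  positive orders split by parity.\<close>

lemma diag_two:
  assumes "l = m" "l = 0 \<or> l = 1" "1 \<le> j" "j \<le> k"
  shows "T 0 j j = (if odd j then T 0 1 1 else T 0 2 2)"
proof -
  have p: "l * (1 - m) = 0" and s: "l + 1 - m = 1" using assms by auto
  have 13: "T 0 1 1 = T 0 3 3" by (rule edges(3)) (simp add: p s)
  have 15: "T 0 1 1 = T 0 5 5" by (rule edges(4)) (simp add: p s)
  have 24: "T 0 2 2 = T 0 4 4" by (rule edges(5)) (simp add: p s)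
  have "1 \<le> j \<longrightarrow> T 0 j j = (if odd j then T 0 1 1 else T 0 2 2)"
  proof (rule chain[OF _ _ assms(4)])
    show "1 \<le> j \<longrightarrow> T 0 j j = (if odd j then T 0 1 1 else T 0 2 2)" if "j \<le> 5" for j
      using le5[OF that] 13 15 24 by auto
  qed (use p in auto)
  then show ?thesis using assms by simp
qed

text \<open>Now \<open>gq\<close> vanishes at 0 and at 1. Hence the edges that
  \<open>gq_not_all_zero\<close> provides end at order 2 or above, and the induction stays within
  orders at least 2.\<close>

lemma diag_three:
  assumes "l = 0" "m = 1" "2 \<le> j" "j \<le> k"
  shows "T 0 j j = (if odd j then T 0 3 3 else T 0 2 2)"
proof -
  have p: "l * (1 - m) = 0" and s: "l + 1 - m = 0" using assms by auto
  have 35: "T 0 3 3 = T 0 5 5" by (rule edges(6)) (simp add: p s)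
  have 24: "T 0 2 2 = T 0 4 4" by (rule edges(5)) (simp add: p s)
  have "2 \<le> j \<longrightarrow> T 0 j j = (if odd j then T 0 3 3 else T 0 2 2)"
    using assms(4)
  proof (induction j rule: less_induct)
    case (less j)
    show ?case
    proof (cases "j \<le> 5")
      case True then show ?thesis using le5[OF True] 35 24 by auto
    next
      case False
      then have j6: "j \<ge> 6" by simp
      obtain r where r: "r \<in> {2, 4, 6}" "gq l m r (j - r) \<noteq> 0"
        using gq_not_all_zero[OF j6, of l m] by blast
      define i where "i = j - r"
      have ij: "i + r = j" "i < j" using r j6 by (auto simp: i_def)
      have "i \<ge> 2"
      proof (rule ccontr)
        assume "\<not> i \<ge> 2"
        then have "i = 0 \<or> i = 1" by auto
        then show False using r(2) assms unfolding i_def[symmetric] gq_def by auto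
      qed
      moreover have "T 0 i i = T 0 j j"
        using edge2[OF ij(2) less.prems] N2_zero_iff[OF ij(1), of k l m] r less.prems by (auto simp: i_def)
      moreover have "even j = even i" using ij(1) r(1) by auto
      ultimately show ?thesis using less.IH[OF ij(2)] ij less.prems by auto
    qed
  qed
  then show ?thesis using assms by simp
qed

end

section \<open>Symmetries with vanishing matrix on constants\<close>

lemma sum_only:
  assumes "j \<le> (k::nat)" "\<And>p. p \<le> k \<Longrightarrow> p \<noteq> j \<Longrightarrow> f p = (0::complex)"
  shows "(\<Sum>p\<le>k. f p) = f j"
proof -
  have "(\<Sum>p\<le>k. f p) = (\<Sum>p\<in>{j}. f p)" by (rule sum.mono_neutral_right) (use assms in auto)
  then show ?thesis by simp
qed

text \<open>Elimination for \<open>lower_facts\<close>: \<open>v0\<close>, \<open>v1\<close>,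
  \<open>v2\<close> and \<open>w0\<close>, \<open>w1\<close>, \<open>w2\<close> are the entries of
  \<open>T 1\<close> and \<open>T 2\<close> in column \<open>J\<close>, read upwards from row
  \<open>b = J - 1\<close>. Modes 1 and 2 together overdetermine them.\<close>

lemma lower_algebra:
  fixes v0 :: complex
  assumes "- v1 + Kb1 * v0 = 0" "-2 * v2 + K1a * v1 - Kba * v0 = 0"
    "w0 = 2 * v0" "w1 = 3 * v1 + Kb1 * v0" "w2 = 4 * v2 + K1a * v1 + Kba * v0"
    "-4 * w2 + 4 * K1a * w1 - 8 * Kba * w0 = 0"
  shows "v0 * (K1a * Kb1 - 3 * Kba) = 0"
  using assms by algebra

lemma lower_algebra2:
  fixes v0 :: complex
  assumes "- v1 + Kb1 * v0 = 0" "-2 * v2 + K1a * v1 - Kba * v0 = 0"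
    "w0 = 2 * v0" "w1 = 3 * v1 + Kb1 * v0" "w2 = 4 * v2 + K1a * v1 + Kba * v0"
    "-4 * w2 + 4 * K1a * w1 - 8 * Kba * w0 = 0"
    "-3 * v3 + Kad * v2 - K1d * v1 + Kbd * v0 = 0"
    "w3 = 5 * v3 + Kad * v2 + K1d * v1 + Kbd * v0"
    "-6 * w3 + 4 * Kad * w2 - 8 * K1d * w1 + 16 * Kbd * w0 = 0"
  shows "v0 * (4 * Kad * Kba - 7 * K1d * Kb1 + 4 * Kbd) = 0"
proof -
  have r: "v0 * (K1a * Kb1 - 3 * Kba) = 0" by (rule lower_algebra[OF assms(1-6)])
  have v1: "v1 = Kb1 * v0" using assms(1) by algebra
  have v2: "v2 = Kba * v0" using assms(2) v1 r by algebra
  have w1: "w1 = 4 * Kb1 * v0" using assms(4) v1 by algebra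
  have w2: "w2 = 8 * Kba * v0" using assms(5) v1 v2 r by algebra
  have v3: "3 * v3 = (Kad * Kba - K1d * Kb1 + Kbd) * v0" using assms(7) v1 v2 by algebra
  have "3 * w3 = (8 * Kad * Kba - 2 * K1d * Kb1 + 8 * Kbd) * v0" using assms(8) v1 v2 v3 by algebra
  then show ?thesis using assms(3,9) w1 w2 by algebra
qed

text \<open>The counterpart along row \<open>b\<close>, for the columns \<open>J\<close>,
  \<open>J + 1\<close>, \<open>J + 2\<close>; capital \<open>U\<close> belongs to mode 2.\<close>

lemma upper_algebra:
  fixes u0 :: complex
  assumes "- u1 + K1 * u0 = 0" "-2 * u2 + K2 * u1 + K3 * u0 = 0"
    "-2 * U1 + 4 * K1 * U0 = 0" "-4 * U2 + 4 * K2 * U1 + 8 * K3 * U0 = 0" "U0 = 2 * u0"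
    "- U2 + K2 * U1 + K3 * U0 = 2 * u2"
  shows "u0 * (K1 * K2 + 3 * K3) = 0"
  using assms by algebra

lemma upper_algebra2:
  fixes u0 :: complex
  assumes "- u1 + K1 * u0 = 0" "-2 * u2 + K2 * u1 + K3 * u0 = 0"
    "-2 * U1 + 4 * K1 * U0 = 0" "-4 * U2 + 4 * K2 * U1 + 8 * K3 * U0 = 0" "U0 = 2 * u0"
    "- U2 + K2 * U1 + K3 * U0 = 2 * u2"
    "-3 * u3 + K4 * u2 + K5 * u1 + K6 * u0 = 0"
    "-6 * U3 + 4 * K4 * U2 + 8 * K5 * U1 + 16 * K6 * U0 = 0"
    "-2 * U3 + K4 * U2 + K5 * U1 + K6 * U0 = 2 * u3"
  shows "u0 * (5 * K4 * K3 - 11 * K5 * K1 - 14 * K6) = 0"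
proof -
  have r: "u0 * (K1 * K2 + 3 * K3) = 0" by (rule upper_algebra[OF assms(1-6)])
  have u1: "u1 = K1 * u0" using assms(1) by algebra
  have u2: "u2 = - K3 * u0" using assms(2) u1 r by algebra
  have U1: "U1 = 4 * K1 * u0" using assms(3,5) by algebra
  have U2: "U2 = - 8 * K3 * u0" using assms(4,5) U1 r by algebra
  have u3: "3 * u3 = (- K4 * K3 + K5 * K1 + K6) * u0" using assms(7) u1 u2 by algebra
  have U3: "6 * U3 = (- 32 * K4 * K3 + 32 * K5 * K1 + 32 * K6) * u0" using assms(5,8) U1 U2 by algebra
  show ?thesis using assms(5,9) U1 U2 u3 U3 by algebra
qed

context csym5
begin

context
  fixes J :: nat
  assumes Z: "\<And>i j. i \<le> k \<Longrightarrow> j \<le> k \<Longrightarrow> T 0 i j = 0"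
    and J: "m - l = of_nat J" "J \<le> k"
begin

lemma row_rel: "i \<le> k \<Longrightarrow> j \<le> k \<Longrightarrow> (\<Sum>p\<le>k. T z i p * ell l m (of_int z) 0 p j) = 0"
  using T_comm[of i j 0 z] Z by simp

lemma col_rel: "i \<le> k \<Longrightarrow> j \<le> k \<Longrightarrow> (\<Sum>p\<le>k. ell l m (- of_int z) (of_int z) i p * T z p j) = 0"
  using T_comm[of i j z "- z"] Z by simp

text \<open>With \<open>T 0 = 0\<close> the relation from mode 0 to mode \<open>z\<close> is
  triangular in the columns with diagonal \<open>(J - p) z\<close>, so it can be solved before
  column \<open>J\<close>.\<close>

lemma T_low:
  assumes "z \<noteq> 0" "i \<le> k" "p < J" shows "T z i p = 0"
  using assms(3)
proof (induction p rule: less_induct)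
  case (less p)
  have p: "p \<le> k" using less.prems J by simp
  have "(\<Sum>q\<le>k. T z i q * ell l m (of_int z) 0 q p) = T z i p * ell l m (of_int z) 0 p p"
    by (rule sum_only[OF p]) (metis ell_gt less.IH less.prems linorder_neqE_nat mult_eq_0_iff order.strict_trans)
  then have "T z i p * ((of_nat J - of_nat p) * of_int z) = 0"
    using row_rel[OF assms(2) p, of z] J by (simp add: ell_diag)
  moreover have "of_nat J - of_nat p \<noteq> (0::complex)" using less.prems by simp
  ultimately show ?case using assms(1) by simp
qed

text \<open>The relation from mode \<open>z\<close> back to 0 is triangular in the rows with
  diagonal \<open>(i + 1 - J) z\<close>. Only row \<open>J - 1\<close> escapes, and the rows above
  it follow from it.\<close>

lemma T_down:
  assumes "z \<noteq> 0" "i \<le> k" "j \<le> k" "\<And>p. p \<le> k \<Longrightarrow> p > i \<Longrightarrow> T z p j = 0" "Suc i \<noteq> J"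
  shows "T z i j = 0"
proof -
  have "(\<Sum>p\<le>k. ell l m (- of_int z) (of_int z) i p * T z p j) = ell l m (- of_int z) (of_int z) i i * T z i j"
    by (rule sum_only[OF assms(2)]) (metis assms(4) ell_gt linorder_neqE_nat mult_eq_0_iff)
  then have "of_int z * (of_nat (Suc i) - of_nat J) * T z i j = 0"
    using col_rel[OF assms(2,3), of z] J by (simp add: ell_diag algebra_simps)
  moreover have "of_nat (Suc i) - of_nat J \<noteq> (0::complex)"
    using assms(5) by (metis eq_iff_diff_eq_0 of_nat_eq_iff)
  ultimately show ?thesis using assms(1) by (metis mult_eq_0_iff of_int_eq_0_iff)
qed

lemma T_high:
  assumes "z \<noteq> 0" "j \<le> k" "i \<le> k" "J \<le> i" shows "T z i j = 0"
  using assms(3,4)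
proof (induction "k - i" arbitrary: i rule: less_induct)
  case less
  show ?case
    by (rule T_down[OF assms(1) less.prems(1) assms(2)]) (use less in auto)
qed

lemma T_rest:
  assumes "z \<noteq> 0" "j \<le> k" "i \<le> k" "\<And>b. J = Suc b \<Longrightarrow> T z b j = 0" shows "T z i j = 0"
  using assms(3)
proof (induction "k - i" arbitrary: i rule: less_induct)
  case less
  show ?case
  proof (cases "Suc i = J")
    case False
    show ?thesis
      by (rule T_down[OF assms(1) less.prems(1) assms(2)]) (use less False in auto)
  qed (use assms(4) in auto)
qed

lemma col_sum:
  assumes "J = Suc b" "w \<noteq> 0" "j \<le> k"
  shows "(\<Sum>p\<le>k. ell l m z n i p * T w p j) = (\<Sum>p\<in>{i..b}. ell l m z n i p * T w p j)"
  by (rule sum.mono_neutral_right) (use T_high[OF assms(2,3)] assms(1) J(2) in \<open>auto simp: ell_gt not_le\<close>)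

lemma row_sum:
  assumes "w \<noteq> 0" "i \<le> k" "j \<le> k"
  shows "(\<Sum>p\<le>k. T w i p * ell l m z n p j) = (\<Sum>p\<in>{J..j}. T w i p * ell l m z n p j)"
  by (rule sum.mono_neutral_right) (use T_low[OF assms(1,2)] assms(3) in \<open>auto simp: ell_gt not_le\<close>)

text \<open>The field \<open>ee 1\<close> ties mode 1 to mode 2. This is the extra information on
  the entry in row \<open>J - 1\<close> that the relations with mode 0 leave open.\<close>

lemma mixed:
  assumes "i \<le> k" "j \<le> k"
  shows "(\<Sum>p\<in>{J..j}. T 2 i p * ell l m 1 1 p j) = (\<Sum>p\<le>k. ell l m 1 1 i p * T 1 p j)"
  using T_comm[of i j 1 1] row_sum[of 2 i j 1 1] assms by simp

context
  fixes b :: nat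
  assumes b: "J = Suc b"
begin

lemma colz:
  assumes "i \<le> b" "z = 1 \<or> z = 2"
  shows "(\<Sum>p\<in>{i..b}. ell l m (- of_int z) (of_int z) i p * T z p J) = 0"
  using col_rel[of i J z] col_sum[OF b, of z J] assms J b by auto

lemma colmix:
  assumes "i \<le> b" shows "T 2 i J = (\<Sum>p\<in>{i..b}. ell l m 1 1 i p * T 1 p J)"
  using mixed[of i J] col_sum[OF b, of 1 J 1 1 i] assms J b by (simp add: ell_diag)

lemma rowz:
  assumes "j \<le> k"
  shows "(\<Sum>p\<in>{J..j}. T 1 b p * ell l m 1 0 p j) = 0" "(\<Sum>p\<in>{J..j}. T 2 b p * ell l m 2 0 p j) = 0"
  using row_rel[of b j 1] row_rel[of b j 2] row_sum[of 1 b j] row_sum[of 2 b j] assms J b by auto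

lemma rowmix:
  assumes "j \<le> k" shows "(\<Sum>p\<in>{J..j}. T 2 b p * ell l m 1 1 p j) = 2 * T 1 b j"
  using mixed[of b j] col_sum[OF b, of 1 j 1 1 b] assms J b by (simp add: ell_diag)

lemma ml: "m - l = of_nat b + 1" using J b by simp

lemma lower_facts:
  assumes a: "b = Suc (Suc a)"
  shows "- T 1 (Suc a) J + kap l (Suc (Suc a)) (Suc a) * T 1 b J = 0"
    "-2 * T 1 a J + kap l (Suc a) a * T 1 (Suc a) J - kap l (Suc (Suc a)) a * T 1 b J = 0"
    "T 2 b J = 2 * T 1 b J" "T 2 (Suc a) J = 3 * T 1 (Suc a) J + kap l (Suc (Suc a)) (Suc a) * T 1 b J"
    "T 2 a J = 4 * T 1 a J + kap l (Suc a) a * T 1 (Suc a) J + kap l (Suc (Suc a)) a * T 1 b J"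
    "-4 * T 2 a J + 4 * kap l (Suc a) a * T 2 (Suc a) J - 8 * kap l (Suc (Suc a)) a * T 2 b J = 0"
  using colz[of "Suc a" 1] colz[of a 1] colmix[of b] colmix[of "Suc a"] colmix[of a] colz[of a 2]
  by (simp_all add: a ell_diag ell_less ml atLeastAtMostSuc_conv Suc_diff_le algebra_simps power2_eq_square power3_eq_cube)

lemma lower_facts2:
  assumes a: "b = Suc (Suc (Suc d))"
  shows "-3 * T 1 d J + kap l (Suc d) d * T 1 (Suc d) J - kap l (Suc (Suc d)) d * T 1 (Suc (Suc d)) J + kap l (Suc (Suc (Suc d))) d * T 1 b J = 0"
    "T 2 d J = 5 * T 1 d J + kap l (Suc d) d * T 1 (Suc d) J + kap l (Suc (Suc d)) d * T 1 (Suc (Suc d)) J + kap l (Suc (Suc (Suc d))) d * T 1 b J"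
    "-6 * T 2 d J + 4 * kap l (Suc d) d * T 2 (Suc d) J - 8 * kap l (Suc (Suc d)) d * T 2 (Suc (Suc d)) J + 16 * kap l (Suc (Suc (Suc d))) d * T 2 b J = 0"
  using colz[of d 1] colmix[of d] colz[of d 2]
  by (simp_all add: a ell_diag ell_less ml atLeastAtMostSuc_conv Suc_diff_le algebra_simps eval_nat_numeral)

lemma upper_facts:
  assumes a: "Suc (Suc J) \<le> k"
  shows "- T 1 b (Suc J) + kap l (Suc J) J * T 1 b J = 0"
    "-2 * T 1 b (Suc (Suc J)) + kap l (Suc (Suc J)) (Suc J) * T 1 b (Suc J) + kap l (Suc (Suc J)) J * T 1 b J = 0"
    "-2 * T 2 b (Suc J) + 4 * kap l (Suc J) J * T 2 b J = 0"
    "-4 * T 2 b (Suc (Suc J)) + 4 * kap l (Suc (Suc J)) (Suc J) * T 2 b (Suc J) + 8 * kap l (Suc (Suc J)) J * T 2 b J = 0"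
    "T 2 b J = 2 * T 1 b J"
    "- T 2 b (Suc (Suc J)) + kap l (Suc (Suc J)) (Suc J) * T 2 b (Suc J) + kap l (Suc (Suc J)) J * T 2 b J = 2 * T 1 b (Suc (Suc J))"
  using rowz[of "Suc J"] rowz[of "Suc (Suc J)"] rowmix[of J] rowmix[of "Suc (Suc J)"] a
  by (simp_all add: J ell_diag ell_less atLeastAtMostSuc_conv Suc_diff_le algebra_simps eval_nat_numeral)

lemma upper_facts2:
  assumes a: "Suc (Suc (Suc J)) \<le> k"
  shows "-3 * T 1 b (Suc (Suc (Suc J))) + kap l (Suc (Suc (Suc J))) (Suc (Suc J)) * T 1 b (Suc (Suc J))
      + kap l (Suc (Suc (Suc J))) (Suc J) * T 1 b (Suc J) + kap l (Suc (Suc (Suc J))) J * T 1 b J = 0"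
    "-6 * T 2 b (Suc (Suc (Suc J))) + 4 * kap l (Suc (Suc (Suc J))) (Suc (Suc J)) * T 2 b (Suc (Suc J))
      + 8 * kap l (Suc (Suc (Suc J))) (Suc J) * T 2 b (Suc J) + 16 * kap l (Suc (Suc (Suc J))) J * T 2 b J = 0"
    "-2 * T 2 b (Suc (Suc (Suc J))) + kap l (Suc (Suc (Suc J))) (Suc (Suc J)) * T 2 b (Suc (Suc J))
      + kap l (Suc (Suc (Suc J))) (Suc J) * T 2 b (Suc J) + kap l (Suc (Suc (Suc J))) J * T 2 b J = 2 * T 1 b (Suc (Suc (Suc J)))"
  using rowz[of "Suc (Suc (Suc J))"] rowmix[of "Suc (Suc (Suc J))"] a
  by (simp_all add: J ell_diag ell_less atLeastAtMostSuc_conv Suc_diff_le algebra_simps eval_nat_numeral)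

lemma lower_cond:
  assumes a: "b = Suc (Suc a)" and nz: "T 1 b J \<noteq> 0"
  shows "(of_nat a + 2 * l) * (of_nat a + 1 + 2 * l) + 2 * (of_nat a + 3 * l) = 0"
proof -
  let ?a = "of_nat a :: complex"
  have "T 1 b J * (kap l (Suc a) a * kap l (Suc (Suc a)) (Suc a) - 3 * kap l (Suc (Suc a)) a) = 0"
    by (rule lower_algebra[OF lower_facts[OF a]])
  then have "kap l (Suc a) a * kap l (Suc (Suc a)) (Suc a) - 3 * kap l (Suc (Suc a)) a = 0" using nz by simp
  moreover have "2 * kap l (Suc a) a = - (?a + 1) * (?a + 2 * l)" by (rule kap_1)
  moreover have "2 * kap l (Suc (Suc a)) (Suc a) = - (?a + 2) * (?a + 1 + 2 * l)" using kap_1[of l "Suc a"] by (simp add: ac_simps)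
  moreover have "6 * kap l (Suc (Suc a)) a = - (?a + 2) * (?a + 1) * (?a + 3 * l)" by (rule kap_2)
  ultimately have "(?a + 1) * ((?a + 2) * ((?a + 2 * l) * (?a + 1 + 2 * l) + 2 * (?a + 3 * l))) = 0" by algebra
  then show ?thesis using of_nat_pos_nz(1,2)[of a] by (metis mult_eq_0_iff)
qed

lemma lower_cond2:
  assumes a: "b = Suc (Suc (Suc d))" and nz: "T 1 b J \<noteq> 0"
  shows "6 * l\<^sup>2 + (5 * of_nat d + 14) * l + (of_nat d)\<^sup>2 + 4 * of_nat d = 0"
proof -
  let ?d = "of_nat d :: complex"
  have "T 1 b J * (4 * kap l (Suc d) d * kap l (Suc (Suc (Suc d))) (Suc d) - 7 * kap l (Suc (Suc d)) d * kap l (Suc (Suc (Suc d))) (Suc (Suc d)) + 4 * kap l (Suc (Suc (Suc d))) d) = 0"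
    by (rule lower_algebra2[OF lower_facts[OF a] lower_facts2[OF a]])
  then have "4 * kap l (Suc d) d * kap l (Suc (Suc (Suc d))) (Suc d) - 7 * kap l (Suc (Suc d)) d * kap l (Suc (Suc (Suc d))) (Suc (Suc d)) + 4 * kap l (Suc (Suc (Suc d))) d = 0" using nz by simp
  moreover have "2 * kap l (Suc d) d = - (?d + 1) * (?d + 2 * l)" by (rule kap_1)
  moreover have "6 * kap l (Suc (Suc (Suc d))) (Suc d) = - (?d + 3) * (?d + 2) * (?d + 1 + 3 * l)" using kap_2[of l "Suc d"] by (simp add: ac_simps)
  moreover have "6 * kap l (Suc (Suc d)) d = - (?d + 2) * (?d + 1) * (?d + 3 * l)" by (rule kap_2)
  moreover have "2 * kap l (Suc (Suc (Suc d))) (Suc (Suc d)) = - (?d + 3) * (?d + 2 + 2 * l)" using kap_1[of l "Suc (Suc d)"] by (simp add: ac_simps)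
  moreover have "24 * kap l (Suc (Suc (Suc d))) d = - (?d + 3) * (?d + 2) * (?d + 1) * (?d + 4 * l)" by (rule kap_3)
  ultimately have "(?d + 1) * ((?d + 2) * ((?d + 3) * (6 * l\<^sup>2 + (5 * ?d + 14) * l + ?d\<^sup>2 + 4 * ?d))) = 0" by algebra
  then show ?thesis using of_nat_pos_nz(1,2,3)[of d] by (metis mult_eq_0_iff)
qed

lemma upper_cond:
  assumes a: "Suc (Suc J) \<le> k" and nz: "T 1 b J \<noteq> 0"
  shows "(of_nat J + 2 * l) * (of_nat J + 1 + 2 * l) - 2 * (of_nat J + 3 * l) = 0"
proof -
  let ?J = "of_nat J :: complex"
  have "T 1 b J * (kap l (Suc J) J * kap l (Suc (Suc J)) (Suc J) + 3 * kap l (Suc (Suc J)) J) = 0"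
    by (rule upper_algebra[OF upper_facts[OF a]])
  then have "kap l (Suc J) J * kap l (Suc (Suc J)) (Suc J) + 3 * kap l (Suc (Suc J)) J = 0" using nz by simp
  moreover have "2 * kap l (Suc J) J = - (?J + 1) * (?J + 2 * l)" by (rule kap_1)
  moreover have "2 * kap l (Suc (Suc J)) (Suc J) = - (?J + 2) * (?J + 1 + 2 * l)" using kap_1[of l "Suc J"] by (simp add: ac_simps)
  moreover have "6 * kap l (Suc (Suc J)) J = - (?J + 2) * (?J + 1) * (?J + 3 * l)" by (rule kap_2)
  ultimately have "(?J + 1) * ((?J + 2) * ((?J + 2 * l) * (?J + 1 + 2 * l) - 2 * (?J + 3 * l))) = 0" by algebra
  then show ?thesis using of_nat_pos_nz(1,2)[of J] by (metis mult_eq_0_iff)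
qed

lemma upper_cond2:
  assumes a: "J = 2" and nz: "T 1 b J \<noteq> 0" shows False
proof -
  have k': "Suc (Suc (Suc J)) \<le> k" "Suc (Suc J) \<le> k" using k5 a by auto
  have "(2 + 2 * l) * (2 + 1 + 2 * l) - 2 * (2 + 3 * l) = 0" using upper_cond[OF k'(2) nz] a by simp
  then have q: "4 * l\<^sup>2 + 4 * l + 2 = 0" by algebra
  have "T 1 b J * (5 * kap l (Suc (Suc (Suc J))) (Suc (Suc J)) * kap l (Suc (Suc J)) J - 11 * kap l (Suc (Suc (Suc J))) (Suc J) * kap l (Suc J) J - 14 * kap l (Suc (Suc (Suc J))) J) = 0"
    by (rule upper_algebra2[OF upper_facts[OF k'(2)] upper_facts2[OF k'(1)]])
  then have "5 * kap l (Suc (Suc (Suc J))) (Suc (Suc J)) * kap l (Suc (Suc J)) J - 11 * kap l (Suc (Suc (Suc J))) (Suc J) * kap l (Suc J) J - 14 * kap l (Suc (Suc (Suc J))) J = 0" using nz by simp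
  moreover have "2 * kap l (Suc (Suc (Suc J))) (Suc (Suc J)) = - 5 * (4 + 2 * l)" using kap_1[of l "Suc (Suc J)"] a by simp
  moreover have "6 * kap l (Suc (Suc J)) J = - 12 * (2 + 3 * l)" using kap_2[of l J] a by simp
  moreover have "6 * kap l (Suc (Suc (Suc J))) (Suc J) = - 20 * (3 + 3 * l)" using kap_2[of l "Suc J"] a by simp
  moreover have "2 * kap l (Suc J) J = - 3 * (2 + 2 * l)" using kap_1[of l J] a by simp
  moreover have "24 * kap l (Suc (Suc (Suc J))) J = - 60 * (2 + 4 * l)" using kap_3[of l J] a by simp
  ultimately have "30 * (2 * l + 1) = 0" using q by algebra
  then have "2 * l + 1 = 0" by (metis mult_eq_0_iff zero_neq_numeral)
  then have "(1::complex) = 0" using q by algebra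
  then show False by simp
qed

text \<open>For \<open>b = 0\<close> the condition along the row leaves only \<open>l = 0\<close>,
  \<open>m = 1\<close>. Otherwise two conditions on \<open>l\<close> are available and incompatible:
  both along the row for \<open>b = 1\<close>, one along row and one along column for
  \<open>b = 2\<close>, both along the column from \<open>b = 3\<close> on. The rows need columns up
  to 5, hence \<open>k \<ge> 5\<close>.\<close>

lemma T1_edge:
  assumes sp: "l = 0 \<Longrightarrow> m = 1 \<Longrightarrow> T 1 0 1 = 0"
  shows "T 1 b J = 0"
proof (rule ccontr)
  assume nz: "T 1 b J \<noteq> 0"
  have "b = 0 \<or> b = 1 \<or> b = 2 \<or> (\<exists>d. b = Suc (Suc (Suc d)))" by presburger
  then show False
  proof (elim disjE exE)
    assume b0: "b = 0"
    then have "(1 + 2 * l) * (1 + 1 + 2 * l) - 2 * (1 + 3 * l) = 0" using upper_cond[OF _ nz] b k5 by simp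
    then have "4 * l\<^sup>2 = 0" by algebra
    then have "l = 0" by simp
    moreover then have "m = 1" using ml b0 by simp
    ultimately show False using sp nz b b0 by simp
  next
    assume "b = 1" then show False using upper_cond2 b nz by simp
  next
    assume b2: "b = 2"
    then have "(0 + 2 * l) * (0 + 1 + 2 * l) + 2 * (0 + 3 * l) = 0" using lower_cond[of 0] nz by (simp add: numeral_2_eq_2)
    moreover have "(3 + 2 * l) * (3 + 1 + 2 * l) - 2 * (3 + 3 * l) = 0" using upper_cond[OF _ nz] b b2 k5 by simp
    ultimately have "(6::complex) = 0" by algebra
    then show False by simp
  next
    fix d assume d: "b = Suc (Suc (Suc d))"
    let ?d = "of_nat d :: complex"
    have 1: "(?d + 1 + 2 * l) * (?d + 1 + 1 + 2 * l) + 2 * (?d + 1 + 3 * l) = 0"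
      using lower_cond[OF d nz] by (simp add: ac_simps)
    have 2: "6 * l\<^sup>2 + (5 * ?d + 14) * l + ?d\<^sup>2 + 4 * ?d = 0" by (rule lower_cond2[OF d nz])
    have "(?d + 4) * (2 * l + ?d + 3) = 0" using 1 2 by algebra
    then have "2 * l + ?d + 3 = 0" using of_nat_pos_nz(4) by (metis mult_eq_0_iff)
    then have "?d + 5 = 0" using 1 by algebra
    then show False using of_nat_pos_nz(5) by simp
  qed
qed

end

lemma T1_vanish:
  assumes sp: "l = 0 \<Longrightarrow> m = 1 \<Longrightarrow> T 1 0 1 = 0" and i: "i \<le> k"
  shows "T 1 i J = 0"
  by (rule T_rest[OF _ J(2) i]) (use T1_edge sp in auto)

end

text \<open>By \<open>H_vanish\<close> it suffices to kill \<open>d^j\<close>, whose images are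
  recorded in \<open>T 0\<close>, and in weight zero \<open>ee 1 d^j\<close>, whose image is column
  \<open>j\<close> of \<open>T 1\<close>.\<close>

lemma H_determined:
  assumes Z: "\<And>i j. i \<le> k \<Longrightarrow> j \<le> k \<Longrightarrow> T 0 i j = 0"
    and sp: "l = 0 \<Longrightarrow> m = 1 \<Longrightarrow> T 1 0 1 = 0" and a: "a \<in> Cf k"
  shows "H a = (\<lambda>i x. 0)"
proof (rule H_vanish[OF _ _ a])
  fix j assume j: "j \<le> k"
  have z: "H (sgl j (ee n)) i x = 0" if "i > k" for n i x
    using H_Cf[OF sgl_Cf[OF ee_Fsp j]] that by (simp add: Cf_def)
  show "H (sgl j (\<lambda>x. 1)) = (\<lambda>i x. 0)"
  proof (intro ext)
    fix i x show "H (sgl j (\<lambda>x. 1)) i x = 0"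
      using H_ee[OF j, of 0 i x] Z[of i j] z[of i 0 x] j unfolding ee_0 by (cases "i \<le> k") auto
  qed
  assume J: "m - l = of_nat j"
  show "H (sgl j (ee 1)) = (\<lambda>i x. 0)"
  proof (intro ext)
    fix i x
    show "H (sgl j (ee 1)) i x = 0"
    proof (cases "i \<le> k")
      case True
      have "T 1 i j = 0" by (rule T1_vanish[OF _ J j _ True]) (rule Z, assumption, assumption, rule sp, assumption, assumption)
      then show ?thesis using H_ee[OF j, of 1 i x] by simp
    qed (use z in simp)
  qed
qed

end

section \<open>Construction of symmetries\<close>

definition cint :: "(real \<Rightarrow> complex) \<Rightarrow> complex" where
  "cint f = integral {0..1} f"

lemma Fsp_continuous: "f \<in> Fsp \<Longrightarrow> continuous_on S f"
  using Fsp_deriv[of f] has_vector_derivative_continuous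
  by (metis continuous_at_imp_continuous_on)

lemma Fsp_integrable: "f \<in> Fsp \<Longrightarrow> f integrable_on {0..1::real}"
  by (intro integrable_continuous_real Fsp_continuous)

lemma cint_FTC: "(\<And>x. (G has_vector_derivative f x) (at x)) \<Longrightarrow> cint f = G 1 - G 0"
  unfolding cint_def
  by (intro integral_unique fundamental_theorem_of_calculus) (auto intro: has_vector_derivative_at_within)

lemma cint_vd: "f \<in> Fsp \<Longrightarrow> cint (vd f) = 0"
  using cint_FTC[of f "vd f"] Fsp_deriv[of f] Fsp_periodic[of f 0] by simp

lemma cint_add: "f \<in> Fsp \<Longrightarrow> h \<in> Fsp \<Longrightarrow> cint (\<lambda>x. f x + h x) = cint f + cint h"
  unfolding cint_def by (intro integral_add Fsp_integrable)

lemma cint_cmult: "cint (\<lambda>x. c * f x) = c * cint f"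
  unfolding cint_def by simp

lemma cint_sum: "finite S \<Longrightarrow> (\<And>i. i \<in> S \<Longrightarrow> f i \<in> Fsp) \<Longrightarrow> cint (\<lambda>x. \<Sum>i\<in>S. f i x) = (\<Sum>i\<in>S. cint (f i))"
  unfolding cint_def by (intro integral_sum Fsp_integrable)

text \<open>Substitution turns the left side into the increment of an antiderivative over an
  interval of length 1 starting at \<open>g 0\<close>, and by periodicity this increment does not
  depend on the starting point.\<close>

lemma cint_pull:
  assumes g: "g \<in> DiffS1" and f: "f \<in> Fsp"
  shows "cint (\<lambda>x. exp (lgd g x) * f (g x)) = cint f"
proof -
  obtain G where G: "\<And>x. (G has_vector_derivative f x) (at x)"
    using einterval_antiderivative[of "-\<infinity>" "\<infinity>" f] Fsp_continuous[OF f, of UNIV]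
    by (auto simp: continuous_on_eq_continuous_at)
  have per: "G (x + 1) - G x = G 1 - G 0" for x
  proof -
    have "((\<lambda>x. G (x + 1) - G x) has_vector_derivative f (x + 1) - f x) (at x)" for x
      by (intro has_vector_derivative_diff has_vector_derivative_shift G)
    then have "((\<lambda>x. G (x + 1) - G x) has_vector_derivative 0) (at x within UNIV)" for x
      using Fsp_periodic[OF f] by simp
    from has_vector_derivative_zero_constant[OF convex_UNIV this]
    obtain c where c: "\<And>x. x \<in> UNIV \<Longrightarrow> G (x + 1) - G x = c" by blast
    show ?thesis using c[of x] c[of 0] by simp
  qed
  have "((\<lambda>x. G (g x)) has_vector_derivative exp (lgd g x) * f (g x)) (at x)" for x
    using vector_diff_chain_at[OF DiffS1_deriv(1)[OF g] G] exp_lgd[OF g, of x]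
    by (simp add: o_def scaleR_conv_of_real)
  then have "cint (\<lambda>x. exp (lgd g x) * f (g x)) = G (g 1) - G (g 0)" by (rule cint_FTC)
  also have "g 1 = g 0 + 1" using DiffS1_deriv(3)[OF g, of 0] by simp
  finally show ?thesis using per[of "g 0"] cint_FTC[of G f, OF G] by simp
qed

lemma cint_nondegenerate:
  assumes f: "f \<in> Fsp" and z: "\<And>\<phi>. \<phi> \<in> Fsp \<Longrightarrow> cint (\<lambda>x. \<phi> x * f x) = 0"
  shows "f x = 0"
proof -
  have cont: "continuous_on {0..1} (\<lambda>x. (norm (f x))\<^sup>2)" by (intro continuous_intros Fsp_continuous f)
  have cf: "(\<lambda>x. cnj (f x) * f x) \<in> Fsp" by (intro Fsp_mult Fsp_cnj f)
  have "integral {0..1} (\<lambda>x. Re (cnj (f x) * f x)) = Re (cint (\<lambda>x. cnj (f x) * f x))"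
    unfolding cint_def using integral_linear[OF Fsp_integrable[OF cf] bounded_linear_Re] by (simp add: o_def)
  also have "\<dots> = 0" using z[OF Fsp_cnj[OF f]] by simp
  moreover have "(norm (f x))\<^sup>2 = Re (cnj (f x) * f x)" for x
    unfolding cmod_power2 by (simp add: power2_eq_square)
  ultimately have "integral {0..1} (\<lambda>x. (norm (f x))\<^sup>2) = 0" by simp
  then have 0: "f x = 0" if "x \<in> {0..1}" for x
    using integral_eq_0_iff[OF cont] that by auto
  have "f x = f (x + of_int (- \<lfloor>x\<rfloor>))" using periodic_int[of f] Fsp_periodic[OF f] by metis
  moreover have "x + of_int (- \<lfloor>x\<rfloor>) \<in> {0..1}" by auto linarith
  ultimately show ?thesis using 0 by metis
qed

section \<open>The formal adjoint\<close>

lemma dnth_mult: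
  assumes f: "f \<in> Fsp" and h: "h \<in> Fsp"
  shows "dnth n (\<lambda>x. f x * h x) = (\<lambda>x. \<Sum>i\<le>n. of_nat (n choose i) * (dnth (n - i) f x * dnth i h x))"
proof (induction n)
  case (Suc n)
  let ?F = "\<lambda>p. dnth p f" and ?G = "\<lambda>p. dnth p h"
  have FG: "?F p \<in> Fsp" "?G p \<in> Fsp" for p by (intro Fsp_dnth f h)+
  have "dnth (Suc n) (\<lambda>x. f x * h x) = (\<lambda>x. \<Sum>i\<le>n. of_nat (n choose i) * (?F (n - i) x * ?G (Suc i) x + ?F (Suc (n - i)) x * ?G i x))"
    unfolding dnth_Suc_vd Suc
    by (subst vd_sum) (auto simp: vd_cmult vd_mult FG Fsp_mult Fsp_const dnth_Suc_vd simp del: dnth.simps)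
  also have "\<dots> = (\<lambda>x. \<Sum>i\<le>Suc n. of_nat (Suc n choose i) * (?F (Suc n - i) x * ?G i x))"
  proof
    fix x
    have 1: "(\<Sum>i\<le>n. of_nat (n choose i) * (?F (Suc (n - i)) x * ?G i x)) = (\<Sum>i\<le>Suc n. of_nat (n choose i) * (?F (Suc n - i) x * ?G i x))"
      by (simp add: Suc_diff_le binomial_eq_0 del: dnth.simps)
    have 2: "(\<Sum>i\<le>n. of_nat (n choose i) * (?F (n - i) x * ?G (Suc i) x)) = (\<Sum>i\<le>Suc n. (if i = 0 then 0 else of_nat (n choose (i - 1))) * (?F (Suc n - i) x * ?G i x))"
      by (simp only: sum.atMost_Suc_shift) simp
    have c: "of_nat (Suc n choose i) = of_nat (n choose i) + (if i = 0 then 0 else of_nat (n choose (i - 1)) :: complex)" for i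
      by (cases i) auto
    show "(\<Sum>i\<le>n. of_nat (n choose i) * (?F (n - i) x * ?G (Suc i) x + ?F (Suc (n - i)) x * ?G i x)) = (\<Sum>i\<le>Suc n. of_nat (Suc n choose i) * (?F (Suc n - i) x * ?G i x))"
      unfolding c distrib_right sum.distrib distrib_left 1[symmetric] 2[symmetric] by (rule add.commute)
  qed
  finally show ?case .
qed simp

lemma cint_by_parts:
  assumes "\<phi> \<in> Fsp" "\<psi> \<in> Fsp"
  shows "cint (\<lambda>x. dnth i \<phi> x * \<psi> x) = (-1) ^ i * cint (\<lambda>x. \<phi> x * dnth i \<psi> x)"
  using assms(2)
proof (induction i arbitrary: \<psi>)
  case (Suc i)
  have F: "dnth i \<phi> \<in> Fsp" "vd \<psi> \<in> Fsp" by (intro Fsp_dnth Fsp_vd assms Suc.prems)+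
  have "cint (\<lambda>x. dnth i \<phi> x * vd \<psi> x + dnth (Suc i) \<phi> x * \<psi> x) = 0"
    using cint_vd[OF Fsp_mult[OF F(1) Suc.prems]] unfolding vd_mult[OF F(1) Suc.prems] dnth_Suc_vd .
  then have "cint (\<lambda>x. dnth (Suc i) \<phi> x * \<psi> x) = - cint (\<lambda>x. dnth i \<phi> x * vd \<psi> x)"
    using cint_add[OF Fsp_mult[OF F] Fsp_mult[OF Fsp_dnth[OF assms(1), of "Suc i"] Suc.prems]]
    by (simp add: add_eq_0_iff del: dnth.simps)
  also have "\<dots> = (-1) ^ Suc i * cint (\<lambda>x. \<phi> x * dnth i (vd \<psi>) x)" unfolding Suc.IH[OF F(2)] by simp
  finally show ?case unfolding dnth_Suc_right .
qed simp

text \<open>The adjoint of the sum of \<open>a_i d^i\<close> is the sum of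
  \<open>(-1)^i d^i a_i\<close>; Leibniz' rule yields these coefficients.\<close>

definition adjh :: "nat \<Rightarrow> coeffs \<Rightarrow> coeffs" where
  "adjh k a s = (\<lambda>x. \<Sum>i\<in>{s..k}. (-1) ^ i * of_nat (i choose s) * dnth (i - s) (a i) x)"

lemma adjh_Cf: "a \<in> Cf k \<Longrightarrow> adjh k a \<in> Cf k"
  unfolding Cf_def adjh_def by (auto intro!: Fsp_sum Fsp_mult Fsp_const Fsp_dnth)

lemma diffop_Fsp: "a \<in> Cf k \<Longrightarrow> \<phi> \<in> Fsp \<Longrightarrow> diffop k a \<phi> \<in> Fsp"
  unfolding Cf_def diffop_def by (auto intro!: Fsp_sum Fsp_mult Fsp_dnth)

lemma diffop_adjh:
  assumes a: "a \<in> Cf k" and \<phi>: "\<phi> \<in> Fsp" and \<psi>: "\<psi> \<in> Fsp"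
  shows "cint (\<lambda>x. diffop k a \<phi> x * \<psi> x) = cint (\<lambda>x. \<phi> x * diffop k (adjh k a) \<psi> x)"
proof -
  have ai: "a i \<in> Fsp" for i using a by (simp add: Cf_def)
  have a\<psi>: "(\<lambda>x. a i x * \<psi> x) \<in> Fsp" for i by (intro Fsp_mult ai \<psi>)
  have "diffop k (adjh k a) \<psi> x = (\<Sum>i\<le>k. (-1) ^ i * dnth i (\<lambda>x. a i x * \<psi> x) x)" for x
  proof -
    have "diffop k (adjh k a) \<psi> x = (\<Sum>s\<le>k. \<Sum>i\<in>{s..k}. (-1) ^ i * (of_nat (i choose s) * (dnth (i - s) (a i) x * dnth s \<psi> x)))"
      using \<psi> by (simp add: diffop_def adjh_def sum_distrib_right mult.assoc)
    also have "\<dots> = (\<Sum>i\<le>k. \<Sum>s\<le>i. (-1) ^ i * (of_nat (i choose s) * (dnth (i - s) (a i) x * dnth s \<psi> x)))"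
      by (rule sum_triangle[symmetric])
    finally show ?thesis unfolding dnth_mult[OF ai \<psi>] by (simp add: sum_distrib_left)
  qed
  then have "cint (\<lambda>x. \<phi> x * diffop k (adjh k a) \<psi> x) = cint (\<lambda>x. \<Sum>i\<le>k. (-1) ^ i * (\<phi> x * dnth i (\<lambda>x. a i x * \<psi> x) x))"
    by (simp add: sum_distrib_left mult_ac)
  also have "\<dots> = (\<Sum>i\<le>k. (-1) ^ i * cint (\<lambda>x. \<phi> x * dnth i (\<lambda>x. a i x * \<psi> x) x))"
    by (subst cint_sum) (auto simp: cint_cmult intro!: Fsp_mult Fsp_const \<phi> Fsp_dnth[OF a\<psi>])
  also have "\<dots> = (\<Sum>i\<le>k. cint (\<lambda>x. dnth i \<phi> x * (a i x * \<psi> x)))"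
    unfolding cint_by_parts[OF \<phi> a\<psi>] ..
  also have "\<dots> = cint (\<lambda>x. \<Sum>i\<le>k. dnth i \<phi> x * (a i x * \<psi> x))"
    by (subst cint_sum) (auto intro!: Fsp_mult Fsp_dnth \<phi> ai \<psi>)
  also have "\<dots> = cint (\<lambda>x. diffop k a \<phi> x * \<psi> x)"
    using \<phi> by (simp add: diffop_def sum_distrib_left mult_ac)
  finally show ?thesis ..
qed

text \<open>Equivariant linear maps between operator spaces of different orders and weights.
  Symmetries are assembled from steps that change them, such as the adjoint or splitting off a
  factor \<open>d\<close>.\<close>

definition chom :: "nat \<Rightarrow> complex \<Rightarrow> complex \<Rightarrow> nat \<Rightarrow> complex \<Rightarrow> complex \<Rightarrow>
    (coeffs \<Rightarrow> coeffs) \<Rightarrow> bool" where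
  "chom k l m k' l' m' F \<longleftrightarrow> (\<forall>a\<in>Cf k. F a \<in> Cf k') \<and>
     (\<forall>a\<in>Cf k. \<forall>b\<in>Cf k. F (cadd a b) = cadd (F a) (F b)) \<and>
     (\<forall>a\<in>Cf k. \<forall>c. F (cscale c a) = cscale c (F a)) \<and>
     (\<forall>a\<in>Cf k. \<forall>g\<in>DiffS1. F (acth l m k g a) = acth l' m' k' g (F a))"

lemma csym_iff_chom: "csym k l m H \<longleftrightarrow> chom k l m k l m H"
  unfolding csym_def chom_def by blast

lemma chom_id: "chom k l m k l m (\<lambda>a. a)"
  by (simp add: chom_def)

lemma chom_comp: "chom k l m k' l' m' F \<Longrightarrow> chom k' l' m' k'' l'' m'' G \<Longrightarrow> chom k l m k'' l'' m'' (\<lambda>a. G (F a))"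
  unfolding chom_def by (metis (no_types, lifting))

lemma acth_cadd: "acth l m k g (cadd a b) = cadd (acth l m k g a) (acth l m k g b)"
  unfolding acth_def cadd_def by (auto simp: fun_eq_iff sum.distrib ring_distribs)

lemma acth_cscale: "acth l m k g (cscale c a) = cscale c (acth l m k g a)"
  unfolding acth_def cscale_def by (auto simp: fun_eq_iff sum_distrib_left mult_ac)

lemma chom_add: "chom k l m k' l' m' F \<Longrightarrow> chom k l m k' l' m' G \<Longrightarrow> chom k l m k' l' m' (\<lambda>a. cadd (F a) (G a))"
  unfolding chom_def
  by (auto simp: cadd_Cf acth_cadd) (auto simp: cadd_def cscale_def fun_eq_iff algebra_simps)

lemma chom_scale: "chom k l m k' l' m' F \<Longrightarrow> chom k l m k' l' m' (\<lambda>a. cscale c (F a))"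
  unfolding chom_def
  by (auto simp: cscale_Cf acth_cscale) (auto simp: cadd_def cscale_def fun_eq_iff algebra_simps)

lemma cint_pull_pair:
  assumes g: "g \<in> DiffS1" and u: "u \<in> Fsp" and v: "v \<in> Fsp"
  shows "cint (\<lambda>x. pull l g u x * v x) = cint (\<lambda>x. u x * pull (1 - l) (inv g) v x)"
proof -
  let ?w = "pull (1 - l) (inv g) v"
  have w: "?w \<in> Fsp" by (intro pull_Fsp DiffS1_inv g v)
  have "v = pull (1 - l) g ?w" using pull_inv[OF g] by simp
  then have "cint (\<lambda>x. pull l g u x * v x) = cint (\<lambda>x. pull l g u x * pull (1 - l) g ?w x)" by simp
  also have "\<dots> = cint (\<lambda>x. exp (lgd g x) * (u (g x) * ?w (g x)))"
  proof -
    have "exp (l * lgd g x) * exp ((1 - l) * lgd g x) = exp (lgd g x)" for x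
      unfolding mult_exp_exp by (simp add: algebra_simps)
    then have "pull l g u x * pull (1 - l) g ?w x = exp (lgd g x) * (u (g x) * ?w (g x))" for x
      unfolding pull_lgd[OF g] by (metis mult.assoc mult.left_commute)
    then show ?thesis by simp
  qed
  also have "\<dots> = cint (\<lambda>x. u x * ?w x)"
    using cint_pull[OF g Fsp_mult[OF u w]] .
  finally show ?thesis .
qed

lemma act_inv_apply:
  assumes "g \<in> DiffS1" "a \<in> Cf k" "\<phi> \<in> Fsp"
  shows "diffop k (acth l m k g a) \<phi> = pull m g (diffop k a (pull l (inv g) \<phi>))"
  unfolding act_inv_diffop[OF assms(1,2), symmetric] using DiffS1_inv(2)[OF assms(1)] assms(3) by (simp add: act_def)

text \<open>The pairing of densities of weights \<open>l\<close> and \<open>1 - l\<close> by integration is invariant and nondegenerate.\<close>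
lemma chom_adjh: "chom k l m k (1 - m) (1 - l) (adjh k)"
  unfolding chom_def
proof (intro conjI ballI allI)
  fix a assume a: "a \<in> Cf k"
  have ai: "a i \<in> Fsp" for i using a by (simp add: Cf_def)
  show "adjh k a \<in> Cf k" by (rule adjh_Cf[OF a])
  show "adjh k (cadd a b) = cadd (adjh k a) (adjh k b)" if "b \<in> Cf k" for b
  proof -
    have bi: "b i \<in> Fsp" for i using that by (simp add: Cf_def)
    show ?thesis unfolding adjh_def cadd_def dnth_add[OF ai bi] by (simp add: fun_eq_iff sum.distrib ring_distribs)
  qed
  show "adjh k (cscale c a) = cscale c (adjh k a)" for c
    unfolding adjh_def cscale_def dnth_cmult[OF ai] by (simp add: fun_eq_iff sum_distrib_left mult_ac)
  show "adjh k (acth l m k g a) = acth (1 - m) (1 - l) k g (adjh k a)" if g: "g \<in> DiffS1" for g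
  proof (rule diffop_inj)
    note ga = acth_Cf[OF g a, of l m]
    note aa = adjh_Cf[OF a]
    show A: "adjh k (acth l m k g a) \<in> Cf k" by (rule adjh_Cf[OF ga])
    show B: "acth (1 - m) (1 - l) k g (adjh k a) \<in> Cf k" by (rule acth_Cf[OF g aa])
    show "diffop k (adjh k (acth l m k g a)) = diffop k (acth (1 - m) (1 - l) k g (adjh k a))"
    proof (rule ext)
      fix \<psi>
      show "diffop k (adjh k (acth l m k g a)) \<psi> = diffop k (acth (1 - m) (1 - l) k g (adjh k a)) \<psi>"
      proof (cases "\<psi> \<in> Fsp")
        case True
        let ?u = "diffop k (adjh k (acth l m k g a)) \<psi>" and ?v = "diffop k (acth (1 - m) (1 - l) k g (adjh k a)) \<psi>"
        have uv: "?u \<in> Fsp" "?v \<in> Fsp" using diffop_Fsp A B True by auto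
        have gi: "inv g \<in> DiffS1" by (rule DiffS1_inv(1)[OF g])
        \<comment> \<open>Both operators are compared in the pairing with an arbitrary density;
          invariance carries \<open>g\<close> across, which avoids any computation with
          \<open>Pc\<close>.\<close>
        have "cint (\<lambda>x. \<phi> x * ?u x) = cint (\<lambda>x. \<phi> x * ?v x)" if \<phi>: "\<phi> \<in> Fsp" for \<phi>
        proof -
          let ?\<phi> = "pull l (inv g) \<phi>" and ?\<psi> = "pull (1 - m) (inv g) \<psi>"
          have p: "?\<phi> \<in> Fsp" "?\<psi> \<in> Fsp" using pull_Fsp[OF gi] \<phi> True by auto
          have "cint (\<lambda>x. \<phi> x * ?u x) = cint (\<lambda>x. pull m g (diffop k a ?\<phi>) x * \<psi> x)"
            unfolding diffop_adjh[OF ga \<phi> True, symmetric] act_inv_apply[OF g a \<phi>] ..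
          also have "\<dots> = cint (\<lambda>x. diffop k a ?\<phi> x * ?\<psi> x)"
            by (rule cint_pull_pair[OF g diffop_Fsp[OF a p(1)] True])
          also have "\<dots> = cint (\<lambda>x. ?\<phi> x * diffop k (adjh k a) ?\<psi> x)" by (rule diffop_adjh[OF a p])
          also have "\<dots> = cint (\<lambda>x. \<phi> x * pull (1 - l) g (diffop k (adjh k a) ?\<psi>) x)"
            using cint_pull_pair[OF gi \<phi> diffop_Fsp[OF aa p(2)]] DiffS1_inv(2)[OF g] by simp
          also have "\<dots> = cint (\<lambda>x. \<phi> x * ?v x)"
            unfolding act_inv_apply[OF g aa True] ..
          finally show ?thesis .
        qed
        then have "cint (\<lambda>x. \<phi> x * (?u x - ?v x)) = 0" if "\<phi> \<in> Fsp" for \<phi>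
          using cint_add[OF Fsp_mult[OF that uv(1)] Fsp_minus[OF Fsp_mult[OF that uv(2)]]]
            cint_cmult[of "-1" "\<lambda>x. \<phi> x * ?v x"] that by (simp add: algebra_simps)
        then have "?u x - ?v x = 0" for x by (rule cint_nondegenerate[OF Fsp_diff[OF uv]])
        then show ?thesis by auto
      qed (simp add: diffop_def)
    qed
  qed
qed

section \<open>Operators on functions, where constants are invariant\<close>

lemma Pc_zero_weight: "i > 0 \<Longrightarrow> Pc 0 \<eta> i 0 = (\<lambda>x. 0)"
proof (induction i)
  case (Suc i) then show ?case by (cases i) (auto simp: vd_const)
qed simp

text \<open>The derivative of a function is a density of weight 1, so the derivative of order
  \<open>i + 1\<close> of a function transforms like the derivative of order \<open>i\<close> of a
  1-density.\<close>

lemma Pc_shift: "Pc 0 \<eta> (Suc i) (Suc s) = Pc 1 \<eta> i s"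
proof (induction i arbitrary: s)
  case 0 then show ?case by (auto simp: vd_const)
next
  case (Suc i)
  have z: "Pc 0 \<eta> (Suc i) 0 = (\<lambda>x. 0)" by (rule Pc_zero_weight) simp
  show ?case
    unfolding Pc.simps(2)[of 0 \<eta> "Suc i"] Pc.simps(2)[of 1 \<eta> i] Suc
    using z Suc by (cases s) (auto simp: fun_eq_iff algebra_simps simp del: Pc.simps)
qed

lemma acth_sgl0: "acth l m k g (sgl 0 f) = sgl 0 (\<lambda>x. exp ((m - l) * lgd g x) * f (g x))"
proof (intro ext)
  fix s x
  have "acth l m k g (sgl 0 f) s x = (\<Sum>i\<in>{s..k}. if i = 0 then exp ((m - l) * lgd g x) * f (g x) * Pc l (vd (lgd g)) 0 s x else 0)"
    unfolding acth_def by (intro sum.cong refl) (simp add: sgl_def)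
  then show "acth l m k g (sgl 0 f) s x = sgl 0 (\<lambda>x. exp ((m - l) * lgd g x) * f (g x)) s x"
    by (simp add: sum.delta sgl_def)
qed

lemma acth_zero_component: "acth 0 m k g a 0 = (\<lambda>x. exp (m * lgd g x) * a 0 (g x))"
proof
  fix x
  have "acth 0 m k g a 0 x = (\<Sum>i\<in>{0..k}. if i = 0 then exp (m * lgd g x) * a 0 (g x) else 0)"
    unfolding acth_def by (intro sum.cong refl) (auto simp: Pc_zero_weight)
  then show "acth 0 m k g a 0 x = exp (m * lgd g x) * a 0 (g x)" by (simp add: sum.delta)
qed

text \<open>The constant 1 is an invariant function, so \<open>A \<mapsto> A(1)\<close> is
  equivariant. Its value has weight \<open>m = m' - l'\<close> and becomes an operator by
  multiplication.\<close>

lemma chom_value_at_1: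
  assumes "m = m' - l'" shows "chom k 0 m k' l' m' (\<lambda>a. sgl 0 (a 0))"
  unfolding chom_def
  by (auto simp: acth_sgl0 acth_zero_component assms intro: sgl_Cf)
     (auto simp: Cf_def sgl_def cadd_def cscale_def fun_eq_iff Fsp_const)

definition sh :: "coeffs \<Rightarrow> coeffs" where
  "sh a s = a (Suc s)"
definition unsh :: "coeffs \<Rightarrow> coeffs" where
  "unsh b s = (if s = 0 then (\<lambda>x. 0) else b (s - 1))"

text \<open>On functions every operator is \<open>A = A(1) + B d\<close>; \<open>sh\<close> and \<open>unsh\<close> relate \<open>A\<close> and \<open>B\<close>.\<close>
lemma chom_sh: "chom (Suc k) 0 m k 1 m sh"
  unfolding chom_def
proof (intro conjI ballI allI)
  fix a assume a: "a \<in> Cf (Suc k)"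
  show "sh a \<in> Cf k" using a by (auto simp: Cf_def sh_def)
  show "sh (acth 0 m (Suc k) g a) = acth 1 m k g (sh a)" for g
    unfolding acth_def sh_def sum.shift_bounds_cl_Suc_ivl Pc_shift by (intro ext) (simp add: algebra_simps)
qed (auto simp: sh_def cadd_def cscale_def fun_eq_iff)

lemma chom_unsh: "chom k 1 m (Suc k) 0 m unsh"
  unfolding chom_def
proof (intro conjI ballI allI)
  fix b assume b: "b \<in> Cf k"
  show "unsh b \<in> Cf (Suc k)" using b by (auto simp: Cf_def unsh_def Fsp_const)
  show "unsh (acth 1 m k g b) = acth 0 m (Suc k) g (unsh b)" for g
  proof (intro ext)
    fix s x
    show "unsh (acth 1 m k g b) s x = acth 0 m (Suc k) g (unsh b) s x"
    proof (cases s)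
      case 0
      then show ?thesis unfolding acth_zero_component 0 by (simp add: unsh_def)
    next
      case (Suc s')
      show ?thesis unfolding Suc acth_def sum.shift_bounds_cl_Suc_ivl Pc_shift by (simp add: unsh_def algebra_simps)
    qed
  qed
qed (auto simp: unsh_def cadd_def cscale_def fun_eq_iff)

text \<open>The symmetry \<open>A \<mapsto> (\<integral> A(1)) d\<close>.\<close>
lemma chom_integral:
  assumes "k \<ge> 1" shows "chom k 0 1 k 0 1 (\<lambda>a. sgl 1 (\<lambda>x. cint (a 0)))"
  unfolding chom_def
proof (intro conjI ballI allI)
  fix a assume a: "a \<in> Cf k"
  have a0: "a 0 \<in> Fsp" using a by (simp add: Cf_def)
  show "sgl 1 (\<lambda>x. cint (a 0)) \<in> Cf k" using assms by (intro sgl_Cf Fsp_const)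
  show "sgl 1 (\<lambda>x. cint (cadd a b 0)) = cadd (sgl 1 (\<lambda>x. cint (a 0))) (sgl 1 (\<lambda>x. cint (b 0)))" if "b \<in> Cf k" for b
    using that cint_add[OF a0, of "b 0"] by (auto simp: Cf_def cadd_def sgl_def fun_eq_iff)
  show "sgl 1 (\<lambda>x. cint (cscale c a 0)) = cscale c (sgl 1 (\<lambda>x. cint (a 0)))" for c
    by (auto simp: cscale_def sgl_def fun_eq_iff cint_cmult)
  show "sgl 1 (\<lambda>x. cint (acth 0 1 k g a 0)) = acth 0 1 k g (sgl 1 (\<lambda>x. cint (a 0)))" if g: "g \<in> DiffS1" for g
  proof -
    have "cint (acth 0 1 k g a 0) = cint (a 0)"
      unfolding acth_zero_component using cint_pull[OF g a0] by simp
    \<comment> \<open>\<open>d\<close> from functions to 1-densities is itself invariant.\<close>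
    moreover have "acth 0 1 k g (sgl 1 (\<lambda>x. c)) = sgl 1 (\<lambda>x. c)" for c
    proof (intro ext)
      fix s x
      have "acth 0 1 k g (sgl 1 (\<lambda>x. c)) s x = (\<Sum>i\<in>{s..k}. if i = 1 then c * Pc 0 (vd (lgd g)) 1 s x else 0)"
        unfolding acth_def by (intro sum.cong refl) (simp add: sgl_def)
      also have "\<dots> = (if s \<le> 1 then c * Pc 0 (vd (lgd g)) 1 s x else 0)"
        using assms by (simp add: sum.delta)
      also have "\<dots> = sgl 1 (\<lambda>x. c) s x"
        using Pc_zero_weight[of 1 "vd (lgd g)"] Pc_diag[of 0 "vd (lgd g)" 1] by (cases "s = 0"; cases "s = 1") (auto simp: sgl_def)
      finally show "acth 0 1 k g (sgl 1 (\<lambda>x. c)) s x = sgl 1 (\<lambda>x. c) s x" .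
    qed
    ultimately show ?thesis by simp
  qed
qed

lemma dnth_const: "n > 0 \<Longrightarrow> dnth n (\<lambda>x. c :: complex) = (\<lambda>x. 0)"
  using dnth_cmult[OF ee_Fsp, of n c 0] dnth_ee[of n 0] by (simp add: ee_0 power_0_left)

lemma adjh_const:
  assumes "j \<le> k" shows "adjh k (sgl j (\<lambda>x. c)) = sgl j (\<lambda>x. (-1) ^ j * c)"
proof (intro ext)
  fix s x
  have "adjh k (sgl j (\<lambda>x. c)) s x = (\<Sum>i\<in>{s..k}. if i = j then (-1) ^ j * of_nat (j choose s) * dnth (j - s) (\<lambda>x. c) x else 0)"
  proof -
    have "dnth n (\<lambda>x. 0 :: complex) x = 0" for n by (cases "n = 0") (simp_all add: dnth_const)
    then show ?thesis unfolding adjh_def by (intro sum.cong refl) (simp add: sgl_def)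
  qed
  also have "\<dots> = sgl j (\<lambda>x. (-1) ^ j * c) s x"
    using assms by (cases s j rule: linorder_cases) (simp_all add: sum.delta sgl_def dnth_const)
  finally show "adjh k (sgl j (\<lambda>x. c)) s x = sgl j (\<lambda>x. (-1) ^ j * c) s x" .
qed

lemma sh_const: "sh (sgl (Suc j) f) = sgl j f" "sh (sgl 0 f) = (\<lambda>i x. 0)"
  by (auto simp: sh_def sgl_def)

lemma unsh_sgl: "unsh (sgl j f) = sgl (Suc j) f" "unsh (\<lambda>i x. 0) = (\<lambda>i x. 0)"
  by (auto simp: unsh_def sgl_def fun_eq_iff)

section \<open>The algebras\<close>

text \<open>Same as \<open>csym.T\<close>, but without the assumption that \<open>H\<close> is a symmetry.\<close>
definition dat :: "(coeffs \<Rightarrow> coeffs) \<Rightarrow> int \<Rightarrow> nat \<Rightarrow> nat \<Rightarrow> complex" where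
  "dat H n i j = tpi ^ i / tpi ^ j * H (sgl j (ee n)) i 0"

lemma csym_T_dat: "csym k l m H \<Longrightarrow> csym.T H = dat H"
  by (simp add: csym.T_def dat_def fun_eq_iff)

lemma dat_cong: "(\<And>a. a \<in> Cf k \<Longrightarrow> F a = G a) \<Longrightarrow> j \<le> k \<Longrightarrow> dat F n i j = dat G n i j"
  using sgl_Cf[OF ee_Fsp] by (simp add: dat_def)

lemma dat_add: "dat (\<lambda>a. cadd (F a) (G a)) n i j = dat F n i j + dat G n i j"
  by (simp add: dat_def cadd_def ring_distribs)

lemma dat_scale: "dat (\<lambda>a. cscale c (F a)) n i j = c * dat F n i j"
  by (simp add: dat_def cscale_def)

lemma dat_0: "dat H 0 j j = H (sgl j (\<lambda>x. 1)) j 0"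
  using tpi_power_nz[of j] by (simp add: dat_def ee_0)

lemma dat_comp:
  assumes F: "csym k l m F" and G: "csym k l m G" and j: "j \<le> k"
  shows "dat (\<lambda>a. F (G a)) n i j = (\<Sum>p\<le>k. dat F n i p * dat G n p j)"
proof -
  let ?b = "G (sgl j (ee n))"
  have b: "?b \<in> Cf k" using csym.H_Cf[OF G sgl_Cf[OF ee_Fsp j]] .
  have "F ?b i 0 = (\<Sum>p\<le>k. F (sgl p (?b p)) i 0)" by (rule csym.H_lower[OF F b])
  also have "\<dots> = (\<Sum>p\<le>k. tpi ^ j / tpi ^ i * (dat F n i p * dat G n p j))"
  proof (intro sum.cong refl)
    fix p assume "p \<in> {..k}"
    then have p: "p \<le> k" by simp
    have "?b p = (\<lambda>x. (tpi ^ j / tpi ^ p * dat G n p j) * ee n x)"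
      using csym.H_ee[OF G j] unfolding csym_T_dat[OF G] by auto
    then have "F (sgl p (?b p)) i 0 = (tpi ^ j / tpi ^ p * dat G n p j) * F (sgl p (ee n)) i 0"
      using csym.H_sgl_scale[OF F ee_Fsp p] by metis
    also have "F (sgl p (ee n)) i 0 = tpi ^ p / tpi ^ i * dat F n i p * 1"
      using csym.H_ee[OF F p, of n i 0] unfolding csym_T_dat[OF F] by (simp add: ee_def)
    finally show "F (sgl p (?b p)) i 0 = tpi ^ j / tpi ^ i * (dat F n i p * dat G n p j)"
      using tpi_power_nz[of p] tpi_power_nz[of i] by (simp del: power_mult_distrib)
  qed
  finally have "F ?b i 0 = tpi ^ j / tpi ^ i * (\<Sum>p\<le>k. dat F n i p * dat G n p j)"
    by (simp only: sum_distrib_left)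
  then show ?thesis using tpi_power_nz[of j] tpi_power_nz[of i] by (simp add: dat_def[of "\<lambda>a. F (G a)"] del: power_mult_distrib)
qed

lemma csym_determined:
  assumes k: "k \<ge> 5" and F: "csym k l m F" and G: "csym k l m G"
    and eq: "\<And>i j. i \<le> k \<Longrightarrow> j \<le> k \<Longrightarrow> dat F 0 i j = dat G 0 i j"
    and eq1: "l = 0 \<Longrightarrow> m = 1 \<Longrightarrow> dat F 1 0 1 = dat G 1 0 1"
    and a: "a \<in> Cf k"
  shows "F a = G a"
proof -
  let ?D = "\<lambda>a. cadd (F a) (cscale (-1) (G a))"
  have D: "csym k l m ?D"
    using F G unfolding csym_iff_chom by (intro chom_add chom_scale)
  have D5: "csym5 k l m ?D" by (intro csym5.intro D csym5_axioms.intro k)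
  have T: "dat ?D n i j = dat F n i j - dat G n i j" for n i j
    by (simp add: dat_add dat_scale)
  have "?D a = (\<lambda>i x. 0)"
    using csym5.H_determined[OF D5 _ _ a, unfolded csym_T_dat[OF D] T] eq eq1 by simp
  then show ?thesis by (simp add: cadd_def cscale_def fun_eq_iff)
qed

definition lift :: "nat \<Rightarrow> (coeffs \<Rightarrow> coeffs) \<Rightarrow> dop \<Rightarrow> dop" where
  "lift k H = (\<lambda>A\<in>DiffOps k. diffop k (H (cf k A)))"

lemma lift_diffop: "a \<in> Cf k \<Longrightarrow> lift k H (diffop k a) = diffop k (H a)"
  by (simp add: lift_def diffop_Cf cf_diffop)

lemma lift_Symmetries:
  assumes H: "csym k l m H" shows "lift k H \<in> Symmetries k l m"
  unfolding Symmetries_def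
proof (intro CollectI conjI ballI allI)
  note HC = csym.H_Cf[OF H]
  show "lift k H \<in> DiffOps k \<rightarrow>\<^sub>E DiffOps k"
    using HC cf_works diffop_Cf by (auto simp: lift_def)
  fix A assume "A \<in> DiffOps k"
  then obtain a where a: "a \<in> Cf k" "A = diffop k a" by (rule DiffOps_Cf)
  show "lift k H (op_scale c A) = op_scale c (lift k H A)" for c
    using csym.H_scale[OF H a(1)] unfolding a(2) diffop_cscale
      lift_diffop[OF a(1)] lift_diffop[OF cscale_Cf[OF a(1)]] by simp
  show "lift k H (op_add A B) = op_add (lift k H A) (lift k H B)" if "B \<in> DiffOps k" for B
  proof -
    obtain b where b: "b \<in> Cf k" "B = diffop k b" using DiffOps_Cf[OF \<open>B \<in> DiffOps k\<close>] by blast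
    show ?thesis using csym.H_add[OF H a(1) b(1)] unfolding a(2) b(2) diffop_cadd
        lift_diffop[OF a(1)] lift_diffop[OF b(1)] lift_diffop[OF cadd_Cf[OF a(1) b(1)]] by simp
  qed
  show "lift k H (act l m f A) = act l m f (lift k H A)" if f: "f \<in> DiffS1" for f
  proof -
    let ?g = "inv f"
    have g: "?g \<in> DiffS1" "inv ?g = f" using DiffS1_inv[OF f] by auto
    have "lift k H (act l m (inv ?g) (diffop k a)) = act l m (inv ?g) (lift k H (diffop k a))"
      using csym.H_act[OF H a(1) g(1)]
      unfolding act_inv_diffop[OF g(1) a(1)] lift_diffop[OF a(1)] lift_diffop[OF acth_Cf[OF g(1) a(1)]]
        act_inv_diffop[OF g(1) HC[OF a(1)]] by simp
    then show ?thesis unfolding g(2) a(2) .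
  qed
qed

lemma hat_lift: "csym k l m H \<Longrightarrow> a \<in> Cf k \<Longrightarrow> hat k (lift k H) a = H a"
  by (simp add: hat_def lift_diffop cf_diffop csym.H_Cf)

lemma Symmetries_eqI:
  assumes S: "S \<in> Symmetries k l m" and S': "S' \<in> Symmetries k l m"
    and eq: "\<And>a. a \<in> Cf k \<Longrightarrow> hat k S a = hat k S' a"
  shows "S = S'"
proof (rule PiE_ext)
  show "S \<in> DiffOps k \<rightarrow>\<^sub>E DiffOps k" "S' \<in> DiffOps k \<rightarrow>\<^sub>E DiffOps k"
    using S S' by (auto simp: Symmetries_def)
  fix A assume "A \<in> DiffOps k"
  then obtain a where a: "a \<in> Cf k" "A = diffop k a" by (rule DiffOps_Cf)
  show "S A = S' A" unfolding a(2) hat_works(2)[OF S a(1)] hat_works(2)[OF S' a(1)] eq[OF a(1)] ..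
qed

abbreviation sdat :: "nat \<Rightarrow> (dop \<Rightarrow> dop) \<Rightarrow> int \<Rightarrow> nat \<Rightarrow> nat \<Rightarrow> complex" where
  "sdat k S \<equiv> dat (hat k S)"

lemma sdat_lift: "csym k l m H \<Longrightarrow> j \<le> k \<Longrightarrow> sdat k (lift k H) n i j = dat H n i j"
  by (rule dat_cong[of k]) (simp_all add: hat_lift)

lemma sdat_add:
  assumes S: "S \<in> Symmetries k l m" and S': "S' \<in> Symmetries k l m" and j: "j \<le> k"
  shows "sdat k (sym_add k S S') n i j = sdat k S n i j + sdat k S' n i j"
proof -
  have "hat k (sym_add k S S') a = cadd (hat k S a) (hat k S' a)" if a: "a \<in> Cf k" for a
    using hat_works(1)[OF S a] hat_works(1)[OF S' a]
    by (subst hat_def) (simp add: sym_add_def diffop_Cf[OF a] hat_works(2)[OF S a] hat_works(2)[OF S' a] diffop_cadd cf_diffop cadd_Cf)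
  from dat_cong[OF this j] show ?thesis by (simp add: dat_add)
qed

lemma sdat_scale:
  assumes S: "S \<in> Symmetries k l m" and j: "j \<le> k"
  shows "sdat k (sym_scale k c S) n i j = c * sdat k S n i j"
proof -
  have "hat k (sym_scale k c S) a = cscale c (hat k S a)" if a: "a \<in> Cf k" for a
    using hat_works(1)[OF S a]
    by (subst hat_def) (simp add: sym_scale_def diffop_Cf[OF a] hat_works(2)[OF S a] diffop_cscale cf_diffop cscale_Cf)
  from dat_cong[OF this j] show ?thesis by (simp add: dat_scale)
qed

lemma sdat_comp:
  assumes S: "S \<in> Symmetries k l m" and S': "S' \<in> Symmetries k l m" and j: "j \<le> k"
  shows "sdat k (sym_comp k S S') n i j = (\<Sum>p\<le>k. sdat k S n i p * sdat k S' n p j)"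
proof -
  have "hat k (sym_comp k S S') a = hat k S (hat k S' a)" if a: "a \<in> Cf k" for a
    using hat_works(1)[OF S' a] hat_works(1)[OF S hat_works(1)[OF S' a]]
    by (subst hat_def) (simp add: sym_comp_def diffop_Cf[OF a] hat_works(2)[OF S' a] hat_works(2)[OF S] cf_diffop)
  from dat_cong[OF this j] show ?thesis by (simp add: dat_comp[OF csym_hat[OF S] csym_hat[OF S'] j])
qed

lemma Symmetries_determined:
  assumes k: "k \<ge> 5" and S: "S \<in> Symmetries k l m" and S': "S' \<in> Symmetries k l m"
    and eq: "\<And>i j. i \<le> k \<Longrightarrow> j \<le> k \<Longrightarrow> sdat k S 0 i j = sdat k S' 0 i j"
    and eq1: "l = 0 \<Longrightarrow> m = 1 \<Longrightarrow> sdat k S 1 0 1 = sdat k S' 1 0 1"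
  shows "S = S'"
  by (rule Symmetries_eqI[OF S S']) (rule csym_determined[OF k csym_hat[OF S] csym_hat[OF S'] eq eq1])

lemma csym5_hat: "k \<ge> 5 \<Longrightarrow> S \<in> Symmetries k l m \<Longrightarrow> csym5 k l m (hat k S)"
  by (intro csym5.intro csym_hat csym5_axioms.intro)

lemma sdat_offdiag:
  assumes "k \<ge> 5" "S \<in> Symmetries k l m" "i \<le> k" "j \<le> k" "i \<noteq> j" "sdat k S 0 i j \<noteq> 0"
  shows "l = 0 \<and> m = 1 \<and> i = 1 \<and> j = 0"
  using csym5.T0_offdiag[OF csym5_hat[OF assms(1,2)], of i j] assms unfolding csym_T_dat[OF csym_hat[OF assms(2)]] by blast

text \<open>Away from (0, 1) every \<open>T 0\<close> is diagonal, so composition multiplies the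
  diagonals entrywise. \<open>cl\<close> assigns to each order its class and \<open>r\<close> picks
  a representative: the edges of the graph supply \<open>cl\<close>, explicit symmetries supply
  \<open>surj\<close>.\<close>

lemma iso_diagonal:
  fixes r :: "'n::finite \<Rightarrow> nat"
  assumes k: "k \<ge> 5" and n01: "\<not> (l = 0 \<and> m = 1)" and r: "\<And>i. r i \<le> k"
    and cl: "\<And>S j. S \<in> Symmetries k l m \<Longrightarrow> j \<le> k \<Longrightarrow> sdat k S 0 j j = sdat k S 0 (r (cl j)) (r (cl j))"
    and surj: "\<And>v :: complex ^ 'n. \<exists>H. csym k l m H \<and> (\<forall>i. dat H 0 (r i) (r i) = v $ i)"
  shows "iso_Cn k l m TYPE('n)"
proof -
  define \<Phi> where "\<Phi> S = (\<chi> i. sdat k S 0 (r i) (r i))" for S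
  have off: "S \<in> Symmetries k l m \<Longrightarrow> i \<le> k \<Longrightarrow> j \<le> k \<Longrightarrow> i \<noteq> j \<Longrightarrow> sdat k S 0 i j = 0" for S i j
    using sdat_offdiag[OF k, of S l m i j] n01 by blast
  have "inj_on \<Phi> (Symmetries k l m)"
  proof (rule inj_onI)
    fix S S' assume S: "S \<in> Symmetries k l m" and S': "S' \<in> Symmetries k l m" and eq: "\<Phi> S = \<Phi> S'"
    have d: "sdat k S 0 (r i) (r i) = sdat k S' 0 (r i) (r i)" for i
      using arg_cong[OF eq, of "\<lambda>v. v $ i"] by (simp add: \<Phi>_def)
    show "S = S'"
    proof (rule Symmetries_determined[OF k S S'])
      fix i j assume ij: "i \<le> k" "j \<le> k"
      show "sdat k S 0 i j = sdat k S' 0 i j"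
        using off[OF S ij] off[OF S' ij] cl[OF S ij(1)] cl[OF S' ij(1)] d by (cases "i = j") simp_all
    qed (use n01 in blast)
  qed
  moreover have "\<exists>S\<in>Symmetries k l m. v = \<Phi> S" for v :: "complex ^ 'n"
  proof -
    obtain H where H: "csym k l m H" "\<And>i. dat H 0 (r i) (r i) = v $ i" using surj by blast
    show ?thesis
      by (rule bexI[OF _ lift_Symmetries[OF H(1)]]) (simp add: \<Phi>_def vec_eq_iff sdat_lift[OF H(1) r] H(2))
  qed
  ultimately have bij: "bij_betw \<Phi> (Symmetries k l m) UNIV"
    unfolding bij_betw_def by auto
  have mult: "\<Phi> (sym_comp k S S') = \<Phi> S * \<Phi> S'" if S: "S \<in> Symmetries k l m" and S': "S' \<in> Symmetries k l m" for S S'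
  proof -
    have "(\<Sum>p\<le>k. sdat k S 0 i p * sdat k S' 0 p i) = sdat k S 0 i i * sdat k S' 0 i i" if "i \<le> k" for i
      by (rule sum_only[OF that]) (use off[OF S that] in auto)
    then show ?thesis unfolding \<Phi>_def by (simp add: vec_eq_iff sdat_comp[OF S S'] r)
  qed
  show ?thesis
    unfolding iso_Cn_def sym_alg_iso_def
    by (intro exI[of _ \<Phi>] conjI ballI allI bij mult)
       (auto simp: \<Phi>_def vec_eq_iff sdat_add[of _ k l m] sdat_scale[of _ k l m] r)
qed

lemma csym_id: "csym k l m (\<lambda>a. a)" unfolding csym_iff_chom by (rule chom_id)

lemma dat_id: "dat (\<lambda>a. a) n j j = 1"
  using tpi_power_nz[of j] by (simp add: dat_def sgl_def ee_def)

lemma iso_two: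
  assumes k: "k \<ge> 5" and n01: "\<not> (l = 0 \<and> m = 1)"
    and cl: "\<And>S j. S \<in> Symmetries k l m \<Longrightarrow> j \<le> k \<Longrightarrow> sdat k S 0 j j = sdat k S 0 (if P j then 0 else 1) (if P j then 0 else 1)"
    and F: "csym k l m F" and ne: "dat F 0 0 0 \<noteq> dat F 0 1 1"
  shows "iso_Cn k l m TYPE(2)"
proof (rule iso_diagonal[where r = "\<lambda>i::2. if i = 1 then 0 else 1" and cl = "\<lambda>j. if P j then 1 else 2"])
  show "k \<ge> 5" "\<not> (l = 0 \<and> m = 1)" by fact+
  show "(if i = 1 then 0 else 1) \<le> k" for i :: 2 using k by simp
  show "sdat k S 0 j j = sdat k S 0 (if (if P j then 1 else 2 :: 2) = 1 then 0 else 1) (if (if P j then 1 else 2 :: 2) = 1 then 0 else 1)"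
    if "S \<in> Symmetries k l m" "j \<le> k" for S j
    using cl[OF that] by (cases "P j") simp_all
  fix v :: "complex ^ 2"
  \<comment> \<open>Interpolation between two points: a multiple of the identity plus
    \<open>\<beta>\<close> times \<open>F\<close> takes the prescribed values at orders 0 and
    1.\<close>
  define \<beta> where "\<beta> = (v $ 1 - v $ 2) / (dat F 0 0 0 - dat F 0 1 1)"
  have b: "\<beta> * (dat F 0 0 0 - dat F 0 1 1) = v $ 1 - v $ 2" using ne by (simp add: \<beta>_def)
  let ?H = "\<lambda>a. cadd (cscale (v $ 1 - \<beta> * dat F 0 0 0) a) (cscale \<beta> (F a))"
  have "csym k l m ?H" using F csym_id unfolding csym_iff_chom by (intro chom_add chom_scale)
  moreover have "\<forall>i. dat ?H 0 (if i = 1 then 0 else 1) (if i = 1 then 0 else 1) = v $ i"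
    unfolding forall_2 using b by (simp add: dat_add dat_scale[where F = "\<lambda>a. a"] dat_scale dat_id algebra_simps)
  ultimately show "\<exists>H. csym k l m H \<and> (\<forall>i. dat H 0 (if i = 1 then 0 else 1) (if i = 1 then 0 else 1) = v $ i)" by blast
qed

lemma iso_three:
  assumes k: "k \<ge> 5" and n01: "\<not> (l = 0 \<and> m = 1)"
    and cl: "\<And>S j. S \<in> Symmetries k l m \<Longrightarrow> 1 \<le> j \<Longrightarrow> j \<le> k \<Longrightarrow> sdat k S 0 j j = (if odd j then sdat k S 0 1 1 else sdat k S 0 2 2)"
    and F: "csym k l m F" "dat F 0 0 0 = 1" "dat F 0 1 1 = 0" "dat F 0 2 2 = 0"
    and G: "csym k l m G" "dat G 0 0 0 = 1" "dat G 0 1 1 = 1" "dat G 0 2 2 = - 1"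
  shows "iso_Cn k l m TYPE(3)"
proof -
  let ?r = "\<lambda>i::3. if i = 1 then 0 else if i = 2 then 1 else 2 :: nat"
  let ?cl = "\<lambda>j. if j = 0 then 1 else if odd j then 2 else 3 :: 3"
  show ?thesis
  proof (rule iso_diagonal[where r = ?r and cl = ?cl])
    show "k \<ge> 5" "\<not> (l = 0 \<and> m = 1)" by fact+
    show "?r i \<le> k" for i using k by simp
    show "sdat k S 0 j j = sdat k S 0 (?r (?cl j)) (?r (?cl j))" if "S \<in> Symmetries k l m" "j \<le> k" for S j
      using cl[OF that(1) _ that(2)] by (cases "j = 0"; cases "odd j") simp_all
    fix v :: "complex ^ 3"
    let ?H = "\<lambda>a. cadd (cscale ((v $ 2 + v $ 3) / 2) a) (cadd (cscale (v $ 1 - v $ 2) (F a)) (cscale ((v $ 2 - v $ 3) / 2) (G a)))"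
    have "csym k l m ?H" using F G csym_id unfolding csym_iff_chom by (intro chom_add chom_scale)
    moreover have "\<forall>i. dat ?H 0 (?r i) (?r i) = v $ i"
      unfolding forall_3 using F(2-4) G(2-4)
      by (simp add: dat_add dat_scale[where F = "\<lambda>a. a"] dat_scale dat_id field_simps)
    ultimately show "\<exists>H. csym k l m H \<and> (\<forall>i. dat H 0 (?r i) (?r i) = v $ i)" by blast
  qed
qed

lemma sgl_const_0: "sgl j (\<lambda>x. c) 0 = (\<lambda>x. if j = 0 then c else 0)"
  by (simp add: sgl_def)

lemma adjh_zero: "adjh k (\<lambda>i x. 0) = (\<lambda>i x. 0)"
proof -
  have "sgl 0 (\<lambda>x. 0) = (\<lambda>i x. 0 :: complex)" by (auto simp: sgl_def)
  then show ?thesis using adjh_const[of 0 k 0] by simp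
qed

text \<open>The adjoint leads from \<open>(l, m)\<close> to \<open>(1 - m, 1 - l)\<close>, the same
  weights exactly if \<open>l + m = 1\<close>. On \<open>d^j\<close> it is \<open>(-1)^j\<close>,
  which separates the parity classes.\<close>

lemma Symmetries_conj_case:
  assumes k: "k \<ge> 5" and lm: "l + m = 1" "l \<noteq> 0" shows "iso_Cn k l m TYPE(2)"
proof (rule iso_two[OF k, where P = even and F = "adjh k"])
  show "\<not> (l = 0 \<and> m = 1)" using lm by simp
  have "1 - m = l" "1 - l = m" using lm by (auto simp: algebra_simps)
  then show "csym k l m (adjh k)" using chom_adjh[of k l m] unfolding csym_iff_chom by simp
  show "dat (adjh k) 0 0 0 \<noteq> dat (adjh k) 0 1 1" using k by (simp add: dat_0 adjh_const) (simp add: sgl_def)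
  show "sdat k S 0 j j = sdat k S 0 (if even j then 0 else 1) (if even j then 0 else 1)" if "S \<in> Symmetries k l m" "j \<le> k" for S j
    using csym5.diag_conj[OF csym5_hat[OF k that(1)] lm that(2)]
    unfolding csym_T_dat[OF csym_hat[OF that(1)]] by (simp add: mod_2_eq_odd)
qed

lemma one_class:
  assumes k: "k \<ge> 5" and lm: "(l = 0 \<and> m \<noteq> 1) \<or> (m = 1 \<and> l \<noteq> 0)" "\<not> (l = m \<and> l * (1 - m) = 0)"
    and "S \<in> Symmetries k l m" "j \<le> k"
  shows "sdat k S 0 j j = sdat k S 0 (if j = 0 then 0 else 1) (if j = 0 then 0 else 1)"
  using csym5.diag_one[OF csym5_hat[OF k assms(4)] lm _ assms(5)]
  unfolding csym_T_dat[OF csym_hat[OF assms(4)]] by (cases "j = 0") simp_all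

lemma Symmetries_functions_case:
  assumes k: "k \<ge> 5" and lm: "l = 0" "m \<noteq> 1" "m \<noteq> 0" shows "iso_Cn k l m TYPE(2)"
proof (rule iso_two[OF k _ one_class[OF k]])
  show "csym k l m (\<lambda>a. sgl 0 (a 0))" unfolding csym_iff_chom lm by (rule chom_value_at_1) simp
qed (use lm in \<open>auto simp: dat_0 sgl_def\<close>)

text \<open>Conjugation by the adjoint transports symmetries from the weights
  \<open>(1 - m, 1 - l)\<close> and so reduces \<open>m = 1\<close> to operators on
  functions.\<close>

lemma chom_conj: "chom k (1 - m) (1 - l) k (1 - m) (1 - l) F \<Longrightarrow> chom k l m k l m (\<lambda>a. adjh k (F (adjh k a)))"
  using chom_comp[OF chom_comp[OF chom_adjh[of k l m], of k "1 - m" "1 - l" F] chom_adjh[of k "1 - m" "1 - l"]] by simp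

lemma Symmetries_forms_case:
  assumes k: "k \<ge> 5" and lm: "m = 1" "l \<noteq> 1" "l \<noteq> 0" shows "iso_Cn k l m TYPE(2)"
proof (rule iso_two[OF k _ one_class[OF k]])
  show "csym k l m (\<lambda>a. adjh k (sgl 0 (adjh k a 0)))" unfolding csym_iff_chom lm
    using chom_conj[of k 1 l "\<lambda>a. sgl 0 (a 0)"] chom_value_at_1[of "1 - l" "1 - l" 0 k k] by simp
qed (use lm k in \<open>auto simp: dat_0 adjh_const sgl_const_0, simp_all add: sgl_def\<close>)

text \<open>Writing \<open>A = A(1) + B d\<close>, this is \<open>A \<mapsto> A(1) + B\<^sup>* d\<close>.\<close>
definition evn :: "nat \<Rightarrow> coeffs \<Rightarrow> coeffs" where
  "evn k a = cadd (sgl 0 (a 0)) (unsh (adjh (k - 1) (sh a)))"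

text \<open>The operator \<open>B\<close> has weights (1, 0), and since their sum is 1 the adjoint
  preserves its space.\<close>

lemma chom_evn: assumes "k \<ge> 1" shows "chom k 0 0 k 0 0 (evn k)"
proof -
  obtain j where k: "k = Suc j" using assms by (cases k) auto
  have "chom j 1 0 j 1 0 (adjh j)" using chom_adjh[of j 1 0] by simp
  then have "chom k 0 0 k 0 0 (\<lambda>a. unsh (adjh (k - 1) (sh a)))"
    using chom_comp[OF chom_comp[OF chom_sh] chom_unsh] unfolding k diff_Suc_1 by blast
  then show ?thesis unfolding evn_def[abs_def] by (intro chom_add chom_value_at_1) simp_all
qed

lemma evn_const: "j \<le> k \<Longrightarrow> evn k (sgl j (\<lambda>x. c)) = sgl j (\<lambda>x. (if j = 0 then c else (-1) ^ (j - 1) * c))"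
  unfolding evn_def
  by (cases j) (auto simp: sh_const adjh_zero unsh_sgl adjh_const, auto simp: cadd_def sgl_def fun_eq_iff)

lemma two_class:
  assumes k: "k \<ge> 5" and lm: "l = m" "l = 0 \<or> l = 1" and S: "S \<in> Symmetries k l m" "1 \<le> j" "j \<le> k"
  shows "sdat k S 0 j j = (if odd j then sdat k S 0 1 1 else sdat k S 0 2 2)"
  using csym5.diag_two[OF csym5_hat[OF k S(1)] lm S(2,3)] unfolding csym_T_dat[OF csym_hat[OF S(1)]] .

lemma Symmetries_00_case: assumes k: "k \<ge> 5" shows "iso_Cn k 0 0 TYPE(3)"
proof -
  have F: "csym k 0 0 (\<lambda>a. sgl 0 (a 0))" unfolding csym_iff_chom by (rule chom_value_at_1) simp
  have F': "dat (\<lambda>a. sgl 0 (a 0)) 0 0 0 = 1" "dat (\<lambda>a. sgl 0 (a 0)) 0 1 1 = 0" "dat (\<lambda>a. sgl 0 (a 0)) 0 2 2 = 0"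
    by (simp_all add: dat_0 sgl_def)
  have G: "csym k 0 0 (evn k)" unfolding csym_iff_chom using k by (intro chom_evn) simp
  have G': "dat (evn k) 0 0 0 = 1" "dat (evn k) 0 1 1 = 1" "dat (evn k) 0 2 2 = - 1"
    using k by (simp_all add: dat_0 evn_const) (simp_all add: sgl_def)
  show ?thesis by (rule iso_three[OF k _ two_class[OF k] F F' G G']) auto
qed

lemma Symmetries_11_case: assumes k: "k \<ge> 5" shows "iso_Cn k 1 1 TYPE(3)"
proof -
  let ?F = "\<lambda>a. adjh k (sgl 0 (adjh k a 0))" and ?G = "\<lambda>a. adjh k (evn k (adjh k a))"
  have F: "csym k 1 1 ?F" unfolding csym_iff_chom
    using chom_conj[of k 1 1 "\<lambda>a. sgl 0 (a 0)"] chom_value_at_1[of 0 0 0 k k] by simp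
  have G: "csym k 1 1 ?G" unfolding csym_iff_chom
    using chom_conj[of k 1 1 "evn k"] chom_evn[of k] k by simp
  have F': "dat ?F 0 0 0 = 1" "dat ?F 0 1 1 = 0" "dat ?F 0 2 2 = 0"
    using k by (simp_all add: dat_0 adjh_const sgl_const_0) (simp_all add: sgl_def)
  have G': "dat ?G 0 0 0 = 1" "dat ?G 0 1 1 = 1" "dat ?G 0 2 2 = - 1"
    using k by (simp_all add: dat_0 adjh_const evn_const) (simp_all add: sgl_def)
  show ?thesis by (rule iso_three[OF k _ two_class[OF k] F F' G G']) auto
qed

lemma Symmetries_trivial_case:
  assumes k: "k \<ge> 5" and lm: "l + m \<noteq> 1" "l \<noteq> 0" "m \<noteq> 1" shows "sym_trivial k l m"
proof -
  have I: "sym_id k = lift k (\<lambda>a. a)" by (auto simp: sym_id_def lift_def fun_eq_iff cf_works)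
  have sc: "sym_scale k c (sym_id k) = lift k (\<lambda>a. cscale c a)" for c
    by (rule ext) (auto simp: sym_scale_def sym_id_def lift_def cf_works diffop_cscale[symmetric])
  have scs: "csym k l m (\<lambda>a. cscale c a)" for c
    using csym_id unfolding csym_iff_chom by (intro chom_scale)
  have "S = sym_scale k (sdat k S 0 0 0) (sym_id k)" if S: "S \<in> Symmetries k l m" for S
    unfolding sc
  proof (rule Symmetries_determined[OF k S lift_Symmetries[OF scs]])
    fix i j assume ij: "i \<le> k" "j \<le> k"
    have R: "sdat k (lift k (\<lambda>a. cscale c a)) 0 i j = (if i = j then c else 0)" for c
      unfolding sdat_lift[OF scs ij(2)] using dat_id[of 0 j] by (auto simp: dat_scale[where F = "\<lambda>a. a"]) (simp add: dat_def sgl_def)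
    show "sdat k S 0 i j = sdat k (lift k (\<lambda>a. cscale (sdat k S 0 0 0) a)) 0 i j"
      unfolding R using sdat_offdiag[OF k S ij] lm(2) csym5.diag_generic[OF csym5_hat[OF k S] lm ij(1)]
      unfolding csym_T_dat[OF csym_hat[OF S]] by auto
  qed (use lm in simp)
  moreover have "sym_scale k c (sym_id k) \<in> Symmetries k l m" for c
    unfolding sc by (rule lift_Symmetries[OF scs])
  ultimately show ?thesis unfolding sym_trivial_def by auto
qed

section \<open>The exceptional weights (0, 1)\<close>

lemma sum_first_two:
  fixes f :: "nat \<Rightarrow> complex"
  assumes "k \<ge> 1" "\<And>p. 2 \<le> p \<Longrightarrow> p \<le> k \<Longrightarrow> f p = 0"
  shows "(\<Sum>p\<le>k. f p) = f 0 + f 1"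
proof -
  have "(\<Sum>p\<le>k. f p) = (\<Sum>p\<in>{0, 1}. f p)"
    by (rule sum.mono_neutral_right) (use assms in auto)
  then show ?thesis by simp
qed

text \<open>The entry \<open>d\<close> of the matrix algebra is read on mode 1, so its product rule
  involves diagonal entries of \<open>T 1\<close>. The relations between modes 0 and 1 identify
  these with entries of \<open>T 0\<close>.\<close>

lemma sdat_01:
  assumes k: "k \<ge> 5" and S: "S \<in> Symmetries k 0 1"
  shows "sdat k S 1 0 0 = sdat k S 0 0 0" "sdat k S 1 1 1 = sdat k S 0 1 1"
    and "2 \<le> i \<Longrightarrow> i \<le> k \<Longrightarrow> sdat k S 1 i 1 = 0"
proof -
  note C = csym_hat[OF S]
  have comm: "(\<Sum>p\<le>k. sdat k S (n + z) i p * ell 0 1 (of_int z) (of_int n) p j) = (\<Sum>p\<le>k. ell 0 1 (of_int z) (of_int n) i p * sdat k S n p j)"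
    if "i \<le> k" "j \<le> k" for i j n z
    using csym.T_comm[OF C that] unfolding csym_T_dat[OF C] .
  have off: "sdat k S 0 i j = 0" if "i \<le> k" "j \<le> k" "i \<noteq> j" "i \<noteq> 1 \<or> j \<noteq> 0" for i j
    using sdat_offdiag[OF k S that(1-3)] that(4) by blast
  have e01: "ell 0 1 z n 0 1 = 0" for z n by (simp add: ell_less kap_def)
  show "sdat k S 1 0 0 = sdat k S 0 0 0"
  proof -
    have "(\<Sum>p\<le>k. sdat k S 1 0 p * ell 0 1 1 0 p 0) = sdat k S 1 0 0 * ell 0 1 1 0 0 0"
      by (rule sum_only) (auto simp: ell_gt)
    moreover have "(\<Sum>p\<le>k. ell 0 1 1 0 0 p * sdat k S 0 p 0) = ell 0 1 1 0 0 0 * sdat k S 0 0 0"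
    proof (rule sum_only)
      fix p assume "p \<le> k" "p \<noteq> 0"
      then show "ell 0 1 1 0 0 p * sdat k S 0 p 0 = 0" using off[of p 0] e01 by (cases "p = 1") auto
    qed simp
    ultimately show ?thesis using comm[of 0 0 0 1] by (simp add: ell_diag)
  qed
  have col: "sdat k S 0 i 1 = of_nat i * sdat k S 1 i 1"
    if i: "i \<le> k" and up: "\<And>p. i < p \<Longrightarrow> p \<le> k \<Longrightarrow> sdat k S 1 p 1 = 0" for i
  proof -
    have "(\<Sum>p\<le>k. sdat k S 0 i p * ell 0 1 (-1) 1 p 1) = sdat k S 0 i 1 * ell 0 1 (-1) 1 1 1"
    proof (rule sum_only)
      fix p assume "p \<le> k" "p \<noteq> (1::nat)"
      then show "sdat k S 0 i p * ell 0 1 (-1) 1 p 1 = 0" using e01 by (cases "p = 0") (auto simp: ell_gt)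
    qed (use k in simp)
    moreover have "(\<Sum>p\<le>k. ell 0 1 (-1) 1 i p * sdat k S 1 p 1) = ell 0 1 (-1) 1 i i * sdat k S 1 i 1"
    proof (rule sum_only[OF i])
      fix p assume "p \<le> k" "p \<noteq> i"
      then show "ell 0 1 (-1) 1 i p * sdat k S 1 p 1 = 0" using up[of p] by (cases "p < i") (auto simp: ell_gt)
    qed
    ultimately show ?thesis using comm[of i 1 1 "-1"] i k by (simp add: ell_diag)
  qed
  have hi: "sdat k S 1 i 1 = 0" if "2 \<le> i" "i \<le> k" for i
    using that
  proof (induction "k - i" arbitrary: i rule: less_induct)
    case less
    have "sdat k S 1 p 1 = 0" if "i < p" "p \<le> k" for p
      by (rule less.hyps) (use that less.prems in auto)
    from col[OF less.prems(2) this] off[of i 1] less.prems k show ?case by simp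
  qed
  then show "2 \<le> i \<Longrightarrow> i \<le> k \<Longrightarrow> sdat k S 1 i 1 = 0" .
  show "sdat k S 1 1 1 = sdat k S 0 1 1" using col[of 1] hi k by simp
qed

lemma vector_4 [simp]:
  "(vector [w, x, y, z] :: 'a::zero ^ 4) $ 1 = w" "(vector [w, x, y, z] :: 'a ^ 4) $ 2 = x"
  "(vector [w, x, y, z] :: 'a ^ 4) $ 3 = y" "(vector [w, x, y, z] :: 'a ^ 4) $ 4 = z"
  unfolding vector_def by simp_all

definition bmat :: "complex \<Rightarrow> complex \<Rightarrow> complex \<Rightarrow> complex \<Rightarrow> complex^4^4" where
  "bmat a b c d = vector [vector [a, 0, 0, d], vector [0, a, 0, 0], vector [0, c, b, 0], vector [0, 0, 0, b]]"

lemma bmat_eq_iff: "bmat a b c d = bmat a' b' c' d' \<longleftrightarrow> a = a' \<and> b = b' \<and> c = c' \<and> d = d'"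
  by (auto simp: bmat_def vec_eq_iff forall_4)

lemma vector_2_eq_iff: "(vector [a, b] :: 'a::zero ^ 2) = vector [c, d] \<longleftrightarrow> a = c \<and> b = d"
  by (simp add: vec_eq_iff forall_2)

lemma bmat_add: "bmat a b c d + bmat a' b' c' d' = bmat (a + a') (b + b') (c + c') (d + d')"
  by (simp add: bmat_def vec_eq_iff forall_4)

lemma bmat_scale: "mscale e (bmat a b c d) = bmat (e * a) (e * b) (e * c) (e * d)"
  by (simp add: bmat_def mscale_def vec_eq_iff forall_4)

text \<open>Here \<open>c\<close> takes \<open>b\<close> from the left and \<open>a\<close> from the
  right, \<open>d\<close> the other way round, just as the entry (1, 0) of \<open>T 0\<close> and
  the entry (0, 1) of \<open>T 1\<close> do under composition.\<close>

lemma bmat_mult: "bmat a b c d ** bmat a' b' c' d' = bmat (a * a') (b * b') (c * a' + b * c') (a * d' + d * b')"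
  by (simp add: bmat_def matrix_matrix_mult_def vec_eq_iff forall_4 sum_4)

lemma b_alg_bmat: "b_alg = {bmat a b c d | a b c d. True}"
  by (simp add: b_alg_def bmat_def)

lemma dat_sgl0_functions:
  "dat (\<lambda>a. sgl 0 (a 0)) 0 j j = (if j = 0 then 1 else 0)"
  by (simp add: dat_0 sgl_def)

lemma dat_adjh: "j \<le> k \<Longrightarrow> dat (adjh k) 0 j j = (-1) ^ j"
  by (simp add: dat_0 adjh_const) (simp add: sgl_def)

text \<open>Identity and adjoint separate the parities; \<open>?E\<close> and \<open>?X\<close>
  change the diagonal at order 0 and at order 1 alone. \<open>?N\<close>, the integral, contributes
  to the entry \<open>c\<close>, and \<open>?Y\<close>, the map from \<open>A\<close> to
  \<open>A(1)\<close> minus the adjoint of \<open>A\<close> at 1, to the entry \<open>d\<close>. In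
  the splitting \<open>A = A(1) + B d\<close>, \<open>?X\<close> sends \<open>A\<close> to the
  adjoint of \<open>B\<close> at 1, followed by \<open>d\<close>.\<close>

lemma exists_symmetry_01:
  assumes k: "k \<ge> 5"
  shows "\<exists>H. csym k 0 1 H \<and> dat H 0 0 0 = a \<and> dat H 0 1 1 = b \<and> dat H 0 2 2 = u \<and> dat H 0 3 3 = v
    \<and> dat H 0 1 0 = c \<and> dat H 1 0 1 = d"
proof -
  obtain k' where k': "k = Suc k'" using k by (cases k) auto
  let ?E = "\<lambda>a. sgl 0 (a 0)" and ?A = "adjh k" and ?X = "\<lambda>a. unsh (sgl 0 (adjh k' (sh a) 0))"
    and ?N = "\<lambda>a. sgl 1 (\<lambda>x. cint (a 0))"
  let ?Y = "\<lambda>a. cadd (sgl 0 (a 0)) (cscale (-1) (sgl 0 (adjh k a 0)))"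
  have E: "chom k 0 1 k 0 1 ?E" by (rule chom_value_at_1) simp
  have A: "chom k 0 1 k 0 1 ?A" using chom_adjh[of k 0 1] by simp
  have X: "chom k 0 1 k 0 1 ?X"
  proof -
    have "chom k' 1 1 k' 0 0 (adjh k')" using chom_adjh[of k' 1 1] by simp
    moreover have "chom k' 0 0 k' 1 1 ?E" by (rule chom_value_at_1) simp
    ultimately show ?thesis unfolding k'
      using chom_comp[OF chom_comp[OF chom_comp[OF chom_sh]] chom_unsh] by blast
  qed
  have N: "chom k 0 1 k 0 1 ?N" using k by (intro chom_integral) simp
  have Y: "chom k 0 1 k 0 1 ?Y" using chom_comp[OF A E] E by (intro chom_add chom_scale)
  have k0: "j \<le> k" if "j \<le> 3" for j using that k by simp
  have dX: "dat ?X 0 j j = (if j = 1 then 1 else 0)" if "j \<le> k" for j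
    using that unfolding k' dat_0
    by (cases j) (auto simp: sh_const adjh_zero unsh_sgl adjh_const, auto simp: unsh_def sgl_def fun_eq_iff)
  have dN: "dat ?N 0 j j = 0" for j
    by (auto simp: dat_0 sgl_def cint_def)
  have dY: "dat ?Y 0 j j = 0" if "j \<le> k" for j
    using that by (simp add: dat_0 adjh_const) (simp add: sgl_def cadd_def cscale_def)
  have N10: "dat ?N 0 1 0 = tpi" by (simp add: dat_def sgl_def ee_0 cint_def)
  have N01: "dat ?N 1 0 1 = 0" by (simp add: dat_def sgl_def)
  \<comment> \<open>\<open>ee 1 d\<close> kills 1, and its adjoint sends 1 to
    \<open>- vd (ee 1)\<close>. The result \<open>tpi * ee 1\<close> becomes 1 in the normalisation
    of \<open>dat\<close>.\<close>
  have Y01: "dat ?Y 1 0 1 = 1"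
  proof -
    have "adjh k (sgl 1 (ee 1)) 0 0 = (\<Sum>i\<in>{0..k}. if i = 1 then - vd (ee 1) 0 else 0)"
      unfolding adjh_def
    proof (intro sum.cong refl)
      fix i
      have "dnth i (\<lambda>x. 0 :: complex) 0 = 0" by (cases "i = 0") (simp_all add: dnth_const)
      then show "(- 1) ^ i * of_nat (i choose 0) * dnth (i - 0) (sgl 1 (ee 1) i) 0 = (if i = 1 then - vd (ee 1) 0 else 0)"
        by (simp add: sgl_def vd_def)
    qed
    also have "\<dots> = - tpi" using k unfolding vd_ee by (simp add: sum.delta ee_def)
    finally have "sgl 0 (adjh k (sgl 1 (ee 1)) 0) 0 0 = - tpi" by (simp add: sgl_def)
    then show ?thesis by (simp add: dat_def cadd_def cscale_def) (simp add: sgl_def)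
  qed
  define W where "W = (\<lambda>x. cadd (cscale ((u + v) / 2) x) (cadd (cscale ((u - v) / 2) (?A x))
      (cadd (cscale (a - u) (?E x)) (cscale (b - v) (?X x)))))"
  have W: "chom k 0 1 k 0 1 W" unfolding W_def using chom_id E A X by (intro chom_add chom_scale)
  have dW: "dat W 0 0 0 = a" "dat W 0 1 1 = b" "dat W 0 2 2 = u" "dat W 0 3 3 = v"
    using k unfolding W_def
    by (simp_all add: dat_add dat_scale[where F = "\<lambda>a. a"] dat_scale dat_id dat_adjh dat_sgl0_functions dX field_simps)
  \<comment> \<open>\<open>y\<close> can be chosen first because \<open>?N\<close> does not affect
    the entry (0, 1) on mode 1; \<open>n\<close> then corrects what \<open>W\<close> and
    \<open>?Y\<close> contribute to the entry \<open>c\<close>.\<close>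
  define y where "y = d - dat W 1 0 1"
  define n where "n = (c - dat W 0 1 0 - y * dat ?Y 0 1 0) / tpi"
  let ?H = "\<lambda>a. cadd (W a) (cadd (cscale y (?Y a)) (cscale n (?N a)))"
  have T: "dat ?H z i j = dat W z i j + (y * dat ?Y z i j + n * dat ?N z i j)" for z i j
    by (simp only: dat_add dat_scale)
  have "csym k 0 1 ?H" unfolding csym_iff_chom by (intro chom_add chom_scale W Y N)
  moreover have "dat ?H 0 0 0 = a" "dat ?H 0 1 1 = b" "dat ?H 0 2 2 = u" "dat ?H 0 3 3 = v"
    unfolding T dN using dW k by (simp_all only: dY[OF k0]) simp_all
  moreover have "dat ?H 1 0 1 = d" unfolding T N01 Y01 by (simp add: y_def)
  moreover have "dat ?H 0 1 0 = c" unfolding T N10 by (simp add: n_def)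
  ultimately show ?thesis by blast
qed

lemma Symmetries_01_case:
  assumes k: "k \<ge> 5" shows "iso_b_C2 k 0 1"
proof -
  define \<Phi> where "\<Phi> S = (bmat (sdat k S 0 0 0) (sdat k S 0 1 1) (sdat k S 0 1 0) (sdat k S 1 0 1),
    vector [sdat k S 0 2 2, sdat k S 0 3 3] :: complex ^ 2)" for S
  have le: "0 \<le> k" "1 \<le> k" "2 \<le> k" "3 \<le> k" using k by auto
  have off: "sdat k S 0 i j = 0" if "S \<in> Symmetries k 0 1" "i \<le> k" "j \<le> k" "i \<noteq> j" "i \<noteq> 1 \<or> j \<noteq> 0" for S i j
    using sdat_offdiag[OF k that(1-4)] that(5) by blast
  have three: "sdat k S 0 j j = (if odd j then sdat k S 0 3 3 else sdat k S 0 2 2)"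
    if "S \<in> Symmetries k 0 1" "2 \<le> j" "j \<le> k" for S j
    using csym5.diag_three[OF csym5_hat[OF k that(1)] _ _ that(2,3)] unfolding csym_T_dat[OF csym_hat[OF that(1)]] by simp
  have inj: "inj_on \<Phi> (Symmetries k 0 1)"
  proof (rule inj_onI)
    fix S S' assume S: "S \<in> Symmetries k 0 1" and S': "S' \<in> Symmetries k 0 1" and "\<Phi> S = \<Phi> S'"
    then have e: "sdat k S 0 0 0 = sdat k S' 0 0 0" "sdat k S 0 1 1 = sdat k S' 0 1 1" "sdat k S 0 1 0 = sdat k S' 0 1 0"
        "sdat k S 1 0 1 = sdat k S' 1 0 1" "sdat k S 0 2 2 = sdat k S' 0 2 2" "sdat k S 0 3 3 = sdat k S' 0 3 3"
      by (simp_all add: \<Phi>_def bmat_eq_iff vector_2_eq_iff)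
    show "S = S'"
    proof (rule Symmetries_determined[OF k S S'])
      fix i j assume ij: "i \<le> k" "j \<le> k"
      show "sdat k S 0 i j = sdat k S' 0 i j"
      proof (cases "i = j")
        case True
        consider "j = 0" | "j = 1" | "2 \<le> j" by linarith
        then show ?thesis using three[OF S _ ij(2)] three[OF S' _ ij(2)] e True by cases auto
      next
        case False
        then show ?thesis using off[OF S ij] off[OF S' ij] e by (cases "i = 1 \<and> j = 0") auto
      qed
    qed (rule e)
  qed
  have im: "\<Phi> ` Symmetries k 0 1 = b_alg \<times> UNIV"
  proof (intro equalityI subsetI)
    fix M assume "M \<in> b_alg \<times> (UNIV :: (complex ^ 2) set)"
    then obtain a b c d w where M: "M = (bmat a b c d, w)" by (auto simp: b_alg_bmat)
    obtain H where H: "csym k 0 1 H" "dat H 0 0 0 = a" "dat H 0 1 1 = b" "dat H 0 2 2 = w $ 1" "dat H 0 3 3 = w $ 2"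
        "dat H 0 1 0 = c" "dat H 1 0 1 = d"
      using exists_symmetry_01[OF k] by blast
    have "M = \<Phi> (lift k H)"
      unfolding M \<Phi>_def sdat_lift[OF H(1) le(1)] sdat_lift[OF H(1) le(2)] sdat_lift[OF H(1) le(3)] sdat_lift[OF H(1) le(4)] H(2-7)
      by (simp add: vec_eq_iff forall_2)
    then show "M \<in> \<Phi> ` Symmetries k 0 1" using lift_Symmetries[OF H(1)] by blast
  qed (auto simp: \<Phi>_def b_alg_bmat)
  have mult: "\<Phi> (sym_comp k S S') = (case \<Phi> S of (A, v) \<Rightarrow> \<lambda>(B, w). (A ** B, v * w)) (\<Phi> S')"
    if S: "S \<in> Symmetries k 0 1" and S': "S' \<in> Symmetries k 0 1" for S S'
  proof -
    have d: "sdat k (sym_comp k S S') 0 j j = sdat k S 0 j j * sdat k S' 0 j j" if j: "j \<le> k" for j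
      unfolding sdat_comp[OF S S' j]
    proof (rule sum_only[OF j])
      fix p assume "p \<le> k" "p \<noteq> j"
      then show "sdat k S 0 j p * sdat k S' 0 p j = 0"
        using off[OF S j, of p] off[OF S' _ j, of p] by (cases "j = 1 \<and> p = 0") auto
    qed
    have c: "sdat k (sym_comp k S S') 0 1 0 = sdat k S 0 1 0 * sdat k S' 0 0 0 + sdat k S 0 1 1 * sdat k S' 0 1 0"
      unfolding sdat_comp[OF S S' le(1)]
      by (rule sum_first_two[OF le(2)]) (use off[OF S' _ le(1)] in auto)
    have "sdat k (sym_comp k S S') 1 0 1 = sdat k S 1 0 0 * sdat k S' 1 0 1 + sdat k S 1 0 1 * sdat k S' 1 1 1"
      unfolding sdat_comp[OF S S' le(2)]
      by (rule sum_first_two[OF le(2)]) (use sdat_01(3)[OF k S'] in auto)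
    then show ?thesis
      unfolding \<Phi>_def d[OF le(1)] d[OF le(2)] d[OF le(3)] d[OF le(4)] c sdat_01(1)[OF k S] sdat_01(2)[OF k S']
      by (simp add: bmat_mult vec_eq_iff forall_2)
  qed
  have add: "\<Phi> (sym_add k S S') = (case \<Phi> S of (A, v) \<Rightarrow> \<lambda>(B, w). (A + B, v + w)) (\<Phi> S')"
    if S: "S \<in> Symmetries k 0 1" and S': "S' \<in> Symmetries k 0 1" for S S'
    using le by (simp add: \<Phi>_def sdat_add[OF S S'] bmat_add vec_eq_iff forall_2)
  have scale: "\<Phi> (sym_scale k c S) = (case \<Phi> S of (A, v) \<Rightarrow> (mscale c A, c *s v))"
    if S: "S \<in> Symmetries k 0 1" for S c
    using le by (simp add: \<Phi>_def sdat_scale[OF S] bmat_scale vec_eq_iff forall_2)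
  show ?thesis
    unfolding iso_b_C2_def sym_alg_iso_def
    by (intro exI[of _ \<Phi>] conjI ballI allI bij_betw_imageI inj im add mult scale)
qed

theorem theorem3p1:
  fixes k :: nat and l m :: complex
  assumes "k \<ge> 5"
  shows "(((l + m = 1 \<and> l \<noteq> 0) \<or> (l = 0 \<and> m \<noteq> 1 \<and> m \<noteq> 0) \<or> (m = 1 \<and> l \<noteq> 1 \<and> l \<noteq> 0))
            \<longrightarrow> iso_Cn k l m TYPE(2))
       \<and> (((l = 0 \<and> m = 0) \<or> (l = 1 \<and> m = 1)) \<longrightarrow> iso_Cn k l m TYPE(3))
       \<and> ((l = 0 \<and> m = 1) \<longrightarrow> iso_b_C2 k l m)
       \<and> (\<not> ((l + m = 1 \<and> l \<noteq> 0) \<or> (l = 0 \<and> m \<noteq> 1 \<and> m \<noteq> 0) \<or> (m = 1 \<and> l \<noteq> 1 \<and> l \<noteq> 0))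
          \<and> \<not> ((l = 0 \<and> m = 0) \<or> (l = 1 \<and> m = 1))
          \<and> \<not> (l = 0 \<and> m = 1)
          \<longrightarrow> sym_trivial k l m)"
proof (intro conjI impI)
  assume "(l + m = 1 \<and> l \<noteq> 0) \<or> (l = 0 \<and> m \<noteq> 1 \<and> m \<noteq> 0) \<or> (m = 1 \<and> l \<noteq> 1 \<and> l \<noteq> 0)"
  then show "iso_Cn k l m TYPE(2)"
    using Symmetries_conj_case[OF assms] Symmetries_functions_case[OF assms] Symmetries_forms_case[OF assms] by blast
next
  assume "(l = 0 \<and> m = 0) \<or> (l = 1 \<and> m = 1)"
  then show "iso_Cn k l m TYPE(3)" using Symmetries_00_case[OF assms] Symmetries_11_case[OF assms] by blast
next
  assume "l = 0 \<and> m = 1"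
  then show "iso_b_C2 k l m" using Symmetries_01_case[OF assms] by blast
next
  assume *: "\<not> ((l + m = 1 \<and> l \<noteq> 0) \<or> (l = 0 \<and> m \<noteq> 1 \<and> m \<noteq> 0) \<or> (m = 1 \<and> l \<noteq> 1 \<and> l \<noteq> 0))
          \<and> \<not> ((l = 0 \<and> m = 0) \<or> (l = 1 \<and> m = 1)) \<and> \<not> (l = 0 \<and> m = 1)"
  show "sym_trivial k l m"
    by (rule Symmetries_trivial_case[OF assms]) (use * in auto)
qed

end
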